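(* Let $n\ge 1$ and $p\in(1,+\infty)$. Then there exist $\alpha\in(0,1]$ and constants $r_*\in(0,1]$, $C>0$ (depending only on $n$ and $p$) such that the following holds. Let $u\in L^p(Q_1^-)$ and $f\in L^p(Q_1^-)$ satisfy $\Delta u-u_t=f$ in $Q_1^-$, where the origin is a Lebesgue point of $f$ with $f(0)=0$, and let $\tilde\omega(r)=\tilde\omega(f,r)$. Then: i) (Pointwise BMO estimate) $$\sup_{r\in(0,1]}\tilde N(u,r)\le C\left\{\left(\int_{Q_1^-}|u|^p\right)^{1/p}+\left(\int_{Q_1^-}|f|^p\right)^{1/p}+\sup_{r\in(0,1]}\tilde\omega(r)\right\}.$$ ii) (Pointwise VMO estimate) If $\tilde\omega(r)\to0$ as $r\to0^+$, then $\tilde N(u,r)\to0$ as $r\to0^+$. iii) (Pointwise control on the solution) If $\tilde\omega$ is Dini, then $\tilde N(u,\cdot)$ is Dini, and there exists a caloric polynomial $P_0$ (i.e. $(P_0)_t=\Delta P_0$) of degree at most two in space and at most one in time such that for every $r\in(0,r_*]$ $$\left(\frac1{|Q_r^-|}\int_{Q_r^-}\left|\frac{u(x,t)-P_0(x,t)}{r^2}\right|^p\right)^{1/p}\le C\left(\tilde M_0r^\alpha+\int_0^r\frac{\tilde\omega(s)}s\,ds+r^\alpha\int_r^1\frac{\tilde\omega(s)}{s^{1+\alpha}}\,ds\right),$$ and $$P_0(x,t)=a+b\cdot x+\tfrac12\,{}^tx\cdot c\cdot x+mt\quad\text{with}\quad |a|+|b|+|c|+|m|\le C\tilde M_0,$$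 where $$\tilde M_0=\int_0^1\frac{\tilde\omega(s)}s\,ds+\left(\int_{Q_1^-}|u|^p\right)^{1/p}+\left(\int_{Q_1^-}|f|^p\right)^{1/p}.$$
   Context: $B_r$ is the open ball of radius $r$ in $\mathbb R^n$ centered at $0$, and $Q_r^-=B_r\times(-r^2,0]$. Equations are understood in the sense of distributions. The origin $(0,0)$ is a Lebesgue point of $f$ with value $f(0)$ if $\frac1{|Q_r^-|}\int_{Q_r^-}|f-f(0)|\to0$ as $r\to0^+$. $\tilde\omega(f,r)=\inf_{c\in\mathbb R}\left(\frac1{|Q_r^-|}\int_{Q_r^-}|f(x,t)-c|^p\right)^{1/p}$. $\tilde{\mathcal P}_2$ is the set of polynomials of parabolic degree at most two, i.e. of the form $a+b\cdot x+\frac12\,{}^tx\cdot c\cdot x+mt$ with $a,m\in\mathbb R$, $b\in\mathbb R^n$, $c$ a symmetric $n\times n$ matrix. $\tilde N(u,r)=\inf_{P\in\tilde{\mathcal P}_2}\left(\frac1{r^{n+2+2p}}\int_{Q_r^-}|u-P|^p\right)^{1/p}$. A function $\sigma$ on $(0,1]$ is called Dini if $\int_0^1\frac{\sigma(r)}r\,dr<+\infty$. *)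

theory Defs
  imports "HOL-Analysis.Analysis"
begin

definition Qm :: "real \<Rightarrow> ((real ^ 'n) \<times> real) set" where
  "Qm r = ball 0 r \<times> {- (r\<^sup>2) <.. 0}"

text \<open>Functions in \<open>L\<^sup>p(Q\<^sub>1\<^sup>-)\<close> are represented by total functions; their values outside
  \<open>Q\<^sub>1\<^sup>-\<close> never matter.\<close>

definition in_Lp :: "real \<Rightarrow> ('a::euclidean_space) set \<Rightarrow> ('a \<Rightarrow> real) \<Rightarrow> bool" where
  "in_Lp p S u \<longleftrightarrow>
     u \<in> borel_measurable (lebesgue_on S) \<and> integrable (lebesgue_on S) (\<lambda>z. \<bar>u z\<bar> powr p)"

definition Lp_norm :: "real \<Rightarrow> ('a::euclidean_space) set \<Rightarrow> ('a \<Rightarrow> real) \<Rightarrow> real" where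
  "Lp_norm p S u = (LINT z:S|lebesgue. \<bar>u z\<bar> powr p) powr (1 / p)"

definition average :: "('a::euclidean_space) set \<Rightarrow> ('a \<Rightarrow> real) \<Rightarrow> real" where
  "average S g = (1 / measure lebesgue S) * (LINT z:S|lebesgue. g z)"

definition lebesgue_point_origin :: "((real ^ 'n) \<times> real \<Rightarrow> real) \<Rightarrow> real \<Rightarrow> bool" where
  "lebesgue_point_origin f v \<longleftrightarrow>
     ((\<lambda>r. average (Qm r) (\<lambda>z. \<bar>f z - v\<bar>)) \<longlongrightarrow> 0) (at_right 0)"

definition dir_deriv :: "'a::euclidean_space \<Rightarrow> ('a \<Rightarrow> real) \<Rightarrow> 'a \<Rightarrow> real" where
  "dir_deriv v \<phi> z = frechet_derivative \<phi> (at z) v"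

definition laplacian_x :: "((real ^ 'n) \<times> real \<Rightarrow> real) \<Rightarrow> (real ^ 'n) \<times> real \<Rightarrow> real" where
  "laplacian_x \<phi> z = (\<Sum>i\<in>UNIV. dir_deriv (axis i 1, 0) (dir_deriv (axis i 1, 0) \<phi>) z)"

definition time_deriv :: "((real ^ 'n) \<times> real \<Rightarrow> real) \<Rightarrow> (real ^ 'n) \<times> real \<Rightarrow> real" where
  "time_deriv \<phi> = dir_deriv (0, 1) \<phi>"

fun Ck :: "nat \<Rightarrow> ('a::euclidean_space \<Rightarrow> real) \<Rightarrow> bool" where
  "Ck 0 \<phi> \<longleftrightarrow> continuous_on UNIV \<phi>"
| "Ck (Suc k) \<phi> \<longleftrightarrow> (\<forall>z. \<phi> differentiable (at z)) \<and> (\<forall>v. Ck k (dir_deriv v \<phi>))"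

definition test_function :: "('a::euclidean_space) set \<Rightarrow> ('a \<Rightarrow> real) \<Rightarrow> bool" where
  "test_function U \<phi> \<longleftrightarrow>
     (\<forall>k. Ck k \<phi>) \<and> compact (closure {z. \<phi> z \<noteq> 0}) \<and> closure {z. \<phi> z \<noteq> 0} \<subseteq> U"

text \<open>\<open>\<Delta>u - u\<^sub>t = f\<close> in the sense of distributions: test functions are supported in the open set
  \<open>B\<^sub>1 \<times> (-1, 0)\<close>, and integrating by parts moves \<open>\<Delta> - \<partial>\<^sub>t\<close> to \<open>\<Delta> + \<partial>\<^sub>t\<close> on \<open>\<phi>\<close>.\<close>

definition heat_equation_Q1 ::
  "((real ^ 'n) \<times> real \<Rightarrow> real) \<Rightarrow> ((real ^ 'n) \<times> real \<Rightarrow> real) \<Rightarrow> bool" where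
  "heat_equation_Q1 u f \<longleftrightarrow>
     (\<forall>\<phi>. test_function (interior (Qm 1)) \<phi> \<longrightarrow>
        (LINT z:Qm 1|lebesgue. u z * (laplacian_x \<phi> z + time_deriv \<phi> z)) =
        (LINT z:Qm 1|lebesgue. f z * \<phi> z))"

definition omega_t :: "real \<Rightarrow> ((real ^ 'n) \<times> real \<Rightarrow> real) \<Rightarrow> real \<Rightarrow> real" where
  "omega_t p f r = (INF c::real. (average (Qm r) (\<lambda>z. \<bar>f z - c\<bar> powr p)) powr (1 / p))"

definition par_poly ::
  "real \<Rightarrow> real ^ 'n \<Rightarrow> real ^ 'n ^ 'n \<Rightarrow> real \<Rightarrow> (real ^ 'n) \<times> real \<Rightarrow> real" where
  "par_poly a b c m = (\<lambda>(x, t). a + b \<bullet> x + (1 / 2) * (x \<bullet> (c *v x)) + m * t)"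

definition P2_t :: "((real ^ 'n) \<times> real \<Rightarrow> real) set" where
  "P2_t = {par_poly a b c m | a b c m. transpose c = c}"

definition N_t :: "real \<Rightarrow> ((real ^ 'n) \<times> real \<Rightarrow> real) \<Rightarrow> real \<Rightarrow> real" where
  "N_t p u r =
     (INF P\<in>P2_t. ((1 / r powr (real CARD('n) + 2 + 2 * p)) *
        (LINT z:Qm r|lebesgue. \<bar>u z - P z\<bar> powr p)) powr (1 / p))"

text \<open>Only used for nonnegative \<open>\<sigma>\<close>, where integrability is finiteness of the integral.\<close>

definition Dini :: "(real \<Rightarrow> real) \<Rightarrow> bool" where
  "Dini \<sigma> \<longleftrightarrow> set_integrable lebesgue {0<..1} (\<lambda>r. \<sigma> r / r)"

definition caloric :: "((real ^ 'n) \<times> real \<Rightarrow> real) \<Rightarrow> bool" where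
  "caloric P \<longleftrightarrow> (\<forall>z. time_deriv P z = laplacian_x P z)"

definition M0_t ::
  "real \<Rightarrow> ((real ^ 'n) \<times> real \<Rightarrow> real) \<Rightarrow> ((real ^ 'n) \<times> real \<Rightarrow> real) \<Rightarrow> real" where
  "M0_t p u f =
     (LINT s:{0<..1}|lebesgue. omega_t p f s / s) + Lp_norm p (Qm 1) u + Lp_norm p (Qm 1) f"

end

theory Submission
  imports Defs "HOL-Probability.Probability" "HOL-Real_Asymp.Real_Asymp"
begin

text \<open>
  Let \<open>E = \<eta> \<Gamma>\<close> be the heat kernel multiplied by a cutoff that is \<open>1\<close> near the origin. Then
  \<open>\<Delta>E - E\<^sub>t = k - \<delta>\<^sub>0\<close> with \<open>k\<close> smooth and compactly supported, so that \<open>u = k * u - E * f\<close> near the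
  origin. The parabolic Taylor expansion of \<open>k\<close> makes \<open>k * u\<close> a quadratic polynomial up to an error of order
  three, Young's inequality controls \<open>E * (f - c)\<close> in \<open>L\<^sup>p\<close>, and \<open>E * c\<close> is constant, hence part of the
  polynomial. By scaling and subtraction of polynomials, passing from \<open>Q\<^sub>r\<close> to \<open>Q\<^sub>l\<^sub>r\<close> contracts the normalised
  distance of \<open>u\<close> to the parabolic quadratic polynomials by \<open>l\<^sup>1\<^sup>/\<^sup>2\<close>, up to the oscillation of \<open>f\<close> on
  \<open>Q\<^sub>r\<close>. Iterating gives the BMO and VMO estimates; under the Dini condition the increments of the
  approximating polynomials are summable. The limit polynomial is caloric, as is seen by testing the equation
  with \<open>\<phi>(x/r, t/r\<^sup>2)\<close> and using that the origin is a Lebesgue point of \<open>f\<close> with value \<open>0\<close>.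
\<close>

section \<open>Smooth functions on open sets\<close>

text \<open>The estimates reach the final time 0, where test functions must vanish. This is harmless
  because \<open>trunc_ker\<close> only looks into the past: for \<open>z\<close> in
  \<open>Qm (1/2)\<close>, the function \<open>reg_ker \<delta> (z - y)\<close> of \<open>y\<close>
  is supported strictly before time 0, so no boundary datum enters.

  Polynomials in \<open>P2_t\<close> need not be caloric. Subtracting one changes the right-hand
  side by a constant, to which the oscillation is insensitive; this is what allows the step to be
  repeated. The price is a free constant \<open>c0\<close> in the one-step estimate, of which the
  bound on the coefficients has to be independent.

  The Taylor error has order three while the norm is divided by the square of the radius, so a step
  of ratio \<open>l\<close> gains a factor \<open>C * l\<close>. Choosing \<open>l\<close> at most
  \<open>1 / C^2\<close> turns this into \<open>sqrt l\<close>: half a power is given up to absorb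
  \<open>C\<close>, which yields the exponent 1/2 of the theorem, with \<open>l\<close> itself as
  the largest admissible radius.

  As only the existence of constants is claimed, sharp inequalities are replaced by crude ones: a
  factor 4 instead of Minkowski, a weak Jensen inequality instead of the exact one.\<close>

fun Ck_on :: "'a::euclidean_space set \<Rightarrow> nat \<Rightarrow> ('a \<Rightarrow> real) \<Rightarrow> bool" where
  "Ck_on U 0 f \<longleftrightarrow> continuous_on U f"
| "Ck_on U (Suc k) f \<longleftrightarrow> (\<forall>z\<in>U. f differentiable (at z)) \<and> (\<forall>v. Ck_on U k (dir_deriv v f))"

definition smooth_on :: "'a::euclidean_space set \<Rightarrow> ('a \<Rightarrow> real) \<Rightarrow> bool" where
  "smooth_on U f \<longleftrightarrow> (\<forall>k. Ck_on U k f)"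

lemma Ck_on_UNIV: "Ck_on UNIV k f \<longleftrightarrow> Ck k f"
  by (induction k arbitrary: f) auto

lemma dir_deriv_eq: "(f has_derivative f') (at z) \<Longrightarrow> dir_deriv v f z = f' v"
  unfolding dir_deriv_def by (metis frechet_derivative_at)

lemma dir_deriv_has_derivative:
  "f differentiable (at z) \<Longrightarrow> (f has_derivative (\<lambda>v. dir_deriv v f z)) (at z)"
  unfolding dir_deriv_def using frechet_derivative_works by (metis (no_types, lifting) eta_contract_eq)

text \<open>The Frechet derivative is picked by choice among the functions satisfying
  \<open>has_derivative\<close>. Local agreement makes the two predicates equal, hence also the
  choices, so the second claim holds even where neither function is differentiable.\<close>

lemma dir_deriv_cong_open:
  assumes "open U" "z \<in> U" "\<And>x. x \<in> U \<Longrightarrow> f x = g x"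
  shows "f differentiable (at z) \<longleftrightarrow> g differentiable (at z)" "dir_deriv v f z = dir_deriv v g z"
proof -
  have e: "(f has_derivative f') (at z) \<longleftrightarrow> (g has_derivative f') (at z)" for f'
    using assms by (metis has_derivative_transform_within_open)
  then show "f differentiable (at z) \<longleftrightarrow> g differentiable (at z)"
    by (simp add: differentiable_def)
  show "dir_deriv v f z = dir_deriv v g z"
    unfolding dir_deriv_def frechet_derivative_def by (simp add: e)
qed

text \<open>Derivatives of sums, products and compositions are computed on \<open>U\<close> only,
  while \<open>Ck_on\<close> speaks of the total function \<open>dir_deriv v f\<close>. Openness
  makes the values off \<open>U\<close> irrelevant, so the inductions below compute the derivative
  on \<open>U\<close> and transfer its regularity by this lemma.\<close>

lemma Ck_on_cong:
  assumes "open U" "\<And>x. x \<in> U \<Longrightarrow> f x = g x" "Ck_on U k f"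
  shows "Ck_on U k g"
  using assms(2,3)
proof (induction k arbitrary: f g)
  case 0
  then show ?case using continuous_on_cong by (metis Ck_on.simps(1))
next
  case (Suc k)
  have "g differentiable (at z)" if "z \<in> U" for z
    using Suc.prems dir_deriv_cong_open(1)[OF assms(1) that, of f g] that by auto
  moreover have "Ck_on U k (dir_deriv v g)" for v
    by (rule Suc.IH[of "dir_deriv v f"])
      (use Suc.prems dir_deriv_cong_open(2)[OF assms(1), of _ f g] in auto)
  ultimately show ?case by simp
qed

lemma Ck_on_continuous: "open U \<Longrightarrow> Ck_on U k f \<Longrightarrow> continuous_on U f"
  by (cases k) (auto simp: continuous_on_eq_continuous_at intro!: differentiable_imp_continuous_within)

lemma Ck_on_Suc: "open U \<Longrightarrow> Ck_on U (Suc k) f \<Longrightarrow> Ck_on U k f"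
proof (induction k arbitrary: f)
  case 0
  then have "continuous_on U f" by (rule Ck_on_continuous)
  then show ?case by simp
next
  case (Suc k)
  then show ?case by auto
qed

lemma Ck_on_subset: "Ck_on U k f \<Longrightarrow> V \<subseteq> U \<Longrightarrow> Ck_on V k f"
proof (induction k arbitrary: f)
  case 0
  then show ?case using continuous_on_subset by (metis Ck_on.simps(1))
qed auto

lemma Ck_on_Un: "open U \<Longrightarrow> open V \<Longrightarrow> Ck_on U k f \<Longrightarrow> Ck_on V k f \<Longrightarrow> Ck_on (U \<union> V) k f"
  by (induction k arbitrary: f) (auto intro: continuous_on_open_Un)

lemma Ck_on_const: "Ck_on U k (\<lambda>_. c)"
proof (induction k arbitrary: c)
  case (Suc k)
  have "dir_deriv v (\<lambda>_::'a. c) = (\<lambda>_. 0)" for v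
    by (rule ext, rule dir_deriv_eq) (auto intro!: derivative_eq_intros)
  then show ?case using Suc by auto
qed auto

lemma Ck_on_add:
  assumes "open U" "Ck_on U k f" "Ck_on U k g"
  shows "Ck_on U k (\<lambda>z. f z + g z)"
  using assms(2,3)
proof (induction k arbitrary: f g)
  case (Suc k)
  have d: "f differentiable (at z)" "g differentiable (at z)" if "z \<in> U" for z
    using Suc.prems that by auto
  have e: "dir_deriv v (\<lambda>z. f z + g z) z = dir_deriv v f z + dir_deriv v g z" if "z \<in> U" for v z
    by (rule dir_deriv_eq) (intro has_derivative_add dir_deriv_has_derivative d that)
  have c: "Ck_on U k (\<lambda>z. dir_deriv v f z + dir_deriv v g z)" for v
    using Suc.prems by (intro Suc.IH) auto
  have c: "Ck_on U k (dir_deriv v (\<lambda>z. f z + g z))" for v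
    by (rule Ck_on_cong[OF assms(1) _ c]) (rule e[symmetric])
  then show ?case using d by auto
qed (auto intro: continuous_intros)

lemma Ck_on_mult:
  assumes "open U" "Ck_on U k f" "Ck_on U k g"
  shows "Ck_on U k (\<lambda>z. f z * g z)"
  using assms(2,3)
proof (induction k arbitrary: f g)
  case (Suc k)
  have d: "f differentiable (at z)" "g differentiable (at z)" if "z \<in> U" for z
    using Suc.prems that by auto
  have e: "dir_deriv v (\<lambda>z. f z * g z) z = f z * dir_deriv v g z + dir_deriv v f z * g z"
    if "z \<in> U" for v z
    by (rule dir_deriv_eq) (intro has_derivative_mult dir_deriv_has_derivative d that)
  have c: "Ck_on U k (\<lambda>z. f z * dir_deriv v g z + dir_deriv v f z * g z)" for v
    using Suc.prems Ck_on_Suc[OF assms(1) Suc.prems(1)] Ck_on_Suc[OF assms(1) Suc.prems(2)]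
    by (intro Ck_on_add[OF assms(1)] Suc.IH) auto
  have c: "Ck_on U k (dir_deriv v (\<lambda>z. f z * g z))" for v
    by (rule Ck_on_cong[OF assms(1) _ c]) (rule e[symmetric])
  then show ?case using d by auto
qed (auto intro: continuous_intros)

text \<open>The induction varies \<open>g\<close>: by the chain rule the derivative is
  \<open>dir_deriv 1 g\<close> composed with \<open>f\<close>, times a derivative of
  \<open>f\<close>, so the hypothesis is applied to \<open>dir_deriv 1 g\<close>.\<close>

lemma Ck_on_compose:
  fixes g :: "real \<Rightarrow> real"
  assumes "open U" "open V" "Ck_on U k f" "Ck_on V k g" "f ` U \<subseteq> V"
  shows "Ck_on U k (\<lambda>z. g (f z))"
  using assms(3,4)
proof (induction k arbitrary: g)
  case 0
  then show ?case using assms(5) continuous_on_compose2 by (metis Ck_on.simps(1))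
next
  case (Suc k)
  have d: "f differentiable (at z)" "g differentiable (at (f z))" if "z \<in> U" for z
    using Suc.prems that assms(5) by auto
  have e: "dir_deriv v (\<lambda>z. g (f z)) z = dir_deriv 1 g (f z) * dir_deriv v f z"
    if "z \<in> U" for v z
  proof -
    have "((\<lambda>z. g (f z)) has_derivative (\<lambda>v. dir_deriv (dir_deriv v f z) g (f z))) (at z)"
      by (intro has_derivative_compose[of f _ z UNIV g] dir_deriv_has_derivative d that)
    then have "dir_deriv v (\<lambda>z. g (f z)) z = dir_deriv (dir_deriv v f z) g (f z)"
      by (rule dir_deriv_eq)
    also have "\<dots> = dir_deriv v f z * dir_deriv 1 g (f z)"
      using linear_simps(5)[OF has_derivative_bounded_linear[OF dir_deriv_has_derivative[OF d(2)[OF that]]],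
          of "dir_deriv v f z" 1] by simp
    finally show ?thesis by simp
  qed
  have c: "Ck_on U k (\<lambda>z. dir_deriv 1 g (f z) * dir_deriv v f z)" for v
  proof (rule Ck_on_mult[OF assms(1)])
    show "Ck_on U k (\<lambda>z. dir_deriv 1 g (f z))"
      by (rule Suc.IH) (use Suc.prems Ck_on_Suc[OF assms(1) Suc.prems(1)] in auto)
    show "Ck_on U k (dir_deriv v f)" using Suc.prems by auto
  qed
  have c: "Ck_on U k (dir_deriv v (\<lambda>z. g (f z)))" for v
    by (rule Ck_on_cong[OF assms(1) _ c]) (rule e[symmetric])
  have "(\<lambda>z. g (f z)) differentiable (at z)" if "z \<in> U" for z
    using differentiable_compose[OF d(2) d(1), OF that that] .
  with c show ?case by simp
qed

lemma dir_deriv_affine: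
  fixes f :: "'a::euclidean_space \<Rightarrow> real" and L :: "'b::euclidean_space \<Rightarrow> 'a"
  assumes "bounded_linear L" "f differentiable (at (c + L z))"
  shows "(\<lambda>z. f (c + L z)) differentiable (at z)"
    "dir_deriv v (\<lambda>z. f (c + L z)) z = dir_deriv (L v) f (c + L z)"
proof -
  have "((\<lambda>z. c + L z) has_derivative L) (at z)"
    using bounded_linear_imp_has_derivative[OF assms(1)] by (auto intro!: derivative_eq_intros)
  then have *: "((\<lambda>z. f (c + L z)) has_derivative (\<lambda>v. dir_deriv (L v) f (c + L z))) (at z)"
    by (rule has_derivative_compose) (rule dir_deriv_has_derivative[OF assms(2)])
  show "(\<lambda>z. f (c + L z)) differentiable (at z)"
    using * by (auto simp: differentiable_def)
  show "dir_deriv v (\<lambda>z. f (c + L z)) z = dir_deriv (L v) f (c + L z)"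
    by (rule dir_deriv_eq[OF *])
qed

lemma Ck_on_affine:
  fixes f :: "'a::euclidean_space \<Rightarrow> real" and L :: "'b::euclidean_space \<Rightarrow> 'a"
  assumes L: "bounded_linear L" and "open U" "open V" "Ck_on V k f" "\<And>z. z \<in> U \<Longrightarrow> c + L z \<in> V"
  shows "Ck_on U k (\<lambda>z. f (c + L z))"
  using assms(4)
proof (induction k arbitrary: f)
  case 0
  have "continuous_on U (\<lambda>z. c + L z)"
    using L by (intro continuous_intros) (simp add: linear_continuous_on)
  then show ?case using 0 assms(5) by (auto intro: continuous_on_compose2)
next
  case (Suc k)
  have d: "f differentiable (at (c + L z))" if "z \<in> U" for z
    using Suc.prems that assms(5) by auto
  have "Ck_on U k (dir_deriv v (\<lambda>z. f (c + L z)))" for v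
    by (rule Ck_on_cong[OF assms(2), where f = "\<lambda>z. dir_deriv (L v) f (c + L z)"])
      (use Suc dir_deriv_affine(2)[OF L d] in auto)
  then show ?case using dir_deriv_affine(1)[OF L d] by auto
qed

lemma Ck_on_bounded_linear:
  assumes "bounded_linear L" shows "Ck_on U k L"
proof (cases k)
  case 0 then show ?thesis using assms by (simp add: linear_continuous_on)
next
  case (Suc j)
  have h: "(L has_derivative L) (at z)" for z using assms by (rule bounded_linear_imp_has_derivative)
  then have "dir_deriv v L = (\<lambda>_. L v)" for v by (intro ext dir_deriv_eq)
  then show ?thesis using Suc h by (auto simp: Ck_on_const differentiable_def)
qed

lemma smooth_on_cong: "open U \<Longrightarrow> (\<And>x. x \<in> U \<Longrightarrow> f x = g x) \<Longrightarrow> smooth_on U f \<Longrightarrow> smooth_on U g"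
  unfolding smooth_on_def using Ck_on_cong by blast

lemma smooth_on_subset: "smooth_on U f \<Longrightarrow> V \<subseteq> U \<Longrightarrow> smooth_on V f"
  unfolding smooth_on_def using Ck_on_subset by blast

lemma smooth_on_Un: "open U \<Longrightarrow> open V \<Longrightarrow> smooth_on U f \<Longrightarrow> smooth_on V f \<Longrightarrow> smooth_on (U \<union> V) f"
  unfolding smooth_on_def using Ck_on_Un by blast

lemma smooth_on_const: "smooth_on U (\<lambda>_. c)"
  unfolding smooth_on_def using Ck_on_const by blast

lemma smooth_on_bounded_linear: "bounded_linear L \<Longrightarrow> smooth_on U L"
  unfolding smooth_on_def using Ck_on_bounded_linear by blast

lemma smooth_on_add: "open U \<Longrightarrow> smooth_on U f \<Longrightarrow> smooth_on U g \<Longrightarrow> smooth_on U (\<lambda>z. f z + g z)"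
  unfolding smooth_on_def using Ck_on_add by blast

lemma smooth_on_mult: "open U \<Longrightarrow> smooth_on U f \<Longrightarrow> smooth_on U g \<Longrightarrow> smooth_on U (\<lambda>z. f z * g z)"
  unfolding smooth_on_def using Ck_on_mult by blast

lemma smooth_on_diff:
  "open U \<Longrightarrow> smooth_on U f \<Longrightarrow> smooth_on U g \<Longrightarrow> smooth_on U (\<lambda>z. f z - g z)"
  using smooth_on_add[OF _ _ smooth_on_mult[OF _ smooth_on_const[of _ "-1"]], of U f g] by simp

lemma smooth_on_sum:
  "open U \<Longrightarrow> (\<And>i. i \<in> I \<Longrightarrow> smooth_on U (f i)) \<Longrightarrow> smooth_on U (\<lambda>z. \<Sum>i\<in>I. f i z)"
  by (induction I rule: infinite_finite_induct) (auto simp: smooth_on_const intro: smooth_on_add)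

lemma smooth_on_compose:
  fixes g :: "real \<Rightarrow> real"
  shows "open U \<Longrightarrow> open V \<Longrightarrow> smooth_on V g \<Longrightarrow> smooth_on U f \<Longrightarrow> f ` U \<subseteq> V \<Longrightarrow>
    smooth_on U (\<lambda>z. g (f z))"
  unfolding smooth_on_def using Ck_on_compose by blast

lemma smooth_on_affine:
  "bounded_linear L \<Longrightarrow> open U \<Longrightarrow> open V \<Longrightarrow> smooth_on V f \<Longrightarrow> (\<And>z. z \<in> U \<Longrightarrow> c + L z \<in> V) \<Longrightarrow>
    smooth_on U (\<lambda>z. f (c + L z))"
  unfolding smooth_on_def using Ck_on_affine by blast

lemma smooth_on_dir_deriv: "smooth_on U f \<Longrightarrow> smooth_on U (dir_deriv v f)"
  unfolding smooth_on_def using Ck_on.simps(2) by blast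

lemma smooth_on_differentiable: "smooth_on U f \<Longrightarrow> z \<in> U \<Longrightarrow> f differentiable (at z)"
  unfolding smooth_on_def using Ck_on.simps(2) by blast

lemma smooth_on_continuous: "smooth_on U f \<Longrightarrow> continuous_on U f"
  unfolding smooth_on_def by (metis Ck_on.simps(1))

text \<open>A family closed under differentiation up to linear combinations is smooth, because the
  induction on the order runs over all members at once. No formula for higher derivatives is needed,
  and two terms suffice for powers, the exponential and the flat functions below.\<close>

lemma smooth_on_real:
  fixes f :: "'i \<Rightarrow> real \<Rightarrow> real"
  assumes "open U"
    and "\<And>i. i \<in> I \<Longrightarrow> \<exists>a b j l. j \<in> I \<and> l \<in> I \<and>
      (\<forall>x\<in>U. (f i has_real_derivative a * f j x + b * f l x) (at x))"
    and "i \<in> I"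
  shows "smooth_on U (f i)"
proof -
  have "Ck_on U k (f i)" if "i \<in> I" for k i
    using that
  proof (induction k arbitrary: i)
    case 0
    then show ?case using assms(2)[OF 0] DERIV_isCont
      by (metis Ck_on.simps(1) continuous_at_imp_continuous_on)
  next
    case (Suc k)
    obtain a b j l where "j \<in> I" "l \<in> I"
      and d: "\<And>x. x \<in> U \<Longrightarrow> (f i has_real_derivative a * f j x + b * f l x) (at x)"
      using assms(2)[OF Suc.prems] by blast
    have e: "dir_deriv v (f i) x = v * (a * f j x + b * f l x)" if "x \<in> U" for v x
      using dir_deriv_eq[OF d[OF that, unfolded has_field_derivative_def], of v] by simp
    have c: "Ck_on U k (\<lambda>x. v * (a * f j x + b * f l x))" for v
      by (intro Ck_on_mult Ck_on_add Ck_on_const assms Suc.IH \<open>j \<in> I\<close> \<open>l \<in> I\<close>)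
    have c: "Ck_on U k (dir_deriv v (f i))" for v
    by (rule Ck_on_cong[OF assms(1) _ c]) (rule e[symmetric])
    have "f i differentiable (at x)" if "x \<in> U" for x
      using d[OF that] by (auto simp: differentiable_def has_field_derivative_def)
    with c show ?case by simp
  qed
  then show ?thesis using assms(3) unfolding smooth_on_def by blast
qed

lemma smooth_on_powr: "smooth_on {0<..} (\<lambda>x::real. x powr a)"
proof -
  have "smooth_on {0<..} ((\<lambda>a x::real. x powr a) a)"
  proof (rule smooth_on_real[where I = UNIV])
    fix i :: real
    show "\<exists>a b j l. j \<in> UNIV \<and> l \<in> UNIV \<and>
      (\<forall>x\<in>{0<..}. ((\<lambda>x. x powr i) has_real_derivative a * x powr j + b * x powr l) (at x))"
      by (rule exI[of _ i], rule exI[of _ 0], rule exI[of _ "i - 1"])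
        (auto intro!: has_real_derivative_powr)
  qed auto
  then show ?thesis by simp
qed

lemma smooth_on_exp: "smooth_on UNIV (exp :: real \<Rightarrow> real)"
proof -
  have "smooth_on UNIV ((\<lambda>a::unit. exp :: real \<Rightarrow> real) ())"
  proof (rule smooth_on_real[where I = UNIV])
    show "\<exists>a b j l. j \<in> UNIV \<and> l \<in> UNIV \<and>
      (\<forall>x\<in>UNIV. (exp has_real_derivative a * exp x + b * exp x) (at x))"
      by (rule exI[of _ 1], rule exI[of _ 0]) (auto intro!: derivative_eq_intros)
  qed auto
  then show ?thesis by simp
qed

section \<open>Flat functions and cutoffs\<close>

text \<open>The factor 1/4 and the free exponent are dictated by the heat kernel: for
  \<open>x \<noteq> 0\<close> it equals
  \<open>(x \<bullet> x) powr a * flat_powr a (t / (x \<bullet> x))\<close> with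
  \<open>a = - n / 2\<close>. Letting the exponent vary also closes the family under
  differentiation.\<close>

definition flat_powr :: "real \<Rightarrow> real \<Rightarrow> real" where
  "flat_powr a t = (if 0 < t then t powr a * exp (- 1 / (4 * t)) else 0)"

lemma flat_powr_deriv:
  "(flat_powr a has_real_derivative a * flat_powr (a - 1) t + (1/4) * flat_powr (a - 2) t) (at t)"
proof -
  consider "t > 0" | "t < 0" | "t = 0" by linarith
  then show ?thesis
  proof cases
    case 1
    have "((\<lambda>t. t powr a * exp (- 1 / (4 * t))) has_real_derivative
        a * flat_powr (a - 1) t + (1/4) * flat_powr (a - 2) t) (at t)"
      using 1 by (auto intro!: derivative_eq_intros
          simp: flat_powr_def powr_diff field_simps powr_numeral power2_eq_square)
    then show ?thesis
      by (rule has_field_derivative_transform_within_open[where S = "{0<..}"])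
        (use 1 in \<open>auto simp: flat_powr_def\<close>)
  next
    case 2
    have "((\<lambda>t. 0) has_real_derivative 0) (at t)" by simp
    then have "(flat_powr a has_real_derivative 0) (at t)"
      by (rule has_field_derivative_transform_within_open[where S = "{..<0}"])
        (use 2 in \<open>auto simp: flat_powr_def\<close>)
    then show ?thesis using 2 by (simp add: flat_powr_def)
  next
    case 3
    \<comment> \<open>From the right the exponential beats every power of \<open>h\<close>, whatever
      the sign of \<open>a\<close>; from the left the difference quotient is identically
      zero.\<close>
    have r: "((\<lambda>h. flat_powr a h / h) \<longlongrightarrow> 0) (at_right 0)"
    proof (rule Lim_transform_eventually)
      show "((\<lambda>h::real. h powr a * exp (- 1 / (4 * h)) / h) \<longlongrightarrow> 0) (at_right 0)"
        by real_asymp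
      show "\<forall>\<^sub>F h in at_right 0. h powr a * exp (- 1 / (4 * h)) / h = flat_powr a h / h"
        by (auto simp: flat_powr_def eventually_at_right_less eventually_at_filter)
    qed
    have "((\<lambda>h. flat_powr a h / h) \<longlongrightarrow> 0) (at_left 0)"
      by (rule Lim_transform_eventually[of "\<lambda>_. 0"])
        (auto simp: flat_powr_def eventually_at_filter)
    with r have "((\<lambda>h. flat_powr a h / h) \<longlongrightarrow> 0) (at 0)"
      by (simp add: filterlim_split_at)
    then show ?thesis using 3 by (simp add: DERIV_def flat_powr_def)
  qed
qed

lemma smooth_flat_powr: "smooth_on UNIV (flat_powr a)"
proof (rule smooth_on_real[where I = UNIV])
  fix i :: real
  show "\<exists>a b j l. j \<in> UNIV \<and> l \<in> UNIV \<and>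
    (\<forall>x\<in>UNIV. (flat_powr i has_real_derivative a * flat_powr j x + b * flat_powr l x) (at x))"
    using flat_powr_deriv[of i] by blast
qed auto

definition smooth_step :: "real \<Rightarrow> real" where
  "smooth_step t = flat_powr 0 t / (flat_powr 0 t + flat_powr 0 (1 - t))"

lemma flat_powr_nonneg: "0 \<le> flat_powr a t"
  by (simp add: flat_powr_def)

lemma flat_powr_pos: "0 < t \<Longrightarrow> 0 < flat_powr a t"
  by (simp add: flat_powr_def)

lemma smooth_step_denom_pos: "0 < flat_powr 0 t + flat_powr 0 (1 - t)"
  using flat_powr_nonneg[of 0 t] flat_powr_nonneg[of 0 "1 - t"] flat_powr_pos[of t 0]
    flat_powr_pos[of "1 - t" 0] by (cases "0 < t") auto

lemma smooth_step_0: "t \<le> 0 \<Longrightarrow> smooth_step t = 0"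
  by (simp add: smooth_step_def flat_powr_def)

lemma smooth_step_1: "1 \<le> t \<Longrightarrow> smooth_step t = 1"
  by (simp add: smooth_step_def flat_powr_def)

lemma smooth_step_bounds: "0 \<le> smooth_step t" "smooth_step t \<le> 1"
  using smooth_step_denom_pos[of t] flat_powr_nonneg[of 0 t] flat_powr_nonneg[of 0 "1 - t"]
  by (auto simp: smooth_step_def divide_simps)

lemma smooth_smooth_step: "smooth_on UNIV smooth_step"
proof -
  have s: "smooth_on UNIV (\<lambda>t. flat_powr 0 (1 + - t))"
    by (rule smooth_on_affine[where V = UNIV])
      (auto simp: smooth_flat_powr intro: bounded_linear_minus bounded_linear_ident)
  \<comment> \<open>The reciprocal of the positive denominator is written as a power, so that
    smoothness of \<open>powr\<close> on the positive half-line applies.\<close>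
  have "smooth_on UNIV (\<lambda>t. (flat_powr 0 t + flat_powr 0 (1 - t)) powr (-1))"
    using s smooth_step_denom_pos
    by (intro smooth_on_compose[where V = "{0<..}", OF _ _ smooth_on_powr] smooth_on_add)
      (auto simp: smooth_flat_powr)
  then have "smooth_on UNIV (\<lambda>t. flat_powr 0 t * (flat_powr 0 t + flat_powr 0 (1 - t)) powr (-1))"
    by (intro smooth_on_mult) (auto simp: smooth_flat_powr)
  then show ?thesis
    by (rule smooth_on_cong[rotated 2])
      (use smooth_step_denom_pos in \<open>auto simp: smooth_step_def powr_minus_divide less_imp_le\<close>)
qed

section \<open>A truncated heat kernel\<close>

abbreviation ex :: "'n::finite \<Rightarrow> (real ^ 'n) \<times> real" where
  "ex i \<equiv> (axis i 1, 0)"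

abbreviation et :: "(real ^ 'n) \<times> real" where
  "et \<equiv> (0, 1)"

definition heat_op :: "((real ^ 'n) \<times> real \<Rightarrow> real) \<Rightarrow> (real ^ 'n) \<times> real \<Rightarrow> real" where
  "heat_op \<phi> z = laplacian_x \<phi> z - time_deriv \<phi> z"

text \<open>Without the factor \<open>(4\<pi>)\<^sup>-\<^sup>n\<^sup>/\<^sup>2\<close>, which reappears as \<open>sqrt (4 * pi) ^ n\<close> in front of \<open>u\<close>.\<close>

definition heat_ker :: "(real ^ 'n) \<times> real \<Rightarrow> real" where
  "heat_ker z = (if 0 < snd z
     then snd z powr (- real CARD('n) / 2) * exp (- (fst z \<bullet> fst z) / (4 * snd z)) else 0)"

text \<open>Space enters through the square of the norm, which is smooth at \<open>x = 0\<close>.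
  The value is 1 when this square is at most 1/32 and the time at most 1/8, and 0 once the norm or
  the time reaches 1/4. Negative times are not cut off, as the heat kernel vanishes there.\<close>

definition cutoff :: "(real ^ 'n) \<times> real \<Rightarrow> real" where
  "cutoff z = (1 - smooth_step (32 * (fst z \<bullet> fst z) - 1)) * (1 - smooth_step (8 * snd z - 1))"

definition trunc_ker :: "(real ^ 'n) \<times> real \<Rightarrow> real" where
  "trunc_ker z = cutoff z * heat_ker z"

lemma smooth_on_snd: "smooth_on U (snd :: 'a::euclidean_space \<times> real \<Rightarrow> real)"
  by (intro smooth_on_bounded_linear bounded_linear_snd)

lemma smooth_on_fst_nth: "smooth_on U (\<lambda>z :: (real ^ 'n) \<times> real. fst z $ i)"
  by (intro smooth_on_bounded_linear bounded_linear_compose[OF bounded_linear_vec_nth bounded_linear_fst])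

lemma smooth_on_fst_inner: "open U \<Longrightarrow> smooth_on U (\<lambda>z :: (real ^ 'n) \<times> real. fst z \<bullet> fst z)"
  unfolding inner_vec_def inner_real_def by (intro smooth_on_sum smooth_on_mult smooth_on_fst_nth)

lemma smooth_cutoff: "smooth_on UNIV cutoff"
  unfolding cutoff_def
  by (intro smooth_on_mult smooth_on_diff smooth_on_const smooth_on_fst_inner smooth_on_snd
      smooth_on_compose[OF _ _ smooth_smooth_step]) auto

lemma cutoff_bounds: "0 \<le> cutoff z" "cutoff z \<le> 1"
  unfolding cutoff_def using smooth_step_bounds by (auto intro!: mult_le_one)

lemma cutoff_eq_1: "fst z \<bullet> fst z \<le> 1/32 \<Longrightarrow> snd z \<le> 1/8 \<Longrightarrow> cutoff z = 1"
  by (simp add: cutoff_def smooth_step_0)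

lemma cutoff_eq_0: "1/16 \<le> fst z \<bullet> fst z \<or> 1/4 \<le> snd z \<Longrightarrow> cutoff z = 0"
  by (auto simp: cutoff_def smooth_step_1)

lemma heat_ker_nonneg: "0 \<le> heat_ker z"
  by (simp add: heat_ker_def)

lemma open_fst_nonzero: "open {z :: 'a::euclidean_space \<times> real. fst z \<noteq> 0}"
  by (intro open_Collect_neq continuous_intros)

lemma open_snd_pos: "open {z :: 'a::euclidean_space \<times> real. 0 < snd z}"
  by (intro open_Collect_less continuous_intros)

lemma open_snd_neg: "open {z :: 'a::euclidean_space \<times> real. snd z < 0}"
  by (intro open_Collect_less continuous_intros)

text \<open>The delicate points have \<open>t = 0\<close> and \<open>x \<noteq> 0\<close>. There the
  kernel is a power of \<open>x \<bullet> x\<close> times a flat function of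
  \<open>t / (x \<bullet> x)\<close>, which treats both signs of \<open>t\<close> at once. The
  remaining points with \<open>x = 0\<close> lie in one of the two open half-spaces.\<close>

lemma smooth_heat_ker: "smooth_on (- {0}) (heat_ker :: (real ^ 'n) \<times> real \<Rightarrow> real)"
proof -
  define a where "a = - real CARD('n) / 2"
  let ?X = "{z :: (real ^ 'n) \<times> real. fst z \<noteq> 0}"
  let ?P = "{z :: (real ^ 'n) \<times> real. 0 < snd z}"
  let ?N = "{z :: (real ^ 'n) \<times> real. snd z < 0}"
  have "smooth_on ?X (\<lambda>z. (fst z \<bullet> fst z) powr a * flat_powr a (snd z * (fst z \<bullet> fst z) powr (-1)))"
    by (intro smooth_on_mult smooth_on_compose[where V = "{0<..}", OF _ _ smooth_on_powr]
        smooth_on_compose[where V = UNIV, OF _ _ smooth_flat_powr] smooth_on_fst_inner smooth_on_snd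
        open_fst_nonzero) auto
  then have X: "smooth_on ?X heat_ker"
  proof (rule smooth_on_cong[OF open_fst_nonzero, rotated])
    fix z :: "(real ^ 'n) \<times> real" assume "z \<in> ?X"
    then have q: "0 < fst z \<bullet> fst z" by simp
    then have e: "snd z * (fst z \<bullet> fst z) powr (-1) = snd z / (fst z \<bullet> fst z)"
      by (simp add: powr_minus_divide less_imp_le)
    show "(fst z \<bullet> fst z) powr a * flat_powr a (snd z * (fst z \<bullet> fst z) powr (-1)) = heat_ker z"
      unfolding e flat_powr_def heat_ker_def a_def[symmetric] using q
      by (auto simp: powr_divide zero_less_divide_iff dest: order.asym)
  qed
  have "smooth_on ?P (\<lambda>z. snd z powr a * exp ((fst z \<bullet> fst z) * ((- 1 / 4) * snd z powr (-1))))"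
    by (intro smooth_on_mult smooth_on_compose[where V = "{0<..}", OF _ _ smooth_on_powr]
        smooth_on_compose[where V = UNIV, OF _ _ smooth_on_exp] smooth_on_fst_inner smooth_on_snd
        smooth_on_const open_snd_pos) auto
  then have P: "smooth_on ?P heat_ker"
    by (rule smooth_on_cong[OF open_snd_pos, rotated])
      (auto simp: heat_ker_def a_def powr_minus_divide)
  have N: "smooth_on ?N heat_ker"
    by (rule smooth_on_cong[OF open_snd_neg _ smooth_on_const[of _ 0]]) (auto simp: heat_ker_def)
  have "smooth_on (?X \<union> ?P \<union> ?N) heat_ker"
    by (intro smooth_on_Un X P N open_fst_nonzero open_snd_pos open_snd_neg open_Un)
  moreover have "?X \<union> ?P \<union> ?N = - {0}" by (auto simp: prod_eq_iff)
  ultimately show ?thesis by simp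
qed

lemma open_Compl_0: "open (- {0 :: 'a::euclidean_space})"
  by (simp add: open_Compl)

lemma smooth_trunc_ker: "smooth_on (- {0}) trunc_ker"
  unfolding trunc_ker_def
  by (intro smooth_on_mult open_Compl_0 smooth_heat_ker smooth_on_subset[OF smooth_cutoff]) auto

text \<open>Reduces each partial derivative of the kernel to an ordinary derivative along a line.
  Differentiability has to be known beforehand, since a derivative along one line alone does not
  determine the Frechet derivative.\<close>

lemma dir_deriv_1D:
  assumes "f differentiable (at z)" "((\<lambda>s. f (z + s *\<^sub>R v)) has_real_derivative d) (at 0)"
  shows "dir_deriv v f z = d"
proof -
  have "((\<lambda>s. z + s *\<^sub>R v) has_derivative (\<lambda>s. s *\<^sub>R v)) (at (0::real))"
    by (auto intro!: derivative_eq_intros)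
  then have "((\<lambda>s. f (z + s *\<^sub>R v)) has_derivative (\<lambda>s. dir_deriv (s *\<^sub>R v) f z)) (at 0)"
    using has_derivative_compose[of "\<lambda>s. z + s *\<^sub>R v" _ "0::real" UNIV f]
      dir_deriv_has_derivative[OF assms(1)] by auto
  from has_derivative_unique[OF this assms(2)[unfolded has_field_derivative_def]]
  have "dir_deriv (1 *\<^sub>R v) f z = d * 1" by metis
  then show ?thesis by simp
qed

lemma DERIV_inner_axis:
  fixes x :: "real ^ 'n"
  assumes "D = 2 * x $ i"
  shows "((\<lambda>s. (x + s *\<^sub>R axis i 1) \<bullet> (x + s *\<^sub>R axis i 1)) has_real_derivative D) (at 0)"
proof -
  have "(\<lambda>s. (x + s *\<^sub>R axis i 1) \<bullet> (x + s *\<^sub>R axis i 1)) = (\<lambda>s. x \<bullet> x + 2 * s * x $ i + s * s)"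
    by (rule ext) (simp add: inner_add_left inner_add_right inner_axis inner_axis' algebra_simps)
  then show ?thesis using assms by (auto intro!: derivative_eq_intros)
qed

lemma heat_ker_dx:
  fixes z :: "(real ^ 'n) \<times> real"
  assumes "0 < snd z"
  shows "dir_deriv (ex i) heat_ker z = - (fst z $ i) / (2 * snd z) * heat_ker z"
proof (rule dir_deriv_1D)
  show "heat_ker differentiable (at z)"
    using assms by (intro smooth_on_differentiable[OF smooth_heat_ker]) auto
  show "((\<lambda>s. heat_ker (z + s *\<^sub>R ex i)) has_real_derivative
      - (fst z $ i) / (2 * snd z) * heat_ker z) (at 0)"
    using assms unfolding heat_ker_def
    by (auto intro!: derivative_eq_intros DERIV_inner_axis simp: field_simps)
qed

text \<open>Laplacian and time derivative are both
  \<open>- n / (2 * t) + (x \<bullet> x) / (4 * t^2)\<close> times the kernel: the first term comes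
  from summing \<open>n\<close> equal contributions, respectively from differentiating the power of
  \<open>t\<close>.\<close>

lemma heat_op_heat_ker:
  fixes z :: "(real ^ 'n) \<times> real"
  assumes "0 < snd z"
  shows "heat_op heat_ker z = 0"
proof -
  let ?t = "snd z" and ?x = "fst z"
  have "dir_deriv (ex i) (dir_deriv (ex i) heat_ker) z =
      (- 1 / (2 * ?t) + (?x $ i * ?x $ i) / (4 * ?t\<^sup>2)) * heat_ker z" for i
  proof (rule dir_deriv_1D)
    show "dir_deriv (ex i) heat_ker differentiable (at z)"
      using assms by (intro smooth_on_differentiable[OF smooth_on_dir_deriv[OF smooth_heat_ker]]) auto
    have e: "(\<lambda>s. dir_deriv (ex i) heat_ker (z + s *\<^sub>R ex i)) =
        (\<lambda>s. - (?x $ i + s) / (2 * ?t) * heat_ker (z + s *\<^sub>R ex i))"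
      using assms by (subst heat_ker_dx) auto
    show "((\<lambda>s. dir_deriv (ex i) heat_ker (z + s *\<^sub>R ex i)) has_real_derivative
      (- 1 / (2 * ?t) + (?x $ i * ?x $ i) / (4 * ?t\<^sup>2)) * heat_ker z) (at 0)"
      unfolding e using assms unfolding heat_ker_def
      by (auto intro!: derivative_eq_intros DERIV_inner_axis simp: field_simps power2_eq_square)
  qed
  then have "laplacian_x heat_ker z =
      (- real CARD('n) / (2 * ?t) + (?x \<bullet> ?x) / (4 * ?t\<^sup>2)) * heat_ker z"
    by (simp add: laplacian_x_def sum_distrib_right[symmetric] sum.distrib sum_subtractf inner_vec_def
        sum_divide_distrib[symmetric])
  moreover have "time_deriv heat_ker z = (- real CARD('n) / (2 * ?t) + (?x \<bullet> ?x) / (4 * ?t\<^sup>2)) * heat_ker z"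
    unfolding time_deriv_def
  proof (rule dir_deriv_1D)
    show "heat_ker differentiable (at z)"
      using assms by (intro smooth_on_differentiable[OF smooth_heat_ker]) auto
    have d: "((\<lambda>s. (?t + s) powr a * exp (- (?x \<bullet> ?x) / (4 * (?t + s)))) has_real_derivative
      (a / ?t + (?x \<bullet> ?x) / (4 * ?t\<^sup>2)) * (?t powr a * exp (- (?x \<bullet> ?x) / (4 * ?t)))) (at 0)" for a
      using assms
      by (auto intro!: derivative_eq_intros simp: powr_diff field_simps power2_eq_square)
    have "((\<lambda>s. (?t + s) powr (- real CARD('n) / 2) * exp (- (?x \<bullet> ?x) / (4 * (?t + s)))) has_real_derivative
      (- real CARD('n) / (2 * ?t) + (?x \<bullet> ?x) / (4 * ?t\<^sup>2)) * heat_ker z) (at 0)"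
      using d[of "- real CARD('n) / 2"] assms unfolding heat_ker_def by simp
    then show "((\<lambda>s. heat_ker (z + s *\<^sub>R et)) has_real_derivative
      (- real CARD('n) / (2 * ?t) + (?x \<bullet> ?x) / (4 * ?t\<^sup>2)) * heat_ker z) (at 0)"
      by (rule has_field_derivative_transform_within_open[where S = "{- ?t<..}"])
        (use assms in \<open>auto simp: heat_ker_def\<close>)
  qed
  ultimately show ?thesis by (simp add: heat_op_def)
qed

lemma heat_op_cong_open:
  assumes "open U" "z \<in> U" "\<And>x. x \<in> U \<Longrightarrow> f x = g x"
  shows "heat_op f z = heat_op g z"
proof -
  have e: "dir_deriv v f x = dir_deriv v g x" if "x \<in> U" for v x
    using dir_deriv_cong_open(2)[OF assms(1) that assms(3)] .
  have "dir_deriv w (dir_deriv v f) z = dir_deriv w (dir_deriv v g) z" for v w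
    using dir_deriv_cong_open(2)[OF assms(1,2) e] .
  then show ?thesis using e[OF assms(2)] by (simp add: heat_op_def laplacian_x_def time_deriv_def)
qed

lemma dir_deriv_const: "dir_deriv v (\<lambda>_. c) z = 0"
  using dir_deriv_eq[OF has_derivative_const] .

lemma heat_op_const: "heat_op (\<lambda>_. c) z = 0"
  unfolding heat_op_def laplacian_x_def time_deriv_def by (simp add: dir_deriv_const[abs_def])

lemma smooth_heat_op: "open U \<Longrightarrow> smooth_on U f \<Longrightarrow> smooth_on U (heat_op f)"
  unfolding heat_op_def laplacian_x_def time_deriv_def
  by (intro smooth_on_diff smooth_on_sum smooth_on_dir_deriv)

text \<open>This is the function \<open>k\<close> of the representation, that is, the distribution
  obtained from \<open>trunc_ker\<close> without its point mass at the origin. The value 0 there is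
  the smooth extension, because \<open>heat_op trunc_ker\<close> vanishes at all nearby points other
  than the origin.\<close>

definition smooth_ker :: "(real ^ 'n) \<times> real \<Rightarrow> real" where
  "smooth_ker z = (if z = 0 then 0 else heat_op trunc_ker z)"

lemma smooth_ker_near_0:
  fixes z :: "(real ^ 'n) \<times> real"
  assumes "fst z \<bullet> fst z < 1/32" "snd z < 1/8"
  shows "smooth_ker z = 0"
proof (cases "z = 0")
  case False
  let ?V = "{z :: (real ^ 'n) \<times> real. fst z \<bullet> fst z < 1/32 \<and> snd z < 1/8}"
  have oV: "open ?V" by (intro open_Collect_conj open_Collect_less continuous_intros)
  have nz: "heat_op trunc_ker y = 0" if "y \<in> ?V" "snd y \<noteq> 0" for y
  proof (cases "snd y > 0")
    case True
    have "heat_op trunc_ker y = heat_op heat_ker y"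
      by (rule heat_op_cong_open[OF oV that(1)]) (auto simp: trunc_ker_def cutoff_eq_1)
    then show ?thesis using heat_op_heat_ker[OF True] by simp
  next
    case False
    have "heat_op trunc_ker y = heat_op (\<lambda>_. 0) y"
      by (rule heat_op_cong_open[OF open_snd_neg]) (use False that in \<open>auto simp: trunc_ker_def heat_ker_def\<close>)
    then show ?thesis using heat_op_const[of 0] by simp
  qed
  have "heat_op trunc_ker z = 0"
  \<comment> \<open>At time 0 neither the formula for positive times nor the zero function describes
    a full neighbourhood, so the value is found as a limit from negative times.\<close>
  proof (cases "snd z = 0")
    case True
    have "isCont (heat_op trunc_ker) z"
      using smooth_on_continuous[OF smooth_heat_op[OF open_Compl_0 smooth_trunc_ker]] False
      unfolding continuous_on_eq_continuous_at[OF open_Compl_0] by blast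
    moreover have "((\<lambda>s. z - s *\<^sub>R et) \<longlongrightarrow> z - 0 *\<^sub>R et) (at_right (0::real))"
      by (intro tendsto_intros)
    then have "((\<lambda>s. z - s *\<^sub>R et) \<longlongrightarrow> z) (at_right (0::real))"
      by (simp only: scaleR_zero_left diff_zero)
    ultimately have "((\<lambda>s. heat_op trunc_ker (z - s *\<^sub>R et)) \<longlongrightarrow> heat_op trunc_ker z) (at_right (0::real))"
      by (rule isCont_tendsto_compose)
    moreover have "\<forall>\<^sub>F s in at_right (0::real). heat_op trunc_ker (z - s *\<^sub>R et) = 0"
      unfolding eventually_at_filter
      by (rule always_eventually) (use nz True assms in auto)
    ultimately show ?thesis
      using tendsto_unique[OF trivial_limit_at_right_real _ tendsto_eventually[of _ 0]] by blast
  qed (use nz assms in auto)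
  then show ?thesis by (simp add: smooth_ker_def)
qed (simp add: smooth_ker_def)

lemma smooth_smooth_ker: "smooth_on UNIV (smooth_ker :: (real ^ 'n) \<times> real \<Rightarrow> real)"
proof -
  let ?V = "{z :: (real ^ 'n) \<times> real. fst z \<bullet> fst z < 1/32 \<and> snd z < 1/8}"
  have oV: "open ?V" by (intro open_Collect_conj open_Collect_less continuous_intros)
  have "smooth_on (- {0}) (smooth_ker :: (real ^ 'n) \<times> real \<Rightarrow> real)"
    by (rule smooth_on_cong[OF open_Compl_0 _ smooth_heat_op[OF open_Compl_0 smooth_trunc_ker]])
      (simp add: smooth_ker_def)
  moreover have "smooth_on ?V smooth_ker"
    by (rule smooth_on_cong[OF oV _ smooth_on_const[of _ 0]]) (auto simp: smooth_ker_near_0)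
  ultimately have "smooth_on (- {0} \<union> ?V) (smooth_ker :: (real ^ 'n) \<times> real \<Rightarrow> real)"
    by (intro smooth_on_Un open_Compl_0 oV)
  moreover have "- {0} \<union> ?V = UNIV" by auto
  ultimately show ?thesis by simp
qed

lemma trunc_ker_eq_0: "1/4 \<le> norm (fst z) \<or> snd z \<le> 0 \<or> 1/4 \<le> snd z \<Longrightarrow> trunc_ker z = 0"
proof -
  have "1/16 \<le> fst z \<bullet> fst z" if "1/4 \<le> norm (fst z)"
    using power_mono[OF that, of 2] unfolding power2_norm_eq_inner by (simp add: power2_eq_square)
  then show "1/4 \<le> norm (fst z) \<or> snd z \<le> 0 \<or> 1/4 \<le> snd z \<Longrightarrow> trunc_ker z = 0"
    using cutoff_eq_0[of z] by (auto simp: trunc_ker_def heat_ker_def)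
qed

lemma trunc_ker_nonneg: "0 \<le> trunc_ker z"
  by (simp add: trunc_ker_def cutoff_bounds heat_ker_nonneg)

lemma smooth_ker_eq_0:
  fixes z :: "(real ^ 'n) \<times> real"
  assumes "1/4 < norm (fst z) \<or> snd z < 0 \<or> 1/4 < snd z"
  shows "smooth_ker z = 0"
proof (cases "z = 0")
  case False
  let ?V = "{z :: (real ^ 'n) \<times> real. 1/4 < norm (fst z) \<or> snd z < 0 \<or> 1/4 < snd z}"
  have oV: "open ?V" by (intro open_Collect_disj open_Collect_less continuous_intros)
  have "heat_op trunc_ker z = heat_op (\<lambda>_. 0) z"
    by (rule heat_op_cong_open[OF oV]) (use assms in \<open>auto intro!: trunc_ker_eq_0\<close>)
  then show ?thesis by (simp add: heat_op_const smooth_ker_def)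
qed (simp add: smooth_ker_def)

text \<open>\<open>smooth_ker_eq_0\<close> is confined to strict inequalities because it needs an
  open set; continuity adds the time 0. The removal of the time cutoff uses exactly this, since
  \<open>time_cut\<close> does not tend to 1 at nonpositive times.\<close>

lemma smooth_ker_eq_0_past: "snd z \<le> 0 \<Longrightarrow> smooth_ker z = 0"
proof -
  have "((\<lambda>s. smooth_ker (z - s *\<^sub>R et)) \<longlongrightarrow> smooth_ker (z - 0 *\<^sub>R et)) (at_right (0::real))"
    by (intro continuous_on_tendsto_compose[OF smooth_on_continuous[OF smooth_smooth_ker]] tendsto_intros) auto
  moreover assume "snd z \<le> 0"
  then have "\<forall>\<^sub>F s in at_right (0::real). smooth_ker (z - s *\<^sub>R et) = 0"
    unfolding eventually_at_filter by (intro always_eventually) (auto intro!: smooth_ker_eq_0)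
  ultimately have "smooth_ker (z - 0 *\<^sub>R et) = 0"
    using tendsto_unique[OF trivial_limit_at_right_real _ tendsto_eventually[of _ 0]] by blast
  then show "smooth_ker z = 0" by (simp only: scaleR_zero_left diff_zero)
qed

text \<open>The time cutoff at scale \<open>\<delta>\<^sup>2\<close> removes the singularity of the kernel at the origin; the
  price is the approximate identity \<open>approx_id \<delta>\<close>.\<close>

definition time_cut :: "real \<Rightarrow> (real ^ 'n) \<times> real \<Rightarrow> real" where
  "time_cut \<delta> z = smooth_step (snd z / \<delta>\<^sup>2 - 1)"

definition reg_ker :: "real \<Rightarrow> (real ^ 'n) \<times> real \<Rightarrow> real" where
  "reg_ker \<delta> z = time_cut \<delta> z * trunc_ker z"

definition approx_id :: "real \<Rightarrow> (real ^ 'n) \<times> real \<Rightarrow> real" where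
  "approx_id \<delta> z = deriv smooth_step (snd z / \<delta>\<^sup>2 - 1) / \<delta>\<^sup>2 * trunc_ker z"

lemma smooth_time_cut: "smooth_on UNIV (time_cut \<delta>)"
proof -
  have "smooth_on UNIV (\<lambda>z. smooth_step (snd z * (1 / \<delta>\<^sup>2) - 1))"
    by (intro smooth_on_compose[OF _ _ smooth_smooth_step] smooth_on_diff smooth_on_mult smooth_on_snd
        smooth_on_const) auto
  then show ?thesis by (simp add: time_cut_def[abs_def])
qed

lemma open_snd_less: "open {z :: 'a::euclidean_space \<times> real. snd z < c}"
  by (intro open_Collect_less continuous_intros)

text \<open>The times below \<open>\<delta>\<^sup>2\<close> form an open set that contains the
  origin, the only singular point, and on which the time cutoff is zero.\<close>

lemma smooth_reg_ker:
  assumes "0 < \<delta>" shows "smooth_on UNIV (reg_ker \<delta> :: (real ^ 'n) \<times> real \<Rightarrow> real)"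
proof -
  have "smooth_on (- {0}) (reg_ker \<delta> :: (real ^ 'n) \<times> real \<Rightarrow> real)"
    unfolding reg_ker_def
    by (intro smooth_on_mult open_Compl_0 smooth_trunc_ker smooth_on_subset[OF smooth_time_cut]) auto
  moreover have "smooth_on {z :: (real ^ 'n) \<times> real. snd z < \<delta>\<^sup>2} (reg_ker \<delta>)"
    by (rule smooth_on_cong[OF open_snd_less _ smooth_on_const[of _ 0]])
      (use assms in \<open>auto simp: reg_ker_def time_cut_def smooth_step_0\<close>)
  ultimately have "smooth_on (- {0} \<union> {z. snd z < \<delta>\<^sup>2}) (reg_ker \<delta> :: (real ^ 'n) \<times> real \<Rightarrow> real)"
    by (intro smooth_on_Un open_Compl_0 open_snd_less)
  moreover have "- {0 :: (real ^ 'n) \<times> real} \<union> {z. snd z < \<delta>\<^sup>2} = UNIV" using assms by auto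
  ultimately show ?thesis by simp
qed

lemma smooth_step_deriv: "(smooth_step has_real_derivative deriv smooth_step t) (at t)"
  using smooth_on_differentiable[OF smooth_smooth_step, of t]
  by (simp add: DERIV_deriv_iff_real_differentiable)

lemma smooth_deriv_smooth_step: "smooth_on UNIV (deriv smooth_step)"
proof -
  have "dir_deriv 1 smooth_step t = deriv smooth_step t" for t
    using dir_deriv_eq[OF smooth_step_deriv[unfolded has_field_derivative_def], of 1] by simp
  then have "dir_deriv 1 smooth_step = deriv smooth_step" by auto
  then show ?thesis using smooth_on_dir_deriv[OF smooth_smooth_step, of 1] by simp
qed

text \<open>Outside \<open>[0, 1]\<close> the step is locally constant; the two endpoints follow by
  continuity of the derivative.\<close>

lemma deriv_smooth_step_eq_0: "t \<le> 0 \<or> 1 \<le> t \<Longrightarrow> deriv smooth_step t = 0"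
proof -
  have c: "isCont (deriv smooth_step) t" for t
    using smooth_on_continuous[OF smooth_deriv_smooth_step] by (simp add: continuous_on_eq_continuous_at)
  have l: "deriv smooth_step t = 0" if "t < 0" for t
  proof -
    have "((\<lambda>_. 0) has_real_derivative 0) (at t)" by simp
    then have "(smooth_step has_real_derivative 0) (at t)"
      by (rule has_field_derivative_transform_within_open[where S = "{..<0}"])
        (use that in \<open>auto simp: smooth_step_0\<close>)
    then show ?thesis by (rule DERIV_imp_deriv)
  qed
  have r: "deriv smooth_step t = 0" if "1 < t" for t
  proof -
    have "((\<lambda>_. 1) has_real_derivative 0) (at t)" by simp
    then have "(smooth_step has_real_derivative 0) (at t)"
      by (rule has_field_derivative_transform_within_open[where S = "{1<..}"])
        (use that in \<open>auto simp: smooth_step_1\<close>)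
    then show ?thesis by (rule DERIV_imp_deriv)
  qed
  have "deriv smooth_step 0 = 0"
  proof (rule tendsto_unique[OF trivial_limit_at_left_real])
    show "(deriv smooth_step \<longlongrightarrow> deriv smooth_step 0) (at_left 0)"
      using c[of 0] by (simp add: isCont_def filterlim_at_split)
    show "(deriv smooth_step \<longlongrightarrow> 0) (at_left 0)"
      by (rule tendsto_eventually) (auto simp: eventually_at_filter l)
  qed
  moreover have "deriv smooth_step 1 = 0"
  proof (rule tendsto_unique[OF trivial_limit_at_right_real])
    show "(deriv smooth_step \<longlongrightarrow> deriv smooth_step 1) (at_right 1)"
      using c[of 1] by (simp add: isCont_def filterlim_at_split)
    show "(deriv smooth_step \<longlongrightarrow> 0) (at_right 1)"
      by (rule tendsto_eventually) (auto simp: eventually_at_filter r)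
  qed
  ultimately show "t \<le> 0 \<or> 1 \<le> t \<Longrightarrow> deriv smooth_step t = 0"
    using l r by (metis order_le_less)
qed

text \<open>The time cutoff is independent of \<open>x\<close>, so the Laplacian passes through it
  and only the time derivative leaves an extra term. For times below \<open>\<delta>\<^sup>2\<close>
  everything vanishes; at other points the origin is excluded and the product rule applies.\<close>

lemma heat_op_reg_ker:
  fixes z :: "(real ^ 'n) \<times> real"
  assumes "0 < \<delta>"
  shows "heat_op (reg_ker \<delta>) z = time_cut \<delta> z * smooth_ker z - approx_id \<delta> z"
proof (cases "snd z < \<delta>\<^sup>2")
  case True
  have "heat_op (reg_ker \<delta>) z = heat_op (\<lambda>_. 0) z"
    by (rule heat_op_cong_open[OF open_snd_less[of "\<delta>\<^sup>2"]])
      (use True assms in \<open>auto simp: reg_ker_def time_cut_def smooth_step_0\<close>)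
  then show ?thesis using True assms
    by (simp add: heat_op_const approx_id_def time_cut_def smooth_step_0 deriv_smooth_step_eq_0)
next
  case False
  then have z: "z \<noteq> 0" using assms by auto
  have dT: "time_cut \<delta> differentiable (at y)" for y :: "(real ^ 'n) \<times> real"
    by (rule smooth_on_differentiable[OF smooth_time_cut UNIV_I])
  have dE: "trunc_ker differentiable (at y)" if "y \<noteq> 0" for y :: "(real ^ 'n) \<times> real"
    by (rule smooth_on_differentiable[OF smooth_trunc_ker]) (use that in auto)
  have dd: "dir_deriv v (\<lambda>z. time_cut \<delta> z * g z) y = time_cut \<delta> y * dir_deriv v g y + dir_deriv v (time_cut \<delta>) y * g y"
    if "g differentiable (at y)" for v y and g :: "(real ^ 'n) \<times> real \<Rightarrow> real"
    by (rule dir_deriv_eq) (intro has_derivative_mult dir_deriv_has_derivative dT that)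
  have Tx: "dir_deriv (ex i) (time_cut \<delta>) y = 0" for i and y :: "(real ^ 'n) \<times> real"
    by (rule dir_deriv_1D[OF dT]) (simp add: time_cut_def)
  have Tt: "dir_deriv et (time_cut \<delta>) z = deriv smooth_step (snd z / \<delta>\<^sup>2 - 1) / \<delta>\<^sup>2"
  proof (rule dir_deriv_1D[OF dT])
    have "((\<lambda>s. (snd z + s) / \<delta>\<^sup>2 - 1) has_real_derivative 1 / \<delta>\<^sup>2) (at 0)"
      using assms by (auto intro!: derivative_eq_intros simp: field_simps power2_eq_square power4_eq_xxxx)
    from DERIV_chain2[of smooth_step _ _ 0, OF smooth_step_deriv this]
    show "((\<lambda>s. time_cut \<delta> (z + s *\<^sub>R et)) has_real_derivative
        deriv smooth_step (snd z / \<delta>\<^sup>2 - 1) / \<delta>\<^sup>2) (at 0)"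
      by (simp add: time_cut_def)
  qed
  have d1: "dir_deriv (ex i) (reg_ker \<delta>) y = time_cut \<delta> y * dir_deriv (ex i) trunc_ker y"
    if "y \<in> - {0}" for i and y :: "(real ^ 'n) \<times> real"
    using that dd[OF dE, of y "ex i"] Tx by (simp add: reg_ker_def[abs_def])
  have "dir_deriv (ex i) (dir_deriv (ex i) (reg_ker \<delta>)) z =
      dir_deriv (ex i) (\<lambda>y. time_cut \<delta> y * dir_deriv (ex i) trunc_ker y) z" for i
    by (rule dir_deriv_cong_open(2)[OF open_Compl_0]) (use z d1 in auto)
  also have "\<dots> i = time_cut \<delta> z * dir_deriv (ex i) (dir_deriv (ex i) trunc_ker) z" for i
    using dd[of "dir_deriv (ex i) trunc_ker" z "ex i"] Tx z
      smooth_on_differentiable[OF smooth_on_dir_deriv[OF smooth_trunc_ker], of z] by simp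
  finally have "laplacian_x (reg_ker \<delta>) z = time_cut \<delta> z * laplacian_x trunc_ker z"
    by (simp add: laplacian_x_def sum_distrib_left)
  moreover have "time_deriv (reg_ker \<delta>) z = time_cut \<delta> z * time_deriv trunc_ker z + approx_id \<delta> z"
    using dd[OF dE[OF z], of et] Tt by (simp add: time_deriv_def reg_ker_def[abs_def] approx_id_def)
  ultimately show ?thesis using z by (simp add: heat_op_def smooth_ker_def algebra_simps)
qed

section \<open>Parabolic Taylor expansion\<close>

lemma dir_deriv_Basis:
  fixes f :: "'a::euclidean_space \<Rightarrow> real"
  assumes "f differentiable (at z)"
  shows "dir_deriv h f z = (\<Sum>b\<in>Basis. (h \<bullet> b) * dir_deriv b f z)"
proof -
  have l: "linear (\<lambda>v. dir_deriv v f z)"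
    using dir_deriv_has_derivative[OF assms] has_derivative_linear by blast
  have "dir_deriv h f z = dir_deriv (\<Sum>b\<in>Basis. (h \<bullet> b) *\<^sub>R b) f z"
    by (simp add: euclidean_representation)
  also have "\<dots> = (\<Sum>b\<in>Basis. (h \<bullet> b) * dir_deriv b f z)"
    using linear_sum[OF l, of "\<lambda>b. (h \<bullet> b) *\<^sub>R b" Basis] linear_scale[OF l]
    by (simp del: euclidean_representation)
  finally show ?thesis .
qed

lemma dir_deriv_lincomb:
  fixes f :: "'i \<Rightarrow> 'a::euclidean_space \<Rightarrow> real"
  assumes "\<And>i. i \<in> I \<Longrightarrow> f i differentiable (at z)"
  shows "dir_deriv h (\<lambda>z. \<Sum>i\<in>I. c i * f i z) z = (\<Sum>i\<in>I. c i * dir_deriv h (f i) z)"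
proof (rule dir_deriv_eq)
  show "((\<lambda>z. \<Sum>i\<in>I. c i * f i z) has_derivative (\<lambda>h. \<Sum>i\<in>I. c i * dir_deriv h (f i) z)) (at z)"
    using assms by (intro has_derivative_sum has_derivative_mult_right dir_deriv_has_derivative)
qed

lemma smooth_iter_dir_deriv: "smooth_on UNIV f \<Longrightarrow> smooth_on UNIV ((dir_deriv h ^^ m) f)"
  by (induction m) (auto simp: smooth_on_dir_deriv)

lemma iter_dir_deriv_lincomb:
  fixes f :: "'i \<Rightarrow> 'a::euclidean_space \<Rightarrow> real"
  assumes "\<And>i. i \<in> I \<Longrightarrow> smooth_on UNIV (f i)"
  shows "(dir_deriv h ^^ m) (\<lambda>z. \<Sum>i\<in>I. c i * f i z) = (\<lambda>z. \<Sum>i\<in>I. c i * (dir_deriv h ^^ m) (f i) z)"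
proof (induction m)
  case (Suc m)
  have "dir_deriv h (\<lambda>z. \<Sum>i\<in>I. c i * (dir_deriv h ^^ m) (f i) z) z =
      (\<Sum>i\<in>I. c i * dir_deriv h ((dir_deriv h ^^ m) (f i)) z)" for z
    by (rule dir_deriv_lincomb)
      (use smooth_on_differentiable[OF smooth_iter_dir_deriv[OF assms] UNIV_I] in blast)
  then show ?case using Suc by auto
qed simp

lemma smooth_dir_deriv_Basis:
  fixes f :: "'a::euclidean_space \<Rightarrow> real"
  assumes "smooth_on UNIV f"
  shows "dir_deriv h f = (\<lambda>z. \<Sum>b\<in>Basis. (h \<bullet> b) * dir_deriv b f z)"
  using dir_deriv_Basis[OF smooth_on_differentiable[OF assms UNIV_I]] by blast

definition bump :: "('a::euclidean_space \<Rightarrow> real) \<Rightarrow> bool" where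
  "bump f \<longleftrightarrow> smooth_on UNIV f \<and> (\<exists>K. compact K \<and> (\<forall>z. z \<notin> K \<longrightarrow> f z = 0))"

lemma bump_dir_deriv:
  assumes "bump f" shows "bump (dir_deriv v f)"
proof -
  obtain K where K: "compact K" "\<And>z. z \<notin> K \<Longrightarrow> f z = 0" using assms unfolding bump_def by blast
  have "dir_deriv v f z = 0" if "z \<notin> K" for z
  proof -
    have "dir_deriv v f z = dir_deriv v (\<lambda>_. 0) z"
      by (rule dir_deriv_cong_open(2)[of "- K"]) (use K that in \<open>auto simp: open_Compl compact_imp_closed\<close>)
    then show ?thesis by (simp add: dir_deriv_const)
  qed
  then show ?thesis using assms K(1) smooth_on_dir_deriv unfolding bump_def by blast
qed

lemma bump_bounded:
  assumes "bump f" obtains B where "0 \<le> B" "\<And>z. \<bar>f z\<bar> \<le> B"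
proof -
  obtain K where K: "compact K" "\<And>z. z \<notin> K \<Longrightarrow> f z = 0" using assms unfolding bump_def by blast
  have "bounded (f ` K)"
    using assms K(1) unfolding bump_def
    by (intro compact_imp_bounded compact_continuous_image)
      (auto intro: continuous_on_subset[OF smooth_on_continuous])
  then obtain B where "\<And>z. z \<in> K \<Longrightarrow> \<bar>f z\<bar> \<le> B" by (auto simp: bounded_iff)
  then have "\<bar>f z\<bar> \<le> max 0 B" for z using K(2)[of z] by (cases "z \<in> K") fastforce+
  then show ?thesis using that[of "max 0 B"] by auto
qed

text \<open>Only the innermost derivative along \<open>h\<close> is expanded in the basis. This
  replaces \<open>f\<close> by finitely many basis derivatives, which are bumps again, costs one
  factor \<open>norm h\<close> and leaves an iterated derivative of lower order.\<close>

lemma iter_dir_deriv_bound: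
  fixes f :: "'a::euclidean_space \<Rightarrow> real"
  assumes "bump f"
  shows "\<exists>C\<ge>0. \<forall>h z. \<bar>(dir_deriv h ^^ m) f z\<bar> \<le> C * norm h ^ m"
  using assms
proof (induction m arbitrary: f)
  case 0
  then show ?case using bump_bounded[OF 0] by (metis funpow_0 mult.right_neutral power_0)
next
  case (Suc m)
  have "\<exists>C. \<forall>b\<in>Basis. C b \<ge> 0 \<and> (\<forall>h z. \<bar>(dir_deriv h ^^ m) (dir_deriv b f) z\<bar> \<le> C b * norm h ^ m)"
    using Suc.IH[OF bump_dir_deriv[OF Suc.prems]] by metis
  then obtain C where C: "\<And>b. b \<in> Basis \<Longrightarrow> C b \<ge> 0"
    "\<And>b h z. b \<in> Basis \<Longrightarrow> \<bar>(dir_deriv h ^^ m) (dir_deriv b f) z\<bar> \<le> C b * norm h ^ m" by metis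
  have sm: "smooth_on UNIV f" using Suc.prems bump_def by blast
  show ?case
  proof (intro exI[of _ "\<Sum>b\<in>Basis. C b"] conjI allI)
    show "0 \<le> sum C Basis" using C(1) by (simp add: sum_nonneg)
    fix h z
    have "(dir_deriv h ^^ Suc m) f z = (dir_deriv h ^^ m) (dir_deriv h f) z"
      by (simp add: funpow_swap1)
    also have "\<dots> = (\<Sum>b\<in>Basis. (h \<bullet> b) * (dir_deriv h ^^ m) (dir_deriv b f) z)"
      by (subst smooth_dir_deriv_Basis[OF sm], subst iter_dir_deriv_lincomb)
        (auto intro: smooth_on_dir_deriv sm)
    finally have "\<bar>(dir_deriv h ^^ Suc m) f z\<bar> \<le> (\<Sum>b\<in>Basis. \<bar>h \<bullet> b\<bar> * \<bar>(dir_deriv h ^^ m) (dir_deriv b f) z\<bar>)"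
      by (simp add: abs_mult order_trans[OF sum_abs])
    also have "\<dots> \<le> (\<Sum>b\<in>Basis. norm h * (C b * norm h ^ m))"
      by (intro sum_mono mult_mono C Basis_le_norm) auto
    also have "\<dots> = sum C Basis * norm h ^ Suc m"
      by (simp add: sum_distrib_right sum_distrib_left mult_ac)
    finally show "\<bar>(dir_deriv h ^^ Suc m) f z\<bar> \<le> sum C Basis * norm h ^ Suc m" .
  qed
qed

text \<open>Maclaurin's formula on the segment from \<open>w\<close> to \<open>w + h\<close>.
  Differentiation is along the unnormalised vector \<open>h\<close>, so the remainder already
  carries the cube of its norm.\<close>

lemma taylor_2:
  fixes f :: "'a::euclidean_space \<Rightarrow> real"
  assumes "bump f"
  shows "\<exists>C\<ge>0. \<forall>w h. \<bar>f (w + h) - (f w + dir_deriv h f w + dir_deriv h (dir_deriv h f) w / 2)\<bar> \<le> C * norm h ^ 3"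
proof -
  obtain C where C: "C \<ge> 0" "\<And>h z. \<bar>(dir_deriv h ^^ 3) f z\<bar> \<le> C * norm h ^ 3"
    using iter_dir_deriv_bound[OF assms] by blast
  have sm: "smooth_on UNIV f" using assms bump_def by blast
  show ?thesis
  proof (intro exI[of _ C] conjI allI)
    fix w h
    define d where "d m s = (dir_deriv h ^^ m) f (w + s *\<^sub>R h)" for m and s :: real
    have D: "DERIV (d m) s :> d (Suc m) s" for m s
    proof -
      let ?g = "(dir_deriv h ^^ m) f"
      have g: "(?g has_derivative (\<lambda>v. dir_deriv v ?g (w + s *\<^sub>R h))) (at (w + s *\<^sub>R h))"
        by (intro dir_deriv_has_derivative smooth_on_differentiable[OF smooth_iter_dir_deriv[OF sm] UNIV_I])
      have "((\<lambda>s. w + s *\<^sub>R h) has_derivative (\<lambda>s. s *\<^sub>R h)) (at s)"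
        by (auto intro!: derivative_eq_intros)
      from has_derivative_compose[OF this g]
      have "((\<lambda>s. ?g (w + s *\<^sub>R h)) has_derivative (\<lambda>v. dir_deriv (v *\<^sub>R h) ?g (w + s *\<^sub>R h))) (at s)" .
      moreover have "dir_deriv (v *\<^sub>R h) ?g (w + s *\<^sub>R h) = dir_deriv h ?g (w + s *\<^sub>R h) * v" for v
        using linear_simps(5)[OF has_derivative_bounded_linear[OF g], of v h] by simp
      ultimately show ?thesis by (simp add: d_def[abs_def] has_field_derivative_def)
    qed
    obtain t where t: "d 0 1 = (\<Sum>m<3. d m 0 / fact m * 1 ^ m) + d 3 t / fact 3 * 1 ^ 3"
      using Maclaurin_all_le[of d "d 0" 1 3] D by auto
    have "f (w + h) - (f w + dir_deriv h f w + dir_deriv h (dir_deriv h f) w / 2) = d 3 t / 6"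
      using t by (simp add: d_def eval_nat_numeral)
    moreover have "\<bar>d 3 t / 6\<bar> \<le> \<bar>d 3 t\<bar>" by simp
    moreover have "\<bar>d 3 t\<bar> \<le> C * norm h ^ 3" unfolding d_def by (rule C)
    ultimately show "\<bar>f (w + h) - (f w + dir_deriv h f w + dir_deriv h (dir_deriv h f) w / 2)\<bar> \<le> C * norm h ^ 3"
      by linarith
  qed (rule C)
qed

lemma dir_deriv_pair:
  fixes f :: "(real ^ 'n) \<times> real \<Rightarrow> real"
  assumes "f differentiable (at z)"
  shows "dir_deriv (x, t) f z = (\<Sum>i\<in>UNIV. x $ i * dir_deriv (ex i) f z) + t * dir_deriv et f z"
proof -
  have l: "linear (\<lambda>v. dir_deriv v f z)"
    using dir_deriv_has_derivative[OF assms] has_derivative_linear by blast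
  have x: "(\<Sum>i\<in>UNIV. x $ i *\<^sub>R axis i (1::real)) = x"
    by (simp add: vec_eq_iff axis_def if_distrib[of "\<lambda>y. _ * y"] cong: if_cong)
  have "(x, t) = (\<Sum>i\<in>UNIV. x $ i *\<^sub>R ex i) + t *\<^sub>R et"
    by (simp add: prod_eq_iff fst_sum snd_sum x)
  then have "dir_deriv (x, t) f z = dir_deriv ((\<Sum>i\<in>UNIV. x $ i *\<^sub>R ex i) + t *\<^sub>R et) f z" by simp
  also have "\<dots> = (\<Sum>i\<in>UNIV. x $ i * dir_deriv (ex i) f z) + t * dir_deriv et f z"
    using linear_add[OF l] linear_sum[OF l, of "\<lambda>i. x $ i *\<^sub>R ex i" UNIV] linear_scale[OF l, of _ "ex _"]
      linear_scale[OF l, of t et] by simp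
  finally show ?thesis .
qed

text \<open>The increment has norm at most \<open>2 * \<rho>\<close>. In the second-order Taylor
  term the products of \<open>t\<close> with a space coordinate have size \<open>\<rho> ^ 3\<close>
  and the square of \<open>t\<close> is smaller still, so only the pure space derivatives stay in
  the polynomial, which is then of parabolic degree two.\<close>

lemma parabolic_taylor:
  fixes f :: "(real ^ 'n) \<times> real \<Rightarrow> real"
  assumes "bump f"
  shows "\<exists>C\<ge>0. \<forall>w x t \<rho>. 0 < \<rho> \<and> \<rho> \<le> 1 \<and> norm x \<le> \<rho> \<and> \<bar>t\<bar> \<le> \<rho>\<^sup>2 \<longrightarrow>
    \<bar>f (w + (x, t)) - (f w + (\<Sum>i\<in>UNIV. x $ i * dir_deriv (ex i) f w)
      + (\<Sum>i\<in>UNIV. \<Sum>j\<in>UNIV. x $ i * (x $ j) * dir_deriv (ex j) (dir_deriv (ex i) f) w) / 2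
      + t * dir_deriv et f w)\<bar> \<le> C * \<rho> ^ 3"
proof -
  have sm: "smooth_on UNIV f" using assms bump_def by blast
  have df: "f differentiable (at z)" "dir_deriv v f differentiable (at z)" for z v
    using smooth_on_differentiable[OF sm] smooth_on_differentiable[OF smooth_on_dir_deriv[OF sm]] by blast+
  obtain C0 where C0: "C0 \<ge> 0" "\<And>w h. \<bar>f (w + h) - (f w + dir_deriv h f w + dir_deriv h (dir_deriv h f) w / 2)\<bar> \<le> C0 * norm h ^ 3"
    using taylor_2[OF assms] by blast
  have "\<exists>C\<ge>0. \<forall>z. \<bar>dir_deriv et (dir_deriv (ex i) f) z\<bar> \<le> C" for i
    by (rule bump_bounded[OF bump_dir_deriv[OF bump_dir_deriv[OF assms]], of et "ex i"]) blast
  then obtain C1 where C1: "\<And>i. C1 i \<ge> 0" "\<And>i z. \<bar>dir_deriv et (dir_deriv (ex i) f) z\<bar> \<le> C1 i" by metis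
  obtain C2 where C2: "C2 \<ge> 0" "\<And>h z. \<bar>dir_deriv h (dir_deriv et f) z\<bar> \<le> C2 * norm h"
    using iter_dir_deriv_bound[OF bump_dir_deriv[OF assms], of 1 et] by auto
  \<comment> \<open>The 8 is the cube of 2 in the norm of the increment. The sum bounds the mixed
    products of \<open>t\<close> and \<open>x\<close>; the last summand bounds \<open>t\<close>
    times the derivative of the time derivative along the whole increment.\<close>
  define C where "C = 8 * C0 + sum C1 UNIV + 2 * C2"
  show ?thesis
  proof (intro exI[of _ C] conjI allI impI)
    show "0 \<le> C" using C0 C1 C2 by (simp add: C_def sum_nonneg)
    fix w :: "(real ^ 'n) \<times> real" and x :: "real ^ 'n" and t \<rho> :: real
    assume a: "0 < \<rho> \<and> \<rho> \<le> 1 \<and> norm x \<le> \<rho> \<and> \<bar>t\<bar> \<le> \<rho>\<^sup>2"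
    have r2: "\<rho>\<^sup>2 \<le> \<rho>" using a by (simp add: power2_eq_square mult_left_le)
    have nh: "norm (x, t) \<le> 2 * \<rho>"
      using norm_Pair_le[of x t] a r2 by auto
    have "norm (x, t) ^ 3 \<le> (2 * \<rho>) ^ 3" by (rule power_mono[OF nh]) simp
    then have b0: "C0 * norm (x, t) ^ 3 \<le> 8 * C0 * \<rho> ^ 3"
      using mult_left_mono[OF _ C0(1)] by (fastforce simp: power_mult_distrib)
    have Dh: "dir_deriv (x, t) f = (\<lambda>z. (\<Sum>i\<in>UNIV. x $ i * dir_deriv (ex i) f z) + t * dir_deriv et f z)"
      using dir_deriv_pair[OF df(1)] by blast
    have dsum: "dir_deriv v (\<lambda>z. (\<Sum>i\<in>UNIV. x $ i * dir_deriv (ex i) f z) + t * dir_deriv et f z) z =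
       (\<Sum>i\<in>UNIV. x $ i * dir_deriv v (dir_deriv (ex i) f) z) + t * dir_deriv v (dir_deriv et f) z" for v z
      by (rule dir_deriv_eq)
        (intro has_derivative_add has_derivative_sum has_derivative_mult_right dir_deriv_has_derivative df)
    have "dir_deriv (x, t) (dir_deriv (x, t) f) w =
       (\<Sum>i\<in>UNIV. x $ i * dir_deriv (x, t) (dir_deriv (ex i) f) w) + t * dir_deriv (x, t) (dir_deriv et f) w"
      unfolding Dh dsum ..
    also have "\<dots> = (\<Sum>i\<in>UNIV. \<Sum>j\<in>UNIV. x $ i * (x $ j) * dir_deriv (ex j) (dir_deriv (ex i) f) w)
        + t * (\<Sum>i\<in>UNIV. x $ i * dir_deriv et (dir_deriv (ex i) f) w) + t * dir_deriv (x, t) (dir_deriv et f) w"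
      unfolding dir_deriv_pair[OF df(2), of x t "ex _" w]
      by (simp add: distrib_left sum.distrib sum_distrib_left mult_ac)
    finally have D2: "dir_deriv (x, t) (dir_deriv (x, t) f) w =
      (\<Sum>i\<in>UNIV. \<Sum>j\<in>UNIV. x $ i * (x $ j) * dir_deriv (ex j) (dir_deriv (ex i) f) w)
        + t * (\<Sum>i\<in>UNIV. x $ i * dir_deriv et (dir_deriv (ex i) f) w) + t * dir_deriv (x, t) (dir_deriv et f) w" .
    have r3: "\<rho> ^ 3 = \<rho>\<^sup>2 * \<rho>" by (simp add: power3_eq_cube power2_eq_square)
    have "\<bar>\<Sum>i\<in>UNIV. x $ i * dir_deriv et (dir_deriv (ex i) f) w\<bar> \<le> (\<Sum>i\<in>UNIV. \<bar>x $ i\<bar> * \<bar>dir_deriv et (dir_deriv (ex i) f) w\<bar>)"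
      by (simp add: order_trans[OF sum_abs] abs_mult)
    also have "\<dots> \<le> (\<Sum>i\<in>UNIV. \<rho> * C1 i)"
      using a component_le_norm_cart[of x] by (intro sum_mono mult_mono C1) (auto intro: order_trans)
    also have "\<dots> = \<rho> * sum C1 UNIV" by (simp add: sum_distrib_left)
    finally have "\<bar>t\<bar> * \<bar>\<Sum>i\<in>UNIV. x $ i * dir_deriv et (dir_deriv (ex i) f) w\<bar> \<le> \<rho>\<^sup>2 * (\<rho> * sum C1 UNIV)"
      using a by (intro mult_mono) auto
    then have b1: "\<bar>t * (\<Sum>i\<in>UNIV. x $ i * dir_deriv et (dir_deriv (ex i) f) w)\<bar> \<le> sum C1 UNIV * \<rho> ^ 3"
      by (simp add: abs_mult r3 mult_ac)
    have "\<bar>dir_deriv (x, t) (dir_deriv et f) w\<bar> \<le> C2 * (2 * \<rho>)"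
      using C2(2)[of "(x, t)" w] mult_left_mono[OF nh C2(1)] by linarith
    then have "\<bar>t\<bar> * \<bar>dir_deriv (x, t) (dir_deriv et f) w\<bar> \<le> \<rho>\<^sup>2 * (C2 * (2 * \<rho>))"
      using a by (intro mult_mono) auto
    then have b2: "\<bar>t * dir_deriv (x, t) (dir_deriv et f) w\<bar> \<le> 2 * C2 * \<rho> ^ 3"
      by (simp add: abs_mult r3 mult_ac)
    have b3: "C * \<rho> ^ 3 = 8 * C0 * \<rho> ^ 3 + sum C1 UNIV * \<rho> ^ 3 + 2 * C2 * \<rho> ^ 3"
      by (simp add: C_def distrib_right)
    have "0 \<le> sum C1 UNIV * \<rho> ^ 3" "0 \<le> C2 * \<rho> ^ 3" using C1 C2 a by (auto simp: sum_nonneg)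
    with C0(2)[of w "(x, t)", unfolded D2 dir_deriv_pair[OF df(1), of x t]] b0 b1 b2
    show "\<bar>f (w + (x, t)) - (f w + (\<Sum>i\<in>UNIV. x $ i * dir_deriv (ex i) f w)
      + (\<Sum>i\<in>UNIV. \<Sum>j\<in>UNIV. x $ i * (x $ j) * dir_deriv (ex j) (dir_deriv (ex i) f) w) / 2
      + t * dir_deriv et f w)\<bar> \<le> C * \<rho> ^ 3"
      unfolding b3 by (auto simp: add_divide_distrib abs_le_iff)
  qed
qed

section \<open>Integrals of the kernels\<close>

definition par_scale :: "real \<Rightarrow> (real ^ 'n) \<times> real \<Rightarrow> (real ^ 'n) \<times> real" where
  "par_scale r z = (r *\<^sub>R fst z, r\<^sup>2 * snd z)"

lemma bounded_linear_par_scale: "bounded_linear (par_scale r)"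
  unfolding par_scale_def
  by (intro bounded_linear_Pair bounded_linear_scaleR_right[THEN bounded_linear_compose]
      bounded_linear_mult_right[THEN bounded_linear_compose] bounded_linear_fst bounded_linear_snd)

lemma par_scale_measurable[measurable]: "par_scale r \<in> borel_measurable borel"
  by (intro borel_measurable_continuous_onI linear_continuous_on bounded_linear_par_scale)

text \<open>A diagonal map with factor \<open>r\<close> in the space directions and
  \<open>r\<^sup>2\<close> in time. Its determinant \<open>r ^ (n + 2)\<close> is the normalisation
  of all integrals over cylinders below.\<close>

lemma lborel_par_scale:
  assumes "0 < r"
  shows "(lborel :: ((real ^ 'n) \<times> real) measure) =
    density (distr lborel borel (par_scale r)) (\<lambda>_. ennreal (r ^ (CARD('n) + 2)))"
proof -
  define c where "c = (\<lambda>j :: (real ^ 'n) \<times> real. if j = et then r\<^sup>2 else r)"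
  have T: "0 + (\<Sum>j\<in>Basis. (c j * (z \<bullet> j)) *\<^sub>R j) = par_scale r z" for z :: "(real ^ 'n) \<times> real"
  proof -
    have "(\<Sum>j\<in>Basis. (c j * (z \<bullet> j)) *\<^sub>R j) =
        (\<Sum>i\<in>Basis. (r * (fst z \<bullet> i)) *\<^sub>R (i, 0)) + (r\<^sup>2 * snd z) *\<^sub>R et"
      unfolding sum_Basis_prod_eq by (simp add: c_def inner_Pair_0)
    also have "(\<Sum>i\<in>Basis. (r * (fst z \<bullet> i)) *\<^sub>R (i, 0::real)) = (r *\<^sub>R fst z, 0)"
      by (simp add: prod_eq_iff fst_sum snd_sum euclidean_representation
          scaleR_sum_right[symmetric] scaleR_scaleR[symmetric] del: scaleR_scaleR)
    finally show ?thesis by (simp add: par_scale_def)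
  qed
  have et: "et \<in> (Basis :: ((real ^ 'n) \<times> real) set)" by (simp add: Basis_prod_def)
  have "(\<Prod>j\<in>Basis. \<bar>c j\<bar>) = \<bar>c et\<bar> * (\<Prod>j\<in>Basis - {et}. \<bar>c j\<bar>)"
    using et by (intro prod.remove) auto
  also have "(\<Prod>j\<in>Basis - {et}. \<bar>c j\<bar>) = (\<Prod>j\<in>(Basis :: ((real ^ 'n) \<times> real) set) - {et}. r)"
    using assms by (intro prod.cong) (auto simp: c_def)
  also have "\<dots> = r ^ CARD('n)" using et by (simp add: card_Diff_singleton)
  finally have P: "(\<Prod>j\<in>Basis. \<bar>c j\<bar>) = r ^ (CARD('n) + 2)"
    using assms by (simp add: c_def power_add power2_eq_square mult_ac)
  have "\<And>j. j \<in> Basis \<Longrightarrow> c j \<noteq> 0" using assms by (simp add: c_def)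
  from lborel_affine_euclidean[of c 0, OF this, unfolded T P] show ?thesis by simp
qed

lemma nn_integral_par_scale:
  fixes g :: "(real ^ 'n) \<times> real \<Rightarrow> ennreal"
  assumes "0 < r" and [measurable]: "g \<in> borel_measurable borel"
  shows "(\<integral>\<^sup>+z. g z \<partial>lborel) = ennreal (r ^ (CARD('n) + 2)) * (\<integral>\<^sup>+z. g (par_scale r z) \<partial>lborel)"
proof -
  have "(\<integral>\<^sup>+z. g z \<partial>lborel) = (\<integral>\<^sup>+z. g z \<partial>density (distr lborel borel (par_scale r)) (\<lambda>_. ennreal (r ^ (CARD('n) + 2))))"
    using lborel_par_scale[OF assms(1), where 'n = 'n] by simp
  also have "\<dots> = ennreal (r ^ (CARD('n) + 2)) * (\<integral>\<^sup>+z. g (par_scale r z) \<partial>lborel)"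
    by (simp add: nn_integral_density nn_integral_cmult nn_integral_distr)
  finally show ?thesis .
qed

lemma integrable_par_scale:
  fixes g :: "(real ^ 'n) \<times> real \<Rightarrow> real"
  assumes "0 < r" and [measurable]: "g \<in> borel_measurable borel"
  shows "integrable lborel (\<lambda>z. g (par_scale r z)) \<longleftrightarrow> integrable lborel g"
proof -
  have "0 < r ^ (CARD('n) + 2)" using assms by simp
  then show ?thesis using nn_integral_par_scale[OF assms(1), of "\<lambda>z. ennreal (norm (g z))"]
    by (auto simp: integrable_iff_bounded ennreal_mult_less_top)
qed

lemma integral_par_scale:
  fixes g :: "(real ^ 'n) \<times> real \<Rightarrow> real"
  assumes "0 < r" and [measurable]: "g \<in> borel_measurable borel"
  shows "(\<integral>z. g z \<partial>lborel) = r ^ (CARD('n) + 2) * (\<integral>z. g (par_scale r z) \<partial>lborel)"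
proof -
  have "(\<integral>z. g z \<partial>lborel) = (\<integral>z. g z \<partial>density (distr lborel borel (par_scale r)) (\<lambda>_. ennreal (r ^ (CARD('n) + 2))))"
    using lborel_par_scale[OF assms(1), where 'n = 'n] by simp
  also have "\<dots> = r ^ (CARD('n) + 2) * (\<integral>z. g (par_scale r z) \<partial>lborel)"
    using assms(1) by (simp add: integral_density integral_distr)
  finally show ?thesis .
qed

lemma fst_borel[measurable]: "fst \<in> borel_measurable (borel :: ('a::euclidean_space \<times> 'b::euclidean_space) measure)"
  by (intro borel_measurable_continuous_onI continuous_intros)

lemma snd_borel[measurable]: "snd \<in> borel_measurable (borel :: ('a::euclidean_space \<times> 'b::euclidean_space) measure)"
  by (intro borel_measurable_continuous_onI continuous_intros)

lemma heat_ker_measurable[measurable]: "heat_ker \<in> borel_measurable borel"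
  unfolding heat_ker_def by measurable

lemma smooth_measurable: "smooth_on UNIV f \<Longrightarrow> f \<in> borel_measurable borel"
  by (intro borel_measurable_continuous_onI smooth_on_continuous)

lemmas cutoff_measurable[measurable] = smooth_measurable[OF smooth_cutoff]
lemmas time_cut_measurable[measurable] = smooth_measurable[OF smooth_time_cut]
lemmas smooth_ker_measurable[measurable] = smooth_measurable[OF smooth_smooth_ker]
lemmas deriv_smooth_step_measurable[measurable] = smooth_measurable[OF smooth_deriv_smooth_step]

lemma trunc_ker_measurable[measurable]: "trunc_ker \<in> borel_measurable borel"
  unfolding trunc_ker_def by measurable

lemma reg_ker_measurable[measurable]: "reg_ker \<delta> \<in> borel_measurable borel"
  unfolding reg_ker_def by measurable

lemma approx_id_measurable[measurable]: "approx_id \<delta> \<in> borel_measurable borel"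
  unfolding approx_id_def by measurable

section \<open>Mass of the heat kernel and of the approximate identity\<close>

lemma nn_integral_gauss_1:
  "(\<integral>\<^sup>+x. ennreal (exp (- (x\<^sup>2) / 4)) \<partial>lborel) = ennreal (sqrt (4 * pi))"
proof -
  have "exp (- (x\<^sup>2) / 4) = sqrt (4 * pi) * normal_density 0 (sqrt 2) x" for x
    by (simp add: normal_density_def real_sqrt_mult)
  then have "(\<integral>\<^sup>+x. ennreal (exp (- (x\<^sup>2) / 4)) \<partial>lborel) =
      ennreal (\<integral>x. sqrt (4 * pi) * normal_density 0 (sqrt 2) x \<partial>lborel)"
    by (subst nn_integral_eq_integral[symmetric]) auto
  then show ?thesis by simp
qed

lemma nn_integral_gauss:
  "(\<integral>\<^sup>+x. ennreal (exp (- (x \<bullet> x) / 4)) \<partial>(lborel :: (real ^ 'n) measure)) = ennreal (sqrt (4 * pi) ^ CARD('n))"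
proof -
  have "ennreal (exp (- (x \<bullet> x) / 4)) = (\<Prod>b\<in>Basis. ennreal (exp (- ((x \<bullet> b)\<^sup>2) / 4)))" for x :: "real ^ 'n"
  proof -
    have "- (x \<bullet> x) / 4 = (\<Sum>b\<in>Basis. - ((x \<bullet> b)\<^sup>2) / 4)"
      by (subst euclidean_inner) (simp add: sum_negf sum_divide_distrib[symmetric] power2_eq_square)
    then show ?thesis by (simp add: exp_sum prod_ennreal)
  qed
  then have "(\<integral>\<^sup>+x. ennreal (exp (- (x \<bullet> x) / 4)) \<partial>(lborel :: (real ^ 'n) measure)) =
      (\<Prod>b\<in>(Basis :: (real ^ 'n) set). (\<integral>\<^sup>+x. ennreal (exp (- (x\<^sup>2) / 4)) \<partial>lborel))"
    using nn_integral_lborel_prod[of "\<lambda>b::real^'n. \<lambda>x. ennreal (exp (- (x\<^sup>2) / 4))"] by simp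
  then show ?thesis unfolding nn_integral_gauss_1 by (simp add: ennreal_power)
qed

text \<open>The substitution \<open>x = sqrt t * y\<close> shows that all slices have the same mass.
  Hence the kernel is integrable near its singularity, and the approximate identities have a
  limiting mass that can be computed slice by slice.\<close>

lemma nn_integral_heat_ker_slice:
  assumes "0 < t"
  shows "(\<integral>\<^sup>+x. ennreal (heat_ker (x, t)) \<partial>(lborel :: (real ^ 'n) measure)) = ennreal (sqrt (4 * pi) ^ CARD('n))"
proof -
  let ?n = "CARD('n)"
  let ?s = "sqrt t"
  have s: "0 < ?s" using assms by simp
  have sp: "?s ^ ?n = t powr (?n / 2)"
    using assms by (simp add: powr_half_sqrt[symmetric] powr_powr powr_realpow[symmetric] mult.commute)
  have k: "heat_ker (0 + ?s *\<^sub>R x, t) = t powr (- real ?n / 2) * exp (- (x \<bullet> x) / 4)" for x :: "real ^ 'n"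
    using assms by (simp add: heat_ker_def mult.assoc[symmetric] del: mult.assoc)
  have "(\<integral>\<^sup>+x. ennreal (heat_ker (x, t)) \<partial>(lborel :: (real ^ 'n) measure)) =
    (\<integral>\<^sup>+x. ennreal (heat_ker (x, t)) \<partial>density (distr lborel borel (\<lambda>x :: real ^ 'n. 0 + ?s *\<^sub>R x)) (\<lambda>_. ennreal (\<bar>?s\<bar> ^ DIM(real ^ 'n))))"
    by (subst lborel_affine[of ?s "0 :: real ^ 'n"]) (use s in auto)
  also have "\<dots> = ennreal (?s ^ ?n) * (\<integral>\<^sup>+x. ennreal (heat_ker (0 + ?s *\<^sub>R x, t)) \<partial>(lborel :: (real ^ 'n) measure))"
    using s by (simp add: nn_integral_density nn_integral_cmult nn_integral_distr)
  also have "\<dots> = ennreal (?s ^ ?n) * (ennreal (t powr (- real ?n / 2)) * ennreal (sqrt (4 * pi) ^ ?n))"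
    unfolding k nn_integral_gauss[symmetric] by (simp add: ennreal_mult nn_integral_cmult)
  also have "\<dots> = ennreal ((?s ^ ?n * t powr (- real ?n / 2)) * sqrt (4 * pi) ^ ?n)"
    using assms by (simp add: ennreal_mult[symmetric] mult.assoc)
  also have "?s ^ ?n * t powr (- real ?n / 2) = 1"
    using assms by (simp add: sp powr_add[symmetric])
  finally show ?thesis by simp
qed

lemma integrable_heat_ker_slab:
  fixes a b :: real
  assumes "0 \<le> a" "a \<le> b"
  shows "integrable lborel (\<lambda>z :: (real ^ 'n) \<times> real. indicator {a..b} (snd z) * heat_ker z)"
proof (rule integrableI_nonneg)
  have "(\<integral>\<^sup>+z. ennreal (indicator {a..b} (snd z) * heat_ker z) \<partial>(lborel :: ((real ^ 'n) \<times> real) measure)) =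
    (\<integral>\<^sup>+t. \<integral>\<^sup>+x. ennreal (indicator {a..b} t * heat_ker (x :: real ^ 'n, t)) \<partial>lborel \<partial>lborel)"
    by (subst lborel_prod[symmetric], subst lborel_pair.nn_integral_snd[symmetric])
      (simp_all add: lborel_prod)
  also have "\<dots> \<le> (\<integral>\<^sup>+t. ennreal (sqrt (4 * pi) ^ CARD('n)) * indicator {a..b} t \<partial>lborel)"
  proof (intro nn_integral_mono)
    fix t
    show "(\<integral>\<^sup>+x. ennreal (indicator {a..b} t * heat_ker (x :: real ^ 'n, t)) \<partial>lborel) \<le>
      ennreal (sqrt (4 * pi) ^ CARD('n)) * indicator {a..b} t"
    proof (cases "0 < t")
      case True
      then show ?thesis using nn_integral_heat_ker_slice[OF True, where 'n = 'n]
        by (auto simp: indicator_def)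
    qed (auto simp: heat_ker_def)
  qed
  also have "\<dots> < \<infinity>" using assms by (simp add: nn_integral_cmult ennreal_mult_less_top)
  finally show "(\<integral>\<^sup>+z. ennreal (indicator {a..b} (snd z) * heat_ker z) \<partial>(lborel :: ((real ^ 'n) \<times> real) measure)) < \<infinity>" .
qed (auto simp: heat_ker_nonneg)

lemma integrable_trunc_ker: "integrable lborel trunc_ker"
proof (rule Bochner_Integration.integrable_bound[OF integrable_heat_ker_slab[of 0 "1/4"]])
  show "AE z in lborel. norm (trunc_ker z) \<le> norm (indicator {0..1/4} (snd z) * heat_ker z)"
  proof (rule AE_I2)
    fix z :: "(real ^ 'n) \<times> real"
    show "norm (trunc_ker z) \<le> norm (indicator {0..1/4} (snd z) * heat_ker z)"
    proof (cases "snd z \<in> {0..1/4}")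
      case True
      then show ?thesis using cutoff_bounds[of z] heat_ker_nonneg[of z]
        by (simp add: trunc_ker_def mult_left_le_one_le)
    qed (use trunc_ker_eq_0[of z] in auto)
  qed
qed auto

text \<open>What \<open>approx_id \<delta>\<close> looks like in parabolic coordinates of scale
  \<open>\<delta>\<close> when \<open>\<delta>\<close> tends to 0: the cutoff of the kernel becomes
  1. The profile lives between the times 1 and 2.\<close>

definition id_profile :: "(real ^ 'n) \<times> real \<Rightarrow> real" where
  "id_profile z = deriv smooth_step (snd z - 1) * heat_ker z"

lemma id_profile_measurable[measurable]: "id_profile \<in> borel_measurable borel"
  unfolding id_profile_def by measurable

lemma bump_deriv_smooth_step: "bump (deriv smooth_step)"
  unfolding bump_def
  by (intro conjI smooth_deriv_smooth_step exI[of _ "{0..1}"]) (auto intro!: deriv_smooth_step_eq_0)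

lemma integrable_id_profile: "integrable lborel (id_profile :: (real ^ 'n) \<times> real \<Rightarrow> real)"
proof -
  obtain B where B: "0 \<le> B" "\<And>t. \<bar>deriv smooth_step t\<bar> \<le> B"
    using bump_bounded[OF bump_deriv_smooth_step] by blast
  show ?thesis
  proof (rule Bochner_Integration.integrable_bound)
    show "integrable lborel (\<lambda>z :: (real ^ 'n) \<times> real. B * (indicator {1..2} (snd z) * heat_ker z))"
      by (intro integrable_mult_right integrable_heat_ker_slab) auto
    show "AE z in lborel. norm (id_profile (z :: (real ^ 'n) \<times> real)) \<le> norm (B * (indicator {1..2} (snd z) * heat_ker z))"
    proof (rule AE_I2)
      fix z :: "(real ^ 'n) \<times> real"
      show "norm (id_profile z) \<le> norm (B * (indicator {1..2} (snd z) * heat_ker z))"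
      proof (cases "snd z \<in> {1..2}")
        case True
        then show ?thesis using B heat_ker_nonneg[of z]
          by (simp add: id_profile_def abs_mult mult_right_mono)
      qed (use deriv_smooth_step_eq_0[of "snd z - 1"] in \<open>auto simp: id_profile_def\<close>)
    qed
  qed auto
qed

text \<open>Integrating in \<open>x\<close> first, every slice contributes the constant mass times
  \<open>deriv smooth_step (t - 1)\<close>, whose integral is the total rise 1 of the step.\<close>

lemma integral_id_profile:
  "(\<integral>z. id_profile z \<partial>(lborel :: ((real ^ 'n) \<times> real) measure)) = sqrt (4 * pi) ^ CARD('n)"
proof -
  let ?g = "sqrt (4 * pi) ^ CARD('n)"
  have i: "integrable (lborel \<Otimes>\<^sub>M lborel) (\<lambda>(x, t). id_profile (x :: real ^ 'n, t))"
    using integrable_id_profile[where 'n = 'n] by (simp add: lborel_prod split_beta')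
  have "(\<integral>z. id_profile z \<partial>(lborel :: ((real ^ 'n) \<times> real) measure)) =
      (\<integral>t. \<integral>x. id_profile (x :: real ^ 'n, t) \<partial>lborel \<partial>lborel)"
    using lborel_pair.integral_snd[OF i] by (simp add: lborel_prod split_beta')
  also have "(\<lambda>t. \<integral>x. id_profile (x :: real ^ 'n, t) \<partial>lborel) = (\<lambda>t. ?g * deriv smooth_step (t - 1))"
  proof
    fix t :: real
    show "(\<integral>x. id_profile (x :: real ^ 'n, t) \<partial>lborel) = ?g * deriv smooth_step (t - 1)"
    proof (cases "0 < t")
      case True
      have "(\<integral>x. heat_ker (x :: real ^ 'n, t) \<partial>lborel) = ?g"
        by (rule integral_eq_nn_integral[THEN trans])
          (auto simp: heat_ker_nonneg nn_integral_heat_ker_slice[OF True])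
      then show ?thesis by (simp add: id_profile_def)
    qed (auto simp: id_profile_def deriv_smooth_step_eq_0)
  qed
  also have "(\<integral>t. ?g * deriv smooth_step (t - 1) \<partial>lborel) = ?g * (\<integral>t. deriv smooth_step (t - 1) \<partial>lborel)"
    by simp
  also have "(\<lambda>t. deriv smooth_step (t - 1)) = (\<lambda>t. indicator {1..2} t *\<^sub>R deriv smooth_step (t - 1))"
  proof
    fix t :: real
    show "deriv smooth_step (t - 1) = indicator {1..2} t *\<^sub>R deriv smooth_step (t - 1)"
      using deriv_smooth_step_eq_0[of "t - 1"] by (cases "1 \<le> t \<and> t \<le> 2") (auto simp: indicator_def)
  qed
  also have "(\<integral>t. indicator {1..2} t *\<^sub>R deriv smooth_step (t - 1) \<partial>lborel) = smooth_step (2 - 1) - smooth_step (1 - 1)"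
  proof (rule integral_FTC_Icc)
    fix t :: real
    have "((\<lambda>t. smooth_step (t - 1)) has_real_derivative deriv smooth_step (t - 1) * 1) (at t)"
      by (rule DERIV_chain2[OF smooth_step_deriv]) (auto intro!: derivative_eq_intros)
    then show "((\<lambda>t. smooth_step (t - 1)) has_vector_derivative deriv smooth_step (t - 1)) (at t within {1..2})"
      by (simp add: has_real_derivative_iff_has_vector_derivative has_vector_derivative_at_within)
  qed (auto intro!: continuous_intros continuous_on_compose2[OF smooth_on_continuous[OF smooth_deriv_smooth_step]])
  finally show ?thesis by (simp add: smooth_step_0 smooth_step_1)
qed

lemma heat_ker_par_scale:
  assumes "0 < r"
  shows "r ^ CARD('n) * heat_ker (par_scale r z :: (real ^ 'n) \<times> real) = heat_ker z"
proof (cases "0 < snd z")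
  case True
  have "r ^ CARD('n) * (r\<^sup>2 * snd z) powr (- real CARD('n) / 2) = snd z powr (- real CARD('n) / 2)"
  proof -
    have "(r\<^sup>2) powr (- real CARD('n) / 2) = r powr (- real CARD('n))"
      using assms powr_powr[of r 2 "- real CARD('n) / 2"] by simp
    then have "r ^ CARD('n) * (r\<^sup>2) powr (- real CARD('n) / 2) = 1"
      using assms by (simp add: powr_minus powr_realpow)
    then show ?thesis using True assms by (simp add: powr_mult mult.assoc[symmetric])
  qed
  moreover have "- (r *\<^sub>R fst z \<bullet> r *\<^sub>R fst z) / (4 * (r\<^sup>2 * snd z)) = - (fst z \<bullet> fst z) / (4 * snd z)"
    using assms by (simp add: power2_eq_square)
  ultimately show ?thesis using True assms
    by (simp add: heat_ker_def par_scale_def mult.assoc[symmetric])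
qed (use assms in \<open>auto simp: heat_ker_def par_scale_def zero_less_mult_iff\<close>)

lemma approx_id_par_scale:
  assumes "0 < \<delta>"
  shows "\<delta> ^ (CARD('n) + 2) * approx_id \<delta> (par_scale \<delta> z :: (real ^ 'n) \<times> real) =
    id_profile z * cutoff (par_scale \<delta> z)"
proof -
  have "\<delta> ^ (CARD('n) + 2) * approx_id \<delta> (par_scale \<delta> z) =
      deriv smooth_step (snd z - 1) * cutoff (par_scale \<delta> z) * (\<delta> ^ CARD('n) * heat_ker (par_scale \<delta> z))"
    using assms by (simp add: approx_id_def trunc_ker_def par_scale_def power_add power2_eq_square)
  then show ?thesis by (simp add: heat_ker_par_scale[OF assms] id_profile_def)
qed

lemma id_profile_cutoff_le: "\<bar>id_profile z * cutoff w\<bar> \<le> \<bar>id_profile z\<bar>"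
  using cutoff_bounds[of w] by (simp add: abs_mult mult_left_le)

lemma integrable_approx_id:
  assumes "0 < \<delta>"
  shows "integrable lborel (approx_id \<delta> :: (real ^ 'n) \<times> real \<Rightarrow> real)"
proof -
  have "integrable lborel (\<lambda>z :: (real ^ 'n) \<times> real. id_profile z * cutoff (par_scale \<delta> z))"
    by (rule Bochner_Integration.integrable_bound[OF integrable_id_profile])
      (auto simp: id_profile_cutoff_le)
  then have "integrable lborel (\<lambda>z :: (real ^ 'n) \<times> real. \<delta> ^ (CARD('n) + 2) * approx_id \<delta> (par_scale \<delta> z))"
    unfolding approx_id_par_scale[OF assms] .
  then have "integrable lborel (\<lambda>z :: (real ^ 'n) \<times> real. approx_id \<delta> (par_scale \<delta> z))"
    using assms by simp
  then show ?thesis using assms by (simp add: integrable_par_scale)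
qed

lemma integral_abs_approx_id:
  assumes "0 < \<delta>"
  shows "(\<integral>z. \<bar>approx_id \<delta> z\<bar> \<partial>(lborel :: ((real ^ 'n) \<times> real) measure)) \<le> (\<integral>z. \<bar>id_profile (z :: (real ^ 'n) \<times> real)\<bar> \<partial>lborel)"
proof -
  have "(\<integral>z. \<bar>approx_id \<delta> z\<bar> \<partial>(lborel :: ((real ^ 'n) \<times> real) measure)) =
     (\<integral>z. \<bar>\<delta> ^ (CARD('n) + 2) * approx_id \<delta> (par_scale \<delta> z :: (real ^ 'n) \<times> real)\<bar> \<partial>lborel)"
    using assms by (subst integral_par_scale[OF assms]) (auto simp: abs_mult)
  also have "\<dots> \<le> (\<integral>z. \<bar>id_profile (z :: (real ^ 'n) \<times> real)\<bar> \<partial>lborel)"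
    unfolding approx_id_par_scale[OF assms]
    by (rule integral_mono)
      (auto intro!: integrable_id_profile integrable_abs Bochner_Integration.integrable_bound[OF integrable_id_profile]
        simp: id_profile_cutoff_le)
  finally show ?thesis .
qed

text \<open>After the dilation the profile is fixed, up to a cutoff tending to 1, and only the
  argument of \<open>h\<close> moves to the origin. Continuity is asked at that single point because
  \<open>h\<close> will be an indicator function.\<close>

lemma approx_id_tendsto:
  fixes h :: "(real ^ 'n) \<times> real \<Rightarrow> real" and \<delta> :: "nat \<Rightarrow> real"
  assumes [measurable]: "h \<in> borel_measurable borel" and B: "\<And>z. \<bar>h z\<bar> \<le> B" and c: "isCont h 0"
    and \<delta>: "\<And>i. 0 < \<delta> i" "\<delta> \<longlonglongrightarrow> 0"
  shows "(\<lambda>i. \<integral>z. h z * approx_id (\<delta> i) z \<partial>lborel) \<longlonglongrightarrow> sqrt (4 * pi) ^ CARD('n) * h 0"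
proof -
  have e: "(\<integral>z. h z * approx_id (\<delta> i) z \<partial>lborel) =
      (\<integral>z. h (par_scale (\<delta> i) z) * (id_profile z * cutoff (par_scale (\<delta> i) z)) \<partial>lborel)" for i
    by (subst integral_par_scale[OF \<delta>(1)[of i]])
      (auto simp: approx_id_par_scale[OF \<delta>(1), symmetric] mult_ac simp flip: integral_mult_right_zero)
  have "(\<lambda>i. \<integral>z. h (par_scale (\<delta> i) z) * (id_profile z * cutoff (par_scale (\<delta> i) z)) \<partial>lborel)
      \<longlonglongrightarrow> (\<integral>z. h 0 * (id_profile (z :: (real ^ 'n) \<times> real) * 1) \<partial>lborel)"
  proof (rule integral_dominated_convergence)
    show "integrable lborel (\<lambda>z :: (real ^ 'n) \<times> real. B * \<bar>id_profile z\<bar>)"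
      by (intro integrable_mult_right integrable_abs integrable_id_profile)
    show "AE z in lborel. (\<lambda>i. h (par_scale (\<delta> i) z) * (id_profile z * cutoff (par_scale (\<delta> i) z)))
        \<longlonglongrightarrow> h 0 * (id_profile (z :: (real ^ 'n) \<times> real) * 1)"
    proof (rule AE_I2)
      fix z :: "(real ^ 'n) \<times> real"
      have "(\<lambda>i. par_scale (\<delta> i) z) \<longlonglongrightarrow> (0 *\<^sub>R fst z, 0\<^sup>2 * snd z)"
        unfolding par_scale_def by (intro tendsto_intros \<delta>)
      then have s: "(\<lambda>i. par_scale (\<delta> i) z) \<longlonglongrightarrow> 0" by (simp add: zero_prod_def)
      have "isCont (cutoff :: (real ^ 'n) \<times> real \<Rightarrow> real) 0"
        using smooth_on_continuous[OF smooth_cutoff] continuous_on_eq_continuous_at[OF open_UNIV] by blast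
      then have "(\<lambda>i. cutoff (par_scale (\<delta> i) z)) \<longlonglongrightarrow> cutoff (0 :: (real ^ 'n) \<times> real)"
        using s by (rule isCont_tendsto_compose)
      moreover have "cutoff (0 :: (real ^ 'n) \<times> real) = 1" by (rule cutoff_eq_1) auto
      ultimately show "(\<lambda>i. h (par_scale (\<delta> i) z) * (id_profile z * cutoff (par_scale (\<delta> i) z)))
        \<longlonglongrightarrow> h 0 * (id_profile z * 1)"
        by (intro tendsto_intros isCont_tendsto_compose[OF c s]) auto
    qed
    show "AE z in lborel. norm (h (par_scale (\<delta> i) z) * (id_profile z * cutoff (par_scale (\<delta> i) z))) \<le> B * \<bar>id_profile (z :: (real ^ 'n) \<times> real)\<bar>" for i
    proof (rule AE_I2)
      fix z :: "(real ^ 'n) \<times> real"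
      show "norm (h (par_scale (\<delta> i) z) * (id_profile z * cutoff (par_scale (\<delta> i) z))) \<le> B * \<bar>id_profile z\<bar>"
        unfolding real_norm_def abs_mult[of "h _"]
        by (intro mult_mono B id_profile_cutoff_le) (use B[of 0] in auto)
    qed
  qed auto
  then show ?thesis unfolding e by (simp add: integral_id_profile mult.commute)
qed

lemma bump_smooth_ker: "bump (smooth_ker :: (real ^ 'n) \<times> real \<Rightarrow> real)"
  unfolding bump_def
proof (intro conjI smooth_smooth_ker exI[of _ "cball 0 (1/4) \<times> {0..1/4}"] allI impI)
  show "compact (cball (0 :: real ^ 'n) (1/4) \<times> {0..1/4::real})" by (intro compact_Times) auto
  show "smooth_ker z = 0" if "z \<notin> cball (0 :: real ^ 'n) (1/4) \<times> {0..1/4::real}" for z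
    by (rule smooth_ker_eq_0) (use that in \<open>cases z, auto simp: not_le\<close>)
qed

lemma integrable_bump:
  fixes f :: "'a::euclidean_space \<Rightarrow> real"
  assumes "bump f" shows "integrable lborel f"
proof -
  obtain K where K: "compact K" "\<And>z. z \<notin> K \<Longrightarrow> f z = 0" using assms unfolding bump_def by blast
  have "continuous_on K f"
    using assms unfolding bump_def by (auto intro: continuous_on_subset[OF smooth_on_continuous])
  then have "integrable lborel (\<lambda>z. indicator K z *\<^sub>R f z)" by (rule borel_integrable_compact[OF K(1)])
  moreover have "(\<lambda>z. indicator K z *\<^sub>R f z) = f" by (rule ext) (auto simp: indicator_def K(2))
  ultimately show ?thesis by simp
qed

section \<open>The representation formula\<close>

lemma lborel_distr_reflect:
  "distr lborel borel (\<lambda>x. z - x) = (lborel :: 'a::euclidean_space measure)"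
proof -
  have "(lborel :: 'a measure) = density (distr lborel borel (\<lambda>x. z + (-1) *\<^sub>R x)) (\<lambda>_. ennreal (\<bar>-1::real\<bar> ^ DIM('a)))"
    by (rule lborel_affine) simp
  then show ?thesis by (simp add: density_1)
qed

lemma integral_reflect:
  fixes g :: "'a::euclidean_space \<Rightarrow> real"
  assumes [measurable]: "g \<in> borel_measurable borel"
  shows "(\<integral>x. g (z - x) \<partial>lborel) = (\<integral>x. g x \<partial>lborel)"
  by (subst (2) lborel_distr_reflect[of z, symmetric], subst integral_distr) auto

lemma integrable_reflect:
  fixes g :: "'a::euclidean_space \<Rightarrow> real"
  assumes [measurable]: "g \<in> borel_measurable borel"
  shows "integrable lborel (\<lambda>x. g (z - x)) \<longleftrightarrow> integrable lborel g"
  using integrable_distr_eq[of "\<lambda>x. z - x" lborel borel g] by (simp add: lborel_distr_reflect)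

lemma integral_translate:
  fixes g :: "'a::euclidean_space \<Rightarrow> real"
  assumes [measurable]: "g \<in> borel_measurable borel"
  shows "(\<integral>x. g (c + x) \<partial>lborel) = (\<integral>x. g x \<partial>lborel)"
  by (subst (2) lborel_distr_plus[of c, symmetric], subst integral_distr) auto

lemma integrable_translate:
  fixes g :: "'a::euclidean_space \<Rightarrow> real"
  assumes [measurable]: "g \<in> borel_measurable borel"
  shows "integrable lborel (\<lambda>x. g (c + x)) \<longleftrightarrow> integrable lborel g"
  using integrable_distr_eq[of "(+) c" lborel borel g] by (simp add: lborel_distr_plus)

lemma integrable_conv_pair:
  fixes u k :: "'a::euclidean_space \<Rightarrow> real"
  assumes u: "integrable lborel u" and k: "integrable lborel k"
  shows "integrable (lborel \<Otimes>\<^sub>M lborel) (\<lambda>(y, z). u y * k (z - y))"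
proof (rule lborel_pair.Fubini_integrable)
  have [measurable]: "u \<in> borel_measurable borel" "k \<in> borel_measurable borel" using u k by auto
  have tk: "integrable lborel (\<lambda>z. k (z - y))" for y
    using integrable_translate[of k "- y"] k by simp
  show "(\<lambda>(y, z). u y * k (z - y)) \<in> borel_measurable (lborel \<Otimes>\<^sub>M lborel)" by measurable
  have e: "(\<integral>z. norm (case (y, z) of (y, z) \<Rightarrow> u y * k (z - y)) \<partial>lborel) = \<bar>u y\<bar> * (\<integral>z. \<bar>k z\<bar> \<partial>lborel)" for y
    using integral_translate[of "\<lambda>z. \<bar>k z\<bar>" "- y"] by (simp add: abs_mult)
  show "integrable lborel (\<lambda>y. \<integral>z. norm (case (y, z) of (y, z) \<Rightarrow> u y * k (z - y)) \<partial>lborel)"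
    unfolding e using u by auto
  show "AE y in lborel. integrable lborel (\<lambda>z. case (y, z) of (y, z) \<Rightarrow> u y * k (z - y))"
    using tk by auto
qed

lemma integrable_conv:
  fixes u k :: "'a::euclidean_space \<Rightarrow> real"
  assumes "integrable lborel u" "integrable lborel k"
  shows "integrable lborel (\<lambda>z. \<integral>y. u y * k (z - y) \<partial>lborel)"
  using lborel_pair.integrable_snd[OF integrable_conv_pair[OF assms]] by simp

text \<open>Fubini with \<open>z = y + w\<close>. The kernel is moved away from \<open>u\<close>,
  which is merely integrable, to the bounded function \<open>h\<close>, against which limits of
  kernels can be taken pointwise.\<close>

lemma conv_duality:
  fixes u k h :: "'a::euclidean_space \<Rightarrow> real"
  assumes u: "integrable lborel u" and k: "integrable lborel k"
    and [measurable]: "h \<in> borel_measurable borel" and h: "\<And>z. \<bar>h z\<bar> \<le> B"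
  shows "(\<integral>z. h z * (\<integral>y. u y * k (z - y) \<partial>lborel) \<partial>lborel) =
    (\<integral>y. u y * (\<integral>w. h (y + w) * k w \<partial>lborel) \<partial>lborel)"
proof -
  have [measurable]: "u \<in> borel_measurable borel" "k \<in> borel_measurable borel" using u k by auto
  have i: "integrable (lborel \<Otimes>\<^sub>M lborel) (\<lambda>(y, z). h z * (u y * k (z - y)))"
  proof (rule Bochner_Integration.integrable_bound)
    show "integrable (lborel \<Otimes>\<^sub>M lborel) (\<lambda>p. B * (case p of (y, z) \<Rightarrow> u y * k (z - y)))"
      by (intro integrable_mult_right integrable_conv_pair u k)
    have "norm (case p of (y, z) \<Rightarrow> h z * (u y * k (z - y))) \<le> norm (B * (case p of (y, z) \<Rightarrow> u y * k (z - y)))" for p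
      using h[of "snd p"] by (auto simp: split_beta' abs_mult intro!: mult_right_mono)
    then show "AE p in lborel \<Otimes>\<^sub>M lborel. norm (case p of (y, z) \<Rightarrow> h z * (u y * k (z - y)))
        \<le> norm (B * (case p of (y, z) \<Rightarrow> u y * k (z - y)))" by (rule AE_I2)
  qed measurable
  have "(\<integral>z. h z * (\<integral>y. u y * k (z - y) \<partial>lborel) \<partial>lborel) = (\<integral>z. \<integral>y. h z * (u y * k (z - y)) \<partial>lborel \<partial>lborel)"
    by simp
  also have "\<dots> = (\<integral>y. \<integral>z. h z * (u y * k (z - y)) \<partial>lborel \<partial>lborel)"
    using lborel_pair.Fubini_integral[OF i] by simp
  also have "\<dots> = (\<integral>y. u y * (\<integral>z. h z * k (z - y) \<partial>lborel) \<partial>lborel)"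
  proof -
    have "h z * (u y * k (z - y)) = u y * (h z * k (z - y))" for y z by simp
    then show ?thesis by (simp only: integral_mult_right_zero)
  qed
  also have "(\<lambda>y. \<integral>z. h z * k (z - y) \<partial>lborel) = (\<lambda>y. \<integral>w. h (y + w) * k w \<partial>lborel)"
  proof
    fix y
    show "(\<integral>z. h z * k (z - y) \<partial>lborel) = (\<integral>w. h (y + w) * k w \<partial>lborel)"
      using integral_translate[of "\<lambda>z. h z * k (z - y)" y] by simp
  qed
  finally show ?thesis .
qed

text \<open>The positive and the negative part of \<open>G\<close> are densities of two measures
  that agree on boxes. Boxes are stable under intersection and generate the Borel sets, so the
  measures coincide, and with them the densities almost everywhere.\<close>

lemma AE_zero_boxes:
  fixes G :: "'a::euclidean_space \<Rightarrow> real"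
  assumes G: "integrable lborel G" and z: "\<And>a b. (\<integral>x. indicator (box a b) x * G x \<partial>lborel) = 0"
  shows "AE x in lborel. G x = 0"
proof -
  have [measurable]: "G \<in> borel_measurable borel" using G by auto
  let ?p = "\<lambda>x. ennreal (max 0 (G x))" and ?m = "\<lambda>x. ennreal (max 0 (- G x))"
  have ip: "integrable lborel (\<lambda>x. max 0 (G x))" and im: "integrable lborel (\<lambda>x. max 0 (- G x))"
    using G by auto
  have ib: "integrable lborel (\<lambda>x. indicator (box a b) x * max 0 (G x))"
    "integrable lborel (\<lambda>x. indicator (box a b) x * max 0 (- G x))" for a b
    using integrable_real_mult_indicator[OF _ ip, of "box a b"] integrable_real_mult_indicator[OF _ im, of "box a b"]
    by (auto simp: mult.commute)
  have e0: "emeasure (density lborel (\<lambda>x. ennreal (q x))) (box a b) = ennreal (\<integral>x. indicator (box a b) x * q x \<partial>lborel)"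
    if [measurable]: "q \<in> borel_measurable borel" and "integrable lborel (\<lambda>x. indicator (box a b) x * q x)" "\<And>x. 0 \<le> q x"
    for a b q
  proof -
    have "emeasure (density lborel (\<lambda>x. ennreal (q x))) (box a b) = (\<integral>\<^sup>+x. ennreal (q x) * indicator (box a b) x \<partial>lborel)"
      by (rule emeasure_density) auto
    also have "\<dots> = (\<integral>\<^sup>+x. ennreal (indicator (box a b) x * q x) \<partial>lborel)"
      by (intro nn_integral_cong) (auto simp: indicator_def)
    also have "\<dots> = ennreal (\<integral>x. indicator (box a b) x * q x \<partial>lborel)"
      by (rule nn_integral_eq_integral) (use that in auto)
    finally show ?thesis .
  qed
  have e1: "emeasure (density lborel ?p) (box a b) = ennreal (\<integral>x. indicator (box a b) x * max 0 (G x) \<partial>lborel)"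
    "emeasure (density lborel ?m) (box a b) = ennreal (\<integral>x. indicator (box a b) x * max 0 (- G x) \<partial>lborel)" for a b
    by (rule e0[OF _ ib(1)], auto)[1] (rule e0[OF _ ib(2)], auto)
  have e2: "(\<integral>x. indicator (box a b) x * max 0 (G x) \<partial>lborel) = (\<integral>x. indicator (box a b) x * max 0 (- G x) \<partial>lborel)" for a b
  proof -
    have "(\<integral>x. indicator (box a b) x * max 0 (G x) \<partial>lborel) - (\<integral>x. indicator (box a b) x * max 0 (- G x) \<partial>lborel)
      = (\<integral>x. indicator (box a b) x * G x \<partial>lborel)"
      by (subst Bochner_Integration.integral_diff[symmetric, OF ib])
        (auto intro!: Bochner_Integration.integral_cong simp: indicator_def)
    then show ?thesis using z[of a b] by simp
  qed
  have "density lborel ?p = density lborel ?m"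
  proof (rule measure_eqI_generator_eq[where E = "range (\<lambda>(a, b). box a b :: 'a set)" and \<Omega> = UNIV
        and A = "\<lambda>n::nat. box (- (real n *\<^sub>R One)) (real n *\<^sub>R One)"])
    show "Int_stable (range (\<lambda>(a, b). box a b :: 'a set))"
      by (auto simp: Int_stable_def box_Int_box)
    show "sets (density lborel ?p) = sigma_sets UNIV (range (\<lambda>(a, b). box a b :: 'a set))"
      "sets (density lborel ?m) = sigma_sets UNIV (range (\<lambda>(a, b). box a b :: 'a set))"
      by (simp_all add: borel_eq_box)
    show "emeasure (density lborel ?p) X = emeasure (density lborel ?m) X"
      if "X \<in> range (\<lambda>(a, b). box a b :: 'a set)" for X
    proof -
      obtain a b where X: "X = box a b" using \<open>X \<in> _\<close> by auto
      show ?thesis unfolding X e1 e2 ..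
    qed
    show "emeasure (density lborel ?p) (box (- (real i *\<^sub>R One)) (real i *\<^sub>R One)) \<noteq> \<infinity>" for i :: nat
      unfolding e1 by simp
    show "(\<Union>n::nat. box (- (real n *\<^sub>R One)) (real n *\<^sub>R One)) = (UNIV :: 'a set)"
      by (rule UN_box_eq_UNIV)
  qed auto
  then have "AE x in lborel. ?p x = ?m x"
    by (subst (asm) sigma_finite_measure.density_unique_iff[OF sigma_finite_lborel]) auto
  then show ?thesis by eventually_elim (auto simp: max_def split: if_splits)
qed

lemma dir_deriv_uminus_dir:
  "f differentiable (at z) \<Longrightarrow> dir_deriv (- v) f z = - dir_deriv v f z"
  using dir_deriv_has_derivative[of f z] has_derivative_linear linear_neg by blast

text \<open>Reflection keeps second derivatives and changes the sign of first ones. Testing with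
  \<open>g (z - y)\<close> therefore turns the adjoint operator into \<open>heat_op g\<close>, and
  the weak equation into an identity between convolutions at \<open>z\<close>.\<close>

lemma heat_op_reflect:
  fixes g :: "(real ^ 'n) \<times> real \<Rightarrow> real"
  assumes "smooth_on UNIV g"
  shows "laplacian_x (\<lambda>y. g (z - y)) y + time_deriv (\<lambda>y. g (z - y)) y = heat_op g (z - y)"
proof -
  have bl: "bounded_linear (uminus :: (real ^ 'n) \<times> real \<Rightarrow> _)"
    by (intro bounded_linear_minus bounded_linear_ident)
  have d: "h differentiable (at x)" if "smooth_on UNIV h" for h :: "(real ^ 'n) \<times> real \<Rightarrow> real" and x
    by (rule smooth_on_differentiable[OF that UNIV_I])
  have 1: "dir_deriv v (\<lambda>y. h (z - y)) = (\<lambda>y. - dir_deriv v h (z - y))" if "smooth_on UNIV h"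
    for h :: "(real ^ 'n) \<times> real \<Rightarrow> real" and v
    using dir_deriv_affine(2)[OF bl, of h z _ v] dir_deriv_uminus_dir[OF d] d that by auto
  have 2: "dir_deriv v (\<lambda>y. - h (z - y)) = (\<lambda>y. dir_deriv v h (z - y))" if "smooth_on UNIV h"
    for h :: "(real ^ 'n) \<times> real \<Rightarrow> real" and v
  proof -
    have "smooth_on UNIV (\<lambda>x. (-1) * h x)" using that by (intro smooth_on_mult smooth_on_const) auto
    then have s: "smooth_on UNIV (\<lambda>x. - h x)" by simp
    have "dir_deriv v (\<lambda>x. - h x) x = - dir_deriv v h x" for x
      by (rule dir_deriv_eq) (intro has_derivative_minus dir_deriv_has_derivative d that)
    then show ?thesis using 1[OF s, of v] by simp
  qed
  show ?thesis
    using assms by (simp add: laplacian_x_def time_deriv_def heat_op_def 1 2 smooth_on_dir_deriv)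
qed

lemma interior_Qm: "interior (Qm r :: ((real ^ 'n) \<times> real) set) = ball 0 r \<times> {- (r\<^sup>2) <..< 0}"
  by (simp add: Qm_def interior_Times interior_open)

lemma reg_ker_test_function:
  fixes z :: "(real ^ 'n) \<times> real"
  assumes "z \<in> Qm (1/2)" "0 < \<delta>"
  shows "test_function (interior (Qm 1)) (\<lambda>y. reg_ker \<delta> (z - y))"
proof -
  let ?K = "cball (fst z) (1/4) \<times> {snd z - 1/4..snd z - \<delta>\<^sup>2}"
  have K: "compact ?K" by (intro compact_Times) auto
  have "y \<in> ?K" if "reg_ker \<delta> (z - y) \<noteq> 0" for y
  proof -
    have "trunc_ker (z - y) \<noteq> 0" "time_cut \<delta> (z - y) \<noteq> 0" using that by (auto simp: reg_ker_def)
    then have "norm (fst (z - y)) < 1/4" "snd (z - y) < 1/4" "0 < snd (z - y) / \<delta>\<^sup>2 - 1"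
      using trunc_ker_eq_0[of "z - y"] smooth_step_0[of "snd (z - y) / \<delta>\<^sup>2 - 1"]
      by (auto simp: time_cut_def not_le[symmetric])
    then show ?thesis using assms(2) by (cases y) (auto simp: dist_norm field_simps)
  qed
  then have sub: "closure {y. reg_ker \<delta> (z - y) \<noteq> 0} \<subseteq> ?K"
    using compact_imp_closed[OF K] by (intro closure_minimal) auto
  have "?K \<subseteq> interior (Qm 1)"
  proof
    fix y assume y: "y \<in> ?K"
    have "norm (fst y) \<le> norm (fst z) + dist (fst z) (fst y)"
      by (metis dist_commute dist_norm norm_triangle_sub)
    moreover have "dist (fst z) (fst y) \<le> 1/4" "norm (fst z) < 1/2" "- (1/4) < snd z" "snd z \<le> 0" "0 < \<delta>\<^sup>2"
      "snd z - 1/4 \<le> snd y" "snd y \<le> snd z - \<delta>\<^sup>2"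
      using y assms by (auto simp: Qm_def power2_eq_square)
    ultimately have "norm (fst y) < 1" "- 1 < snd y" "snd y < 0" by linarith+
    then show "y \<in> interior (Qm 1)"
      unfolding interior_Qm by (cases y) auto
  qed
  moreover have "Ck k (\<lambda>y. reg_ker \<delta> (z - y))" for k
  proof -
    have "smooth_on UNIV (\<lambda>y. reg_ker \<delta> (z + - y))"
      by (rule smooth_on_affine[where V = UNIV])
        (auto intro: bounded_linear_minus bounded_linear_ident smooth_reg_ker[OF assms(2)])
    then show ?thesis by (simp add: smooth_on_def Ck_on_UNIV)
  qed
  moreover have "compact (closure {y. reg_ker \<delta> (z - y) \<noteq> 0})"
    using compact_Int_closed[OF K closed_closure, of "{y. reg_ker \<delta> (z - y) \<noteq> 0}"] sub
    by (simp only: Int_absorb1)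
  ultimately show ?thesis using sub unfolding test_function_def by blast
qed

lemma lebesgue_set_integral_lborel:
  fixes g :: "'a::euclidean_space \<Rightarrow> real"
  assumes "g \<in> borel_measurable borel" "S \<in> sets borel"
  shows "(LINT z:S|lebesgue. g z) = (\<integral>z. indicator S z * g z \<partial>lborel)"
  unfolding set_lebesgue_integral_def using assms by (subst integral_completion) auto

lemma Qm_borel[measurable]: "Qm r \<in> sets borel"
  unfolding Qm_def by (intro borel_Times) auto

lemma integrable_bounded_mult:
  fixes g v :: "(real ^ 'n) \<times> real \<Rightarrow> real"
  assumes "integrable lborel v" "g \<in> borel_measurable borel" "\<And>y. \<bar>g y\<bar> \<le> B"
  shows "integrable lborel (\<lambda>y. v y * g y)"
proof (rule Bochner_Integration.integrable_bound)
  show "integrable lborel (\<lambda>y. B * v y)" using assms(1) by auto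
  have "\<bar>v y * g y\<bar> \<le> \<bar>B * v y\<bar>" for y
    using assms(3)[of y] by (simp add: abs_mult) (metis abs_ge_self abs_ge_zero mult.commute mult_left_mono order_trans)
  then show "AE y in lborel. norm (v y * g y) \<le> norm (B * v y)" by auto
qed (use assms in auto)

lemma time_cut_tendsto:
  fixes w :: "(real ^ 'n) \<times> real"
  assumes "0 < snd w" "\<delta> \<longlonglongrightarrow> 0" "\<And>i. 0 < \<delta> i"
  shows "(\<lambda>i. time_cut (\<delta> i) w) \<longlonglongrightarrow> 1"
proof (rule tendsto_eventually)
  have "(\<lambda>i. (\<delta> i)\<^sup>2) \<longlonglongrightarrow> 0\<^sup>2" by (intro tendsto_intros assms)
  then have "\<forall>\<^sub>F i in sequentially. (\<delta> i)\<^sup>2 < snd w / 2"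
    using assms(1) by (intro order_tendstoD(2)[where y = "0\<^sup>2"]) auto
  then show "\<forall>\<^sub>F i in sequentially. time_cut (\<delta> i) w = 1"
  proof eventually_elim
    case (elim i)
    have "0 < (\<delta> i)\<^sup>2" using assms(3)[of i] by simp
    then have "2 < snd w / (\<delta> i)\<^sup>2" using elim by (simp add: field_simps)
    then show ?case by (simp add: time_cut_def smooth_step_1)
  qed
qed

text \<open>Dominated convergence twice, first in \<open>w\<close> for fixed \<open>y\<close> and
  then in \<open>y\<close>. The vanishing of \<open>g\<close> at nonpositive times is essential,
  since the cutoff tends to 1 at positive times only.\<close>

lemma cut_kernel_limit:
  fixes v g h :: "(real ^ 'n) \<times> real \<Rightarrow> real"
  assumes v: "integrable lborel v" and g: "integrable lborel g" and g0: "\<And>w. snd w \<le> 0 \<Longrightarrow> g w = 0"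
    and [measurable]: "h \<in> borel_measurable borel" and h: "\<And>z. \<bar>h z\<bar> \<le> 1"
    and \<delta>: "\<delta> \<longlonglongrightarrow> 0" "\<And>i. 0 < \<delta> i"
  shows "(\<lambda>i. \<integral>y. v y * (\<integral>w. h (y + w) * (time_cut (\<delta> i) w * g w) \<partial>lborel) \<partial>lborel)
    \<longlonglongrightarrow> (\<integral>y. v y * (\<integral>w. h (y + w) * g w \<partial>lborel) \<partial>lborel)"
proof -
  have [measurable]: "v \<in> borel_measurable borel" "g \<in> borel_measurable borel" using v g by auto
  show ?thesis
  proof (rule integral_dominated_convergence)
    show "integrable lborel (\<lambda>y. \<bar>v y\<bar> * (\<integral>w. \<bar>g w\<bar> \<partial>lborel))" using v by auto
    have le: "\<bar>h (y + w) * (time_cut (\<delta> i) w * g w)\<bar> \<le> \<bar>g w\<bar>" for y w i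
    proof -
      have "\<bar>h (y + w) * time_cut (\<delta> i) w\<bar> \<le> 1 * 1"
        unfolding abs_mult using smooth_step_bounds[of "snd w / (\<delta> i)\<^sup>2 - 1"]
        by (intro mult_mono h) (auto simp: time_cut_def)
      then have "\<bar>h (y + w) * time_cut (\<delta> i) w\<bar> * \<bar>g w\<bar> \<le> 1 * \<bar>g w\<bar>" by (intro mult_right_mono) auto
      then show ?thesis by (simp add: abs_mult mult.assoc)
    qed
    have lim: "(\<lambda>i. \<integral>w. h (y + w) * (time_cut (\<delta> i) w * g w) \<partial>lborel) \<longlonglongrightarrow> (\<integral>w. h (y + w) * g w \<partial>lborel)" for y
    proof (rule integral_dominated_convergence)
      show "integrable lborel (\<lambda>w. \<bar>g w\<bar>)" using g by auto
      show "AE w in lborel. (\<lambda>i. h (y + w) * (time_cut (\<delta> i) w * g w)) \<longlonglongrightarrow> h (y + w) * g w"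
      proof (rule AE_I2)
        fix w
        show "(\<lambda>i. h (y + w) * (time_cut (\<delta> i) w * g w)) \<longlonglongrightarrow> h (y + w) * g w"
        proof (cases "0 < snd w")
          case True
          have "(\<lambda>i. h (y + w) * (time_cut (\<delta> i) w * g w)) \<longlonglongrightarrow> h (y + w) * (1 * g w)"
            by (intro tendsto_intros time_cut_tendsto True \<delta>)
          then show ?thesis by simp
        qed (simp add: g0)
      qed
    qed (use le in auto)
    show "AE y in lborel. (\<lambda>i. v y * (\<integral>w. h (y + w) * (time_cut (\<delta> i) w * g w) \<partial>lborel)) \<longlonglongrightarrow> v y * (\<integral>w. h (y + w) * g w \<partial>lborel)"
      by (intro AE_I2 tendsto_intros lim)
    have "\<bar>\<integral>w. h (y + w) * (time_cut (\<delta> i) w * g w) \<partial>lborel\<bar> \<le> (\<integral>w. \<bar>g w\<bar> \<partial>lborel)" for y i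
    proof (rule order_trans[OF integral_abs_bound integral_mono])
      show "integrable lborel (\<lambda>w. \<bar>h (y + w) * (time_cut (\<delta> i) w * g w)\<bar>)"
        by (intro integrable_abs, rule Bochner_Integration.integrable_bound[OF g]) (use le in auto)
    qed (use g le in auto)
    then show "AE y in lborel. norm (v y * (\<integral>w. h (y + w) * (time_cut (\<delta> i) w * g w) \<partial>lborel)) \<le> \<bar>v y\<bar> * (\<integral>w. \<bar>g w\<bar> \<partial>lborel)" for i
      by (auto simp: abs_mult intro!: mult_left_mono)
  qed measurable
qed

context
  fixes u f :: "(real ^ 'n) \<times> real \<Rightarrow> real"
  assumes u: "integrable lborel u" and f: "integrable lborel f"
    and u0: "\<And>z. z \<notin> Qm 1 \<Longrightarrow> u z = 0" and f0: "\<And>z. z \<notin> Qm 1 \<Longrightarrow> f z = 0"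
    and heat: "heat_equation_Q1 u f"
begin

lemma reg_identity:
  assumes "z \<in> Qm (1/2)" "0 < \<delta>"
  shows "(\<integral>y. u y * (time_cut \<delta> (z - y) * smooth_ker (z - y)) \<partial>lborel)
     - (\<integral>y. u y * approx_id \<delta> (z - y) \<partial>lborel) = (\<integral>y. f y * reg_ker \<delta> (z - y) \<partial>lborel)"
proof -
  have [measurable]: "u \<in> borel_measurable borel" "f \<in> borel_measurable borel" using u f by auto
  have sm: "smooth_on UNIV (reg_ker \<delta> :: (real ^ 'n) \<times> real \<Rightarrow> real)" by (rule smooth_reg_ker[OF assms(2)])
  have sh: "smooth_on UNIV (heat_op (reg_ker \<delta>) :: (real ^ 'n) \<times> real \<Rightarrow> real)"
    by (rule smooth_heat_op[OF open_UNIV sm])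
  have [measurable]: "heat_op (reg_ker \<delta>) \<in> borel_measurable (borel :: ((real ^ 'n) \<times> real) measure)"
    by (rule smooth_measurable[OF sh])
  have "(LINT y:Qm 1|lebesgue. u y * heat_op (reg_ker \<delta>) (z - y)) = (LINT y:Qm 1|lebesgue. f y * reg_ker \<delta> (z - y))"
    using heat reg_ker_test_function[OF assms] unfolding heat_equation_Q1_def heat_op_reflect[OF sm, symmetric] by blast
  then have "(\<integral>y. indicator (Qm 1) y * (u y * heat_op (reg_ker \<delta>) (z - y)) \<partial>lborel) =
     (\<integral>y. indicator (Qm 1) y * (f y * reg_ker \<delta> (z - y)) \<partial>lborel)"
    by (simp add: lebesgue_set_integral_lborel)
  then have 1: "(\<integral>y. u y * heat_op (reg_ker \<delta>) (z - y) \<partial>lborel) = (\<integral>y. f y * reg_ker \<delta> (z - y) \<partial>lborel)"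
    by (rule box_equals) (auto intro!: Bochner_Integration.integral_cong simp: indicator_def u0 f0)
  obtain B where B: "0 \<le> B" "\<And>y :: (real ^ 'n) \<times> real. \<bar>smooth_ker y\<bar> \<le> B"
    using bump_bounded[OF bump_smooth_ker] by blast
  have bT: "\<bar>time_cut \<delta> y * smooth_ker y\<bar> \<le> B" for y :: "(real ^ 'n) \<times> real"
    using B(2)[of y] smooth_step_bounds[of "snd y / \<delta>\<^sup>2 - 1"] mult_mono[of "\<bar>time_cut \<delta> y\<bar>" 1 "\<bar>smooth_ker y\<bar>" B]
    by (simp add: abs_mult time_cut_def)
  \<comment> \<open>Smooth with compact support, hence bounded. Integrability of \<open>u\<close>
    against \<open>approx_id \<delta>\<close> then follows by writing the latter as a difference of
    two bounded functions, without estimating it separately.\<close>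
  have bH: "bump (heat_op (reg_ker \<delta>) :: (real ^ 'n) \<times> real \<Rightarrow> real)"
    unfolding bump_def
  proof (intro conjI sh exI[of _ "cball 0 (1/4) \<times> {0..1/4}"] allI impI)
    show "compact (cball (0 :: real ^ 'n) (1/4) \<times> {0..1/4::real})" by (intro compact_Times) auto
    show "heat_op (reg_ker \<delta>) w = 0" if "w \<notin> cball (0 :: real ^ 'n) (1/4) \<times> {0..1/4::real}" for w
      using smooth_ker_eq_0[of w] trunc_ker_eq_0[of w] that
      by (cases w) (auto simp: heat_op_reg_ker[OF assms(2)] approx_id_def not_le)
  qed
  obtain B' where B': "\<And>y :: (real ^ 'n) \<times> real. \<bar>heat_op (reg_ker \<delta>) y\<bar> \<le> B'"
    using bump_bounded[OF bH] by blast
  have "(\<integral>y. u y * approx_id \<delta> (z - y) \<partial>lborel) =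
      (\<integral>y. u y * (time_cut \<delta> (z - y) * smooth_ker (z - y)) - u y * heat_op (reg_ker \<delta>) (z - y) \<partial>lborel)"
    by (simp add: heat_op_reg_ker[OF assms(2)] algebra_simps)
  also have "\<dots> = (\<integral>y. u y * (time_cut \<delta> (z - y) * smooth_ker (z - y)) \<partial>lborel) - (\<integral>y. u y * heat_op (reg_ker \<delta>) (z - y) \<partial>lborel)"
    by (intro Bochner_Integration.integral_diff integrable_bounded_mult[OF u, where B = B] integrable_bounded_mult[OF u, where B = B'])
      (use bT B' in auto)
  finally show ?thesis using 1 by simp
qed

text \<open>For merely integrable \<open>u\<close> the convolutions with \<open>approx_id\<close>
  need not converge at a given point. Integrating \<open>reg_identity\<close> over \<open>S\<close>
  and moving the kernels to \<open>indicator S\<close> by duality replaces this by convergence where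
  the indicator is continuous, that is, off the frontier, which is a null set because
  \<open>S\<close> is convex.\<close>

lemma weak_representation:
  fixes S :: "((real ^ 'n) \<times> real) set"
  assumes S: "convex S" "open S" "S \<subseteq> Qm (1/2)"
  shows "(\<integral>z. indicator S z * ((\<integral>y. u y * smooth_ker (z - y) \<partial>lborel) - sqrt (4 * pi) ^ CARD('n) * u z
      - (\<integral>y. f y * trunc_ker (z - y) \<partial>lborel)) \<partial>lborel) = 0"
proof -
  have [measurable]: "u \<in> borel_measurable borel" "f \<in> borel_measurable borel" using u f by auto
  let ?g = "sqrt (4 * pi) ^ CARD('n)"
  let ?h = "indicator S :: (real ^ 'n) \<times> real \<Rightarrow> real"
  have [measurable]: "S \<in> sets borel" using S by auto
  have h1: "\<bar>?h z\<bar> \<le> 1" for z by (simp add: indicator_def)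
  define \<delta> :: "nat \<Rightarrow> real" where "\<delta> i = inverse (real (Suc i))" for i
  have \<delta>: "\<delta> \<longlonglongrightarrow> 0" "\<And>i. 0 < \<delta> i"
    unfolding \<delta>_def by (rule LIMSEQ_inverse_real_of_nat) simp
  have ik: "integrable lborel (smooth_ker :: (real ^ 'n) \<times> real \<Rightarrow> real)"
    by (rule integrable_bump[OF bump_smooth_ker])
  have tc: "\<bar>time_cut (\<delta> i) w * g\<bar> \<le> \<bar>g\<bar>" for i and w :: "(real ^ 'n) \<times> real" and g
    using smooth_step_bounds[of "snd w / (\<delta> i)\<^sup>2 - 1"] by (simp add: abs_mult time_cut_def mult_left_le_one_le)
  have itk: "integrable lborel (\<lambda>w :: (real ^ 'n) \<times> real. time_cut (\<delta> i) w * smooth_ker w)" for i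
    by (rule Bochner_Integration.integrable_bound[OF ik]) (auto simp: tc)
  have itE: "integrable lborel (reg_ker (\<delta> i) :: (real ^ 'n) \<times> real \<Rightarrow> real)" for i
    by (rule Bochner_Integration.integrable_bound[OF integrable_trunc_ker]) (auto simp: tc reg_ker_def)
  have iA: "integrable lborel (approx_id (\<delta> i) :: (real ^ 'n) \<times> real \<Rightarrow> real)" for i
    by (rule integrable_approx_id[OF \<delta>(2)])
  have imult: "integrable lborel (\<lambda>z. ?h z * c z)" if "integrable lborel c" for c :: "(real ^ 'n) \<times> real \<Rightarrow> real"
    using integrable_bounded_mult[OF that, of ?h 1] by (simp add: h1 mult.commute)
  have eq: "(\<integral>y. u y * (\<integral>w. ?h (y + w) * (time_cut (\<delta> i) w * smooth_ker w) \<partial>lborel) \<partial>lborel)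
     - (\<integral>y. u y * (\<integral>w. ?h (y + w) * approx_id (\<delta> i) w \<partial>lborel) \<partial>lborel)
     = (\<integral>y. f y * (\<integral>w. ?h (y + w) * (time_cut (\<delta> i) w * trunc_ker w) \<partial>lborel) \<partial>lborel)" for i
  proof -
    have "(\<integral>z. ?h z * (\<integral>y. u y * (time_cut (\<delta> i) (z - y) * smooth_ker (z - y)) \<partial>lborel) \<partial>lborel)
     - (\<integral>z. ?h z * (\<integral>y. u y * approx_id (\<delta> i) (z - y) \<partial>lborel) \<partial>lborel) =
     (\<integral>z. ?h z * (\<integral>y. u y * (time_cut (\<delta> i) (z - y) * smooth_ker (z - y)) \<partial>lborel)
        - ?h z * (\<integral>y. u y * approx_id (\<delta> i) (z - y) \<partial>lborel) \<partial>lborel)"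
      by (intro Bochner_Integration.integral_diff[symmetric] imult integrable_conv[OF u itk] integrable_conv[OF u iA])
    also have "\<dots> = (\<integral>z. ?h z * (\<integral>y. f y * reg_ker (\<delta> i) (z - y) \<partial>lborel) \<partial>lborel)"
    proof (rule Bochner_Integration.integral_cong[OF refl])
      fix z
      show "?h z * (\<integral>y. u y * (time_cut (\<delta> i) (z - y) * smooth_ker (z - y)) \<partial>lborel)
        - ?h z * (\<integral>y. u y * approx_id (\<delta> i) (z - y) \<partial>lborel) = ?h z * (\<integral>y. f y * reg_ker (\<delta> i) (z - y) \<partial>lborel)"
      proof (cases "z \<in> S")
        case True
        then show ?thesis using reg_identity[of z "\<delta> i"] \<delta>(2) S by auto
      qed simp
    qed
    finally show ?thesis
      by (simp add: conv_duality[OF u itk _ h1] conv_duality[OF u iA _ h1] conv_duality[OF f itE _ h1])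
        (simp add: reg_ker_def)
  qed
  have l1: "(\<lambda>i. \<integral>y. u y * (\<integral>w. ?h (y + w) * (time_cut (\<delta> i) w * smooth_ker w) \<partial>lborel) \<partial>lborel)
      \<longlonglongrightarrow> (\<integral>y. u y * (\<integral>w. ?h (y + w) * smooth_ker w \<partial>lborel) \<partial>lborel)"
    by (rule cut_kernel_limit[OF u ik]) (auto simp: smooth_ker_eq_0_past h1 \<delta>)
  have l2: "(\<lambda>i. \<integral>y. f y * (\<integral>w. ?h (y + w) * (time_cut (\<delta> i) w * trunc_ker w) \<partial>lborel) \<partial>lborel)
      \<longlonglongrightarrow> (\<integral>y. f y * (\<integral>w. ?h (y + w) * trunc_ker w \<partial>lborel) \<partial>lborel)"
    by (rule cut_kernel_limit[OF f integrable_trunc_ker]) (auto simp: trunc_ker_eq_0 h1 \<delta>)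
  have l3: "(\<lambda>i. \<integral>y. u y * (\<integral>w. ?h (y + w) * approx_id (\<delta> i) w \<partial>lborel) \<partial>lborel)
      \<longlonglongrightarrow> (\<integral>y. u y * (?g * ?h y) \<partial>lborel)"
  proof (rule integral_dominated_convergence)
    show "integrable lborel (\<lambda>y. \<bar>u y\<bar> * (\<integral>w. \<bar>id_profile (w :: (real ^ 'n) \<times> real)\<bar> \<partial>lborel))" using u by auto
    have "frontier S \<in> null_sets lborel"
      using negligible_convex_frontier[OF S(1)] null_sets_completion_iff[of "frontier S" lborel]
      by (simp add: negligible_iff_null_sets frontier_closed)
    then have "AE y in lborel. y \<notin> frontier S" by (rule AE_not_in)
    then show "AE y in lborel. (\<lambda>i. u y * (\<integral>w. ?h (y + w) * approx_id (\<delta> i) w \<partial>lborel)) \<longlonglongrightarrow> u y * (?g * ?h y)"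
    proof eventually_elim
      case (elim y)
      have c: "isCont ?h y"
      proof (cases "y \<in> S")
        case True
        have "continuous_on S ?h" by (rule continuous_on_eq[of S "\<lambda>_. 1"]) auto
        then show ?thesis using True continuous_on_eq_continuous_at[OF S(2)] by blast
      next
        case False
        then have "y \<in> - closure S" using elim S(2) by (auto simp: frontier_def interior_open)
        moreover have "continuous_on (- closure S) ?h"
          by (rule continuous_on_eq[of _ "\<lambda>_. 0"]) (use closure_subset[of S] in \<open>auto simp: indicator_def\<close>)
        ultimately show ?thesis
          using continuous_on_eq_continuous_at[OF open_Compl[OF closed_closure[of S]]] by blast
      qed
      have "isCont (\<lambda>w. ?h (y + w)) 0"
        by (rule continuous_at_compose[of 0 "\<lambda>w. y + w" ?h, unfolded o_def]) (use c in \<open>auto intro!: continuous_intros\<close>)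
      then have "(\<lambda>i. \<integral>w. ?h (y + w) * approx_id (\<delta> i) w \<partial>lborel) \<longlonglongrightarrow> ?g * ?h (y + 0)"
        by (intro approx_id_tendsto[where B = 1] \<delta>) (auto simp: h1)
      then show ?case by (intro tendsto_intros) auto
    qed
    have "\<bar>\<integral>w. ?h (y + w) * approx_id (\<delta> i) w \<partial>lborel\<bar> \<le> (\<integral>w. \<bar>id_profile (w :: (real ^ 'n) \<times> real)\<bar> \<partial>lborel)" for y i
    proof -
      have b: "\<bar>?h (y + w) * approx_id (\<delta> i) w\<bar> \<le> \<bar>approx_id (\<delta> i) w\<bar>" for w
        by (simp add: indicator_def)
      have "\<bar>\<integral>w. ?h (y + w) * approx_id (\<delta> i) w \<partial>lborel\<bar> \<le> (\<integral>w. \<bar>?h (y + w) * approx_id (\<delta> i) w\<bar> \<partial>lborel)"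
        by (rule integral_abs_bound)
      also have "\<dots> \<le> (\<integral>w. \<bar>approx_id (\<delta> i) (w :: (real ^ 'n) \<times> real)\<bar> \<partial>lborel)"
        by (intro integral_mono integrable_abs iA, rule Bochner_Integration.integrable_bound[OF iA[of i]])
          (auto simp: b)
      also have "\<dots> \<le> (\<integral>w. \<bar>id_profile (w :: (real ^ 'n) \<times> real)\<bar> \<partial>lborel)"
        by (rule integral_abs_approx_id[OF \<delta>(2)])
      finally show ?thesis .
    qed
    then show "AE y in lborel. norm (u y * (\<integral>w. ?h (y + w) * approx_id (\<delta> i) w \<partial>lborel))
        \<le> \<bar>u y\<bar> * (\<integral>w. \<bar>id_profile (w :: (real ^ 'n) \<times> real)\<bar> \<partial>lborel)" for i
      by (auto simp: abs_mult intro!: mult_left_mono)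
  qed measurable
  have "(\<integral>y. u y * (\<integral>w. ?h (y + w) * smooth_ker w \<partial>lborel) \<partial>lborel) - (\<integral>y. u y * (?g * ?h y) \<partial>lborel)
      = (\<integral>y. f y * (\<integral>w. ?h (y + w) * trunc_ker w \<partial>lborel) \<partial>lborel)"
    using LIMSEQ_unique[OF tendsto_diff[OF l1 l3] l2[folded eq]] .
  then have "(\<integral>z. ?h z * (\<integral>y. u y * smooth_ker (z - y) \<partial>lborel) \<partial>lborel) - (\<integral>z. ?h z * (?g * u z) \<partial>lborel)
      - (\<integral>z. ?h z * (\<integral>y. f y * trunc_ker (z - y) \<partial>lborel) \<partial>lborel) = 0"
    by (simp add: conv_duality[OF u ik _ h1] conv_duality[OF f integrable_trunc_ker _ h1] mult_ac)
  then show ?thesis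
    using imult[OF integrable_conv[OF u ik]] imult[OF integrable_mult_right[OF u, of ?g]]
      imult[OF integrable_conv[OF f integrable_trunc_ker]]
    by (simp add: right_diff_distrib)
qed

text \<open>A box meets the open half-size cylinder in a convex open set, so by
  \<open>weak_representation\<close> the defect of the formula integrates to zero over every
  box.\<close>

lemma representation:
  "AE z in lborel. z \<in> interior (Qm (1/2)) \<longrightarrow> sqrt (4 * pi) ^ CARD('n) * u z =
     (\<integral>y. u y * smooth_ker (z - y) \<partial>lborel) - (\<integral>y. f y * trunc_ker (z - y) \<partial>lborel)"
proof -
  have [measurable]: "u \<in> borel_measurable borel" "f \<in> borel_measurable borel" using u f by auto
  let ?D = "interior (Qm (1/2)) :: ((real ^ 'n) \<times> real) set"
  let ?F = "\<lambda>z. (\<integral>y. u y * smooth_ker (z - y) \<partial>lborel) - sqrt (4 * pi) ^ CARD('n) * u z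
      - (\<integral>y. f y * trunc_ker (z - y) \<partial>lborel)"
  have F: "integrable lborel ?F"
    by (intro Bochner_Integration.integrable_diff integrable_conv u f integrable_trunc_ker
        integrable_bump[OF bump_smooth_ker] integrable_mult_right)
  have "AE z in lborel. indicator ?D z * ?F z = 0"
  proof (rule AE_zero_boxes)
    show "integrable lborel (\<lambda>z. indicator ?D z * ?F z)"
      using integrable_real_mult_indicator[OF _ F, of ?D] by (simp add: mult.commute)
    fix a b :: "(real ^ 'n) \<times> real"
    have "convex (box a b \<inter> ?D)"
      unfolding interior_Qm by (intro convex_Int convex_box convex_Times convex_ball convex_real_interval)
    then have "(\<integral>z. indicator (box a b \<inter> ?D) z * ?F z \<partial>lborel) = 0"
      by (rule weak_representation) (auto simp: interior_subset[THEN subsetD])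
    then show "(\<integral>z. indicator (box a b) z * (indicator ?D z * ?F z) \<partial>lborel) = 0"
      by (simp add: indicator_inter_arith mult.assoc)
  qed
  then show ?thesis by eventually_elim (auto simp: indicator_def)
qed

end

section \<open>Normalised \<open>L\<^sup>p\<close> norms on cylinders\<close>

text \<open>The estimates are carried out for Borel functions and \<open>lborel\<close>, where
  products and convolutions are measurable without further care. The return to Lebesgue measurable
  functions is made by the transfer lemmas of the last section.\<close>

definition LpQ :: "real \<Rightarrow> real \<Rightarrow> ((real ^ 'n) \<times> real \<Rightarrow> real) \<Rightarrow> bool" where
  "LpQ p r g \<longleftrightarrow> g \<in> borel_measurable borel \<and> integrable lborel (\<lambda>z. indicator (Qm r) z * \<bar>g z\<bar> powr p)"

text \<open>Dividing by \<open>r ^ (n + 2)\<close> instead of the volume keeps the quantity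
  invariant under dilations and equal to the plain norm at \<open>r = 1\<close>. It differs from the
  averaged norm by the fixed factor \<open>unit_vol powr (1 / p)\<close>.\<close>

definition avg_norm :: "real \<Rightarrow> real \<Rightarrow> ((real ^ 'n) \<times> real \<Rightarrow> real) \<Rightarrow> real" where
  "avg_norm p r g =
     ((\<integral>z. indicator (Qm r) z * \<bar>g z\<bar> powr p \<partial>lborel) / r ^ (CARD('n) + 2)) powr (1 / p)"

lemma avg_norm_nonneg: "0 \<le> avg_norm p r g"
  by (simp add: avg_norm_def)

lemma par_scale_mem_Qm:
  assumes "0 < r" shows "par_scale r z \<in> Qm (r * s) \<longleftrightarrow> z \<in> Qm s"
proof -
  have "- ((r * s)\<^sup>2) < r\<^sup>2 * snd z \<longleftrightarrow> r\<^sup>2 * (- (s\<^sup>2)) < r\<^sup>2 * snd z"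
    by (simp add: power_mult_distrib)
  then have "- ((r * s)\<^sup>2) < r\<^sup>2 * snd z \<longleftrightarrow> - (s\<^sup>2) < snd z"
    using assms by (simp only: mult_less_cancel_left_pos zero_less_power)
  then show ?thesis using assms
    by (cases z) (auto simp: Qm_def par_scale_def mult_le_0_iff)
qed

lemma Qm_mono: assumes "0 \<le> s" "s \<le> r" shows "Qm s \<subseteq> Qm r"
proof -
  have le: "s\<^sup>2 \<le> r\<^sup>2" using assms by (intro power_mono) auto
  have "{- (s\<^sup>2) <.. 0} \<subseteq> {- (r\<^sup>2) <.. 0}"
  proof
    fix t assume "t \<in> {- (s\<^sup>2) <.. 0}"
    then have "- (s\<^sup>2) < t" "t \<le> 0" by auto
    then have "- (r\<^sup>2) < t" using le by linarith
    then show "t \<in> {- (r\<^sup>2) <.. 0}" using \<open>t \<le> 0\<close> by simp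
  qed
  then show ?thesis using assms unfolding Qm_def by (intro Sigma_mono) auto
qed

lemma emeasure_Qm_finite: "emeasure lborel (Qm r :: ((real ^ 'n) \<times> real) set) < \<infinity>"
proof (rule emeasure_bounded_finite)
  have "bounded (ball (0 :: real ^ 'n) r \<times> {- (r\<^sup>2)..0})" by (intro bounded_Times) auto
  then show "bounded (Qm r :: ((real ^ 'n) \<times> real) set)"
    by (rule bounded_subset) (auto simp: Qm_def)
qed

lemma integrable_indicator_Qm: "integrable lborel (indicator (Qm r) :: (real ^ 'n) \<times> real \<Rightarrow> real)"
  using emeasure_Qm_finite by (intro integrable_real_indicator) auto

lemma LpQ_bound:
  assumes "LpQ p r h" "g \<in> borel_measurable borel" "0 < p" "\<And>z. z \<in> Qm r \<Longrightarrow> \<bar>g z\<bar> \<le> \<bar>h z\<bar>"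
  shows "LpQ p r g"
  unfolding LpQ_def
proof
  have [measurable]: "g \<in> borel_measurable borel" using assms by auto
  show "integrable lborel (\<lambda>z. indicator (Qm r) z * \<bar>g z\<bar> powr p)"
    by (rule Bochner_Integration.integrable_bound[of _ "\<lambda>z. indicator (Qm r) z * \<bar>h z\<bar> powr p"])
      (use assms in \<open>auto simp: LpQ_def indicator_def intro!: powr_mono2\<close>)
qed (use assms in auto)

lemma LpQ_const:
  assumes "0 < p" shows "LpQ p r (\<lambda>_. c)"
  unfolding LpQ_def by (intro conjI integrable_mult_left integrable_indicator_Qm) auto

lemma LpQ_subset:
  assumes "LpQ p r g" "0 \<le> s" "s \<le> r" shows "LpQ p s g"
  unfolding LpQ_def
proof
  have [measurable]: "g \<in> borel_measurable borel" using assms by (simp add: LpQ_def)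
  show "integrable lborel (\<lambda>z. indicator (Qm s) z * \<bar>g z\<bar> powr p)"
    by (rule Bochner_Integration.integrable_bound[of _ "\<lambda>z. indicator (Qm r) z * \<bar>g z\<bar> powr p"])
      (use assms Qm_mono[OF assms(2,3)] in \<open>auto simp: LpQ_def indicator_def\<close>)
qed (use assms in \<open>simp add: LpQ_def\<close>)

lemma abs_add_powr_le:
  fixes a b p :: real
  assumes "0 < p"
  shows "\<bar>a + b\<bar> powr p \<le> 2 powr p * (\<bar>a\<bar> powr p + \<bar>b\<bar> powr p)"
proof -
  have "\<bar>a + b\<bar> powr p \<le> (2 * max \<bar>a\<bar> \<bar>b\<bar>) powr p" using assms by (intro powr_mono2) auto
  also have "\<dots> = 2 powr p * max \<bar>a\<bar> \<bar>b\<bar> powr p" by (simp add: powr_mult)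
  also have "max \<bar>a\<bar> \<bar>b\<bar> powr p \<le> \<bar>a\<bar> powr p + \<bar>b\<bar> powr p" by (simp add: max_def)
  finally show ?thesis by simp
qed

lemma LpQ_add:
  assumes "0 < p" "LpQ p r g" "LpQ p r h"
  shows "LpQ p r (\<lambda>z. g z + h z)"
  unfolding LpQ_def
proof
  have [measurable]: "g \<in> borel_measurable borel" "h \<in> borel_measurable borel" using assms by (auto simp: LpQ_def)
  show "(\<lambda>z. g z + h z) \<in> borel_measurable borel" by measurable
  show "integrable lborel (\<lambda>z. indicator (Qm r) z * \<bar>g z + h z\<bar> powr p)"
  proof (rule Bochner_Integration.integrable_bound)
    show "integrable lborel (\<lambda>z. 2 powr p * (indicator (Qm r) z * \<bar>g z\<bar> powr p + indicator (Qm r) z * \<bar>h z\<bar> powr p))"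
      using assms by (auto simp: LpQ_def)
    show "AE z in lborel. norm (indicator (Qm r) z * \<bar>g z + h z\<bar> powr p)
        \<le> norm (2 powr p * (indicator (Qm r) z * \<bar>g z\<bar> powr p + indicator (Qm r) z * \<bar>h z\<bar> powr p))"
      using abs_add_powr_le[OF assms(1)] by (intro AE_I2) (auto simp: indicator_def)
  qed measurable
qed

lemma LpQ_cmult:
  assumes "LpQ p r g" shows "LpQ p r (\<lambda>z. c * g z)"
proof -
  have "integrable lborel (\<lambda>z. \<bar>c\<bar> powr p * (indicator (Qm r) z * \<bar>g z\<bar> powr p))"
    using assms by (auto simp: LpQ_def)
  then show ?thesis using assms by (auto simp: LpQ_def abs_mult powr_mult mult.left_commute)
qed

lemma LpQ_diff:
  assumes "0 < p" "LpQ p r g" "LpQ p r h"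
  shows "LpQ p r (\<lambda>z. g z - h z)"
  using LpQ_add[OF assms(1,2) LpQ_cmult[OF assms(3), of "-1"]] by simp

lemma avg_norm_mono_AE:
  assumes "0 < p" "0 < r" "LpQ p r h" "LpQ p r g" "AE z in lborel. z \<in> Qm r \<longrightarrow> \<bar>g z\<bar> \<le> \<bar>h z\<bar>"
  shows "avg_norm p r g \<le> avg_norm p r h"
  unfolding avg_norm_def
proof (intro powr_mono2 divide_right_mono integral_mono_AE)
  show "AE z in lborel. indicator (Qm r) z * \<bar>g z\<bar> powr p \<le> indicator (Qm r) z * \<bar>h z\<bar> powr p"
    using assms(5) by eventually_elim (use assms(1) in \<open>auto simp: indicator_def intro!: powr_mono2\<close>)
qed (use assms in \<open>auto simp: LpQ_def\<close>)

lemma avg_norm_mono: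
  assumes "0 < p" "0 < r" "LpQ p r h" "LpQ p r g" "\<And>z. z \<in> Qm r \<Longrightarrow> \<bar>g z\<bar> \<le> \<bar>h z\<bar>"
  shows "avg_norm p r g \<le> avg_norm p r h"
  by (rule avg_norm_mono_AE) (use assms in auto)

text \<open>Stands in for Minkowski's inequality. The hypothesis gives a factor 2 and
  \<open>2 powr (1/p) \<le> 2\<close> another one. The 4 does no harm because the triangle
  inequality is used a fixed number of times at each scale and is never iterated over
  scales.\<close>

lemma powr_quasi_add:
  fixes x y z p :: real
  assumes p: "1 \<le> p" and "0 \<le> x" "0 \<le> y" "0 \<le> z" "x \<le> 2 powr p * (y + z)"
  shows "x powr (1/p) \<le> 4 * (y powr (1/p) + z powr (1/p))"
proof -
  have "x powr (1/p) \<le> (2 powr p * (y + z)) powr (1/p)" using assms by (intro powr_mono2) auto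
  also have "\<dots> = 2 * (y + z) powr (1/p)" using assms by (simp add: powr_mult powr_powr)
  also have "(y + z) powr (1/p) \<le> (2 * max y z) powr (1/p)" using assms by (intro powr_mono2) auto
  also have "(2 * max y z) powr (1/p) = 2 powr (1/p) * max y z powr (1/p)" by (simp add: powr_mult)
  also have "\<dots> \<le> 2 * (y powr (1/p) + z powr (1/p))"
  proof (rule mult_mono)
    have "2 powr (1/p) \<le> 2 powr (1::real)" using p by (intro powr_mono) auto
    then show "2 powr (1/p) \<le> (2::real)" by simp
    show "max y z powr (1/p) \<le> y powr (1/p) + z powr (1/p)" by (simp add: max_def)
  qed auto
  finally show ?thesis by simp
qed

lemma avg_norm_add:
  fixes g h :: "(real ^ 'n) \<times> real \<Rightarrow> real"
  assumes p: "1 \<le> p" and "0 < r" "LpQ p r g" "LpQ p r h"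
  shows "avg_norm p r (\<lambda>z. g z + h z) \<le> 4 * (avg_norm p r g + avg_norm p r h)"
proof -
  let ?J = "\<lambda>g. \<integral>z. indicator (Qm r) z * \<bar>g z\<bar> powr p \<partial>lborel"
  define R where "R = r ^ (CARD('n) + 2)"
  have R: "0 < R" using assms by (simp add: R_def)
  have "?J (\<lambda>z. g z + h z) \<le>
    (\<integral>z. 2 powr p * (indicator (Qm r) z * \<bar>g z\<bar> powr p + indicator (Qm r) z * \<bar>h z\<bar> powr p) \<partial>lborel)"
  proof (rule integral_mono)
    show "integrable lborel (\<lambda>z. indicator (Qm r) z * \<bar>g z + h z\<bar> powr p)"
      using LpQ_add[of p r g h] assms by (simp add: LpQ_def)
    show "indicator (Qm r) z * \<bar>g z + h z\<bar> powr p \<le> 2 powr p * (indicator (Qm r) z * \<bar>g z\<bar> powr p + indicator (Qm r) z * \<bar>h z\<bar> powr p)" for z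
      using abs_add_powr_le[of p "g z" "h z"] p by (auto simp: indicator_def)
  qed (use assms in \<open>auto simp: LpQ_def\<close>)
  also have "\<dots> = 2 powr p * (?J g + ?J h)"
    using assms by (simp add: LpQ_def)
  finally have "?J (\<lambda>z. g z + h z) / R \<le> 2 powr p * (?J g / R + ?J h / R)"
    using R by (simp add: field_simps)
  then show ?thesis unfolding avg_norm_def R_def[symmetric]
    using R p by (intro powr_quasi_add) (auto intro!: divide_nonneg_nonneg Bochner_Integration.integral_nonneg)
qed

lemma avg_norm_cmult:
  assumes "0 < p" shows "avg_norm p r (\<lambda>z. c * g z) = \<bar>c\<bar> * avg_norm p r g"
proof -
  have "(\<integral>z. indicator (Qm r) z * \<bar>c * g z\<bar> powr p \<partial>lborel) = \<bar>c\<bar> powr p * (\<integral>z. indicator (Qm r) z * \<bar>g z\<bar> powr p \<partial>lborel)"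
    by (simp add: abs_mult powr_mult mult.left_commute flip: integral_mult_right_zero)
  then show ?thesis using assms
    unfolding avg_norm_def by (simp only: times_divide_eq_right[symmetric] powr_mult) (simp add: powr_powr)
qed

lemma avg_norm_par_scale:
  fixes g :: "(real ^ 'n) \<times> real \<Rightarrow> real"
  assumes "0 < r" and [measurable]: "g \<in> borel_measurable borel"
  shows "avg_norm p s (\<lambda>z. g (par_scale r z)) = avg_norm p (r * s) g"
proof -
  have "(\<integral>z. indicator (Qm (r * s)) z * \<bar>g z\<bar> powr p \<partial>lborel) =
    r ^ (CARD('n) + 2) * (\<integral>z. indicator (Qm s) z * \<bar>g (par_scale r z)\<bar> powr p \<partial>lborel)"
    by (subst integral_par_scale[OF assms(1)]) (auto simp: indicator_def par_scale_mem_Qm[OF assms(1)])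
  then show ?thesis using assms(1) by (simp add: avg_norm_def power_mult_distrib)
qed

lemma LpQ_par_scale:
  assumes "0 < r" "g \<in> borel_measurable borel"
  shows "LpQ p s (\<lambda>z. g (par_scale r z)) \<longleftrightarrow> LpQ p (r * s) g"
proof -
  have [measurable]: "g \<in> borel_measurable borel" using assms by auto
  have "integrable lborel (\<lambda>z. indicator (Qm (r * s)) (par_scale r z) * \<bar>g (par_scale r z)\<bar> powr p) \<longleftrightarrow>
    integrable lborel (\<lambda>z. indicator (Qm (r * s)) z * \<bar>g z\<bar> powr p)"
    by (rule integrable_par_scale[OF assms(1)]) measurable
  moreover have "(\<lambda>z. indicator (Qm (r * s)) (par_scale r z) * \<bar>g (par_scale r z)\<bar> powr p) =
      (\<lambda>z. indicator (Qm s) z * \<bar>g (par_scale r z)\<bar> powr p)"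
    by (simp add: indicator_def par_scale_mem_Qm[OF assms(1)])
  ultimately show ?thesis using assms unfolding LpQ_def by simp
qed

section \<open>Volume of cylinders and comparison of radii\<close>

definition unit_vol :: "'n::finite itself \<Rightarrow> real" where
  "unit_vol _ = measure lborel (Qm 1 :: ((real ^ 'n) \<times> real) set)"

lemma measure_Qm_scale:
  assumes "0 < r"
  shows "measure lborel (Qm r :: ((real ^ 'n) \<times> real) set) = r ^ (CARD('n) + 2) * unit_vol TYPE('n)"
proof -
  have "(\<integral>z. indicator (Qm r) z \<partial>(lborel :: ((real ^ 'n) \<times> real) measure)) =
    r ^ (CARD('n) + 2) * (\<integral>z. indicator (Qm r) (par_scale r z) \<partial>(lborel :: ((real ^ 'n) \<times> real) measure))"
    by (rule integral_par_scale[OF assms]) measurable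
  also have "(\<lambda>z. indicator (Qm r) (par_scale r z)) = (indicator (Qm 1) :: (real ^ 'n) \<times> real \<Rightarrow> real)"
    by (rule ext) (use par_scale_mem_Qm[OF assms, of "_ :: (real ^ 'n) \<times> real" 1] in \<open>simp add: indicator_def\<close>)
  finally show ?thesis by (simp add: unit_vol_def)
qed

lemma unit_vol_pos: "0 < unit_vol TYPE('n::finite)"
proof -
  have "open (interior (Qm 1 :: ((real ^ 'n) \<times> real) set))" by simp
  moreover have "(0, -1/2) \<in> interior (Qm 1 :: ((real ^ 'n) \<times> real) set)" by (simp add: interior_Qm)
  ultimately have "interior (Qm 1 :: ((real ^ 'n) \<times> real) set) \<notin> null_sets lborel"
    using open_not_negligible[of "interior (Qm 1 :: ((real ^ 'n) \<times> real) set)"]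
    by (auto simp: negligible_iff_null_sets null_sets_completion_iff)
  then have "emeasure lborel (interior (Qm 1 :: ((real ^ 'n) \<times> real) set)) > 0"
    by (auto simp: null_sets_def zero_less_iff_neq_zero)
  also have "\<dots> \<le> emeasure lborel (Qm 1 :: ((real ^ 'n) \<times> real) set)"
    by (intro emeasure_mono interior_subset) auto
  finally show ?thesis using emeasure_Qm_finite[of 1, where 'n = 'n]
    by (simp add: unit_vol_def measure_def enn2real_positive_iff)
qed

lemma avg_norm_const:
  assumes "0 < p" "0 < r"
  shows "avg_norm p r (\<lambda>_ :: (real ^ 'n) \<times> real. c) = unit_vol TYPE('n) powr (1/p) * \<bar>c\<bar>"
proof -
  have "(\<integral>z. indicator (Qm r) z * \<bar>c\<bar> powr p \<partial>(lborel :: ((real ^ 'n) \<times> real) measure)) = r ^ (CARD('n) + 2) * unit_vol TYPE('n) * \<bar>c\<bar> powr p"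
    using measure_Qm_scale[OF assms(2), where 'n = 'n] by simp
  then have "avg_norm p r (\<lambda>_ :: (real ^ 'n) \<times> real. c) = (unit_vol TYPE('n) * \<bar>c\<bar> powr p) powr (1/p)"
    using assms unfolding avg_norm_def by (simp only:) simp
  then show ?thesis using assms unit_vol_pos[where 'n = 'n] by (simp add: powr_mult powr_powr)
qed

lemma avg_norm_bounded:
  assumes "0 < p" "0 < r" "LpQ p r g" "\<And>z :: (real ^ 'n) \<times> real. z \<in> Qm r \<Longrightarrow> \<bar>g z\<bar> \<le> B" "0 \<le> B"
  shows "avg_norm p r g \<le> unit_vol TYPE('n) powr (1/p) * B"
  using avg_norm_mono[OF assms(1,2) LpQ_const[OF assms(1)] assms(3), of B] assms
    avg_norm_const[OF assms(1,2), of B, where 'n = 'n]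
  by auto

text \<open>The integral decreases with the cylinder, so the loss comes from the normalisation
  alone. This extends estimates at the radii \<open>l ^ k\<close> to the radii in between at the
  cost of a fixed factor.\<close>

lemma avg_norm_shrink:
  fixes g :: "(real ^ 'n) \<times> real \<Rightarrow> real"
  assumes "0 < p" "0 < s" "s \<le> r" "LpQ p r g"
  shows "avg_norm p s g \<le> (r / s) powr (real (CARD('n) + 2) / p) * avg_norm p r g"
proof -
  let ?N = "CARD('n) + 2"
  let ?I = "\<lambda>r. \<integral>z. indicator (Qm r) z * \<bar>g z\<bar> powr p \<partial>lborel"
  have "?I s \<le> ?I r"
    using LpQ_subset[OF assms(4), of s] assms Qm_mono[of s r]
    by (intro integral_mono) (auto simp: LpQ_def indicator_def)
  then have "?I s / s ^ ?N \<le> ?I r / s ^ ?N" using assms by (intro divide_right_mono) auto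
  also have "\<dots> = (r / s) ^ ?N * (?I r / r ^ ?N)"
    using assms by (simp add: power_divide)
  finally have "?I s / s ^ ?N \<le> (r / s) ^ ?N * (?I r / r ^ ?N)" .
  then have "avg_norm p s g \<le> ((r / s) ^ ?N * (?I r / r ^ ?N)) powr (1/p)"
    unfolding avg_norm_def using assms by (intro powr_mono2) (auto intro!: divide_nonneg_nonneg Bochner_Integration.integral_nonneg)
  also have "\<dots> = ((r / s) ^ ?N) powr (1/p) * avg_norm p r g"
    using assms by (subst powr_mult) (auto simp: avg_norm_def intro!: divide_nonneg_nonneg Bochner_Integration.integral_nonneg)
  also have "((r / s) ^ ?N) powr (1/p) = (r / s) powr (real ?N / p)"
    using assms powr_realpow[of "r / s" ?N] powr_powr[of "r / s" "real ?N" "1 / p"] by simp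
  finally show ?thesis .
qed

text \<open>A weak form of Jensen's inequality, obtained from \<open>y \<le> a + a\<^sup>1\<^sup>-\<^sup>p y\<^sup>p\<close> with the optimal \<open>a\<close>.\<close>

lemma weak_jensen:
  fixes k g :: "'a \<Rightarrow> real"
  assumes p: "1 < p" and [measurable]: "k \<in> borel_measurable M" "g \<in> borel_measurable M"
    and k: "integrable M k" "\<And>x. 0 \<le> k x" and kg: "integrable M (\<lambda>x. k x * \<bar>g x\<bar> powr p)"
  shows "integrable M (\<lambda>x. k x * g x)"
    "(\<integral>x. k x * \<bar>g x\<bar> \<partial>M) \<le> ((\<integral>x. k x \<partial>M) + 1) * (\<integral>x. k x * \<bar>g x\<bar> powr p \<partial>M) powr (1/p)"
proof -
  have le: "y \<le> a + a powr (1 - p) * y powr p" if "0 < a" "0 \<le> y" for a y :: real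
  proof (cases "y \<le> a")
    case False
    then have y: "0 < y" "a \<le> y" using that by auto
    have "y = y powr (1 - p) * y powr p" using y by (simp flip: powr_add)
    also have "\<dots> \<le> a powr (1 - p) * y powr p"
      using that y p by (intro mult_right_mono powr_mono2') auto
    finally show ?thesis using that by linarith
  qed (use that in \<open>simp add: add_increasing2\<close>)
  have b: "k x * \<bar>g x\<bar> \<le> a * k x + a powr (1 - p) * (k x * \<bar>g x\<bar> powr p)" if "0 < a" for a x
    using mult_left_mono[OF le[OF that, of "\<bar>g x\<bar>"] k(2)[of x]] by (simp add: algebra_simps)
  have i: "integrable M (\<lambda>x. a * k x + a powr (1 - p) * (k x * \<bar>g x\<bar> powr p))" for a
    using k kg by auto
  show ik: "integrable M (\<lambda>x. k x * g x)"
  proof (rule Bochner_Integration.integrable_bound[OF i[of 1]])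
    show "AE x in M. norm (k x * g x) \<le> norm (1 * k x + 1 powr (1 - p) * (k x * \<bar>g x\<bar> powr p))"
      using b[of 1] k(2) by (intro AE_I2) (auto simp: abs_mult)
  qed measurable
  have ik': "integrable M (\<lambda>x. k x * \<bar>g x\<bar>)"
    using integrable_abs[OF ik] k(2) by (simp add: abs_mult)
  let ?K = "\<integral>x. k x \<partial>M" and ?I = "\<integral>x. k x * \<bar>g x\<bar> powr p \<partial>M"
  have main: "(\<integral>x. k x * \<bar>g x\<bar> \<partial>M) \<le> a * ?K + a powr (1 - p) * ?I" if "0 < a" for a
  proof -
    have "(\<integral>x. k x * \<bar>g x\<bar> \<partial>M) \<le> (\<integral>x. a * k x + a powr (1 - p) * (k x * \<bar>g x\<bar> powr p) \<partial>M)"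
      by (intro integral_mono ik' i b that)
    also have "\<dots> = a * ?K + a powr (1 - p) * ?I" using k kg by simp
    finally show ?thesis .
  qed
  have I0: "0 \<le> ?I" using k(2) by (intro Bochner_Integration.integral_nonneg) auto
  have K0: "0 \<le> ?K" using k(2) by (intro Bochner_Integration.integral_nonneg) auto
  show "(\<integral>x. k x * \<bar>g x\<bar> \<partial>M) \<le> (?K + 1) * ?I powr (1/p)"
  proof (cases "?I = 0")
    case True
    \<comment> \<open>The optimal \<open>a\<close> would be 0, which is not admissible; arbitrarily
      small positive values give the bound instead.\<close>
    have "(\<integral>x. k x * \<bar>g x\<bar> \<partial>M) \<le> 0"
    proof (rule field_le_epsilon)
      fix e :: real assume e: "0 < e"
      have "(\<integral>x. k x * \<bar>g x\<bar> \<partial>M) \<le> e / (?K + 1) * ?K"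
        using main[of "e / (?K + 1)"] e K0 True by simp
      also have "\<dots> \<le> e" using e K0 by (simp add: field_simps)
      finally show "(\<integral>x. k x * \<bar>g x\<bar> \<partial>M) \<le> 0 + e" by simp
    qed
    then show ?thesis using True by simp
  next
    case False
    then have I: "0 < ?I" using I0 by simp
    let ?a = "?I powr (1/p)"
    have "?a powr (1 - p) * ?I = ?I powr ((1 - p) / p) * ?I powr 1" using I by (simp add: powr_powr)
    also have "\<dots> = ?I powr ((1 - p) / p + 1)" by (simp only: powr_add)
    also have "(1 - p) / p + 1 = 1 / p" using p by (simp add: field_simps)
    finally show ?thesis using main[of ?a] I by (simp add: algebra_simps)
  qed
qed

lemma L1_le_avg_norm:
  fixes g :: "(real ^ 'n) \<times> real \<Rightarrow> real"
  assumes "1 < p" "LpQ p 1 g"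
  shows "integrable lborel (\<lambda>z. indicator (Qm 1) z * g z)"
    "(\<integral>z. indicator (Qm 1) z * \<bar>g z\<bar> \<partial>lborel) \<le> (unit_vol TYPE('n) + 1) * avg_norm p 1 g"
proof -
  have [measurable]: "g \<in> borel_measurable borel" and i: "integrable lborel (\<lambda>z. indicator (Qm 1) z * \<bar>g z\<bar> powr p)"
    using assms(2) by (auto simp: LpQ_def)
  note J = weak_jensen[OF assms(1) _ _ integrable_indicator_Qm[of 1] _ i]
  show "integrable lborel (\<lambda>z. indicator (Qm 1) z * g z)" by (rule J(1)) auto
  have "(\<integral>z. indicator (Qm 1) z * \<bar>g z\<bar> \<partial>lborel) \<le>
      ((\<integral>z. indicator (Qm 1) z \<partial>(lborel :: ((real ^ 'n) \<times> real) measure)) + 1) *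
      (\<integral>z. indicator (Qm 1) z * \<bar>g z\<bar> powr p \<partial>lborel) powr (1/p)" by (rule J(2)) auto
  then show "(\<integral>z. indicator (Qm 1) z * \<bar>g z\<bar> \<partial>lborel) \<le> (unit_vol TYPE('n) + 1) * avg_norm p 1 g"
    by (simp add: avg_norm_def unit_vol_def)
qed

text \<open>For almost every \<open>z\<close> the nonnegative weight
  \<open>trunc_ker (z - y)\<close> has total mass \<open>e\<close>, and weak Jensen bounds the power
  of \<open>F z\<close> by the convolution of the weight with the power of \<open>g\<close>.
  Integrating in \<open>z\<close> contributes one more factor \<open>e\<close>.\<close>

lemma young_trunc_ker:
  fixes g :: "(real ^ 'n) \<times> real \<Rightarrow> real"
  assumes p: "1 < p" and g: "LpQ p 1 g"
  defines "F \<equiv> \<lambda>z. \<integral>y. (indicator (Qm 1) y * g y) * trunc_ker (z - y) \<partial>lborel"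
    and "e \<equiv> (\<integral>w. trunc_ker (w :: (real ^ 'n) \<times> real) \<partial>lborel)"
  shows "integrable lborel (\<lambda>z. \<bar>F z\<bar> powr p)"
    "(\<integral>z. \<bar>F z\<bar> powr p \<partial>lborel) \<le> (e + 1) powr p * e * (\<integral>y. indicator (Qm 1) y * \<bar>g y\<bar> powr p \<partial>lborel)"
proof -
  have [measurable]: "g \<in> borel_measurable borel" using g by (simp add: LpQ_def)
  have tk: "integrable lborel (trunc_ker :: (real ^ 'n) \<times> real \<Rightarrow> real)" by (rule integrable_trunc_ker)
  let ?H = "\<lambda>y. indicator (Qm 1) y * \<bar>g y\<bar> powr p"
  have H: "integrable lborel ?H" using g by (simp add: LpQ_def)
  let ?G = "\<lambda>z. \<integral>y. ?H y * trunc_ker (z - y) \<partial>lborel"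
  have G: "integrable lborel ?G" by (rule integrable_conv[OF H tk])
  have e0: "0 \<le> e" unfolding e_def by (intro Bochner_Integration.integral_nonneg) (simp add: trunc_ker_nonneg)
  have "AE z in lborel. integrable lborel (\<lambda>y. ?H y * trunc_ker (z - y))"
    using lborel_pair.AE_integrable_snd[OF integrable_conv_pair[OF H tk]] by simp
  then have ae: "AE z in lborel. \<bar>F z\<bar> powr p \<le> (e + 1) powr p * ?G z"
  proof eventually_elim
    case (elim z)
    let ?g = "\<lambda>y. indicator (Qm 1) y * g y" and ?k = "\<lambda>y. trunc_ker (z - y)"
    have eqH: "\<bar>?g y\<bar> powr p = ?H y" for y by (simp add: indicator_def)
    have ki: "integrable lborel ?k" using integrable_reflect[of trunc_ker z] tk by simp
    have ke: "(\<integral>y. ?k y \<partial>lborel) = e" unfolding e_def by (rule integral_reflect) measurable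
    have kg: "integrable lborel (\<lambda>y. ?k y * \<bar>?g y\<bar> powr p)"
      unfolding eqH using elim by (simp add: mult.commute)
    have "\<bar>F z\<bar> \<le> (\<integral>y. \<bar>?g y * ?k y\<bar> \<partial>lborel)" unfolding F_def by (rule integral_abs_bound)
    also have "\<dots> = (\<integral>y. ?k y * \<bar>?g y\<bar> \<partial>lborel)"
      by (rule Bochner_Integration.integral_cong) (auto simp: abs_mult trunc_ker_nonneg)
    also have "\<dots> \<le> (e + 1) * (\<integral>y. ?k y * \<bar>?g y\<bar> powr p \<partial>lborel) powr (1/p)"
      using weak_jensen(2)[OF p _ _ ki _ kg] by (simp add: ke trunc_ker_nonneg)
    also have "(\<integral>y. ?k y * \<bar>?g y\<bar> powr p \<partial>lborel) = ?G z" unfolding eqH by (simp add: mult.commute)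
    finally have "\<bar>F z\<bar> powr p \<le> ((e + 1) * ?G z powr (1/p)) powr p" using p by (intro powr_mono2) auto
    also have "\<dots> = (e + 1) powr p * ?G z"
    proof -
      have "0 \<le> ?G z" by (intro Bochner_Integration.integral_nonneg) (simp add: trunc_ker_nonneg)
      then show ?thesis using p e0 by (simp add: powr_mult powr_powr)
    qed
    finally show ?case .
  qed
  have [measurable]: "F \<in> borel_measurable borel" unfolding F_def by measurable
  show i: "integrable lborel (\<lambda>z. \<bar>F z\<bar> powr p)"
  proof (rule Bochner_Integration.integrable_bound[OF integrable_mult_right[OF G, of "(e + 1) powr p"]])
    show "AE z in lborel. norm (\<bar>F z\<bar> powr p) \<le> norm ((e + 1) powr p * ?G z)"
      using ae by eventually_elim auto
  qed measurable
  have "(\<integral>z. \<bar>F z\<bar> powr p \<partial>lborel) \<le> (\<integral>z. (e + 1) powr p * ?G z \<partial>lborel)"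
    by (intro integral_mono_AE i integrable_mult_right[OF G] ae)
  \<comment> \<open>The factor 1 is written out so that \<open>conv_duality\<close> applies with the
    constant function 1 as \<open>h\<close>.\<close>
  also have "(\<integral>z. (e + 1) powr p * ?G z \<partial>lborel) = (e + 1) powr p * (\<integral>z. 1 * ?G z \<partial>lborel)" by simp
  also have "(\<integral>z. 1 * ?G z \<partial>lborel) = (\<integral>y. ?H y * (\<integral>w. 1 * trunc_ker (w :: (real ^ 'n) \<times> real) \<partial>lborel) \<partial>lborel)"
    using conv_duality[OF H tk, of "\<lambda>_. 1" 1] by simp
  also have "\<dots> = e * (\<integral>y. ?H y \<partial>lborel)" by (simp add: e_def mult.commute)
  finally show "(\<integral>z. \<bar>F z\<bar> powr p \<partial>lborel) \<le> (e + 1) powr p * e * (\<integral>y. ?H y \<partial>lborel)" by (simp add: mult.assoc)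
qed

section \<open>The one-step estimate\<close>

lemma par_poly_eq:
  "par_poly a b c m (x, t) = a + (\<Sum>i\<in>UNIV. x $ i * b $ i)
     + (\<Sum>i\<in>UNIV. \<Sum>j\<in>UNIV. x $ i * x $ j * c $ i $ j) / 2 + t * m"
proof -
  have "x \<bullet> (c *v x) = (\<Sum>i\<in>UNIV. \<Sum>j\<in>UNIV. x $ i * x $ j * c $ i $ j)"
    by (simp add: inner_vec_def matrix_vector_mult_def sum_distrib_left mult_ac)
  then show ?thesis by (simp add: par_poly_def inner_vec_def mult_ac)
qed

lemma par_poly_measurable[measurable]: "par_poly a b c m \<in> borel_measurable borel"
proof -
  have "par_poly a b c m = (\<lambda>z. a + b \<bullet> fst z + (1/2) * (fst z \<bullet> (c *v fst z)) + m * snd z)"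
    by (auto simp: par_poly_def)
  moreover have "continuous_on UNIV (\<lambda>z. a + b \<bullet> fst z + (1/2) * (fst z \<bullet> (c *v fst z)) + m * snd z)"
    by (intro continuous_intros continuous_on_compose2[OF linear_continuous_on[OF matrix_vector_mul_bounded_linear[of c]]]) auto
  ultimately show ?thesis by (metis borel_measurable_continuous_onI)
qed

lemma par_poly_add:
  "par_poly (a + a') (b + b') (c + c') (m + m') z = par_poly a b c m z + par_poly a' b' c' m' z"
  by (cases z) (simp add: par_poly_def inner_add_left inner_add_right matrix_vector_mult_add_rdistrib algebra_simps)

lemma norm_matrix_le_sum:
  "norm (c :: real ^ 'n ^ 'm) \<le> (\<Sum>i\<in>UNIV. \<Sum>j\<in>UNIV. \<bar>c $ i $ j\<bar>)"
proof -
  have "norm c \<le> (\<Sum>i\<in>UNIV. norm (c $ i))" unfolding norm_vec_def by (rule L2_set_le_sum) simp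
  also have "\<dots> \<le> (\<Sum>i\<in>UNIV. \<Sum>j\<in>UNIV. \<bar>c $ i $ j\<bar>)" by (intro sum_mono norm_le_l1_cart)
  finally show ?thesis .
qed

lemma norm_matrix_vector_le: "norm ((c :: real ^ 'n ^ 'm) *v x) \<le> norm c * norm x"
proof -
  have "norm (c *v x) \<le> L2_set (\<lambda>i. norm (c $ i) * norm x) UNIV"
    unfolding norm_vec_def[of "c *v x"]
  proof (rule L2_set_mono)
    fix i
    have "(c *v x) $ i = c $ i \<bullet> x" by (simp add: matrix_vector_mult_def inner_vec_def)
    then show "norm ((c *v x) $ i) \<le> norm (c $ i) * norm x" by (simp add: Cauchy_Schwarz_ineq2)
  qed auto
  also have "\<dots> = norm c * norm x"
    unfolding norm_vec_def[of c] by (simp only: L2_set_left_distrib norm_ge_zero)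
  finally show ?thesis .
qed

lemma par_poly_bound:
  assumes "0 \<le> r" "z \<in> Qm r"
  shows "\<bar>par_poly a b c m z\<bar> \<le> \<bar>a\<bar> + norm b * r + (norm c + \<bar>m\<bar>) * r\<^sup>2"
proof -
  obtain x t where z: "z = (x, t)" by (cases z)
  have x: "norm x \<le> r" and t: "\<bar>t\<bar> \<le> r\<^sup>2" using assms by (auto simp: Qm_def z)
  have 1: "\<bar>b \<bullet> x\<bar> \<le> norm b * r"
    using Cauchy_Schwarz_ineq2[of b x] mult_left_mono[OF x norm_ge_zero[of b]] by linarith
  have "\<bar>x \<bullet> (c *v x)\<bar> \<le> norm x * (norm c * norm x)"
    by (rule order_trans[OF Cauchy_Schwarz_ineq2 mult_left_mono[OF norm_matrix_vector_le]]) auto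
  also have "\<dots> \<le> r * (norm c * r)" using x assms(1) by (intro mult_mono) auto
  finally have 2: "\<bar>x \<bullet> (c *v x)\<bar> \<le> norm c * r\<^sup>2" by (simp add: power2_eq_square mult_ac)
  have 3: "\<bar>m * t\<bar> \<le> \<bar>m\<bar> * r\<^sup>2" using t by (simp add: abs_mult mult_left_mono)
  have "\<bar>par_poly a b c m z\<bar> \<le> \<bar>a\<bar> + \<bar>b \<bullet> x\<bar> + \<bar>x \<bullet> (c *v x)\<bar> + \<bar>m * t\<bar>"
    by (simp add: z par_poly_def)
  with 1 2 3 show ?thesis by (simp add: distrib_right)
qed

lemma LpQ_par_poly: assumes "0 < p" "0 \<le> r" shows "LpQ p r (par_poly a b c m)"
proof (rule LpQ_bound[OF LpQ_const[OF assms(1), of r "\<bar>a\<bar> + norm b * r + (norm c + \<bar>m\<bar>) * r\<^sup>2"] _ assms(1)])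
  show "\<bar>par_poly a b c m z\<bar> \<le> \<bar>\<bar>a\<bar> + norm b * r + (norm c + \<bar>m\<bar>) * r\<^sup>2\<bar>" if "z \<in> Qm r" for z
    using par_poly_bound[OF assms(2) that, of a b c m] by linarith
qed measurable

text \<open>Expand \<open>smooth_ker (z - y)\<close> around \<open>- y\<close> with increment
  \<open>z\<close> and integrate against \<open>U y\<close>: the Taylor coefficients integrate to
  the coefficients of a polynomial. It does not depend on \<open>\<rho>\<close>; only the error
  does, so one polynomial serves all radii.\<close>

lemma conv_smooth_ker_taylor:
  "\<exists>C\<ge>0. \<forall>U :: (real ^ 'n) \<times> real \<Rightarrow> real. integrable lborel U \<longrightarrow>
    (\<exists>a b c m. transpose c = c \<and> \<bar>a\<bar> + norm b + norm c + \<bar>m\<bar> \<le> C * (\<integral>y. \<bar>U y\<bar> \<partial>lborel) \<and>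
      (\<forall>\<rho> z. 0 < \<rho> \<and> \<rho> \<le> 1 \<and> z \<in> Qm \<rho> \<longrightarrow>
        \<bar>(\<integral>y. U y * smooth_ker (z - y) \<partial>lborel) - par_poly a b c m z\<bar> \<le> C * \<rho> ^ 3 * (\<integral>y. \<bar>U y\<bar> \<partial>lborel)))"
proof -
  let ?k = "smooth_ker :: (real ^ 'n) \<times> real \<Rightarrow> real"
  let ?d = "\<lambda>i. dir_deriv (ex i) ?k" and ?dt = "dir_deriv et ?k"
  let ?dd = "\<lambda>i j. dir_deriv (ex j) (dir_deriv (ex i) ?k)"
  have bk: "bump ?k" by (rule bump_smooth_ker)
  obtain C0 where C0': "C0 \<ge> 0 \<and> (\<forall>w x t \<rho>. 0 < \<rho> \<and> \<rho> \<le> 1 \<and> norm x \<le> \<rho> \<and> \<bar>t\<bar> \<le> \<rho>\<^sup>2 \<longrightarrow>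
    \<bar>?k (w + (x, t)) - (?k w + (\<Sum>i\<in>UNIV. x $ i * ?d i w)
      + (\<Sum>i\<in>UNIV. \<Sum>j\<in>UNIV. x $ i * (x $ j) * ?dd i j w) / 2 + t * ?dt w)\<bar> \<le> C0 * \<rho> ^ 3)"
    using parabolic_taylor[OF bk] by (rule exE)
  note C0 = conjunct1[OF C0'] conjunct2[OF C0', rule_format]
  have bb: "\<exists>B\<ge>0. \<forall>z. \<bar>g z\<bar> \<le> B" if "bump g" for g :: "(real ^ 'n) \<times> real \<Rightarrow> real"
    by (rule bump_bounded[OF that]) blast
  obtain Bk where Bk: "0 \<le> Bk" "\<And>z. \<bar>?k z\<bar> \<le> Bk" using bb[OF bk] by blast
  obtain Bt where Bt: "0 \<le> Bt" "\<And>z. \<bar>?dt z\<bar> \<le> Bt" using bb[OF bump_dir_deriv[OF bk]] by blast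
  have "\<forall>i. \<exists>B. 0 \<le> B \<and> (\<forall>z. \<bar>?d i z\<bar> \<le> B)" using bb[OF bump_dir_deriv[OF bk]] by blast
  from choice[OF this] obtain B1 where B1: "\<And>i. 0 \<le> B1 i" "\<And>i z. \<bar>?d i z\<bar> \<le> B1 i" by blast
  have "\<forall>i. \<exists>B. \<forall>j. 0 \<le> B j \<and> (\<forall>z. \<bar>?dd i j z\<bar> \<le> B j)"
    by (intro allI choice) (use bb[OF bump_dir_deriv[OF bump_dir_deriv[OF bk]]] in blast)
  from choice[OF this] obtain B2 where B2: "\<And>i j. 0 \<le> B2 i j" "\<And>i j z. \<bar>?dd i j z\<bar> \<le> B2 i j" by blast
  define C where "C = C0 + Bk + Bt + (\<Sum>i\<in>UNIV. B1 i) + (\<Sum>i\<in>UNIV. \<Sum>j\<in>UNIV. B2 i j + B2 j i)"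
  have nn: "0 \<le> (\<Sum>i\<in>UNIV. B1 i)" "0 \<le> (\<Sum>i\<in>UNIV. \<Sum>j\<in>UNIV. B2 i j + B2 j i)"
    using B1 B2 by (auto intro!: sum_nonneg add_nonneg_nonneg)
  have C: "0 \<le> C" "C0 \<le> C" using nn C0 Bk Bt by (auto simp: C_def)
  show ?thesis
  proof (rule exI[of _ C], intro conjI C(1) allI impI)
    fix U :: "(real ^ 'n) \<times> real \<Rightarrow> real" assume U: "integrable lborel U"
    let ?N = "\<integral>y. \<bar>U y\<bar> \<partial>lborel"
    have N0: "0 \<le> ?N" by (intro Bochner_Integration.integral_nonneg) auto
    have [measurable]: "U \<in> borel_measurable borel" using U by auto
    have meas: "g \<in> borel_measurable borel" if "bump g" for g :: "(real ^ 'n) \<times> real \<Rightarrow> real"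
      using that smooth_measurable by (auto simp: bump_def)
    define I where "I g = (\<integral>y. U y * g (- y) \<partial>lborel)" for g :: "(real ^ 'n) \<times> real \<Rightarrow> real"
    have int: "integrable lborel (\<lambda>y. U y * g (- y))" if bg: "bump g" for g :: "(real ^ 'n) \<times> real \<Rightarrow> real"
    proof -
      obtain B where B: "0 \<le> B" "\<And>z. \<bar>g z\<bar> \<le> B" using bb[OF bg] by blast
      have [measurable]: "g \<in> borel_measurable borel" by (rule meas[OF bg])
      show ?thesis
      proof (rule Bochner_Integration.integrable_bound)
        show "integrable lborel (\<lambda>y. B * \<bar>U y\<bar>)" using U by auto
        show "AE y in lborel. norm (U y * g (- y)) \<le> norm (B * \<bar>U y\<bar>)"
        proof (rule AE_I2)
          fix y
          show "norm (U y * g (- y)) \<le> norm (B * \<bar>U y\<bar>)"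
            using mult_left_mono[OF B(2)[of "- y"] abs_ge_zero[of "U y"]] B(1) by (simp add: abs_mult mult.commute)
        qed
      qed measurable
    qed
    have Ib: "\<bar>I g\<bar> \<le> B * ?N" if "bump g" "\<And>z. \<bar>g z\<bar> \<le> B" for g :: "(real ^ 'n) \<times> real \<Rightarrow> real" and B
    proof -
      have "\<bar>I g\<bar> \<le> (\<integral>y. \<bar>U y * g (- y)\<bar> \<partial>lborel)" unfolding I_def by (rule integral_abs_bound)
      also have "\<dots> \<le> (\<integral>y. B * \<bar>U y\<bar> \<partial>lborel)"
      proof (intro integral_mono integrable_abs integrable_mult_right int that(1) U)
        fix y
        show "\<bar>U y * g (- y)\<bar> \<le> B * \<bar>U y\<bar>"
          using mult_left_mono[OF that(2)[of "- y"] abs_ge_zero[of "U y"]] by (simp add: abs_mult mult.commute)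
      qed
      finally show ?thesis by simp
    qed
    note bd = bump_dir_deriv[OF bk] bump_dir_deriv[OF bump_dir_deriv[OF bk]]
    define b :: "real ^ 'n" where "b = (\<chi> i. I (?d i))"
    \<comment> \<open>The mixed derivatives come in a definite order. Averaging the two orders makes
      \<open>c\<close> symmetric without invoking the symmetry of second derivatives, and leaves the
      quadratic form unchanged.\<close>
    define c :: "real ^ 'n ^ 'n" where "c = (\<chi> i j. (I (?dd i j) + I (?dd j i)) / 2)"
    show "\<exists>a b c m. transpose c = c \<and> \<bar>a\<bar> + norm b + norm c + \<bar>m\<bar> \<le> C * ?N \<and>
      (\<forall>\<rho> z. 0 < \<rho> \<and> \<rho> \<le> 1 \<and> z \<in> Qm \<rho> \<longrightarrow>
        \<bar>(\<integral>y. U y * smooth_ker (z - y) \<partial>lborel) - par_poly a b c m z\<bar> \<le> C * \<rho> ^ 3 * ?N)"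
    proof (rule exI[of _ "I ?k"], rule exI[of _ b], rule exI[of _ c], rule exI[of _ "I ?dt"], intro conjI allI impI)
      show "transpose c = c" by (simp add: transpose_def c_def vec_eq_iff add.commute)
      have "norm b \<le> (\<Sum>i\<in>UNIV. B1 i * ?N)"
        by (rule order_trans[OF norm_le_l1_cart]) (auto simp: b_def intro!: sum_mono Ib bd B1)
      moreover have "norm c \<le> (\<Sum>i\<in>UNIV. \<Sum>j\<in>UNIV. (B2 i j + B2 j i) * ?N)"
      proof (rule order_trans[OF norm_matrix_le_sum], intro sum_mono)
        fix i j
        have "\<bar>I (?dd i j)\<bar> \<le> B2 i j * ?N" "\<bar>I (?dd j i)\<bar> \<le> B2 j i * ?N" by (intro Ib bd B2)+
        then show "\<bar>c $ i $ j\<bar> \<le> (B2 i j + B2 j i) * ?N" by (simp add: c_def distrib_right abs_le_iff)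
      qed
      moreover have "\<bar>I ?k\<bar> \<le> Bk * ?N" "\<bar>I ?dt\<bar> \<le> Bt * ?N" by (intro Ib bd bk Bk Bt)+
      moreover have "0 \<le> C0 * ?N" using C0 N0 by simp
      ultimately show "\<bar>I ?k\<bar> + norm b + norm c + \<bar>I ?dt\<bar> \<le> C * ?N"
        unfolding C_def distrib_right sum_distrib_right by linarith
      fix \<rho> :: real and z :: "(real ^ 'n) \<times> real"
      assume a: "0 < \<rho> \<and> \<rho> \<le> 1 \<and> z \<in> Qm \<rho>"
      obtain x t where z: "z = (x, t)" by (cases z)
      have xt: "norm x \<le> \<rho>" "\<bar>t\<bar> \<le> \<rho>\<^sup>2" using a by (auto simp: z Qm_def)
      define T where "T w = ?k w + (\<Sum>i\<in>UNIV. x $ i * ?d i w)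
        + (\<Sum>i\<in>UNIV. \<Sum>j\<in>UNIV. x $ i * (x $ j) * ?dd i j w) / 2 + t * ?dt w" for w
      have Te: "U y * T (- y) = U y * ?k (- y) + (\<Sum>i\<in>UNIV. x $ i * (U y * ?d i (- y)))
        + (\<Sum>i\<in>UNIV. \<Sum>j\<in>UNIV. x $ i * (x $ j) * (U y * ?dd i j (- y))) / 2 + t * (U y * ?dt (- y))" for y
        by (simp add: T_def distrib_left sum_distrib_left mult_ac)
      have sw: "(\<Sum>i\<in>UNIV. \<Sum>j\<in>UNIV. x $ i * x $ j * c $ i $ j) = (\<Sum>i\<in>UNIV. \<Sum>j\<in>UNIV. x $ i * x $ j * I (?dd i j))"
      proof -
        have "(\<Sum>i\<in>UNIV. \<Sum>j\<in>UNIV. x $ i * x $ j * I (?dd j i)) = (\<Sum>i\<in>UNIV. \<Sum>j\<in>UNIV. x $ i * x $ j * I (?dd i j))"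
          by (subst sum.swap) (simp add: mult_ac)
        moreover have e: "x $ i * x $ j * c $ i $ j = (x $ i * x $ j * I (?dd i j) + x $ i * x $ j * I (?dd j i)) / 2" for i j
          by (simp add: c_def distrib_left)
        ultimately show ?thesis unfolding e by (simp add: sum_divide_distrib[symmetric] sum.distrib)
      qed
      have iT: "integrable lborel (\<lambda>y. U y * T (- y))"
        unfolding Te
        by (intro Bochner_Integration.integrable_add Bochner_Integration.integrable_sum integrable_mult_right
            integrable_divide int bk bd)
      have "(\<integral>y. U y * T (- y) \<partial>lborel) = I ?k + (\<Sum>i\<in>UNIV. x $ i * I (?d i))
        + (\<Sum>i\<in>UNIV. \<Sum>j\<in>UNIV. x $ i * (x $ j) * I (?dd i j)) / 2 + t * I ?dt"
        unfolding Te I_def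
        by (simp add: int bk bd Bochner_Integration.integrable_add Bochner_Integration.integrable_sum
            Bochner_Integration.integral_add Bochner_Integration.integral_sum)
      also have "\<dots> = par_poly (I ?k) b c (I ?dt) z"
        unfolding z par_poly_eq sw by (simp add: b_def)
      finally have P: "par_poly (I ?k) b c (I ?dt) z = (\<integral>y. U y * T (- y) \<partial>lborel)" by simp
      have [measurable]: "?k \<in> borel_measurable borel" by (rule meas[OF bk])
      have ik: "integrable lborel (\<lambda>y. U y * ?k (z - y))"
      proof (rule Bochner_Integration.integrable_bound)
        show "integrable lborel (\<lambda>y. Bk * \<bar>U y\<bar>)" using U by auto
        show "AE y in lborel. norm (U y * ?k (z - y)) \<le> norm (Bk * \<bar>U y\<bar>)"
        proof (rule AE_I2)
          fix y
          show "norm (U y * ?k (z - y)) \<le> norm (Bk * \<bar>U y\<bar>)"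
            using mult_left_mono[OF Bk(2)[of "z - y"] abs_ge_zero[of "U y"]] Bk(1) by (simp add: abs_mult mult.commute)
        qed
      qed measurable
      have "\<bar>(\<integral>y. U y * ?k (z - y) \<partial>lborel) - par_poly (I ?k) b c (I ?dt) z\<bar> =
          \<bar>\<integral>y. U y * ?k (z - y) - U y * T (- y) \<partial>lborel\<bar>"
        unfolding P by (subst Bochner_Integration.integral_diff[OF ik iT]) simp
      also have "\<dots> \<le> (\<integral>y. \<bar>U y * ?k (z - y) - U y * T (- y)\<bar> \<partial>lborel)" by (rule integral_abs_bound)
      also have "\<dots> \<le> (\<integral>y. C0 * \<rho> ^ 3 * \<bar>U y\<bar> \<partial>lborel)"
      proof (intro integral_mono integrable_abs Bochner_Integration.integrable_diff ik iT integrable_mult_right U)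
        fix y
        have "\<bar>?k (z - y) - T (- y)\<bar> \<le> C0 * \<rho> ^ 3"
          using C0(2)[of \<rho> x t "- y"] a xt by (simp add: T_def z)
        then have "\<bar>U y\<bar> * \<bar>?k (z - y) - T (- y)\<bar> \<le> \<bar>U y\<bar> * (C0 * \<rho> ^ 3)" by (intro mult_left_mono) auto
        then show "\<bar>U y * ?k (z - y) - U y * T (- y)\<bar> \<le> C0 * \<rho> ^ 3 * \<bar>U y\<bar>"
          by (simp add: abs_mult[symmetric] right_diff_distrib mult_ac)
      qed
      also have "\<dots> \<le> C * \<rho> ^ 3 * ?N"
        using C a N0 by (simp add: mult_right_mono)
      finally show "\<bar>(\<integral>y. U y * smooth_ker (z - y) \<partial>lborel) - par_poly (I ?k) b c (I ?dt) z\<bar> \<le> C * \<rho> ^ 3 * ?N" .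
    qed
  qed
qed

lemma heat_equation_indicator:
  fixes u f :: "(real ^ 'n) \<times> real \<Rightarrow> real"
  assumes "heat_equation_Q1 u f"
  shows "heat_equation_Q1 (\<lambda>z. indicator (Qm 1) z * u z) (\<lambda>z. indicator (Qm 1) z * f z)"
proof -
  have "(LINT z:Qm 1|lebesgue. indicator (Qm 1) z * v z * w z) = (LINT z:Qm 1|lebesgue. v z * w z)" for v w :: "(real ^ 'n) \<times> real \<Rightarrow> real"
    unfolding set_lebesgue_integral_def by (rule Bochner_Integration.integral_cong) (auto simp: indicator_def)
  then show ?thesis using assms by (simp add: heat_equation_Q1_def)
qed

text \<open>The representation holds on the open cylinder while the norms include its final time;
  the difference lies in the frontier of a convex set.\<close>

lemma AE_interior_Qm:
  "AE z in lborel. z \<in> Qm r \<longrightarrow> z \<in> interior (Qm r :: ((real ^ 'n) \<times> real) set)"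
proof -
  have "convex (Qm r :: ((real ^ 'n) \<times> real) set)"
    unfolding Qm_def by (intro convex_Times convex_ball convex_real_interval)
  from negligible_convex_frontier[OF this]
  have "frontier (Qm r :: ((real ^ 'n) \<times> real) set) \<in> null_sets lborel"
    using null_sets_completion_iff[of "frontier (Qm r :: ((real ^ 'n) \<times> real) set)" lborel]
    by (simp add: negligible_iff_null_sets frontier_closed)
  from AE_not_in[OF this] show ?thesis
    by eventually_elim (use closure_subset in \<open>auto simp: frontier_def\<close>)
qed

text \<open>Split \<open>f\<close> into \<open>c0\<close> and \<open>f - c0\<close>. On
  \<open>Qm (1/2)\<close> the first part contributes the constant \<open>c0 * e\<close> to the
  convolution, which is put into the polynomial; the second is controlled by Young's inequality on
  the unit cylinder, and shrinking to \<open>Qm \<rho>\<close> costs the power of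
  \<open>1 / \<rho>\<close>. The delicate claim is the bound on the coefficients, from which
  \<open>c0\<close> itself must be absent.\<close>

lemma unit_step:
  fixes p :: real
  assumes p: "1 < p"
  shows "\<exists>C>0. \<forall>(u :: (real ^ 'n) \<times> real \<Rightarrow> real) f c0. LpQ p 1 u \<and> LpQ p 1 f \<and> heat_equation_Q1 u f \<longrightarrow>
    (\<exists>a b c m. transpose c = c \<and>
      \<bar>a\<bar> + norm b + norm c + \<bar>m\<bar> \<le> C * (avg_norm p 1 u + avg_norm p 1 (\<lambda>z. f z - c0)) \<and>
      (\<forall>\<rho>. 0 < \<rho> \<and> \<rho> \<le> 1/2 \<longrightarrow> avg_norm p \<rho> (\<lambda>z. u z - par_poly a b c m z) \<le>
        C * (\<rho> ^ 3 * avg_norm p 1 u + (1 / \<rho>) powr (real (CARD('n) + 2) / p) * avg_norm p 1 (\<lambda>z. f z - c0))))"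
proof -
  have p0: "0 < p" and p1: "1 \<le> p" using p by auto
  let ?q = "real (CARD('n) + 2) / p"
  obtain C1 where C1': "C1 \<ge> 0 \<and> (\<forall>U :: (real ^ 'n) \<times> real \<Rightarrow> real. integrable lborel U \<longrightarrow>
    (\<exists>a b c m. transpose c = c \<and> \<bar>a\<bar> + norm b + norm c + \<bar>m\<bar> \<le> C1 * (\<integral>y. \<bar>U y\<bar> \<partial>lborel) \<and>
      (\<forall>\<rho> z. 0 < \<rho> \<and> \<rho> \<le> 1 \<and> z \<in> Qm \<rho> \<longrightarrow>
        \<bar>(\<integral>y. U y * smooth_ker (z - y) \<partial>lborel) - par_poly a b c m z\<bar> \<le> C1 * \<rho> ^ 3 * (\<integral>y. \<bar>U y\<bar> \<partial>lborel))))"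
    using conv_smooth_ker_taylor[where 'n = 'n] by (rule exE)
  note C1 = conjunct1[OF C1'] conjunct2[OF C1', THEN spec, THEN mp]
  define G where "G = sqrt (4 * pi) ^ CARD('n)"
  have G: "0 < G" by (simp add: G_def)
  define V where "V = unit_vol TYPE('n)"
  have V: "0 < V" by (simp add: V_def unit_vol_pos)
  define W where "W = V powr (1/p)"
  have W: "0 < W" using V by (simp add: W_def)
  define e where "e = (\<integral>w. trunc_ker (w :: (real ^ 'n) \<times> real) \<partial>lborel)"
  have e0: "0 \<le> e" unfolding e_def by (intro Bochner_Integration.integral_nonneg) (simp add: trunc_ker_nonneg)
  define Y where "Y = ((e + 1) powr p * e) powr (1/p)"
  have Y: "0 \<le> Y" by (simp add: Y_def)
  \<comment> \<open>\<open>K1\<close> and \<open>K2\<close> bound the Taylor error and the Young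
    term of the remainder, with the factor 4 from the quasi-triangle inequality. \<open>K3\<close>
    bounds the coefficients obtained from the Taylor expansion, and \<open>K4\<close> adds the
    constant coming from \<open>c0\<close>.\<close>
  define K1 where "K1 = 4 * (W * (C1 * (V + 1)) / G)"
  define K2 where "K2 = 4 * (Y / G)"
  have K: "0 \<le> K1" "0 \<le> K2" using W C1 V G Y by (auto simp: K1_def K2_def)
  define K3 where "K3 = C1 * (V + 1) / G"
  have K3: "0 \<le> K3" using C1 V G by (simp add: K3_def)
  define R where "R = 2 powr ?q"
  have R: "0 < R" by (simp add: R_def)
  define K4 where "K4 = K3 + (4 * (4 * (R + K1 + K2 * R) + W * K3)) / W"
  have K4: "0 \<le> K4" using K3 R K W by (auto simp: K4_def)
  define C where "C = K1 + K2 + K4 + 1"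
  have C: "0 < C" "K1 \<le> C" "K2 \<le> C" "K4 \<le> C" using K K4 by (auto simp: C_def)
  show ?thesis
  proof (rule exI[of _ C], intro conjI C(1) allI impI)
    fix u f :: "(real ^ 'n) \<times> real \<Rightarrow> real" and c0 :: real
    assume "LpQ p 1 u \<and> LpQ p 1 f \<and> heat_equation_Q1 u f"
    then have u: "LpQ p 1 u" and f: "LpQ p 1 f" and he: "heat_equation_Q1 u f" by auto
    have [measurable]: "u \<in> borel_measurable borel" "f \<in> borel_measurable borel" using u f by (auto simp: LpQ_def)
    let ?i = "indicator (Qm 1) :: (real ^ 'n) \<times> real \<Rightarrow> real"
    let ?u = "\<lambda>z. ?i z * u z" and ?f = "\<lambda>z. ?i z * f z"
    let ?A = "avg_norm p 1 u" and ?B = "avg_norm p 1 (\<lambda>z. f z - c0)"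
    have A0: "0 \<le> ?A" and B0: "0 \<le> ?B" by (simp_all add: avg_norm_nonneg)
    have iu: "integrable lborel ?u" and iF: "integrable lborel ?f"
      using L1_le_avg_norm(1)[OF p] u f by auto
    have g: "LpQ p 1 (\<lambda>z. f z - c0)" using LpQ_diff[OF p0 f LpQ_const[OF p0]] .
    let ?N = "\<integral>y. \<bar>?u y\<bar> \<partial>lborel"
    have "?N = (\<integral>z. ?i z * \<bar>u z\<bar> \<partial>lborel)" by (rule Bochner_Integration.integral_cong) (auto simp: abs_mult)
    then have N: "?N \<le> (V + 1) * ?A" using L1_le_avg_norm(2)[OF p u] by (simp add: V_def)
    define F where "F z = (\<integral>y. (?i y * (f y - c0)) * trunc_ker (z - y) \<partial>lborel)" for z
    have F_meas[measurable]: "F \<in> borel_measurable borel" unfolding F_def by measurable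
    have Fi: "integrable lborel (\<lambda>z. \<bar>F z\<bar> powr p)"
      and Fle: "(\<integral>z. \<bar>F z\<bar> powr p \<partial>lborel) \<le> (e + 1) powr p * e * (\<integral>y. ?i y * \<bar>f y - c0\<bar> powr p \<partial>lborel)"
      using young_trunc_ker[OF p g] unfolding F_def e_def by auto
    have FL: "LpQ p \<rho> F" for \<rho>
      unfolding LpQ_def using integrable_real_mult_indicator[OF _ Fi, of "Qm \<rho>"] by (simp add: mult.commute)
    have F1: "avg_norm p 1 F \<le> Y * ?B"
    proof -
      have "(\<integral>z. ?i z * \<bar>F z\<bar> powr p \<partial>lborel) \<le> (\<integral>z. \<bar>F z\<bar> powr p \<partial>lborel)"
        using FL[of 1] Fi by (intro integral_mono) (auto simp: LpQ_def indicator_def)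
      with Fle have "(\<integral>z. ?i z * \<bar>F z\<bar> powr p \<partial>lborel) \<le> ((e + 1) powr p * e) * (\<integral>y. ?i y * \<bar>f y - c0\<bar> powr p \<partial>lborel)"
        by linarith
      then have "(\<integral>z. ?i z * \<bar>F z\<bar> powr p \<partial>lborel) powr (1/p) \<le> (((e + 1) powr p * e) * (\<integral>y. ?i y * \<bar>f y - c0\<bar> powr p \<partial>lborel)) powr (1/p)"
        using p0 by (intro powr_mono2) (auto intro!: Bochner_Integration.integral_nonneg)
      also have "\<dots> = Y * (\<integral>y. ?i y * \<bar>f y - c0\<bar> powr p \<partial>lborel) powr (1/p)"
        unfolding Y_def using e0 by (subst powr_mult) (auto intro!: Bochner_Integration.integral_nonneg)
      finally show ?thesis by (simp add: avg_norm_def)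
    qed
    obtain a b c m where sym: "transpose c = c" and co: "\<bar>a\<bar> + norm b + norm c + \<bar>m\<bar> \<le> C1 * ?N"
      and ap: "\<And>\<rho> z. 0 < \<rho> \<Longrightarrow> \<rho> \<le> 1 \<Longrightarrow> z \<in> Qm \<rho> \<Longrightarrow>
        \<bar>(\<integral>y. ?u y * smooth_ker (z - y) \<partial>lborel) - par_poly a b c m z\<bar> \<le> C1 * \<rho> ^ 3 * ?N"
      using C1(2)[OF iu] by blast
    define a' where "a' = (a - c0 * e) / G"
    define b' where "b' = (1 / G) *\<^sub>R b"
    define c' where "c' = (1 / G) *\<^sub>R c"
    define m' where "m' = m / G"
    define P where "P = par_poly a' b' c' m'"
    have Pm[measurable]: "P \<in> borel_measurable borel" unfolding P_def by measurable
    have Pz: "P z = (par_poly a b c m z - c0 * e) / G" for z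
      using G by (cases z) (simp add: P_def par_poly_def a'_def b'_def c'_def m'_def
          scaleR_matrix_vector_assoc[symmetric] field_simps)
    have conv_split: "(\<integral>y. ?f y * trunc_ker (z - y) \<partial>lborel) = F z + c0 * e" if z: "z \<in> Qm (1/2)"
      and fi: "integrable lborel (\<lambda>y. ?f y * trunc_ker (z - y))" for z
    proof -
      have tki: "integrable lborel (\<lambda>y. trunc_ker (z - y))"
        using integrable_reflect[of trunc_ker z] integrable_trunc_ker by simp
      have tke: "(\<integral>y. trunc_ker (z - y) \<partial>lborel) = e" unfolding e_def by (rule integral_reflect) measurable
      \<comment> \<open>Seen from a point of \<open>Qm (1/2)\<close> the kernel is supported inside
        \<open>Qm 1\<close>, so truncation to the unit cylinder does not disturb the constant
        \<open>c0 * e\<close>.\<close>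
      have sup: "?i y * trunc_ker (z - y) = trunc_ker (z - y)" for y
      proof (cases "y \<in> Qm 1")
        case False
        have "trunc_ker (z - y) = 0"
        proof (rule ccontr)
          assume "trunc_ker (z - y) \<noteq> 0"
          then have *: "norm (fst z - fst y) < 1/4" "0 < snd z - snd y" "snd z - snd y < 1/4"
            using trunc_ker_eq_0[of "z - y"] by (auto simp: not_le[symmetric])
          have "norm (fst y) \<le> norm (fst z) + norm (fst z - fst y)"
            by (metis norm_minus_commute norm_triangle_sub)
          then have "norm (fst y) < 1" "- 1 < snd y" "snd y \<le> 0"
            using z * by (auto simp: Qm_def power2_eq_square)
          then show False using False by (cases y) (auto simp: Qm_def)
        qed
        then show ?thesis by simp
      qed simp
      have "F z = (\<integral>y. ?f y * trunc_ker (z - y) - c0 * trunc_ker (z - y) \<partial>lborel)"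
        unfolding F_def
      proof (rule Bochner_Integration.integral_cong[OF refl])
        fix y
        have "?i y * (f y - c0) * trunc_ker (z - y) = ?f y * trunc_ker (z - y) - c0 * (?i y * trunc_ker (z - y))"
          by (simp add: algebra_simps)
        then show "?i y * (f y - c0) * trunc_ker (z - y) = ?f y * trunc_ker (z - y) - c0 * trunc_ker (z - y)"
          unfolding sup .
      qed
      also have "\<dots> = (\<integral>y. ?f y * trunc_ker (z - y) \<partial>lborel) - c0 * e"
        using fi tki tke by simp
      finally show ?thesis by simp
    qed
    have rep: "AE z in lborel. z \<in> interior (Qm (1/2)) \<longrightarrow> G * ?u z =
       (\<integral>y. ?u y * smooth_ker (z - y) \<partial>lborel) - (\<integral>y. ?f y * trunc_ker (z - y) \<partial>lborel)"
      unfolding G_def by (rule representation[OF iu iF _ _ heat_equation_indicator[OF he]]) auto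
    have fiae: "AE z in lborel. integrable lborel (\<lambda>y. ?f y * trunc_ker (z - y))"
      using lborel_pair.AE_integrable_snd[OF integrable_conv_pair[OF iF integrable_trunc_ker]] by simp
    have est: "AE z in lborel. z \<in> Qm \<rho> \<longrightarrow> \<bar>u z - P z\<bar> \<le> C1 * \<rho> ^ 3 * ?N / G + \<bar>F z\<bar> / G"
      if r: "0 < \<rho>" "\<rho> \<le> 1/2" for \<rho>
      using rep fiae AE_interior_Qm[of "1/2"]
    proof eventually_elim
      case (elim z)
      show ?case
      proof
        assume z: "z \<in> Qm \<rho>"
        then have zh: "z \<in> Qm (1/2)" using Qm_mono[of \<rho> "1/2"] r by auto
        then have z1: "z \<in> Qm 1" using Qm_mono[of "1/2" 1] by auto
        have "G * u z = (\<integral>y. ?u y * smooth_ker (z - y) \<partial>lborel) - (F z + c0 * e)"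
          using elim zh z1 conv_split[OF zh] by auto
        then have "u z = ((\<integral>y. ?u y * smooth_ker (z - y) \<partial>lborel) - (F z + c0 * e)) / G"
          using G by (simp add: field_simps)
        then have "u z - P z = (((\<integral>y. ?u y * smooth_ker (z - y) \<partial>lborel) - par_poly a b c m z) - F z) / G"
          unfolding Pz by (simp add: diff_divide_distrib add_divide_distrib)
        then have "\<bar>u z - P z\<bar> \<le> (\<bar>(\<integral>y. ?u y * smooth_ker (z - y) \<partial>lborel) - par_poly a b c m z\<bar> + \<bar>F z\<bar>) / G"
          using G by (simp add: divide_right_mono)
        also have "\<dots> \<le> (C1 * \<rho> ^ 3 * ?N + \<bar>F z\<bar>) / G"
          using ap[OF r(1) _ z] r G by (intro divide_right_mono) auto
        finally show "\<bar>u z - P z\<bar> \<le> C1 * \<rho> ^ 3 * ?N / G + \<bar>F z\<bar> / G" by (simp add: add_divide_distrib)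
      qed
    qed
    have N0: "0 \<le> ?N" by (intro Bochner_Integration.integral_nonneg) auto
    have up: "LpQ p \<rho> (\<lambda>z. u z - P z)" if "0 < \<rho>" "\<rho> \<le> 1" for \<rho>
      unfolding P_def using that by (intro LpQ_diff p0 LpQ_subset[OF u] LpQ_par_poly) auto
    have main: "avg_norm p \<rho> (\<lambda>z. u z - P z) \<le> K1 * \<rho> ^ 3 * ?A + K2 * (1 / \<rho>) powr ?q * ?B"
      if r: "0 < \<rho>" "\<rho> \<le> 1/2" for \<rho>
    proof -
      let ?c = "C1 * \<rho> ^ 3 * ?N / G"
      have c0: "0 \<le> ?c" using C1 N0 G r by simp
      have LF: "LpQ p \<rho> (\<lambda>z. (1/G) * \<bar>F z\<bar>)"
        by (intro LpQ_cmult LpQ_bound[OF FL _ p0]) auto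
      have "avg_norm p \<rho> (\<lambda>z. u z - P z) \<le> avg_norm p \<rho> (\<lambda>z. ?c + (1/G) * \<bar>F z\<bar>)"
      proof (rule avg_norm_mono_AE[OF p0 r(1)])
        show "LpQ p \<rho> (\<lambda>z. ?c + (1/G) * \<bar>F z\<bar>)" by (intro LpQ_add p0 LpQ_const LF)
        show "LpQ p \<rho> (\<lambda>z. u z - P z)" using up r by auto
        show "AE z in lborel. z \<in> Qm \<rho> \<longrightarrow> \<bar>u z - P z\<bar> \<le> \<bar>?c + (1/G) * \<bar>F z\<bar>\<bar>"
          using est[OF r] by eventually_elim auto
      qed
      also have "\<dots> \<le> 4 * (avg_norm p \<rho> (\<lambda>_ :: (real ^ 'n) \<times> real. ?c) + avg_norm p \<rho> (\<lambda>z. (1/G) * \<bar>F z\<bar>))"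
        by (intro avg_norm_add p1 r LpQ_const p0 LF)
      also have "avg_norm p \<rho> (\<lambda>_ :: (real ^ 'n) \<times> real. ?c) = W * ?c"
        unfolding avg_norm_const[OF p0 r(1), where 'n = 'n] abs_of_nonneg[OF c0] by (simp only: W_def V_def)
      also have "avg_norm p \<rho> (\<lambda>z. (1/G) * \<bar>F z\<bar>) = (1/G) * avg_norm p \<rho> F"
        using G by (subst avg_norm_cmult[OF p0]) (simp add: avg_norm_def)
      also have "(1/G) * avg_norm p \<rho> F \<le> (1/G) * ((1 / \<rho>) powr ?q * (Y * ?B))"
        using avg_norm_shrink[OF p0 r(1) _ FL, of 1] F1 r G
        by (intro mult_left_mono) (auto intro: order_trans[OF _ mult_left_mono])
      also have "W * ?c \<le> W * (C1 * \<rho> ^ 3 * ((V + 1) * ?A) / G)"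
        using W C1 N G r by (intro mult_left_mono divide_right_mono) auto
      finally show ?thesis by (simp add: K1_def K2_def algebra_simps)
    qed
    have coT: "\<bar>a / G\<bar> + norm b' + norm c' + \<bar>m'\<bar> \<le> K3 * ?A"
    proof -
      have "\<bar>a / G\<bar> + norm b' + norm c' + \<bar>m'\<bar> = (\<bar>a\<bar> + norm b + norm c + \<bar>m\<bar>) / G"
        using G by (simp add: b'_def c'_def m'_def add_divide_distrib)
      also have "\<dots> \<le> C1 * ((V + 1) * ?A) / G"
        using co mult_left_mono[OF N C1(1)] G by (intro divide_right_mono) linarith+
      finally show ?thesis by (simp add: K3_def)
    qed
    \<comment> \<open>The constant is the difference between \<open>?T\<close> and \<open>P\<close>.
      The coefficients of \<open>?T\<close> are bounded by the data and \<open>u - P\<close> is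
      bounded by \<open>main\<close>, so comparison through \<open>u\<close> on
      \<open>Qm (1/2)\<close> bounds a constant function, hence the number itself, however large
      \<open>c0\<close> is.\<close>
    have coc: "\<bar>c0 * e / G\<bar> \<le> (4 * (4 * (R + K1 + K2 * R) + W * K3)) / W * (?A + ?B)"
    proof -
      let ?T = "par_poly (a / G) b' c' m'"
      have h: "0 < (1/2 :: real)" "(1/2::real) \<le> 1/2" by auto
      have eqc: "(\<lambda>_. - (c0 * e / G)) = (\<lambda>z. (u z + (-1) * (u z - P z)) + (-1) * ?T z)"
      proof
        fix z
        have "P z = ?T z - c0 * e / G"
          by (cases z) (simp add: P_def par_poly_def a'_def diff_divide_distrib)
        then show "- (c0 * e / G) = (u z + (-1) * (u z - P z)) + (-1) * ?T z" by simp
      qed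
      have uh: "LpQ p (1/2) u" using LpQ_subset[OF u, of "1/2"] by simp
      have uph: "LpQ p (1/2) (\<lambda>z. u z - P z)" using up[of "1/2"] by simp
      have Th: "LpQ p (1/2) ?T" by (rule LpQ_par_poly[OF p0]) simp
      have "W * \<bar>c0 * e / G\<bar> = avg_norm p (1/2) (\<lambda>_ :: (real ^ 'n) \<times> real. - (c0 * e / G))"
        using avg_norm_const[OF p0 h(1), of "- (c0 * e / G)", where 'n = 'n] by (simp add: W_def V_def)
      also have "\<dots> \<le> 4 * (avg_norm p (1/2) (\<lambda>z. u z + (-1) * (u z - P z)) + avg_norm p (1/2) (\<lambda>z. (-1) * ?T z))"
        unfolding eqc by (intro avg_norm_add p1 h LpQ_add p0 uh LpQ_cmult uph Th)
      also have "avg_norm p (1/2) (\<lambda>z. u z + (-1) * (u z - P z)) \<le> 4 * (avg_norm p (1/2) u + avg_norm p (1/2) (\<lambda>z. (-1) * (u z - P z)))"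
        by (intro avg_norm_add p1 h LpQ_add p0 uh LpQ_cmult uph Th)
      also have "avg_norm p (1/2) (\<lambda>z. (-1) * (u z - P z)) = avg_norm p (1/2) (\<lambda>z. u z - P z)"
        by (subst avg_norm_cmult[OF p0]) simp
      also have "avg_norm p (1/2) (\<lambda>z. u z - P z) \<le> K1 * ?A + K2 * R * ?B"
      proof -
        have "avg_norm p (1/2) (\<lambda>z. u z - P z) \<le> K1 * (1/2) ^ 3 * ?A + K2 * R * ?B"
          using main[OF h] by (simp add: R_def)
        moreover have "K1 * (1/2) ^ 3 * ?A \<le> K1 * ?A"
          using K A0 by (intro mult_right_mono) (auto simp: power3_eq_cube)
        ultimately show ?thesis by linarith
      qed
      also have "avg_norm p (1/2) u \<le> R * ?A"
        using avg_norm_shrink[OF p0 h(1) _ u] by (simp add: R_def)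
      also have "avg_norm p (1/2) (\<lambda>z. (-1) * ?T z) = avg_norm p (1/2) ?T"
        by (subst avg_norm_cmult[OF p0]) simp
      also have "avg_norm p (1/2) ?T \<le> W * (K3 * ?A)"
        unfolding W_def V_def
      proof (rule avg_norm_bounded[OF p0 h(1) Th])
        fix z :: "(real ^ 'n) \<times> real" assume z: "z \<in> Qm (1/2)"
        have "\<bar>?T z\<bar> \<le> \<bar>a / G\<bar> + norm b' * (1/2) + (norm c' + \<bar>m'\<bar>) * (1/2)\<^sup>2"
          by (rule par_poly_bound[OF _ z]) simp
        also have "\<dots> \<le> \<bar>a / G\<bar> + norm b' + norm c' + \<bar>m'\<bar>"
          using norm_ge_zero[of b'] norm_ge_zero[of c'] abs_ge_zero[of m'] by (simp add: power2_eq_square field_simps)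
        finally show "\<bar>?T z\<bar> \<le> K3 * ?A" using coT by linarith
      qed (use K3 A0 in auto)
      finally have "W * \<bar>c0 * e / G\<bar> \<le> 4 * (4 * (R * ?A + (K1 * ?A + K2 * R * ?B)) + W * (K3 * ?A))" by simp
      also have "\<dots> \<le> (4 * (4 * (R + K1 + K2 * R) + W * K3)) * (?A + ?B)"
      proof -
        have "0 \<le> R * ?B" "0 \<le> K1 * ?B" "0 \<le> K2 * R * ?A" "0 \<le> W * K3 * ?B" using R K W K3 A0 B0 by auto
        then show ?thesis by (simp add: algebra_simps)
      qed
      finally show ?thesis using W by (simp add: field_simps)
    qed
    show "\<exists>a b c m. transpose c = c \<and> \<bar>a\<bar> + norm b + norm c + \<bar>m\<bar> \<le> C * (?A + ?B) \<and>
      (\<forall>\<rho>. 0 < \<rho> \<and> \<rho> \<le> 1/2 \<longrightarrow> avg_norm p \<rho> (\<lambda>z. u z - par_poly a b c m z) \<le>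
        C * (\<rho> ^ 3 * ?A + (1 / \<rho>) powr ?q * ?B))"
    proof (rule exI[of _ a'], rule exI[of _ b'], rule exI[of _ c'], rule exI[of _ m'], intro conjI allI impI)
      show "transpose c' = c'" using sym by (simp add: c'_def transpose_def vec_eq_iff)
      have "\<bar>a'\<bar> \<le> \<bar>a / G\<bar> + \<bar>c0 * e / G\<bar>" unfolding a'_def diff_divide_distrib by (rule abs_triangle_ineq4)
      then have "\<bar>a'\<bar> + norm b' + norm c' + \<bar>m'\<bar> \<le> K3 * ?A + (4 * (4 * (R + K1 + K2 * R) + W * K3)) / W * (?A + ?B)"
        using coT coc by linarith
      also have "\<dots> \<le> K4 * (?A + ?B)"
        using K3 B0 by (simp add: K4_def distrib_right distrib_left)
      also have "\<dots> \<le> C * (?A + ?B)" using C A0 B0 by (intro mult_right_mono) auto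
      finally show "\<bar>a'\<bar> + norm b' + norm c' + \<bar>m'\<bar> \<le> C * (?A + ?B)" .
      fix \<rho> :: real assume r: "0 < \<rho> \<and> \<rho> \<le> 1/2"
      have "avg_norm p \<rho> (\<lambda>z. u z - P z) \<le> K1 * (\<rho> ^ 3 * ?A) + K2 * ((1 / \<rho>) powr ?q * ?B)"
        using main[of \<rho>] r by (simp add: mult.assoc)
      also have "\<dots> \<le> C * (\<rho> ^ 3 * ?A) + C * ((1 / \<rho>) powr ?q * ?B)"
        using C r A0 B0 by (intro add_mono mult_right_mono) auto
      finally show "avg_norm p \<rho> (\<lambda>z. u z - par_poly a' b' c' m' z) \<le> C * (\<rho> ^ 3 * ?A + (1 / \<rho>) powr ?q * ?B)"
        by (simp add: P_def distrib_left)
    qed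
  qed
qed

section \<open>Scaling and subtracting polynomials\<close>

abbreviation adj_op :: "((real ^ 'n) \<times> real \<Rightarrow> real) \<Rightarrow> (real ^ 'n) \<times> real \<Rightarrow> real" where
  "adj_op \<phi> z \<equiv> laplacian_x \<phi> z + time_deriv \<phi> z"

lemma test_function_smooth: "test_function U \<phi> \<Longrightarrow> smooth_on UNIV \<phi>"
  by (simp add: test_function_def smooth_on_def Ck_on_UNIV)

lemma test_function_bump: "test_function U \<phi> \<Longrightarrow> bump \<phi>"
proof -
  assume t: "test_function U \<phi>"
  have "\<phi> z = 0" if "z \<notin> closure {z. \<phi> z \<noteq> 0}" for z
    using that subsetD[OF closure_subset, of z "{z. \<phi> z \<noteq> 0}"] by auto
  then show "bump \<phi>" using test_function_smooth[OF t] t unfolding bump_def test_function_def by blast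
qed

lemma bump_add:
  assumes "bump f" "bump g" shows "bump (\<lambda>z. f z + g z)"
proof -
  obtain K K' where "compact K" "\<And>z. z \<notin> K \<Longrightarrow> f z = 0" "compact K'" "\<And>z. z \<notin> K' \<Longrightarrow> g z = 0"
    using assms unfolding bump_def by blast
  then show ?thesis using assms unfolding bump_def
    by (auto intro!: smooth_on_add exI[of _ "K \<union> K'"])
qed

lemma bump_smooth_mult:
  assumes "smooth_on UNIV f" "bump g" shows "bump (\<lambda>z. f z * g z)"
  using assms unfolding bump_def by (auto intro!: smooth_on_mult)

lemma bump_sum: "(\<And>i. i \<in> I \<Longrightarrow> bump (f i)) \<Longrightarrow> bump (\<lambda>z. \<Sum>i\<in>I. f i z)"
proof (induction I rule: infinite_finite_induct)
  case (insert x F)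
  then show ?case by (auto intro: bump_add)
qed (auto simp: bump_def smooth_on_const intro!: exI[of _ "{}"])

lemma bump_adj_op: "bump \<phi> \<Longrightarrow> bump (\<lambda>z. adj_op \<phi> z)"
  unfolding laplacian_x_def time_deriv_def by (intro bump_add bump_sum bump_dir_deriv)

lemma adj_op_outside:
  fixes \<phi> :: "(real ^ 'n) \<times> real \<Rightarrow> real"
  assumes "test_function U \<phi>" "z \<notin> U"
  shows "\<phi> z = 0" "adj_op \<phi> z = 0"
proof -
  let ?V = "- closure {z. \<phi> z \<noteq> 0}"
  have V: "open ?V" "z \<in> ?V" using assms by (auto simp: test_function_def open_Compl)
  have 0: "\<phi> y = 0" if "y \<in> ?V" for y
    using that subsetD[OF closure_subset, of y "{z. \<phi> z \<noteq> 0}"] by auto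
  have d: "dir_deriv v \<phi> y = 0" if "y \<in> ?V" for v y
  proof -
    have "dir_deriv v \<phi> y = dir_deriv v (\<lambda>_. 0) y"
      by (rule dir_deriv_cong_open(2)[OF V(1) that]) (rule 0)
    then show ?thesis by (simp only: dir_deriv_const)
  qed
  have "dir_deriv w (dir_deriv v \<phi>) z = 0" for v w
  proof -
    have "dir_deriv w (dir_deriv v \<phi>) z = dir_deriv w (\<lambda>_. 0) z"
      by (rule dir_deriv_cong_open(2)[OF V]) (rule d)
    then show ?thesis by (simp only: dir_deriv_const)
  qed
  then show "adj_op \<phi> z = 0" using d[OF V(2)] by (simp add: laplacian_x_def time_deriv_def)
  show "\<phi> z = 0" by (rule 0[OF V(2)])
qed

text \<open>A test function and its derivatives vanish off its support, so the set integrals extend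
  to the whole space, where dilations can be substituted freely.\<close>

lemma heat_equation_Borel:
  fixes u f :: "(real ^ 'n) \<times> real \<Rightarrow> real"
  assumes [measurable]: "u \<in> borel_measurable borel" "f \<in> borel_measurable borel"
  shows "heat_equation_Q1 u f \<longleftrightarrow> (\<forall>\<phi>. test_function (interior (Qm 1)) \<phi> \<longrightarrow>
    (\<integral>z. u z * adj_op \<phi> z \<partial>lborel) = (\<integral>z. f z * \<phi> z \<partial>lborel))"
proof -
  have "(LINT z:Qm 1|lebesgue. u z * adj_op \<phi> z) = (\<integral>z. u z * adj_op \<phi> z \<partial>lborel)"
    "(LINT z:Qm 1|lebesgue. f z * \<phi> z) = (\<integral>z. f z * \<phi> z \<partial>lborel)"
    if t: "test_function (interior (Qm 1)) \<phi>" for \<phi>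
  proof -
    have b: "bump \<phi>" by (rule test_function_bump[OF t])
    have m\<phi>: "\<phi> \<in> borel_measurable borel" and ma: "(\<lambda>z. adj_op \<phi> z) \<in> borel_measurable borel"
      using b bump_adj_op[OF b] smooth_measurable unfolding bump_def by blast+
    have o: "\<phi> z = 0" "adj_op \<phi> z = 0" if "z \<notin> Qm 1" for z
      using adj_op_outside[OF t, of z] that interior_subset by blast+
    have e: "(\<lambda>z. indicator (Qm 1) z * (u z * adj_op \<phi> z)) = (\<lambda>z. u z * adj_op \<phi> z)"
      "(\<lambda>z. indicator (Qm 1) z * (f z * \<phi> z)) = (\<lambda>z. f z * \<phi> z)"
      by (rule ext, rename_tac z, case_tac "z \<in> Qm 1", simp_all add: o)+
    show "(LINT z:Qm 1|lebesgue. u z * adj_op \<phi> z) = (\<integral>z. u z * adj_op \<phi> z \<partial>lborel)"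
      by (subst lebesgue_set_integral_lborel[OF borel_measurable_times[OF assms(1) ma] Qm_borel]) (simp only: e)
    show "(LINT z:Qm 1|lebesgue. f z * \<phi> z) = (\<integral>z. f z * \<phi> z \<partial>lborel)"
      by (subst lebesgue_set_integral_lborel[OF borel_measurable_times[OF assms(2) m\<phi>] Qm_borel]) (simp only: e)
  qed
  then show ?thesis unfolding heat_equation_Q1_def by simp
qed

lemma heat_equation_BorelI:
  fixes u f :: "(real ^ 'n) \<times> real \<Rightarrow> real"
  assumes "\<And>\<phi>. test_function (interior (Qm 1)) \<phi> \<Longrightarrow>
    (\<integral>z. u z * adj_op \<phi> z \<partial>lborel) = (\<integral>z. f z * \<phi> z \<partial>lborel)"
    and "u \<in> borel_measurable borel" "f \<in> borel_measurable borel"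
  shows "heat_equation_Q1 u f"
  unfolding heat_equation_Borel[OF assms(2,3)] using assms(1) by blast

text \<open>The difference quotients \<open>q i\<close> have integral zero by translation
  invariance. By the mean value theorem they are bounded by \<open>B\<close>, and they vanish off
  the compact set swept out by \<open>K\<close> moving along \<open>- v\<close>, so the limit may be
  taken under the integral.\<close>

lemma integral_dir_deriv_bump:
  fixes F :: "'a::euclidean_space \<Rightarrow> real"
  assumes F: "bump F" shows "(\<integral>z. dir_deriv v F z \<partial>lborel) = 0"
proof -
  obtain K where K: "compact K" "\<And>z. z \<notin> K \<Longrightarrow> F z = 0" using F unfolding bump_def by blast
  obtain B where B: "0 \<le> B" "\<And>z. \<bar>dir_deriv v F z\<bar> \<le> B" using bump_bounded[OF bump_dir_deriv[OF F]] by blast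
  have sm: "smooth_on UNIV F" using F bump_def by blast
  have [measurable]: "F \<in> borel_measurable borel" by (rule smooth_measurable[OF sm])
  define q where "q i z = real (Suc i) * (F (z + (1 / real (Suc i)) *\<^sub>R v) - F z)" for i z
  have iF: "integrable lborel F" by (rule integrable_bump[OF F])
  have q0: "(\<integral>z. q i z \<partial>lborel) = 0" for i
  proof -
    let ?c = "(1 / real (Suc i)) *\<^sub>R v"
    have t: "(\<integral>z. F (z + ?c) \<partial>lborel) = (\<integral>z. F z \<partial>lborel)" "integrable lborel (\<lambda>z. F (z + ?c))"
      using integral_translate[of F ?c] integrable_translate[of F ?c] iF by (simp_all add: add.commute)
    have "(\<integral>z. q i z \<partial>lborel) = real (Suc i) * ((\<integral>z. F (z + ?c) \<partial>lborel) - (\<integral>z. F z \<partial>lborel))"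
      unfolding q_def by (subst integral_mult_right_zero, subst Bochner_Integration.integral_diff[OF t(2) iF]) simp
    then show ?thesis using t(1) by simp
  qed
  have dF: "((\<lambda>s. F (z + s *\<^sub>R v)) has_real_derivative dir_deriv v F (z + s *\<^sub>R v)) (at s)" for z s
  proof -
    have g: "(F has_derivative (\<lambda>h. dir_deriv h F (z + s *\<^sub>R v))) (at (z + s *\<^sub>R v))"
      by (intro dir_deriv_has_derivative smooth_on_differentiable[OF sm UNIV_I])
    have "((\<lambda>s. z + s *\<^sub>R v) has_derivative (\<lambda>s. s *\<^sub>R v)) (at s)" by (auto intro!: derivative_eq_intros)
    from has_derivative_compose[OF this g]
    have "((\<lambda>s. F (z + s *\<^sub>R v)) has_derivative (\<lambda>h. dir_deriv (h *\<^sub>R v) F (z + s *\<^sub>R v))) (at s)" .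
    moreover have "dir_deriv (h *\<^sub>R v) F (z + s *\<^sub>R v) = dir_deriv v F (z + s *\<^sub>R v) * h" for h
      using linear_simps(5)[OF has_derivative_bounded_linear[OF g], of h v] by simp
    ultimately show ?thesis by (simp add: has_field_derivative_def)
  qed
  let ?K = "(\<lambda>(x, s). x - s *\<^sub>R v) ` (K \<times> {0..1::real})"
  have cK: "compact ?K"
    by (intro compact_continuous_image compact_Times K compact_Icc)
      (auto simp: split_beta' intro!: continuous_intros)
  have qb: "\<bar>q i z\<bar> \<le> B * indicator ?K z" for i z
  proof (cases "z \<in> ?K")
    case True
    let ?h = "1 / real (Suc i)"
    have "\<exists>s>0. s < ?h \<and> F (z + ?h *\<^sub>R v) - F (z + 0 *\<^sub>R v) = (?h - 0) * dir_deriv v F (z + s *\<^sub>R v)"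
      by (rule MVT2) (auto intro: dF)
    then obtain s where "F (z + ?h *\<^sub>R v) - F z = ?h * dir_deriv v F (z + s *\<^sub>R v)" by auto
    then have "q i z = dir_deriv v F (z + s *\<^sub>R v)" by (simp add: q_def)
    then show ?thesis using B True by simp
  next
    case False
    have "z + s *\<^sub>R v \<notin> K" if "0 \<le> s" "s \<le> 1" for s
    proof
      assume "z + s *\<^sub>R v \<in> K"
      then have "(\<lambda>(x, s). x - s *\<^sub>R v) (z + s *\<^sub>R v, s) \<in> ?K" using that by (intro imageI) auto
      then show False using False by simp
    qed
    from this[of 0] this[of "1 / real (Suc i)"] show ?thesis using False K(2) by (simp add: q_def)
  qed
  have "(\<lambda>i. \<integral>z. q i z \<partial>lborel) \<longlonglongrightarrow> (\<integral>z. dir_deriv v F z \<partial>lborel)"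
  proof (rule integral_dominated_convergence)
    show "(\<lambda>z. dir_deriv v F z) \<in> borel_measurable lborel"
      using smooth_measurable[OF smooth_on_dir_deriv[OF sm]] by simp
    show "integrable lborel (\<lambda>z. B * indicator ?K z)"
      using cK by (intro integrable_mult_right integrable_real_indicator) (use emeasure_compact_finite[OF cK] in \<open>auto simp: compact_imp_closed\<close>)
    show "AE z in lborel. (\<lambda>i. q i z) \<longlonglongrightarrow> dir_deriv v F z"
    proof (rule AE_I2)
      fix z
      have "((\<lambda>h. (F (z + h *\<^sub>R v) - F z) / h) \<longlongrightarrow> dir_deriv v F z) (at 0)"
        using dF[of z 0] by (simp add: DERIV_def)
      moreover have "filterlim (\<lambda>i. 1 / real (Suc i)) (at 0) sequentially"
        using LIMSEQ_inverse_real_of_nat by (auto simp: filterlim_at inverse_eq_divide)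
      ultimately have "(\<lambda>i. (F (z + (1 / real (Suc i)) *\<^sub>R v) - F z) / (1 / real (Suc i))) \<longlonglongrightarrow> dir_deriv v F z"
        by (rule filterlim_compose)
      then show "(\<lambda>i. q i z) \<longlonglongrightarrow> dir_deriv v F z" by (simp add: q_def[abs_def] mult.commute)
    qed
  qed (use qb in \<open>auto simp: q_def\<close>)
  then show ?thesis using q0 LIMSEQ_unique tendsto_const by (simp add: LIMSEQ_const_iff)
qed

section \<open>Quadratic polynomials as solutions with constant right-hand side\<close>

lemma smooth_par_poly: "smooth_on UNIV (par_poly a b c m)"
proof -
  have "smooth_on UNIV (\<lambda>z. a + (\<Sum>i\<in>UNIV. fst z $ i * b $ i)
     + (\<Sum>i\<in>UNIV. \<Sum>j\<in>UNIV. fst z $ i * fst z $ j * c $ i $ j) * (1/2) + snd z * m)"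
    by (intro smooth_on_add smooth_on_mult smooth_on_sum smooth_on_const smooth_on_fst_nth smooth_on_snd) auto
  then show ?thesis
    by (rule smooth_on_cong[rotated 2]) (auto simp: par_poly_eq)
qed

lemma dir_deriv_par_poly:
  fixes b :: "real ^ 'n"
  shows "dir_deriv (ex i) (par_poly a b c m) z = b $ i + (axis i 1 \<bullet> (c *v fst z) + fst z \<bullet> (c *v axis i 1)) / 2"
    "dir_deriv (ex i) (dir_deriv (ex i) (par_poly a b c m)) z = c $ i $ i"
    "dir_deriv et (par_poly a b c m) z = m"
proof -
  have d: "par_poly a b c m differentiable (at z)" "dir_deriv (ex i) (par_poly a b c m) differentiable (at z)" for z
    using smooth_on_differentiable[OF smooth_par_poly] smooth_on_differentiable[OF smooth_on_dir_deriv[OF smooth_par_poly]]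
    by blast+
  show 1: "dir_deriv (ex i) (par_poly a b c m) z = b $ i + (axis i 1 \<bullet> (c *v fst z) + fst z \<bullet> (c *v axis i 1)) / 2" for z
  proof (rule dir_deriv_1D[OF d(1)])
    have "par_poly a b c m (z + s *\<^sub>R ex i) = par_poly a b c m z
        + s * (b $ i + (axis i 1 \<bullet> (c *v fst z) + fst z \<bullet> (c *v axis i 1)) / 2)
        + s * s * (axis i 1 \<bullet> (c *v axis i 1)) / 2" for s
      by (cases z) (simp add: par_poly_def inner_add_left inner_add_right matrix_vector_right_distrib
          matrix_vector_mult_scaleR inner_axis algebra_simps add_divide_distrib)
    then show "((\<lambda>s. par_poly a b c m (z + s *\<^sub>R ex i)) has_real_derivative
      b $ i + (axis i 1 \<bullet> (c *v fst z) + fst z \<bullet> (c *v axis i 1)) / 2) (at 0)"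
      by (auto intro!: derivative_eq_intros)
  qed
  show "dir_deriv (ex i) (dir_deriv (ex i) (par_poly a b c m)) z = c $ i $ i"
  proof (rule dir_deriv_1D[OF d(2)])
    have "(c *v axis i 1) $ i = c $ i $ i" by (simp add: matrix_vector_mul_component inner_axis)
    then have "dir_deriv (ex i) (par_poly a b c m) (z + s *\<^sub>R ex i) = dir_deriv (ex i) (par_poly a b c m) z + s * c $ i $ i" for s
      unfolding 1 by (simp add: inner_add_left inner_add_right matrix_vector_right_distrib
          matrix_vector_mult_scaleR inner_axis' algebra_simps add_divide_distrib)
    then show "((\<lambda>s. dir_deriv (ex i) (par_poly a b c m) (z + s *\<^sub>R ex i)) has_real_derivative c $ i $ i) (at 0)"
      by (auto intro!: derivative_eq_intros)
  qed
  show "dir_deriv et (par_poly a b c m) z = m"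
  proof (rule dir_deriv_1D[OF d(1)])
    have "par_poly a b c m (z + s *\<^sub>R et) = par_poly a b c m z + s * m" for s
      by (cases z) (simp add: par_poly_def algebra_simps)
    then show "((\<lambda>s. par_poly a b c m (z + s *\<^sub>R et)) has_real_derivative m) (at 0)"
      by (auto intro!: derivative_eq_intros)
  qed
qed

lemma heat_op_par_poly:
  "laplacian_x (par_poly a b c m) z = (\<Sum>i\<in>UNIV. c $ i $ i)" "time_deriv (par_poly a b c m) z = m"
  by (simp_all add: laplacian_x_def time_deriv_def dir_deriv_par_poly)

text \<open>Green's identity. The polynomial times the Laplacian of \<open>\<phi>\<close>, minus the
  same with the roles exchanged, is a sum of derivatives of the bumps \<open>A i\<close> and
  \<open>B i\<close>; the time terms combine into the derivative of \<open>T\<close>. All of these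
  integrate to zero and leave the constant trace of \<open>c\<close> minus \<open>m\<close>.\<close>

lemma integral_par_poly_adj_op:
  fixes \<phi> :: "(real ^ 'n) \<times> real \<Rightarrow> real"
  assumes \<phi>: "bump \<phi>"
  shows "(\<integral>z. par_poly a b c m z * adj_op \<phi> z \<partial>lborel) = ((\<Sum>i\<in>UNIV. c $ i $ i) - m) * (\<integral>z. \<phi> z \<partial>lborel)"
proof -
  let ?P = "par_poly a b c m"
  have sP: "smooth_on UNIV ?P" by (rule smooth_par_poly)
  have s\<phi>: "smooth_on UNIV \<phi>" using \<phi> bump_def by blast
  have prod: "dir_deriv v (\<lambda>z. f z * g z) z = f z * dir_deriv v g z + dir_deriv v f z * g z"
    if "smooth_on UNIV f" "smooth_on UNIV g" for v z and f g :: "(real ^ 'n) \<times> real \<Rightarrow> real"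
    by (rule dir_deriv_eq)
      (intro has_derivative_mult dir_deriv_has_derivative smooth_on_differentiable[OF that(1) UNIV_I]
        smooth_on_differentiable[OF that(2) UNIV_I])
  define A where "A i z = ?P z * dir_deriv (ex i) \<phi> z" for i z
  define B where "B i z = dir_deriv (ex i) ?P z * \<phi> z" for i z
  define T where "T z = ?P z * \<phi> z" for z
  have bA: "bump (A i)" and bB: "bump (B i)" and bT: "bump T" for i
    unfolding A_def B_def T_def by (intro bump_smooth_mult sP smooth_on_dir_deriv bump_dir_deriv \<phi>)+
  have e: "?P z * adj_op \<phi> z = (\<Sum>i\<in>UNIV. dir_deriv (ex i) (A i) z - dir_deriv (ex i) (B i) z) + dir_deriv et T z
      + ((\<Sum>i\<in>UNIV. c $ i $ i) - m) * \<phi> z" for z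
  proof -
    have s: "dir_deriv (ex i) (A i) z - dir_deriv (ex i) (B i) z = ?P z * dir_deriv (ex i) (dir_deriv (ex i) \<phi>) z - c $ i $ i * \<phi> z" for i
      using prod[OF sP smooth_on_dir_deriv[OF s\<phi>], of "ex i" "ex i" z] prod[OF smooth_on_dir_deriv[OF sP] s\<phi>, of "ex i" "ex i" z]
      by (simp add: A_def[abs_def] B_def[abs_def] dir_deriv_par_poly(2))
    have t: "dir_deriv et T z = ?P z * dir_deriv et \<phi> z + m * \<phi> z"
      using prod[OF sP s\<phi>, of et z] by (simp add: T_def[abs_def] dir_deriv_par_poly(3))
    show ?thesis unfolding s t
      by (simp add: laplacian_x_def time_deriv_def sum_subtractf sum_distrib_left sum_distrib_right algebra_simps)
  qed
  note i = integrable_bump[OF bump_dir_deriv[OF bA]] integrable_bump[OF bump_dir_deriv[OF bB]]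
    integrable_bump[OF bump_dir_deriv[OF bT]] integrable_bump[OF \<phi>]
  show ?thesis unfolding e using i
    by (simp add: Bochner_Integration.integral_sum integral_dir_deriv_bump bA bB bT)
qed

lemma integrable_test_mult:
  fixes u \<phi> :: "(real ^ 'n) \<times> real \<Rightarrow> real"
  assumes u: "integrable lborel (\<lambda>z. indicator (Qm 1) z * u z)" "u \<in> borel_measurable borel"
    and b: "bump \<phi>" "\<And>z. z \<notin> Qm 1 \<Longrightarrow> \<phi> z = 0"
  shows "integrable lborel (\<lambda>z. u z * \<phi> z)"
proof -
  obtain B where B: "0 \<le> B" "\<And>z. \<bar>\<phi> z\<bar> \<le> B" using bump_bounded[OF b(1)] by blast
  have [measurable]: "\<phi> \<in> borel_measurable borel" "u \<in> borel_measurable borel"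
    using b smooth_measurable u(2) by (auto simp: bump_def)
  show ?thesis
  proof (rule Bochner_Integration.integrable_bound[OF integrable_mult_right[OF u(1), of B]])
    show "AE z in lborel. norm (u z * \<phi> z) \<le> norm (B * (indicator (Qm 1) z * u z))"
    proof (rule AE_I2)
      fix z
      show "norm (u z * \<phi> z) \<le> norm (B * (indicator (Qm 1) z * u z))"
        using mult_left_mono[OF B(2)[of z] abs_ge_zero[of "u z"]] B(1) b(2)[of z]
        by (cases "z \<in> Qm 1") (simp_all add: abs_mult mult.commute)
    qed
  qed measurable
qed

text \<open>The heat operator of a polynomial of parabolic degree two is constant. The new
  right-hand side thus has the same oscillation as \<open>f\<close>, which is why all of
  \<open>P2_t\<close> may be used as competitors.\<close>

lemma heat_equation_sub_poly:
  fixes u f :: "(real ^ 'n) \<times> real \<Rightarrow> real"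
  assumes p: "1 < p" and u: "LpQ p 1 u" and f: "LpQ p 1 f" and he: "heat_equation_Q1 u f"
  shows "heat_equation_Q1 (\<lambda>z. u z - par_poly a b c m z) (\<lambda>z. f z - ((\<Sum>i\<in>UNIV. c $ i $ i) - m))"
proof -
  have [measurable]: "u \<in> borel_measurable borel" "f \<in> borel_measurable borel" using u f by (auto simp: LpQ_def)
  show ?thesis
  proof (rule heat_equation_BorelI)
    fix \<phi> :: "(real ^ 'n) \<times> real \<Rightarrow> real" assume t: "test_function (interior (Qm 1)) \<phi>"
    have b: "bump \<phi>" and ba: "bump (\<lambda>z. adj_op \<phi> z)"
      using test_function_bump[OF t] bump_adj_op by blast+
    have o: "\<phi> z = 0" "adj_op \<phi> z = 0" if "z \<notin> Qm 1" for z
      using adj_op_outside[OF t, of z] that interior_subset by blast+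
    have iu: "integrable lborel (\<lambda>z. u z * adj_op \<phi> z)"
      by (intro integrable_test_mult[OF L1_le_avg_norm(1)[OF p u]] ba) (auto simp: o)
    have if': "integrable lborel (\<lambda>z. f z * \<phi> z)"
      by (intro integrable_test_mult[OF L1_le_avg_norm(1)[OF p f]] b) (auto simp: o)
    have iP: "integrable lborel (\<lambda>z. par_poly a b c m z * adj_op \<phi> z)" for a b c m
      by (intro integrable_bump bump_smooth_mult smooth_par_poly ba)
    have "(\<integral>z. u z * adj_op \<phi> z \<partial>lborel) = (\<integral>z. f z * \<phi> z \<partial>lborel)"
      using he t heat_equation_Borel[of u f] by auto
    then show "(\<integral>z. (u z - par_poly a b c m z) * adj_op \<phi> z \<partial>lborel) =
        (\<integral>z. (f z - ((\<Sum>i\<in>UNIV. c $ i $ i) - m)) * \<phi> z \<partial>lborel)"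
      using iu if' iP integrable_bump[OF b] integral_par_poly_adj_op[OF b, of a _ c m]
      by (simp add: left_diff_distrib)
  qed measurable
qed

section \<open>Parabolic rescaling of solutions\<close>

lemma adj_op_par_scale:
  fixes \<phi> :: "(real ^ 'n) \<times> real \<Rightarrow> real"
  assumes s: "smooth_on UNIV \<phi>"
  shows "adj_op (\<lambda>z. \<phi> (par_scale r z)) z = r\<^sup>2 * adj_op \<phi> (par_scale r z)"
proof -
  have d: "h differentiable (at x)" if "smooth_on UNIV h" for h :: "(real ^ 'n) \<times> real \<Rightarrow> real" and x
    by (rule smooth_on_differentiable[OF that UNIV_I])
  have 1: "dir_deriv v (\<lambda>z. h (par_scale r z)) z = dir_deriv (par_scale r v) h (par_scale r z)"
    if "smooth_on UNIV h" for h :: "(real ^ 'n) \<times> real \<Rightarrow> real" and v z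
    using dir_deriv_affine(2)[OF bounded_linear_par_scale, of h 0 r z v] d[OF that] by simp
  have 2: "dir_deriv (c *\<^sub>R v) h z = c * dir_deriv v h z" if "smooth_on UNIV h" for h :: "(real ^ 'n) \<times> real \<Rightarrow> real" and c v z
    using linear_simps(5)[OF has_derivative_bounded_linear[OF dir_deriv_has_derivative[OF d[OF that]]], of c v] by simp
  have px: "par_scale r (ex i) = r *\<^sub>R ex i" "par_scale r et = r\<^sup>2 *\<^sub>R et" for i :: 'n
    by (simp_all add: par_scale_def)
  have 3: "dir_deriv (ex i) (\<lambda>z. \<phi> (par_scale r z)) = (\<lambda>z. r * dir_deriv (ex i) \<phi> (par_scale r z))" for i
    by (rule ext) (simp only: 1[OF s] 2[OF s] px)
  have sr: "smooth_on UNIV (\<lambda>x. r * dir_deriv (ex i) \<phi> x)" for i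
    by (intro smooth_on_mult smooth_on_const smooth_on_dir_deriv s) auto
  have "dir_deriv (ex i) (dir_deriv (ex i) (\<lambda>z. \<phi> (par_scale r z))) z = r\<^sup>2 * dir_deriv (ex i) (dir_deriv (ex i) \<phi>) (par_scale r z)" for i
  proof -
    have "dir_deriv (ex i) (\<lambda>x. r * dir_deriv (ex i) \<phi> x) y = r * dir_deriv (ex i) (dir_deriv (ex i) \<phi>) y" for y
      by (rule dir_deriv_eq) (intro has_derivative_mult_right dir_deriv_has_derivative d smooth_on_dir_deriv s)
    then show ?thesis unfolding 3 by (simp only: 1[OF sr] px 2[OF sr]) (simp add: power2_eq_square)
  qed
  moreover have "dir_deriv et (\<lambda>z. \<phi> (par_scale r z)) z = r\<^sup>2 * dir_deriv et \<phi> (par_scale r z)"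
    by (simp only: 1[OF s] px 2[OF s])
  ultimately show ?thesis
    by (simp add: laplacian_x_def time_deriv_def sum_distrib_left distrib_left)
qed

lemma par_scale_inverse: "r \<noteq> 0 \<Longrightarrow> par_scale (1/r) (par_scale r z) = z" "r \<noteq> 0 \<Longrightarrow> par_scale r (par_scale (1/r) z) = z"
  by (cases z; simp add: par_scale_def power_divide)+

lemma test_function_par_scale:
  fixes \<phi> :: "(real ^ 'n) \<times> real \<Rightarrow> real"
  assumes t: "test_function (interior (Qm 1)) \<phi>" and r: "0 < r" "r \<le> 1"
  shows "test_function (interior (Qm 1)) (\<lambda>z. \<phi> (par_scale (1/r) z))"
proof -
  let ?K = "par_scale r ` closure {z. \<phi> z \<noteq> 0}"
  have K: "compact ?K"
    using t by (intro compact_continuous_image linear_continuous_on bounded_linear_par_scale) (simp add: test_function_def)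
  have "{z. \<phi> (par_scale (1/r) z) \<noteq> 0} \<subseteq> ?K"
  proof
    fix z assume "z \<in> {z. \<phi> (par_scale (1/r) z) \<noteq> 0}"
    then have "par_scale (1/r) z \<in> closure {z. \<phi> z \<noteq> 0}" 
      using subsetD[OF closure_subset, of "par_scale (1/r) z" "{z. \<phi> z \<noteq> 0}"] by simp
    then have "par_scale r (par_scale (1/r) z) \<in> ?K" by (rule imageI)
    then show "z \<in> ?K" using r by (simp add: par_scale_inverse)
  qed
  then have sub: "closure {z. \<phi> (par_scale (1/r) z) \<noteq> 0} \<subseteq> ?K"
    by (rule closure_minimal) (rule compact_imp_closed[OF K])
  have "?K \<subseteq> interior (Qm 1)"
  proof
    fix z assume "z \<in> ?K"
    then obtain w where w: "w \<in> interior (Qm 1)" "z = par_scale r w" using t by (auto simp: test_function_def)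
    have wn: "norm (fst w) < 1" "- 1 < snd w" "snd w < 0" using w by (auto simp: interior_Qm)
    have "r * norm (fst w) \<le> 1 * norm (fst w)" using r by (intro mult_right_mono) auto
    then have "r * norm (fst w) < 1" using wn by simp
    moreover have "r\<^sup>2 \<le> 1" using r by (simp add: power_le_one)
    then have "r\<^sup>2 * (- snd w) \<le> 1 * (- snd w)" using wn by (intro mult_right_mono) auto
    then have "- 1 < r\<^sup>2 * snd w" using wn by (simp only: mult_minus_right mult_1)
    moreover have "r\<^sup>2 * snd w < 0" using wn r by (simp add: mult_pos_neg)
    ultimately show "z \<in> interior (Qm 1)" using r by (simp add: w(2) par_scale_def interior_Qm)
  qed
  moreover have "compact (closure {z. \<phi> (par_scale (1/r) z) \<noteq> 0})"
    using compact_Int_closed[OF K closed_closure, of "{z. \<phi> (par_scale (1/r) z) \<noteq> 0}"] sub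
    by (simp only: Int_absorb1)
  moreover have "smooth_on UNIV (\<lambda>z. \<phi> (0 + par_scale (1/r) z))"
    by (rule smooth_on_affine[OF bounded_linear_par_scale _ _ test_function_smooth[OF t]]) auto
  ultimately show ?thesis using sub unfolding test_function_def by (auto simp: smooth_on_def Ck_on_UNIV)
qed

text \<open>Division by \<open>r\<^sup>2\<close> compensates the factor that the operator acquires
  under dilation, so \<open>f\<close> is only composed. Test functions are transported by the
  inverse dilation, and \<open>r \<le> 1\<close> keeps their supports in the unit cylinder.\<close>

lemma heat_equation_par_scale:
  fixes u f :: "(real ^ 'n) \<times> real \<Rightarrow> real"
  assumes [measurable]: "u \<in> borel_measurable borel" "f \<in> borel_measurable borel"
    and he: "heat_equation_Q1 u f" and r: "0 < r" "r \<le> 1"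
  shows "heat_equation_Q1 (\<lambda>z. u (par_scale r z) / r\<^sup>2) (\<lambda>z. f (par_scale r z))"
proof (rule heat_equation_BorelI)
  fix \<phi> :: "(real ^ 'n) \<times> real \<Rightarrow> real" assume t: "test_function (interior (Qm 1)) \<phi>"
  have b: "bump \<phi>" and ba: "bump (\<lambda>z. adj_op \<phi> z)"
    using test_function_bump[OF t] bump_adj_op by blast+
  have [measurable]: "\<phi> \<in> borel_measurable borel" "(\<lambda>z. adj_op \<phi> z) \<in> borel_measurable borel"
    using b ba smooth_measurable unfolding bump_def by blast+
  have r0: "r \<noteq> 0" using r by simp
  let ?R = "r ^ (CARD('n) + 2)"
  have "(\<integral>z. u z * adj_op (\<lambda>z. \<phi> (par_scale (1/r) z)) z \<partial>lborel) = (\<integral>z. f z * \<phi> (par_scale (1/r) z) \<partial>lborel)"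
    using he test_function_par_scale[OF t r] heat_equation_Borel[of u f] by auto
  then have "(\<integral>z. u z * ((1/r)\<^sup>2 * adj_op \<phi> (par_scale (1/r) z)) \<partial>lborel) = (\<integral>z. f z * \<phi> (par_scale (1/r) z) \<partial>lborel)"
    unfolding adj_op_par_scale[OF test_function_smooth[OF t]] .
  moreover have "(\<integral>z. u z * ((1/r)\<^sup>2 * adj_op \<phi> (par_scale (1/r) z)) \<partial>lborel) =
     ?R * (\<integral>z. u (par_scale r z) * ((1/r)\<^sup>2 * adj_op \<phi> z) \<partial>lborel)"
    by (subst integral_par_scale[OF r(1)]) (auto simp: par_scale_inverse[OF r0])
  moreover have "(\<integral>z. f z * \<phi> (par_scale (1/r) z) \<partial>lborel) = ?R * (\<integral>z. f (par_scale r z) * \<phi> z \<partial>lborel)"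
    by (subst integral_par_scale[OF r(1)]) (auto simp: par_scale_inverse[OF r0])
  ultimately have "?R * (\<integral>z. u (par_scale r z) * ((1/r)\<^sup>2 * adj_op \<phi> z) \<partial>lborel) = ?R * (\<integral>z. f (par_scale r z) * \<phi> z \<partial>lborel)"
    by simp
  then have "(\<integral>z. u (par_scale r z) * ((1/r)\<^sup>2 * adj_op \<phi> z) \<partial>lborel) = (\<integral>z. f (par_scale r z) * \<phi> z \<partial>lborel)"
    using r by (subst (asm) mult_left_cancel) auto
  then show "(\<integral>z. u (par_scale r z) / r\<^sup>2 * adj_op \<phi> z \<partial>lborel) = (\<integral>z. f (par_scale r z) * \<phi> z \<partial>lborel)"
    by (simp add: power_divide)
qed measurable

lemma scaled_solution:
  fixes u f :: "(real ^ 'n) \<times> real \<Rightarrow> real" and a m :: real and b :: "real ^ 'n" and c :: "real ^ 'n ^ 'n"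
  assumes p: "1 < p" and u: "LpQ p 1 u" and f: "LpQ p 1 f" and he: "heat_equation_Q1 u f"
    and r: "0 < r" "r \<le> 1"
  defines "v \<equiv> \<lambda>z. (u (par_scale r z) - par_poly a b c m (par_scale r z)) / r\<^sup>2"
    and "g \<equiv> \<lambda>z. f (par_scale r z) - ((\<Sum>i\<in>UNIV. c $ i $ i) - m)"
  shows "heat_equation_Q1 v g" "LpQ p 1 v" "LpQ p 1 g"
    "avg_norm p 1 v = avg_norm p r (\<lambda>z. u z - par_poly a b c m z) / r\<^sup>2"
proof -
  have p0: "0 < p" using p by simp
  have [measurable]: "u \<in> borel_measurable borel" "f \<in> borel_measurable borel" using u f by (auto simp: LpQ_def)
  show "heat_equation_Q1 v g" unfolding v_def g_def
    using heat_equation_par_scale[OF _ _ heat_equation_sub_poly[OF p u f he] r] by simp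
  have uP: "LpQ p r (\<lambda>z. u z - par_poly a b c m z)"
    using r by (intro LpQ_diff p0 LpQ_subset[OF u] LpQ_par_poly) auto
  then have "LpQ p 1 (\<lambda>z. u (par_scale r z) - par_poly a b c m (par_scale r z))"
    using LpQ_par_scale[OF r(1), of "\<lambda>z. u z - par_poly a b c m z" p 1] by simp
  from LpQ_cmult[OF this, of "1 / r\<^sup>2"] show "LpQ p 1 v" unfolding v_def by simp
  have "LpQ p 1 (\<lambda>z. f (par_scale r z))"
    using LpQ_par_scale[OF r(1), of f p 1] LpQ_subset[OF f] r by simp
  then show "LpQ p 1 g" unfolding g_def by (intro LpQ_diff p0 LpQ_const)
  have "v = (\<lambda>z. (1 / r\<^sup>2) * (u (par_scale r z) - par_poly a b c m (par_scale r z)))" by (simp add: v_def)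
  then show "avg_norm p 1 v = avg_norm p r (\<lambda>z. u z - par_poly a b c m z) / r\<^sup>2"
    using avg_norm_cmult[OF p0, of 1 "1 / r\<^sup>2" "\<lambda>z. u (par_scale r z) - par_poly a b c m (par_scale r z)"]
      avg_norm_par_scale[OF r(1), of "\<lambda>z. u z - par_poly a b c m z" p 1] by simp
qed

text \<open>\<open>unit_step\<close> for the rescaled remainder, with the constant \<open>c0\<close>
  shifted by the heat operator of the polynomial already subtracted. Undoing the dilation multiplies
  the coefficients by \<open>r\<^sup>2\<close>, \<open>r\<close>, 1 and 1, hence the weights on the
  left; division by \<open>\<rho>\<^sup>2\<close> turns the cubic error into the factor
  \<open>\<rho>\<close>.\<close>

lemma one_step:
  fixes p :: real
  assumes p: "1 < p"
  shows "\<exists>C>0. \<forall>(u :: (real ^ 'n) \<times> real \<Rightarrow> real) f. LpQ p 1 u \<and> LpQ p 1 f \<and> heat_equation_Q1 u f \<longrightarrow>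
    (\<forall>r a b c m c0. 0 < r \<and> r \<le> 1 \<longrightarrow> (\<exists>a' b' c' m'. transpose c' = c' \<and>
      \<bar>a'\<bar> / r\<^sup>2 + norm b' / r + norm c' + \<bar>m'\<bar>
        \<le> C * (avg_norm p r (\<lambda>z. u z - par_poly a b c m z) / r\<^sup>2 + avg_norm p r (\<lambda>z. f z - c0)) \<and>
      (\<forall>\<rho>. 0 < \<rho> \<and> \<rho> \<le> 1/2 \<longrightarrow>
        avg_norm p (r * \<rho>) (\<lambda>z. u z - par_poly (a + a') (b + b') (c + c') (m + m') z) / (r * \<rho>)\<^sup>2 \<le>
        C * (\<rho> * (avg_norm p r (\<lambda>z. u z - par_poly a b c m z) / r\<^sup>2)
           + (1 / \<rho>) powr (real (CARD('n) + 2) / p) / \<rho>\<^sup>2 * avg_norm p r (\<lambda>z. f z - c0)))))"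
proof -
  have p0: "0 < p" using p by simp
  let ?q = "real (CARD('n) + 2) / p"
  obtain C where C': "0 < C \<and> (\<forall>(u :: (real ^ 'n) \<times> real \<Rightarrow> real) f c0. LpQ p 1 u \<and> LpQ p 1 f \<and> heat_equation_Q1 u f \<longrightarrow>
    (\<exists>a b c m. transpose c = c \<and>
      \<bar>a\<bar> + norm b + norm c + \<bar>m\<bar> \<le> C * (avg_norm p 1 u + avg_norm p 1 (\<lambda>z. f z - c0)) \<and>
      (\<forall>\<rho>. 0 < \<rho> \<and> \<rho> \<le> 1/2 \<longrightarrow> avg_norm p \<rho> (\<lambda>z. u z - par_poly a b c m z) \<le>
        C * (\<rho> ^ 3 * avg_norm p 1 u + (1 / \<rho>) powr ?q * avg_norm p 1 (\<lambda>z. f z - c0)))))"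
    using unit_step[OF p, where 'n = 'n] by (rule exE)
  note C = conjunct1[OF C'] conjunct2[OF C', THEN spec, THEN spec, THEN spec, THEN mp]
  show ?thesis
  proof (rule exI[of _ C], intro conjI C(1) allI impI)
    fix u f :: "(real ^ 'n) \<times> real \<Rightarrow> real" and r a c0 m :: real and b c
    assume "LpQ p 1 u \<and> LpQ p 1 f \<and> heat_equation_Q1 u f" and r': "0 < r \<and> r \<le> 1"
    then have u: "LpQ p 1 u" and f: "LpQ p 1 f" and he: "heat_equation_Q1 u f" by auto
    have [measurable]: "u \<in> borel_measurable borel" "f \<in> borel_measurable borel" using u f by (auto simp: LpQ_def)
    have r: "0 < r" "r \<le> 1" using r' by auto
    let ?X = "avg_norm p r (\<lambda>z. u z - par_poly a b c m z) / r\<^sup>2" and ?Y = "avg_norm p r (\<lambda>z. f z - c0)"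
    define v where "v = (\<lambda>z. (u (par_scale r z) - par_poly a b c m (par_scale r z)) / r\<^sup>2)"
    define \<kappa> where "\<kappa> = (\<Sum>i\<in>UNIV. c $ i $ i) - m"
    define g where "g = (\<lambda>z. f (par_scale r z) - \<kappa>)"
    have S: "heat_equation_Q1 v g" "LpQ p 1 v" "LpQ p 1 g"
      "avg_norm p 1 v = avg_norm p r (\<lambda>z. u z - par_poly a b c m z) / r\<^sup>2"
      unfolding v_def g_def \<kappa>_def by (rule scaled_solution[OF p u f he r])+
    have Y: "avg_norm p 1 (\<lambda>z. g z - (c0 - \<kappa>)) = ?Y"
      using avg_norm_par_scale[OF r(1), of "\<lambda>z. f z - c0" p 1] by (simp add: g_def)
    obtain a1 b1 c1 m1 where sym: "transpose c1 = c1" and co: "\<bar>a1\<bar> + norm b1 + norm c1 + \<bar>m1\<bar> \<le> C * (?X + ?Y)"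
      and es: "\<And>\<rho>. 0 < \<rho> \<Longrightarrow> \<rho> \<le> 1/2 \<Longrightarrow> avg_norm p \<rho> (\<lambda>z. v z - par_poly a1 b1 c1 m1 z) \<le> C * (\<rho> ^ 3 * ?X + (1 / \<rho>) powr ?q * ?Y)"
      using C(2)[of v g "c0 - \<kappa>"] S Y by auto
    show "\<exists>a' b' c' m'. transpose c' = c' \<and> \<bar>a'\<bar> / r\<^sup>2 + norm b' / r + norm c' + \<bar>m'\<bar> \<le> C * (?X + ?Y) \<and>
      (\<forall>\<rho>. 0 < \<rho> \<and> \<rho> \<le> 1/2 \<longrightarrow>
        avg_norm p (r * \<rho>) (\<lambda>z. u z - par_poly (a + a') (b + b') (c + c') (m + m') z) / (r * \<rho>)\<^sup>2 \<le>
        C * (\<rho> * ?X + (1 / \<rho>) powr ?q / \<rho>\<^sup>2 * ?Y))"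
    proof (rule exI[of _ "r\<^sup>2 * a1"], rule exI[of _ "r *\<^sub>R b1"], rule exI[of _ c1], rule exI[of _ m1], intro conjI allI impI)
      show "transpose c1 = c1" by (rule sym)
      show "\<bar>r\<^sup>2 * a1\<bar> / r\<^sup>2 + norm (r *\<^sub>R b1) / r + norm c1 + \<bar>m1\<bar> \<le> C * (?X + ?Y)"
        using co r by (simp add: abs_mult)
      fix \<rho> :: real assume rho: "0 < \<rho> \<and> \<rho> \<le> 1/2"
      let ?h = "\<lambda>z. u z - par_poly (a + r\<^sup>2 * a1) (b + r *\<^sub>R b1) (c + c1) (m + m1) z"
      have "v z - par_poly a1 b1 c1 m1 z = (1 / r\<^sup>2) * ?h (par_scale r z)" for z
      proof -
        have "par_poly (r\<^sup>2 * a1) (r *\<^sub>R b1) c1 m1 (par_scale r z) = r\<^sup>2 * par_poly a1 b1 c1 m1 z"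
          by (cases z) (simp add: par_poly_def par_scale_def matrix_vector_mult_scaleR power2_eq_square algebra_simps)
        then have h: "?h (par_scale r z) = u (par_scale r z) - par_poly a b c m (par_scale r z) - r\<^sup>2 * par_poly a1 b1 c1 m1 z"
          by (simp only: par_poly_add diff_diff_eq)
        show ?thesis unfolding h v_def using r by (simp add: diff_divide_distrib)
      qed
      then have "avg_norm p \<rho> (\<lambda>z. v z - par_poly a1 b1 c1 m1 z) = (1 / r\<^sup>2) * avg_norm p (r * \<rho>) ?h"
        using avg_norm_cmult[OF p0, of \<rho> "1 / r\<^sup>2" "\<lambda>z. ?h (par_scale r z)"] avg_norm_par_scale[OF r(1), of ?h p \<rho>] by simp
      then have "avg_norm p (r * \<rho>) ?h / (r * \<rho>)\<^sup>2 = avg_norm p \<rho> (\<lambda>z. v z - par_poly a1 b1 c1 m1 z) / \<rho>\<^sup>2"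
        by (simp add: power_mult_distrib)
      also have "\<dots> \<le> (C * (\<rho> ^ 3 * ?X + (1 / \<rho>) powr ?q * ?Y)) / \<rho>\<^sup>2"
        using es[of \<rho>] rho by (intro divide_right_mono) auto
      also have "\<dots> = C * (\<rho> * ?X + (1 / \<rho>) powr ?q / \<rho>\<^sup>2 * ?Y)"
      proof -
        have "(C * (\<rho> ^ 3 * x + z * y)) / \<rho>\<^sup>2 = C * (\<rho> * x + z / \<rho>\<^sup>2 * y)" for x y z
          using rho by (simp add: field_simps power3_eq_cube power2_eq_square)
        then show ?thesis by blast
      qed
      finally show "avg_norm p (r * \<rho>) ?h / (r * \<rho>)\<^sup>2 \<le> C * (\<rho> * ?X + (1 / \<rho>) powr ?q / \<rho>\<^sup>2 * ?Y)" .
    qed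
  qed
qed

text \<open>The reflected kernel of the representation formula serves again. It is nonnegative, and
  with \<open>\<delta> = 1/10\<close> both cutoffs equal 1 at the point \<open>(0, -1/10)\<close>,
  where it is therefore positive.\<close>

lemma exists_test_function:
  "\<exists>\<psi> :: (real ^ 'n) \<times> real \<Rightarrow> real. test_function (interior (Qm 1)) \<psi> \<and> 0 < (\<integral>z. \<psi> z \<partial>lborel)"
proof -
  let ?\<psi> = "\<lambda>y :: (real ^ 'n) \<times> real. reg_ker (1/10) (0 - y)"
  have t: "test_function (interior (Qm 1)) ?\<psi>"
    by (rule reg_ker_test_function) (auto simp: Qm_def zero_prod_def)
  have nn: "0 \<le> ?\<psi> z" for z
    using trunc_ker_nonneg[of "0 - z"] smooth_step_bounds[of "snd (0 - z) / (1/10)\<^sup>2 - 1"]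
    by (simp add: reg_ker_def time_cut_def)
  let ?U = "{z. 0 < ?\<psi> z}"
  have "open ?U"
    by (intro open_Collect_less continuous_intros smooth_on_continuous[OF test_function_smooth[OF t]])
  moreover have "(0, - 1/10) \<in> ?U"
  proof -
    have "cutoff (0 - (0, - 1/10) :: (real ^ 'n) \<times> real) = 1" by (rule cutoff_eq_1) auto
    moreover have "time_cut (1/10) (0 - (0, - 1/10) :: (real ^ 'n) \<times> real) = 1"
      by (simp add: time_cut_def power2_eq_square smooth_step_1)
    moreover have "0 < heat_ker (0 - (0, - 1/10) :: (real ^ 'n) \<times> real)" by (simp add: heat_ker_def)
    ultimately show ?thesis by (simp add: reg_ker_def trunc_ker_def)
  qed
  ultimately have "\<not> negligible ?U" by (intro open_not_negligible) (auto simp only:)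
  then have "?U \<notin> null_sets lborel"
    using \<open>open ?U\<close> unfolding negligible_iff_null_sets by (simp add: null_sets_completion_iff)
  moreover have "?U \<in> null_sets lborel" if "(\<integral>z. ?\<psi> z \<partial>lborel) = 0"
  proof -
    have "AE z in lborel. ?\<psi> z = 0"
      using that integral_nonneg_eq_0_iff_AE[OF integrable_bump[OF test_function_bump[OF t]]] nn by auto
    then have "AE z in lborel. z \<notin> ?U" by eventually_elim auto
    then show ?thesis using \<open>open ?U\<close> by (subst (asm) AE_iff_null_sets[symmetric]) auto
  qed
  moreover have "0 \<le> (\<integral>z. ?\<psi> z \<partial>lborel)" by (intro Bochner_Integration.integral_nonneg nn)
  ultimately show ?thesis using t by (metis (no_types, lifting) order_le_less)
qed

lemma abs_integral_test_le:
  fixes u \<phi> :: "(real ^ 'n) \<times> real \<Rightarrow> real"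
  assumes u: "integrable lborel (\<lambda>z. indicator (Qm 1) z * u z)"
    and u': "u \<in> borel_measurable borel"
    and b: "bump \<phi>" "\<And>z. z \<notin> Qm 1 \<Longrightarrow> \<phi> z = 0" "\<And>z. \<bar>\<phi> z\<bar> \<le> B"
  shows "\<bar>\<integral>z. u z * \<phi> z \<partial>lborel\<bar> \<le> B * (\<integral>z. indicator (Qm 1) z * \<bar>u z\<bar> \<partial>lborel)"
proof -
  have i: "integrable lborel (\<lambda>z. u z * \<phi> z)" by (rule integrable_test_mult[OF u u' b(1)]) (rule b(2))
  have ia: "integrable lborel (\<lambda>z. indicator (Qm 1) z * \<bar>u z\<bar>)"
    using integrable_abs[OF u] by (simp add: abs_mult)
  have "\<bar>\<integral>z. u z * \<phi> z \<partial>lborel\<bar> \<le> (\<integral>z. \<bar>u z * \<phi> z\<bar> \<partial>lborel)" by (rule integral_abs_bound)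
  also have "\<dots> \<le> (\<integral>z. B * (indicator (Qm 1) z * \<bar>u z\<bar>) \<partial>lborel)"
  proof (intro integral_mono integrable_abs i integrable_mult_right ia)
    fix z
    show "\<bar>u z * \<phi> z\<bar> \<le> B * (indicator (Qm 1) z * \<bar>u z\<bar>)"
      using mult_left_mono[OF b(3)[of z] abs_ge_zero[of "u z"]] b(2)[of z]
      by (cases "z \<in> Qm 1") (simp_all add: abs_mult mult.commute)
  qed
  finally show ?thesis by simp
qed

text \<open>One fixed \<open>\<psi>\<close> is tested against the rescaled remainder. The defect
  \<open>\<kappa>\<close> times the integral of \<open>\<psi>\<close> equals a term in
  \<open>f (par_scale r z)\<close> minus a term in the remainder. The first is bounded by averages
  of the modulus of \<open>f\<close>, which is where the Lebesgue value \<open>f(0) = 0\<close>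
  enters, and the second by the quantity assumed to tend to 0.\<close>

lemma caloric_limit:
  fixes u f :: "(real ^ 'n) \<times> real \<Rightarrow> real"
  assumes p: "1 < p" and u: "LpQ p 1 u" and f: "LpQ p 1 f" and he: "heat_equation_Q1 u f"
    and lim: "((\<lambda>r. avg_norm p r (\<lambda>z. u z - par_poly a b c m z) / r\<^sup>2) \<longlongrightarrow> 0) (at_right 0)"
    and leb: "((\<lambda>r. (\<integral>z. indicator (Qm r) z * \<bar>f z\<bar> \<partial>lborel) / r ^ (CARD('n) + 2)) \<longlongrightarrow> 0) (at_right 0)"
  shows "(\<Sum>i\<in>UNIV. c $ i $ i) = m"
proof -
  have [measurable]: "u \<in> borel_measurable borel" "f \<in> borel_measurable borel" using u f by (auto simp: LpQ_def)
  obtain \<psi> :: "(real ^ 'n) \<times> real \<Rightarrow> real" where t: "test_function (interior (Qm 1)) \<psi>" and I: "0 < (\<integral>z. \<psi> z \<partial>lborel)"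
    using exists_test_function by blast
  have b: "bump \<psi>" and ba: "bump (\<lambda>z. adj_op \<psi> z)"
    using test_function_bump[OF t] bump_adj_op by blast+
  have o: "\<psi> z = 0" "adj_op \<psi> z = 0" if "z \<notin> Qm 1" for z
    using adj_op_outside[OF t, of z] that interior_subset by blast+
  obtain B1 where B1: "0 \<le> B1" "\<And>z. \<bar>adj_op \<psi> z\<bar> \<le> B1" using bump_bounded[OF ba] by blast
  obtain B2 where B2: "0 \<le> B2" "\<And>z. \<bar>\<psi> z\<bar> \<le> B2" using bump_bounded[OF b] by blast
  define \<kappa> where "\<kappa> = (\<Sum>i\<in>UNIV. c $ i $ i) - m"
  let ?V = "unit_vol TYPE('n) + 1"
  have le: "\<bar>\<kappa>\<bar> * (\<integral>z. \<psi> z \<partial>lborel) \<le>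
     B2 * ((\<integral>z. indicator (Qm r) z * \<bar>f z\<bar> \<partial>lborel) / r ^ (CARD('n) + 2))
     + B1 * (?V * (avg_norm p r (\<lambda>z. u z - par_poly a b c m z) / r\<^sup>2))" if r: "0 < r" "r \<le> 1" for r
  proof -
    define v where "v = (\<lambda>z. (u (par_scale r z) - par_poly a b c m (par_scale r z)) / r\<^sup>2)"
    define g where "g = (\<lambda>z. f (par_scale r z) - \<kappa>)"
    have S: "heat_equation_Q1 v g" "LpQ p 1 v" "LpQ p 1 g"
      "avg_norm p 1 v = avg_norm p r (\<lambda>z. u z - par_poly a b c m z) / r\<^sup>2"
      unfolding v_def g_def \<kappa>_def by (rule scaled_solution[OF p u f he r])+
    have [measurable]: "v \<in> borel_measurable borel" "g \<in> borel_measurable borel" using S by (auto simp: LpQ_def)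
    have fS: "LpQ p 1 (\<lambda>z. f (par_scale r z))"
      using LpQ_par_scale[OF r(1), of f p 1] LpQ_subset[OF f] r by simp
    have "(\<integral>z. v z * adj_op \<psi> z \<partial>lborel) = (\<integral>z. g z * \<psi> z \<partial>lborel)"
      using S(1) t heat_equation_Borel[of v g] by auto
    also have "\<dots> = (\<integral>z. f (par_scale r z) * \<psi> z \<partial>lborel) - \<kappa> * (\<integral>z. \<psi> z \<partial>lborel)"
      using integrable_bump[OF b] integrable_test_mult[OF L1_le_avg_norm(1)[OF p fS] _ b o(1)]
      by (simp add: g_def left_diff_distrib)
    finally have "\<kappa> * (\<integral>z. \<psi> z \<partial>lborel) = (\<integral>z. f (par_scale r z) * \<psi> z \<partial>lborel) - (\<integral>z. v z * adj_op \<psi> z \<partial>lborel)"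
      by simp
    then have "\<bar>\<kappa> * (\<integral>z. \<psi> z \<partial>lborel)\<bar> \<le> \<bar>\<integral>z. f (par_scale r z) * \<psi> z \<partial>lborel\<bar> + \<bar>\<integral>z. v z * adj_op \<psi> z \<partial>lborel\<bar>"
      by (simp only: abs_triangle_ineq4)
    then have "\<bar>\<kappa>\<bar> * (\<integral>z. \<psi> z \<partial>lborel) \<le> \<bar>\<integral>z. f (par_scale r z) * \<psi> z \<partial>lborel\<bar> + \<bar>\<integral>z. v z * adj_op \<psi> z \<partial>lborel\<bar>"
      by (simp only: abs_mult abs_of_pos[OF I])
    moreover have "\<bar>\<integral>z. f (par_scale r z) * \<psi> z \<partial>lborel\<bar> \<le> B2 * (\<integral>z. indicator (Qm 1) z * \<bar>f (par_scale r z)\<bar> \<partial>lborel)"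
      by (rule abs_integral_test_le[OF L1_le_avg_norm(1)[OF p fS] _ b o(1) B2(2)]) measurable
    moreover have fe: "(\<integral>z. indicator (Qm 1) z * \<bar>f (par_scale r z)\<bar> \<partial>lborel) = (\<integral>z. indicator (Qm r) z * \<bar>f z\<bar> \<partial>lborel) / r ^ (CARD('n) + 2)"
    proof -
      have "(\<integral>z. indicator (Qm r) z * \<bar>f z\<bar> \<partial>lborel) = r ^ (CARD('n) + 2) * (\<integral>z. indicator (Qm r) (par_scale r z) * \<bar>f (par_scale r z)\<bar> \<partial>lborel)"
        by (rule integral_par_scale[OF r(1)]) measurable
      also have "(\<lambda>z. indicator (Qm r) (par_scale r z) * \<bar>f (par_scale r z)\<bar>) = (\<lambda>z. indicator (Qm 1) z * \<bar>f (par_scale r z)\<bar>)"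
        by (rule ext) (use par_scale_mem_Qm[OF r(1), of "_ :: (real ^ 'n) \<times> real" 1] in \<open>simp add: indicator_def\<close>)
      finally show ?thesis using r by simp
    qed
    moreover have "\<bar>\<integral>z. v z * adj_op \<psi> z \<partial>lborel\<bar> \<le> B1 * (\<integral>z. indicator (Qm 1) z * \<bar>v z\<bar> \<partial>lborel)"
      by (rule abs_integral_test_le[OF L1_le_avg_norm(1)[OF p S(2)] _ ba o(2) B1(2)]) measurable
    moreover have "B1 * (\<integral>z. indicator (Qm 1) z * \<bar>v z\<bar> \<partial>lborel) \<le> B1 * (?V * avg_norm p 1 v)"
      by (intro mult_left_mono B1 L1_le_avg_norm(2)[OF p S(2)])
    ultimately show ?thesis unfolding S(4) fe by linarith
  qed
  have "((\<lambda>r. B2 * ((\<integral>z. indicator (Qm r) z * \<bar>f z\<bar> \<partial>lborel) / r ^ (CARD('n) + 2))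
     + B1 * (?V * (avg_norm p r (\<lambda>z. u z - par_poly a b c m z) / r\<^sup>2))) \<longlongrightarrow> B2 * 0 + B1 * (?V * 0)) (at_right 0)"
    by (intro tendsto_intros lim leb)
  moreover have "\<forall>\<^sub>F r in at_right 0. \<bar>\<kappa>\<bar> * (\<integral>z. \<psi> z \<partial>lborel) \<le>
     B2 * ((\<integral>z. indicator (Qm r) z * \<bar>f z\<bar> \<partial>lborel) / r ^ (CARD('n) + 2))
     + B1 * (?V * (avg_norm p r (\<lambda>z. u z - par_poly a b c m z) / r\<^sup>2))"
    by (rule eventually_mono[OF eventually_at_right_real[of 0 1]], simp, rule le) auto
  ultimately have "\<bar>\<kappa>\<bar> * (\<integral>z. \<psi> z \<partial>lborel) \<le> B2 * 0 + B1 * (?V * 0)"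
    by (rule tendsto_lowerbound) simp
  then have "\<bar>\<kappa>\<bar> \<le> 0" using I by (simp add: mult_le_0_iff)
  then show ?thesis by (simp add: \<kappa>_def)
qed

section \<open>The iteration\<close>

text \<open>Counterparts of \<open>omega_t\<close> and \<open>N_t\<close> for Borel functions:
  \<open>excess\<close> is the same as \<open>N_t\<close>, while \<open>osc\<close> is
  \<open>omega_t\<close> times \<open>unit_vol powr (1 / p)\<close>.\<close>

definition osc :: "real \<Rightarrow> ((real ^ 'n) \<times> real \<Rightarrow> real) \<Rightarrow> real \<Rightarrow> real" where
  "osc p f r = (INF c. avg_norm p r (\<lambda>z. f z - c))"

definition excess :: "real \<Rightarrow> ((real ^ 'n) \<times> real \<Rightarrow> real) \<Rightarrow> real \<Rightarrow> real" where
  "excess p u r = (INF P\<in>P2_t. avg_norm p r (\<lambda>z. u z - P z) / r\<^sup>2)"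

lemma osc_le: "osc p f r \<le> avg_norm p r (\<lambda>z. f z - c)"
  unfolding osc_def by (rule cINF_lower) (auto intro!: bdd_belowI[of _ 0] avg_norm_nonneg)

lemma osc_nonneg: "0 \<le> osc p f r"
  unfolding osc_def by (rule cINF_greatest) (auto intro: avg_norm_nonneg)

lemma osc_approx:
  assumes "0 < e" obtains c where "avg_norm p r (\<lambda>z. f z - c) < osc p f r + e"
  using cInf_lessD[of "range (\<lambda>c. avg_norm p r (\<lambda>z. f z - c))" "osc p f r + e"] assms
  by (auto simp: osc_def)

lemma P2_t_nonempty: "P2_t \<noteq> {}"
proof -
  have "transpose (0 :: real ^ 'a ^ 'a) = 0" by (simp add: transpose_def vec_eq_iff)
  then have "par_poly 0 0 (0 :: real ^ 'a ^ 'a) 0 \<in> P2_t" unfolding P2_t_def by blast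
  then show "(P2_t :: ((real ^ 'a) \<times> real \<Rightarrow> real) set) \<noteq> {}" by blast
qed

lemma excess_le: "P \<in> P2_t \<Longrightarrow> excess p u r \<le> avg_norm p r (\<lambda>z. u z - P z) / r\<^sup>2"
  unfolding excess_def by (rule cINF_lower) (auto intro!: bdd_belowI[of _ 0] divide_nonneg_nonneg avg_norm_nonneg)

lemma excess_nonneg: "0 \<le> excess p u r"
  unfolding excess_def by (rule cINF_greatest[OF P2_t_nonempty]) (simp add: avg_norm_nonneg)

lemma excess_approx:
  assumes "0 < e" obtains P where "P \<in> P2_t" "avg_norm p r (\<lambda>z. u z - P z) / r\<^sup>2 < excess p u r + e"
  using cInf_lessD[of "(\<lambda>P. avg_norm p r (\<lambda>z. u z - P z) / r\<^sup>2) ` P2_t" "excess p u r + e"] assms P2_t_nonempty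
  by (auto simp: excess_def)

lemma LpQ_P2: "0 < p \<Longrightarrow> 0 \<le> r \<Longrightarrow> P \<in> P2_t \<Longrightarrow> LpQ p r P"
  unfolding P2_t_def using LpQ_par_poly by blast

text \<open>Every constant is a competitor on both cylinders, so the comparison of norms passes to
  the infimum. This weak monotonicity is what allows a single value of \<open>osc\<close> to be
  bounded by an integral over nearby radii.\<close>

lemma osc_shrink:
  fixes f :: "(real ^ 'n) \<times> real \<Rightarrow> real"
  assumes p: "0 < p" and f: "LpQ p 1 f" and r: "0 < s" "s \<le> r" "r \<le> 1"
  shows "osc p f s \<le> (r / s) powr (real (CARD('n) + 2) / p) * osc p f r"
proof -
  let ?k = "(r / s) powr (real (CARD('n) + 2) / p)"
  have k: "0 < ?k" using r by simp
  have "osc p f s / ?k \<le> osc p f r"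
    unfolding osc_def[of p f r]
  proof (rule cINF_greatest)
    fix c
    have "LpQ p r (\<lambda>z. f z - c)" using r by (intro LpQ_diff p LpQ_subset[OF f] LpQ_const) auto
    then have "osc p f s \<le> ?k * avg_norm p r (\<lambda>z. f z - c)"
      using osc_le[of p f s c] avg_norm_shrink[OF p r(1,2)] by fastforce
    then show "osc p f s / ?k \<le> avg_norm p r (\<lambda>z. f z - c)" using k by (simp add: divide_le_eq mult.commute)
  qed auto
  then show ?thesis using k by (simp add: divide_le_eq mult.commute)
qed

lemma scaled_shrink:
  fixes g :: "(real ^ 'n) \<times> real \<Rightarrow> real"
  assumes p: "0 < p" and g: "LpQ p r g" and r: "0 < s" "s \<le> r"
  shows "avg_norm p s g / s\<^sup>2 \<le> (r / s) powr (real (CARD('n) + 2) / p + 2) * (avg_norm p r g / r\<^sup>2)"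
proof -
  have "avg_norm p s g / s\<^sup>2 \<le> ((r / s) powr (real (CARD('n) + 2) / p) * avg_norm p r g) / s\<^sup>2"
    using avg_norm_shrink[OF p r g] by (intro divide_right_mono) auto
  also have "\<dots> = (r / s) powr (real (CARD('n) + 2) / p) * (r / s)\<^sup>2 * (avg_norm p r g / r\<^sup>2)"
    using r by (simp add: power_divide)
  also have "(r / s)\<^sup>2 = (r / s) powr 2" using r by simp
  finally show ?thesis by (simp only: powr_add)
qed

lemma excess_shrink:
  fixes u :: "(real ^ 'n) \<times> real \<Rightarrow> real"
  assumes p: "0 < p" and u: "LpQ p 1 u" and r: "0 < s" "s \<le> r" "r \<le> 1"
  shows "excess p u s \<le> (r / s) powr (real (CARD('n) + 2) / p + 2) * excess p u r"
proof -
  let ?k = "(r / s) powr (real (CARD('n) + 2) / p + 2)"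
  have k: "0 < ?k" using r by simp
  have "excess p u s / ?k \<le> excess p u r"
    unfolding excess_def[of p u r]
  proof (rule cINF_greatest[OF P2_t_nonempty])
    fix P :: "(real ^ 'n) \<times> real \<Rightarrow> real" assume P: "P \<in> P2_t"
    have "LpQ p r (\<lambda>z. u z - P z)" using r P by (intro LpQ_diff p LpQ_subset[OF u] LpQ_P2) auto
    then have "excess p u s \<le> ?k * (avg_norm p r (\<lambda>z. u z - P z) / r\<^sup>2)"
      using excess_le[OF P, of p u s] scaled_shrink[OF p _ r(1,2)] by fastforce
    then show "excess p u s / ?k \<le> avg_norm p r (\<lambda>z. u z - P z) / r\<^sup>2" using k by (simp add: divide_le_eq mult.commute)
  qed
  then show ?thesis using k by (simp add: divide_le_eq mult.commute)
qed

text \<open>Every radius in \<open>(0, R]\<close> is a power of \<open>l\<close> times one in the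
  first shell \<open>(l * R, R]\<close>. Estimates are thus propagated along all radii at once, not
  only along a fixed geometric sequence.\<close>

lemma geometric_scale_induct:
  fixes l R :: real
  assumes l: "0 < l" "l < 1" and R: "0 < R"
    and base: "\<And>r. l * R < r \<Longrightarrow> r \<le> R \<Longrightarrow> Q r"
    and step: "\<And>r. 0 < r \<Longrightarrow> r \<le> R \<Longrightarrow> Q r \<Longrightarrow> Q (r * l)"
    and r: "0 < r" "r \<le> R"
  shows "Q r"
proof -
  have *: "\<And>r. l ^ Suc k * R < r \<Longrightarrow> r \<le> R \<Longrightarrow> Q r" for k
  proof (induction k)
    case 0 then show ?case using base by simp
  next
    case (Suc k)
    show ?case
    proof (cases "l ^ Suc k * R < r")
      case True then show ?thesis using Suc by blast
    next
      case False
      have "0 < l ^ Suc (Suc k) * R" using l R by simp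
      then have r0: "0 < r" using Suc.prems by linarith
      have "r / l \<le> l ^ k * R" using False l by (simp add: field_simps)
      also have "\<dots> \<le> 1 * R" using l R by (intro mult_right_mono power_le_one) auto
      finally have le: "r / l \<le> R" by simp
      have "l ^ Suc k * R < r / l" using Suc.prems(1) l by (simp add: field_simps)
      from Suc.IH[OF this le] step[of "r / l"] r0 l le show ?thesis by simp
    qed
  qed
  obtain k where k: "l ^ k < r / R" using real_arch_pow_inv[of "r / R" l] l r R by auto
  have "l ^ Suc k \<le> l ^ k" using l by (intro power_decreasing) auto
  then have "l ^ Suc k < r / R" using k by linarith
  then have "l ^ Suc k * R < r" using R by (simp add: field_simps)
  then show ?thesis using * r by blast
qed

lemma one_step_fixed:
  fixes p :: real
  assumes p: "1 < p"
  shows "\<exists>l C K. 0 < l \<and> l \<le> 1/2 \<and> 0 < C \<and> 0 < K \<and>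
    (\<forall>(u :: (real ^ 'n) \<times> real \<Rightarrow> real) f. LpQ p 1 u \<and> LpQ p 1 f \<and> heat_equation_Q1 u f \<longrightarrow>
    (\<forall>r a b c m c0. 0 < r \<and> r \<le> 1 \<longrightarrow> (\<exists>a' b' c' m'. transpose c' = c' \<and>
      \<bar>a'\<bar> / r\<^sup>2 + norm b' / r + norm c' + \<bar>m'\<bar>
        \<le> C * (avg_norm p r (\<lambda>z. u z - par_poly a b c m z) / r\<^sup>2 + avg_norm p r (\<lambda>z. f z - c0)) \<and>
      avg_norm p (r * l) (\<lambda>z. u z - par_poly (a + a') (b + b') (c + c') (m + m') z) / (r * l)\<^sup>2 \<le>
        sqrt l * (avg_norm p r (\<lambda>z. u z - par_poly a b c m z) / r\<^sup>2) + K * avg_norm p r (\<lambda>z. f z - c0))))"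
proof -
  let ?q = "real (CARD('n) + 2) / p"
  obtain C where C': "0 < C \<and> (\<forall>(u :: (real ^ 'n) \<times> real \<Rightarrow> real) f. LpQ p 1 u \<and> LpQ p 1 f \<and> heat_equation_Q1 u f \<longrightarrow>
    (\<forall>r a b c m c0. 0 < r \<and> r \<le> 1 \<longrightarrow> (\<exists>a' b' c' m'. transpose c' = c' \<and>
      \<bar>a'\<bar> / r\<^sup>2 + norm b' / r + norm c' + \<bar>m'\<bar>
        \<le> C * (avg_norm p r (\<lambda>z. u z - par_poly a b c m z) / r\<^sup>2 + avg_norm p r (\<lambda>z. f z - c0)) \<and>
      (\<forall>\<rho>. 0 < \<rho> \<and> \<rho> \<le> 1/2 \<longrightarrow>
        avg_norm p (r * \<rho>) (\<lambda>z. u z - par_poly (a + a') (b + b') (c + c') (m + m') z) / (r * \<rho>)\<^sup>2 \<le>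
        C * (\<rho> * (avg_norm p r (\<lambda>z. u z - par_poly a b c m z) / r\<^sup>2)
           + (1 / \<rho>) powr ?q / \<rho>\<^sup>2 * avg_norm p r (\<lambda>z. f z - c0))))))"
    using one_step[OF p, where 'n = 'n] by (rule exE)
  note C = conjunct1[OF C'] conjunct2[OF C', THEN spec, THEN spec, THEN mp, rule_format]
  \<comment> \<open>\<open>l \<le> 1 / C\<^sup>2\<close> is equivalent to
    \<open>C * l \<le> sqrt l\<close>, so the contraction factor no longer involves
    \<open>C\<close>. The bound 1/2 is the range of ratios allowed in
    \<open>one_step\<close>.\<close>
  define l where "l = min (1/2) (1 / C\<^sup>2)"
  have l: "0 < l" "l \<le> 1/2" "l \<le> 1 / C\<^sup>2" using C(1) by (auto simp: l_def)
  have "C * sqrt l \<le> 1"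
  proof -
    have "sqrt l \<le> sqrt (1 / C\<^sup>2)" using l by (intro real_sqrt_le_mono)
    also have "\<dots> = 1 / C" using C(1) by (simp add: real_sqrt_divide)
    finally show ?thesis using C(1) by (simp add: field_simps)
  qed
  then have "C * sqrt l * sqrt l \<le> 1 * sqrt l" using l by (intro mult_right_mono) auto
  moreover have "C * l = C * sqrt l * sqrt l" using l by (simp add: mult.assoc)
  ultimately have Cl: "C * l \<le> sqrt l" by (simp only: mult_1)
  define K where "K = C * ((1 / l) powr ?q / l\<^sup>2)"
  have K: "0 < K" using C(1) l by (simp add: K_def)
  show ?thesis
  proof (rule exI[of _ l], rule exI[of _ C], rule exI[of _ K], intro conjI l C(1) K allI impI)
    fix u f :: "(real ^ 'n) \<times> real \<Rightarrow> real" and r a c0 m :: real and b c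
    assume h: "LpQ p 1 u \<and> LpQ p 1 f \<and> heat_equation_Q1 u f" and r: "0 < r \<and> r \<le> 1"
    let ?X = "avg_norm p r (\<lambda>z. u z - par_poly a b c m z) / r\<^sup>2" and ?Y = "avg_norm p r (\<lambda>z. f z - c0)"
    have X: "0 \<le> ?X" by (simp add: avg_norm_nonneg)
    obtain a' b' c' m' where 1: "transpose c' = c'" "\<bar>a'\<bar> / r\<^sup>2 + norm b' / r + norm c' + \<bar>m'\<bar> \<le> C * (?X + ?Y)"
      and 2: "\<forall>\<rho>. 0 < \<rho> \<and> \<rho> \<le> 1/2 \<longrightarrow>
        avg_norm p (r * \<rho>) (\<lambda>z. u z - par_poly (a + a') (b + b') (c + c') (m + m') z) / (r * \<rho>)\<^sup>2 \<le>
        C * (\<rho> * ?X + (1 / \<rho>) powr ?q / \<rho>\<^sup>2 * ?Y)"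
      using C(2)[OF h r, of a b c m c0] by blast
    have "avg_norm p (r * l) (\<lambda>z. u z - par_poly (a + a') (b + b') (c + c') (m + m') z) / (r * l)\<^sup>2 \<le> C * (l * ?X + (1 / l) powr ?q / l\<^sup>2 * ?Y)"
      using 2 l by blast
    also have "\<dots> = (C * l) * ?X + K * ?Y" by (simp only: K_def distrib_left mult.assoc)
    also have "\<dots> \<le> sqrt l * ?X + K * ?Y" using Cl X by (intro add_right_mono mult_right_mono)
    finally show "\<exists>a' b' c' m'. transpose c' = c' \<and> \<bar>a'\<bar> / r\<^sup>2 + norm b' / r + norm c' + \<bar>m'\<bar> \<le> C * (?X + ?Y) \<and>
      avg_norm p (r * l) (\<lambda>z. u z - par_poly (a + a') (b + b') (c + c') (m + m') z) / (r * l)\<^sup>2 \<le> sqrt l * ?X + K * ?Y"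
      using 1 by blast
  qed
qed

text \<open>Summing the recursion makes the sum of the \<open>e j\<close> reappear on the right with
  factor \<open>th\<close>, where it is absorbed. The induction keeps \<open>e m\<close> on the
  left. Starting at an arbitrary \<open>k\<close> gives control of tails, which the rates
  need.\<close>

lemma contraction_sum:
  fixes e w :: "nat \<Rightarrow> real"
  assumes th: "0 \<le> th" "th < 1" and e: "\<And>k. 0 \<le> e k" and step: "\<And>k. e (Suc k) \<le> th * e k + K * w k"
    and km: "k \<le> m"
  shows "(1 - th) * (\<Sum>j\<in>{k..<m}. e j) \<le> e k + K * (\<Sum>j\<in>{k..<m}. w j)"
  using km
proof -
  have "(\<Sum>j\<in>{k..<m}. e j) + e m \<le> e k + th * (\<Sum>j\<in>{k..<m}. e j) + K * (\<Sum>j\<in>{k..<m}. w j)"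
    using km
  proof (induction m rule: dec_induct)
    case (step n)
    then show ?case using assms(4)[of n] by (simp add: algebra_simps)
  qed simp
  then show ?thesis using e[of m] by (simp add: algebra_simps)
qed

text \<open>Since \<open>s\<close> decreases it can be taken out of a tail at its first index. With
  \<open>s\<close> equal to the square of the radius, the radius, or 1, this yields the parabolic
  rate of convergence for each kind of coefficient.\<close>

lemma telescope_limit:
  fixes x :: "nat \<Rightarrow> 'a::banach"
  assumes d: "summable d" "\<And>j. 0 \<le> d j" and s: "decseq s" "\<And>j. 0 \<le> s j"
    and x: "\<And>j. norm (x (Suc j) - x j) \<le> s j * d j"
  obtains L where "x \<longlonglongrightarrow> L" "\<And>k. norm (L - x k) \<le> s k * (\<Sum>j. d (j + k))"
proof -
  have tail: "norm (x (k + i) - x k) \<le> s k * (\<Sum>j. d (j + k))" for k i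
  proof -
    have "norm (x (k + i) - x k) \<le> (\<Sum>j<i. s k * d (j + k))"
    proof (induction i)
      case (Suc i)
      have "norm (x (k + Suc i) - x k) \<le> norm (x (Suc (k + i)) - x (k + i)) + norm (x (k + i) - x k)"
        using norm_triangle_ineq[of "x (Suc (k + i)) - x (k + i)" "x (k + i) - x k"] by simp
      also have "norm (x (Suc (k + i)) - x (k + i)) \<le> s k * d (i + k)"
        using x[of "k + i"] mult_right_mono[OF decseqD[OF s(1), of k "k + i"] d(2)[of "i + k"]] by (simp add: add.commute)
      finally show ?case using Suc by simp
    qed simp
    also have "\<dots> = s k * (\<Sum>j<i. d (j + k))" by (simp add: sum_distrib_left)
    also have "\<dots> \<le> s k * (\<Sum>j. d (j + k))"
      using d by (intro mult_left_mono s sum_le_suminf) (auto simp: summable_iff_shift)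
    finally show ?thesis .
  qed
  have "summable (\<lambda>j. norm (x (Suc j) - x j))"
  proof (rule summable_comparison_test_ev)
    show "\<forall>\<^sub>F j in sequentially. norm (norm (x (Suc j) - x j)) \<le> s 0 * d j"
      using x mult_right_mono[OF decseqD[OF s(1), of 0] d(2)] by (intro always_eventually allI) (auto intro: order_trans)
    show "summable (\<lambda>j. s 0 * d j)" using d by (intro summable_mult)
  qed
  then have "summable (\<lambda>j. x (Suc j) - x j)" by (rule summable_norm_cancel)
  then have "(\<lambda>n. \<Sum>j<n. x (Suc j) - x j) \<longlonglongrightarrow> (\<Sum>j. x (Suc j) - x j)" by (rule summable_LIMSEQ)
  then have "(\<lambda>n. x n - x 0) \<longlonglongrightarrow> (\<Sum>j. x (Suc j) - x j)" by (simp add: sum_lessThan_telescope)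
  then have "(\<lambda>n. (x n - x 0) + x 0) \<longlonglongrightarrow> (\<Sum>j. x (Suc j) - x j) + x 0" by (intro tendsto_intros)
  then obtain L where L: "x \<longlonglongrightarrow> L" by auto
  have "norm (L - x k) \<le> s k * (\<Sum>j. d (j + k))" for k
  proof (rule tendsto_upperbound)
    have "(\<lambda>i. x (i + k)) \<longlonglongrightarrow> L" by (rule LIMSEQ_ignore_initial_segment[OF L])
    then show "(\<lambda>i. norm (x (i + k) - x k)) \<longlonglongrightarrow> norm (L - x k)" by (intro tendsto_intros)
    show "\<forall>\<^sub>F i in sequentially. norm (x (i + k) - x k) \<le> s k * (\<Sum>j. d (j + k))"
      using tail[of k] by (simp add: add.commute)
  qed simp
  then show ?thesis using that L by blast
qed

text \<open>The conclusion of \<open>one_step_fixed\<close> for a single pair \<open>u\<close>,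
  \<open>f\<close>. The iteration uses only this property and no longer the equation.\<close>

definition decay_step :: "real \<Rightarrow> real \<Rightarrow> real \<Rightarrow> real \<Rightarrow>
    ((real ^ 'n) \<times> real \<Rightarrow> real) \<Rightarrow> ((real ^ 'n) \<times> real \<Rightarrow> real) \<Rightarrow> bool" where
  "decay_step p l C K u f \<longleftrightarrow> (\<forall>r a b c m c0. 0 < r \<and> r \<le> 1 \<longrightarrow> (\<exists>a' b' c' m'. transpose c' = c' \<and>
      \<bar>a'\<bar> / r\<^sup>2 + norm b' / r + norm c' + \<bar>m'\<bar>
        \<le> C * (avg_norm p r (\<lambda>z. u z - par_poly a b c m z) / r\<^sup>2 + avg_norm p r (\<lambda>z. f z - c0)) \<and>
      avg_norm p (r * l) (\<lambda>z. u z - par_poly (a + a') (b + b') (c + c') (m + m') z) / (r * l)\<^sup>2 \<le>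
        sqrt l * (avg_norm p r (\<lambda>z. u z - par_poly a b c m z) / r\<^sup>2) + K * avg_norm p r (\<lambda>z. f z - c0)))"

lemma excess_step:
  fixes u f :: "(real ^ 'n) \<times> real \<Rightarrow> real"
  assumes st: "decay_step p l C K u f" and l: "0 < l" and K: "0 < K" and r: "0 < r" "r \<le> 1"
  shows "excess p u (r * l) \<le> sqrt l * excess p u r + K * osc p f r"
proof (rule field_le_epsilon)
  fix e :: real assume e: "0 < e"
  \<comment> \<open>The slack is chosen so that near-minimisers of both infima together cost exactly
    \<open>e\<close>.\<close>
  define d where "d = e / (sqrt l + K)"
  have sk: "0 < sqrt l + K" using l K by (simp add: add_pos_pos)
  have d: "0 < d" using e sk by (simp add: d_def)
  obtain P where P: "P \<in> P2_t" "avg_norm p r (\<lambda>z. u z - P z) / r\<^sup>2 < excess p u r + d"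
    using excess_approx[OF d] by blast
  obtain c0 where c0: "avg_norm p r (\<lambda>z. f z - c0) < osc p f r + d" using osc_approx[OF d] by blast
  obtain a b c m where Pe: "P = par_poly a b c m" and sym: "transpose c = c" using P(1) by (auto simp: P2_t_def)
  obtain a' b' c' m' where s': "transpose c' = c'"
    and le: "avg_norm p (r * l) (\<lambda>z. u z - par_poly (a + a') (b + b') (c + c') (m + m') z) / (r * l)\<^sup>2 \<le>
        sqrt l * (avg_norm p r (\<lambda>z. u z - P z) / r\<^sup>2) + K * avg_norm p r (\<lambda>z. f z - c0)"
    using st r unfolding decay_step_def Pe by blast
  have "transpose (c + c') = c + c'" using sym s' by (simp add: transpose_def vec_eq_iff)
  then have "par_poly (a + a') (b + b') (c + c') (m + m') \<in> P2_t" unfolding P2_t_def by blast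
  then have "excess p u (r * l) \<le> sqrt l * (avg_norm p r (\<lambda>z. u z - P z) / r\<^sup>2) + K * avg_norm p r (\<lambda>z. f z - c0)"
    using order_trans[OF excess_le le] by blast
  also have "\<dots> \<le> sqrt l * (excess p u r + d) + K * (osc p f r + d)"
    using P c0 l K by (intro add_mono mult_left_mono) auto
  also have "\<dots> = sqrt l * excess p u r + K * osc p f r + d * (sqrt l + K)" by (simp add: algebra_simps)
  also have "d * (sqrt l + K) = e" using sk by (simp add: d_def)
  finally show "excess p u (r * l) \<le> sqrt l * excess p u r + K * osc p f r + e" .
qed

text \<open>\<open>?G * S\<close> is the fixed point of
  \<open>x \<mapsto> sqrt l * x + K * S\<close>, so a bound of the form \<open>?B + ?G * S\<close>
  reproduces itself under a step. The first shell is reached by comparison of radii, which produces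
  the power of \<open>1 / l\<close>.\<close>

lemma excess_bound:
  fixes u f :: "(real ^ 'n) \<times> real \<Rightarrow> real"
  assumes p: "0 < p" and u: "LpQ p 1 u" and st: "decay_step p l C K u f" and l: "0 < l" "l \<le> 1/2" and K: "0 < K"
    and R: "0 < R" "R \<le> 1" and S: "\<And>r. 0 < r \<Longrightarrow> r \<le> R \<Longrightarrow> osc p f r \<le> S" and r: "0 < r" "r \<le> R"
  shows "excess p u r \<le> (1 / l) powr (real (CARD('n) + 2) / p + 2) * excess p u R + K / (1 - sqrt l) * S"
proof -
  let ?q = "real (CARD('n) + 2) / p + 2"
  let ?B = "(1 / l) powr ?q * excess p u R" and ?G = "K / (1 - sqrt l)"
  have th: "0 < sqrt l" "sqrt l < 1" using l by auto
  have S0: "0 \<le> S" using S[of R] R osc_nonneg[of p f R] by linarith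
  have G: "0 < ?G" using th K by simp
  have GS: "sqrt l * (?G * S) + K * S = ?G * S" using th by (simp add: field_simps)
  have B0: "0 \<le> ?B" by (simp add: excess_nonneg)
  show ?thesis
  proof (rule geometric_scale_induct[where l = l and R = R and r = r and Q = "\<lambda>r. excess p u r \<le> ?B + ?G * S"])
    fix r assume r: "l * R < r" "r \<le> R"
    have r0: "0 < r" using r l R by (smt (verit) mult_pos_pos)
    have "excess p u r \<le> (R / r) powr ?q * excess p u R" by (rule excess_shrink[OF p u r0 r(2) R(2)])
    also have "\<dots> \<le> ?B"
      using r r0 l R p by (intro mult_right_mono powr_mono2 excess_nonneg) (auto simp: field_simps)
    finally show "excess p u r \<le> ?B + ?G * S" using mult_nonneg_nonneg[OF less_imp_le[OF G] S0] by linarith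
  next
    fix r assume r: "0 < r" "r \<le> R" and IH: "excess p u r \<le> ?B + ?G * S"
    have "excess p u (r * l) \<le> sqrt l * excess p u r + K * osc p f r"
      using excess_step[OF st l(1) K r(1)] r R by simp
    also have "\<dots> \<le> sqrt l * (?B + ?G * S) + K * S"
      using th K by (intro add_mono mult_left_mono IH S r) auto
    also have "\<dots> = sqrt l * ?B + ?G * S" unfolding distrib_left using GS by linarith
    also have "\<dots> \<le> ?B + ?G * S" using B0 th by (intro add_right_mono mult_left_le_one_le) auto
    finally show "excess p u (r * l) \<le> ?B + ?G * S" .
  qed (use l R r in auto)
qed

text \<open>Below a radius \<open>R\<close> where the oscillation is at most \<open>h\<close>, the
  initial bound decays geometrically down to the fixed point \<open>G * h\<close>, which is made
  equal to \<open>e / 2\<close>. The number of steps is uniform in the starting radius, so all radii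
  below \<open>R * l ^ k\<close> are covered.\<close>

lemma excess_vanishes:
  fixes u f :: "(real ^ 'n) \<times> real \<Rightarrow> real"
  assumes p: "0 < p" and u: "LpQ p 1 u" and st: "decay_step p l C K u f" and l: "0 < l" "l \<le> 1/2" and K: "0 < K"
    and lim: "(osc p f \<longlongrightarrow> 0) (at_right 0)"
  shows "(excess p u \<longlongrightarrow> 0) (at_right 0)"
proof (rule order_tendstoI)
  fix a :: real assume "a < 0"
  then show "\<forall>\<^sub>F r in at_right 0. a < excess p u r"
    using excess_nonneg[of p u] by (auto intro!: always_eventually intro: less_le_trans)
next
  fix e :: real assume e: "0 < e"
  have th: "0 < sqrt l" "sqrt l < 1" using l by auto
  define G where "G = K / (1 - sqrt l)"
  have G: "0 < G" using th K by (simp add: G_def)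
  define h where "h = e / (2 * G)"
  have h: "0 < h" "G * h = e / 2" using e G by (auto simp: h_def)
  obtain b where b: "0 < b" "\<And>r. 0 < r \<Longrightarrow> r < b \<Longrightarrow> osc p f r < h"
    using order_tendstoD(2)[OF lim h(1)] by (auto simp: eventually_at_right_field)
  define R where "R = min 1 (b / 2)"
  have R: "0 < R" "R \<le> 1" using b by (auto simp: R_def)
  have S: "osc p f r \<le> h" if "0 < r" "r \<le> R" for r using b(2)[of r] that b(1) by (simp add: R_def)
  define B where "B = (1 / l) powr (real (CARD('n) + 2) / p + 2) * excess p u R + G * h"
  have GS: "sqrt l * (G * h) + K * h = G * h" using th by (simp add: G_def field_simps)
  have it: "excess p u (r * l ^ k) \<le> sqrt l ^ k * B + G * h" if r: "0 < r" "r \<le> R" for r k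
  proof (induction k)
    case 0
    have "excess p u r \<le> B"
      unfolding B_def G_def by (rule excess_bound[OF p u st l K R S r])
    then show ?case using mult_pos_pos[OF G h(1)] by simp
  next
    case (Suc k)
    have lk: "0 < l ^ k" "l ^ k \<le> 1" using l by (auto intro: power_le_one)
    have rk: "0 < r * l ^ k" "r * l ^ k \<le> R" using r lk by (auto intro: order_trans[OF mult_left_le])
    have "excess p u (r * l ^ k * l) \<le> sqrt l * excess p u (r * l ^ k) + K * osc p f (r * l ^ k)"
      using excess_step[OF st l(1) K rk(1)] rk R by simp
    also have "\<dots> \<le> sqrt l * (sqrt l ^ k * B + G * h) + K * h"
      using th K by (intro add_mono mult_left_mono Suc S rk) auto
    also have "\<dots> = sqrt l ^ Suc k * B + G * h" using GS by (simp add: distrib_left mult.assoc)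
    finally show ?case by (simp add: mult_ac)
  qed
  have "(\<lambda>k. sqrt l ^ k * B) \<longlonglongrightarrow> 0 * B" by (intro tendsto_intros LIMSEQ_power_zero) (use th in auto)
  then have "\<forall>\<^sub>F k in sequentially. sqrt l ^ k * B < e / 2"
    using e by (intro order_tendstoD(2)[where y = "0 * B"]) auto
  then obtain k where k: "sqrt l ^ k * B < e / 2" by (auto simp: eventually_sequentially)
  have lk: "0 < l ^ k" using l by simp
  have "excess p u s < e" if "0 < s" "s < R * l ^ k" for s
  proof -
    have "excess p u (s / l ^ k * l ^ k) \<le> sqrt l ^ k * B + G * h"
      using that lk by (intro it) (auto simp: field_simps)
    moreover have sk: "s / l ^ k * l ^ k = s" using l by simp
    ultimately have "excess p u s \<le> sqrt l ^ k * B + G * h" by (simp only: sk)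
    then show ?thesis using k h(2) by linarith
  qed
  then show "\<forall>\<^sub>F r in at_right 0. excess p u r < e"
    using R lk by (auto simp: eventually_at_right_field intro!: exI[of _ "R * l ^ k"])
qed

text \<open>By weak monotonicity the value of \<open>osc\<close> at \<open>a\<close> is dominated by
  its values on the shell \<open>(a, a / l]\<close>, hence by the integral of
  \<open>osc p f s / s\<close> there. This integral is a difference of \<open>\<Phi>\<close>, or,
  after using \<open>s powr (1/2) \<le> sqrt (a / l)\<close>, at most a multiple of a difference of
  \<open>\<Psi>\<close>. Half-open shells are disjoint, so along a geometric sequence the
  differences telescope.\<close>

lemma osc_integral_bounds:
  fixes f :: "(real ^ 'n) \<times> real \<Rightarrow> real"
  assumes p: "0 < p" and f: "LpQ p 1 f" and l: "0 < l" "l \<le> 1/2"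
    and di: "set_integrable lebesgue {0<..1} (\<lambda>s. osc p f s / s)"
  defines "\<Phi> \<equiv> \<lambda>t. LINT s:{0<..t}|lebesgue. osc p f s / s"
    and "\<Psi> \<equiv> \<lambda>t. LINT s:{t<..1}|lebesgue. osc p f s / s powr (1 + 1/2)"
    and "D \<equiv> (1 / l) powr (real (CARD('n) + 2) / p) / (1 - l)"
  shows "\<And>a. 0 < a \<Longrightarrow> a \<le> l \<Longrightarrow> osc p f a \<le> D * (\<Phi> (a / l) - \<Phi> a)"
    "\<And>a. 0 < a \<Longrightarrow> a \<le> l \<Longrightarrow> osc p f a \<le> D * sqrt (a / l) * (\<Psi> a - \<Psi> (a / l))"
    "\<And>a b. 0 \<le> a \<Longrightarrow> a \<le> b \<Longrightarrow> b \<le> 1 \<Longrightarrow> \<Phi> a \<le> \<Phi> b"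
    "\<And>a b. 0 < a \<Longrightarrow> a \<le> b \<Longrightarrow> b \<le> 1 \<Longrightarrow> \<Psi> b \<le> \<Psi> a"
    "\<And>a. 0 \<le> a \<Longrightarrow> a \<le> 1 \<Longrightarrow> 0 \<le> \<Phi> a" "\<And>a. 0 \<le> \<Psi> a"
    "\<And>a b. 0 < a \<Longrightarrow> a \<le> b \<Longrightarrow> b \<le> 1 \<Longrightarrow> \<Psi> b \<le> (LINT s:{a..1}|lebesgue. osc p f s / s powr (1 + 1/2))"
proof -
  let ?g = "\<lambda>s. osc p f s / s" and ?h = "\<lambda>s. osc p f s / s powr (1 + 1/2)"
  have hg: "?h s = ?g s * s powr (- (1/2))" if "0 < s" for s
    using that powr_add[of s 1 "1/2"] by (simp add: powr_minus_divide)
  have gi: "set_integrable lebesgue A ?g" if "A \<subseteq> {0<..1}" "A \<in> sets lebesgue" for A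
    using set_integrable_subset[OF di] that by blast
  \<comment> \<open>Measurability of the oscillation is taken from the integrability hypothesis: the
    second integrand is the first one times a power of \<open>s\<close> that is bounded away from
    0.\<close>
  have hi: "set_integrable lebesgue A ?h" if "0 < a" "A \<subseteq> {a..1}" "A \<in> sets lebesgue" for A a
  proof -
    have A: "A \<subseteq> {0<..1}" using that by force
    have b: "integrable lebesgue (\<lambda>s. indicator A s *\<^sub>R ?g s)" using gi[OF A that(3)] by (simp add: set_integrable_def)
    have "integrable lebesgue (\<lambda>s. indicator A s *\<^sub>R (indicator A s *\<^sub>R ?g s * s powr (- (1/2))))"
    proof (rule Bochner_Integration.integrable_bound[OF integrable_mult_right[OF b, of "a powr (- (1/2))"]])
      show "(\<lambda>s. indicator A s *\<^sub>R (indicator A s *\<^sub>R ?g s * s powr (- (1/2)))) \<in> borel_measurable lebesgue"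
      proof -
        have [measurable]: "(\<lambda>s. indicator A s *\<^sub>R ?g s) \<in> borel_measurable lebesgue" using b by simp
        have [measurable]: "(\<lambda>s::real. s powr (- (1/2))) \<in> borel_measurable lebesgue"
          by (intro measurable_completion) measurable
        have [measurable]: "A \<in> sets lebesgue" by (rule that)
        show ?thesis by measurable
      qed
      show "AE s in lebesgue. norm (indicator A s *\<^sub>R (indicator A s *\<^sub>R ?g s * s powr (- (1/2)))) \<le>
          norm (a powr (- (1/2)) * (indicator A s *\<^sub>R ?g s))"
      proof (rule AE_I2)
        fix s
        show "norm (indicator A s *\<^sub>R (indicator A s *\<^sub>R ?g s * s powr (- (1/2)))) \<le> norm (a powr (- (1/2)) * (indicator A s *\<^sub>R ?g s))"
        proof (cases "s \<in> A")
          case True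
          then have "a \<le> s" using that by auto
          then have "s powr (- (1/2)) \<le> a powr (- (1/2))" using that(1) by (intro powr_mono2') auto
          then show ?thesis using True osc_nonneg[of p f s]
            by (simp add: abs_mult mult.commute mult_left_mono divide_right_mono)
        qed simp
      qed
    qed
    also have "(\<lambda>s. indicator A s *\<^sub>R (indicator A s *\<^sub>R ?g s * s powr (- (1/2)))) = (\<lambda>s. indicator A s *\<^sub>R ?h s)"
    proof
      fix s
      show "indicator A s *\<^sub>R (indicator A s *\<^sub>R ?g s * s powr (- (1/2))) = indicator A s *\<^sub>R ?h s"
        using hg[of s] A by (cases "s \<in> A") auto
    qed
    finally show ?thesis by (simp add: set_integrable_def)
  qed
  have gnn: "0 \<le> (LINT s:A|lebesgue. ?g s)" if "A \<subseteq> {0<..}" for A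
    unfolding set_lebesgue_integral_def
    by (intro Bochner_Integration.integral_nonneg) (use that osc_nonneg[of p f] in \<open>auto simp: indicator_def subset_eq\<close>)
  have hnn: "0 \<le> (LINT s:A|lebesgue. ?h s)" for A
    unfolding set_lebesgue_integral_def
    by (intro Bochner_Integration.integral_nonneg) (use osc_nonneg[of p f] in \<open>auto simp: indicator_def\<close>)
  have \<Phi>_split: "\<Phi> b = \<Phi> a + (LINT s:{a<..b}|lebesgue. ?g s)" if "0 \<le> a" "a \<le> b" "b \<le> 1" for a b
  proof -
    have e: "{0<..b} = {0<..a} \<union> {a<..b}" using that by auto
    show ?thesis unfolding \<Phi>_def e using that by (intro set_integral_Un gi) auto
  qed
  have \<Psi>_split: "\<Psi> a = (LINT s:{a<..b}|lebesgue. ?h s) + \<Psi> b" if "0 < a" "a \<le> b" "b \<le> 1" for a b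
  proof -
    have e: "{a<..1} = {a<..b} \<union> {b<..1}" using that by auto
    show ?thesis unfolding \<Psi>_def e using that by (intro set_integral_Un hi[OF that(1)]) auto
  qed
  show "\<Phi> a \<le> \<Phi> b" if "0 \<le> a" "a \<le> b" "b \<le> 1" for a b
  proof -
    have "{a<..b} \<subseteq> {0<..}" using that by auto
    from gnn[OF this] show ?thesis using \<Phi>_split[OF that] by linarith
  qed
  show "\<Psi> b \<le> \<Psi> a" if "0 < a" "a \<le> b" "b \<le> 1" for a b
    using \<Psi>_split[OF that] hnn[of "{a<..b}"] by auto
  show "0 \<le> \<Phi> a" if "0 \<le> a" "a \<le> 1" for a unfolding \<Phi>_def by (rule gnn) auto
  show "0 \<le> \<Psi> a" for a unfolding \<Psi>_def by (rule hnn)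
  show "\<Psi> b \<le> (LINT s:{a..1}|lebesgue. ?h s)" if "0 < a" "a \<le> b" "b \<le> 1" for a b
  proof -
    have "{a..1} = {a..b} \<union> {b<..1}" using that by auto
    then have "(LINT s:{a..1}|lebesgue. ?h s) = (LINT s:{a..b}|lebesgue. ?h s) + \<Psi> b"
      unfolding \<Psi>_def using that by (simp only:) (intro set_integral_Un hi[OF that(1)], auto)
    then show ?thesis using hnn[of "{a..b}"] by simp
  qed
  let ?k = "(1 / l) powr (real (CARD('n) + 2) / p)"
  have k: "0 < ?k" using l by simp
  have main: "osc p f a \<le> D * (LINT s:{a<..a/l}|lebesgue. ?g s)" if a: "0 < a" "a \<le> l" for a
  proof -
    have al: "a < a / l" "a / l \<le> 1" using a l by (auto simp: field_simps)
    \<comment> \<open>On the shell \<open>osc p f s\<close> is at least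
      \<open>osc p f a / ?k\<close> and \<open>1 / s\<close> at least \<open>l / a\<close>. The
      length of the shell times \<open>l / a\<close> is \<open>1 - l\<close>, the denominator of
      \<open>D\<close>.\<close>
    have "(LINT s:{a<..a/l}|lebesgue. osc p f a / ?k * (l / a)) \<le> (LINT s:{a<..a/l}|lebesgue. ?g s)"
    proof (rule set_integral_mono)
      show "set_integrable lebesgue {a<..a/l} (\<lambda>s. osc p f a / ?k * (l / a))"
        unfolding set_integrable_def by (intro integrable_scaleR_left integrable_real_indicator) (auto simp: emeasure_lborel_Ioc al less_imp_le)
      show "set_integrable lebesgue {a<..a/l} ?g"
        by (intro gi subsetI) (use a in \<open>auto intro: order_trans[OF _ al(2)]\<close>)
      fix s assume s: "s \<in> {a<..a/l}"
      have s1: "s \<le> 1" by (rule order_trans[OF _ al(2)]) (use s in auto)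
      have s0: "0 < s" "s / a \<le> 1 / l" using s a l by (auto simp: field_simps)
      have "osc p f a \<le> (s / a) powr (real (CARD('n) + 2) / p) * osc p f s"
        using s a s0 s1 by (intro osc_shrink[OF p f]) auto
      also have "\<dots> \<le> ?k * osc p f s"
        using s0 s a p by (intro mult_right_mono powr_mono2 osc_nonneg) auto
      finally have "osc p f a / ?k \<le> osc p f s" using k by (simp add: divide_le_eq mult.commute)
      moreover have "l / a \<le> 1 / s" using s0 s a l by (simp add: field_simps)
      ultimately show "osc p f a / ?k * (l / a) \<le> ?g s"
        using mult_mono[of "osc p f a / ?k" "osc p f s" "l / a" "1 / s"] osc_nonneg[of p f s] l a by simp
    qed
    also have "(LINT s:{a<..a/l}|lebesgue. osc p f a / ?k * (l / a)) = osc p f a / D"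
    proof -
      have "(LINT s:{a<..a/l}|lebesgue. osc p f a / ?k * (l / a)) = (a / l - a) * (osc p f a / ?k * (l / a))"
        using al by (simp add: set_integral_const measure_lborel_Ioc measure_completion)
      also have "\<dots> = osc p f a / D" using a l k by (simp add: D_def field_simps)
      finally show ?thesis .
    qed
    finally have "osc p f a / D \<le> (LINT s:{a<..a/l}|lebesgue. ?g s)" .
    moreover have "0 < D" using k l by (simp add: D_def)
    ultimately show ?thesis by (simp add: divide_le_eq mult.commute)
  qed
  have D0: "0 < D" using k l by (simp add: D_def)
  show "osc p f a \<le> D * (\<Phi> (a / l) - \<Phi> a)" if a: "0 < a" "a \<le> l" for a
  proof -
    have al: "a \<le> a / l" "a / l \<le> 1" using a l by (auto simp: field_simps)
    show ?thesis using main[OF a] \<Phi>_split[of a "a / l"] a al by simp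
  qed
  show "osc p f a \<le> D * sqrt (a / l) * (\<Psi> a - \<Psi> (a / l))" if a: "0 < a" "a \<le> l" for a
  proof -
    have al: "a \<le> a / l" "a / l \<le> 1" using a l by (auto simp: field_simps)
    have "(LINT s:{a<..a/l}|lebesgue. ?g s) \<le> (LINT s:{a<..a/l}|lebesgue. sqrt (a / l) * ?h s)"
    proof (rule set_integral_mono)
      show "set_integrable lebesgue {a<..a/l} ?g"
        by (intro gi subsetI) (use a in \<open>auto intro: order_trans[OF _ al(2)]\<close>)
      show "set_integrable lebesgue {a<..a/l} (\<lambda>s. sqrt (a / l) * ?h s)"
        by (intro set_integrable_mult_right hi[OF a(1)] subsetI) (auto intro: order_trans[OF _ al(2)])
      fix s assume s: "s \<in> {a<..a/l}"
      have s0: "0 < s" using s a by auto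
      have "s powr (1/2) \<le> sqrt (a / l)" using s s0 by (simp add: powr_half_sqrt real_sqrt_le_mono)
      then have "1 \<le> sqrt (a / l) * s powr (- (1/2))" using s0 by (simp add: powr_minus_divide field_simps)
      then have "?g s * 1 \<le> ?g s * (sqrt (a / l) * s powr (- (1/2)))"
        using osc_nonneg[of p f s] s0 by (intro mult_left_mono) auto
      then show "?g s \<le> sqrt (a / l) * ?h s" unfolding hg[OF s0] by (simp add: mult_ac)
    qed
    also have "\<dots> = sqrt (a / l) * (\<Psi> a - \<Psi> (a / l))"
      by (subst set_integral_mult_right, subst \<Psi>_split[OF a(1) al]) simp
    finally have "D * (LINT s:{a<..a/l}|lebesgue. ?g s) \<le> D * (sqrt (a / l) * (\<Psi> a - \<Psi> (a / l)))"
      using D0 by (intro mult_left_mono) auto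
    with main[OF a] show ?thesis by (simp only: mult.assoc)
  qed
qed

lemma ex_geometric_scale:
  fixes l r :: real
  assumes l: "0 < l" "l < 1" and r: "0 < r" "r \<le> 1"
  shows "\<exists>k. l ^ Suc k < r \<and> r \<le> l ^ k"
proof (rule geometric_scale_induct[OF l, of 1 "\<lambda>r. \<exists>k. l ^ Suc k < r \<and> r \<le> l ^ k"])
  fix r assume "\<exists>k. l ^ Suc k < r \<and> r \<le> l ^ k"
  then obtain k where "l ^ Suc k < r" "r \<le> l ^ k" by blast
  then have "l ^ Suc (Suc k) < r * l" "r * l \<le> l ^ Suc k" using l by (auto simp: mult.commute mult_less_cancel_left_pos)
  then show "\<exists>k. l ^ Suc k < r * l \<and> r * l \<le> l ^ k" by blast
qed (use r in \<open>auto intro: exI[of _ 0]\<close>)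

text \<open>Dependent choice along the radii \<open>l ^ k\<close>, starting from the zero
  polynomial. The strict inequality for \<open>y k\<close> provides an admissible constant
  \<open>c0\<close> at each scale, although the infimum in \<open>osc\<close> need not be
  attained.\<close>

lemma decay_sequence:
  fixes u f :: "(real ^ 'n) \<times> real \<Rightarrow> real" and y :: "nat \<Rightarrow> real"
  assumes st: "decay_step p l C K u f" and l: "0 < l" "l \<le> 1/2" and C: "0 < C" and K: "0 < K"
    and y: "\<And>k. osc p f (l ^ k) < y k"
  shows "\<exists>(a :: nat \<Rightarrow> real) (b :: nat \<Rightarrow> real ^ 'n) (c :: nat \<Rightarrow> real ^ 'n ^ 'n) (m :: nat \<Rightarrow> real).
    a 0 = 0 \<and> b 0 = 0 \<and> c 0 = 0 \<and> m 0 = 0 \<and> (\<forall>k. transpose (c k) = c k) \<and>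
    (\<forall>k. \<bar>a (Suc k) - a k\<bar> / (l ^ k)\<^sup>2 + norm (b (Suc k) - b k) / l ^ k + norm (c (Suc k) - c k) + \<bar>m (Suc k) - m k\<bar>
       \<le> C * (avg_norm p (l ^ k) (\<lambda>z. u z - par_poly (a k) (b k) (c k) (m k) z) / (l ^ k)\<^sup>2 + y k)) \<and>
    (\<forall>k. avg_norm p (l ^ Suc k) (\<lambda>z. u z - par_poly (a (Suc k)) (b (Suc k)) (c (Suc k)) (m (Suc k)) z) / (l ^ Suc k)\<^sup>2
       \<le> sqrt l * (avg_norm p (l ^ k) (\<lambda>z. u z - par_poly (a k) (b k) (c k) (m k) z) / (l ^ k)\<^sup>2) + K * y k)"
proof -
  \<comment> \<open>Dependent choice produces a single sequence, so the four coefficients are packed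
    into one state and read off by projections.\<close>
  define A :: "real \<times> (real ^ 'n) \<times> (real ^ 'n ^ 'n) \<times> real \<Rightarrow> real" where "A x = fst x" for x
  define B :: "real \<times> (real ^ 'n) \<times> (real ^ 'n ^ 'n) \<times> real \<Rightarrow> real ^ 'n" where "B x = fst (snd x)" for x
  define G :: "real \<times> (real ^ 'n) \<times> (real ^ 'n ^ 'n) \<times> real \<Rightarrow> real ^ 'n ^ 'n" where "G x = fst (snd (snd x))" for x
  define M :: "real \<times> (real ^ 'n) \<times> (real ^ 'n ^ 'n) \<times> real \<Rightarrow> real" where "M x = snd (snd (snd x))" for x
  define E where "E x r = avg_norm p r (\<lambda>z. u z - par_poly (A x) (B x) (G x) (M x) z) / r\<^sup>2" for x r
  have "\<exists>X. \<forall>k. ((k = 0 \<longrightarrow> X k = (0, 0, 0, 0)) \<and> transpose (G (X k)) = G (X k)) \<and>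
     (\<bar>A (X (Suc k)) - A (X k)\<bar> / (l ^ k)\<^sup>2 + norm (B (X (Suc k)) - B (X k)) / l ^ k + norm (G (X (Suc k)) - G (X k))
        + \<bar>M (X (Suc k)) - M (X k)\<bar> \<le> C * (E (X k) (l ^ k) + y k) \<and>
      E (X (Suc k)) (l ^ Suc k) \<le> sqrt l * E (X k) (l ^ k) + K * y k)"
  proof (rule dependent_nat_choice)
    show "\<exists>x. (0 = (0::nat) \<longrightarrow> x = (0, 0, 0, 0)) \<and> transpose (G x) = G x"
      by (rule exI[of _ "(0, 0, 0, 0)"]) (simp add: G_def transpose_def vec_eq_iff)
  next
    fix x :: "real \<times> (real ^ 'n) \<times> (real ^ 'n ^ 'n) \<times> real" and k :: nat
    assume x: "(k = 0 \<longrightarrow> x = (0, 0, 0, 0)) \<and> transpose (G x) = G x"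
    have lk: "0 < l ^ k" "l ^ k \<le> 1" using l by (auto intro: power_le_one)
    obtain c0 where c0: "avg_norm p (l ^ k) (\<lambda>z. f z - c0) < osc p f (l ^ k) + (y k - osc p f (l ^ k))"
      by (rule osc_approx[of "y k - osc p f (l ^ k)"]) (use y[of k] in simp)
    obtain a' b' c' m' where s: "transpose c' = c'"
      and 1: "\<bar>a'\<bar> / (l ^ k)\<^sup>2 + norm b' / l ^ k + norm c' + \<bar>m'\<bar> \<le> C * (E x (l ^ k) + avg_norm p (l ^ k) (\<lambda>z. f z - c0))"
      and 2: "avg_norm p (l ^ k * l) (\<lambda>z. u z - par_poly (A x + a') (B x + b') (G x + c') (M x + m') z) / (l ^ k * l)\<^sup>2
        \<le> sqrt l * E x (l ^ k) + K * avg_norm p (l ^ k) (\<lambda>z. f z - c0)"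
      using st lk unfolding decay_step_def E_def by blast
    have c1: "avg_norm p (l ^ k) (\<lambda>z. f z - c0) \<le> y k" using c0 by simp
    show "\<exists>x'. ((Suc k = 0 \<longrightarrow> x' = (0, 0, 0, 0)) \<and> transpose (G x') = G x') \<and>
     (\<bar>A x' - A x\<bar> / (l ^ k)\<^sup>2 + norm (B x' - B x) / l ^ k + norm (G x' - G x) + \<bar>M x' - M x\<bar> \<le> C * (E x (l ^ k) + y k) \<and>
      E x' (l ^ Suc k) \<le> sqrt l * E x (l ^ k) + K * y k)"
    proof (rule exI[of _ "(A x + a', B x + b', G x + c', M x + m')"], intro conjI)
      let ?x = "(A x + a', B x + b', G x + c', M x + m')"
      have X: "A ?x = A x + a'" "B ?x = B x + b'" "G ?x = G x + c'" "M ?x = M x + m'"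
        by (simp_all add: A_def B_def G_def M_def)
      show "transpose (G ?x) = G ?x" using s x unfolding X by (simp add: transpose_def vec_eq_iff)
      have "C * (E x (l ^ k) + avg_norm p (l ^ k) (\<lambda>z. f z - c0)) \<le> C * (E x (l ^ k) + y k)"
        using C c1 by (intro mult_left_mono) auto
      then show "\<bar>A ?x - A x\<bar> / (l ^ k)\<^sup>2 + norm (B ?x - B x) / l ^ k + norm (G ?x - G x) + \<bar>M ?x - M x\<bar> \<le> C * (E x (l ^ k) + y k)"
        using 1 unfolding X by simp
      have "K * avg_norm p (l ^ k) (\<lambda>z. f z - c0) \<le> K * y k" using K c1 by (intro mult_left_mono) auto
      moreover have lS: "l ^ Suc k = l ^ k * l" by simp
      ultimately show "E ?x (l ^ Suc k) \<le> sqrt l * E x (l ^ k) + K * y k"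
        using 2 unfolding E_def X lS by linarith
    qed simp
  qed
  then obtain X where X: "X 0 = (0, 0, 0, 0)" "\<And>k. transpose (G (X k)) = G (X k)"
    "\<And>k. \<bar>A (X (Suc k)) - A (X k)\<bar> / (l ^ k)\<^sup>2 + norm (B (X (Suc k)) - B (X k)) / l ^ k + norm (G (X (Suc k)) - G (X k))
        + \<bar>M (X (Suc k)) - M (X k)\<bar> \<le> C * (E (X k) (l ^ k) + y k)"
    "\<And>k. E (X (Suc k)) (l ^ Suc k) \<le> sqrt l * E (X k) (l ^ k) + K * y k" by blast
  show ?thesis
    by (rule exI[of _ "\<lambda>k. A (X k)"], rule exI[of _ "\<lambda>k. B (X k)"], rule exI[of _ "\<lambda>k. G (X k)"], rule exI[of _ "\<lambda>k. M (X k)"])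
      (use X in \<open>auto simp: E_def A_def B_def G_def M_def\<close>)
qed

text \<open>The induction carries the additional term \<open>2 * l ^ m\<close> on the left, which
  pays for the next summand because \<open>2 * l \<le> 1\<close>.\<close>

lemma geometric_tail_le:
  fixes l :: real
  assumes "0 \<le> l" "l \<le> 1/2" "k \<le> m"
  shows "(\<Sum>j\<in>{k..<m}. l ^ j) \<le> 2 * l ^ k"
proof -
  have "(\<Sum>j\<in>{k..<m}. l ^ j) + 2 * l ^ m \<le> 2 * l ^ k"
    using assms(3)
  proof (induction m rule: dec_induct)
    case (step n)
    have "2 * (l * l ^ n) \<le> 1 * l ^ n"
      using mult_right_mono[of "2 * l" 1 "l ^ n"] assms by simp
    then show ?case using step by simp
  qed simp
  then show ?thesis using assms by (smt (verit) zero_le_power)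
qed

text \<open>The slack \<open>\<eta>\<close> allows near minimisers of the infima in \<open>osc\<close> to be chosen at every scale.\<close>

lemma dini_core:
  fixes p l C K :: real
  assumes p: "1 < p" and l: "0 < l" "l \<le> 1/2" and C: "0 < C" and K: "0 < K"
  shows "\<exists>D>0. \<forall>(u :: (real ^ 'n) \<times> real \<Rightarrow> real) f \<eta> M. LpQ p 1 u \<and> LpQ p 1 f \<and> decay_step p l C K u f \<and> 0 < \<eta> \<and>
    set_integrable lebesgue {0<..1} (\<lambda>s. osc p f s / s) \<and>
    M = (LINT s:{0<..1}|lebesgue. osc p f s / s) + avg_norm p 1 u + avg_norm p 1 f + \<eta> \<longrightarrow>
    (\<exists>e. summable e \<and> (\<forall>k r. l ^ Suc k < r \<and> r \<le> l ^ k \<longrightarrow> excess p u r \<le> e k)) \<and>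
    (\<exists>a b c m. transpose c = c \<and> \<bar>a\<bar> + norm b + norm c + \<bar>m\<bar> \<le> D * M \<and>
      ((\<lambda>r. avg_norm p r (\<lambda>z. u z - par_poly a b c m z) / r\<^sup>2) \<longlongrightarrow> 0) (at_right 0) \<and>
      (\<forall>r. 0 < r \<and> r \<le> l \<longrightarrow> avg_norm p r (\<lambda>z. u z - par_poly a b c m z) / r\<^sup>2 \<le>
        D * (M * sqrt r + (LINT s:{0<..r}|lebesgue. osc p f s / s)
          + sqrt r * (LINT s:{r..1}|lebesgue. osc p f s / s powr (1 + 1/2)))))"
proof -
  have p0: "0 < p" and p1: "1 \<le> p" using p by auto
  define q where "q = real (CARD('n) + 2) / p"
  have q: "0 \<le> q" using p0 by (simp add: q_def)
  define th where "th = sqrt l"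
  have th: "0 < th" "th < 1" using l by (auto simp: th_def)
  have th2: "th\<^sup>2 = l" using l by (simp add: th_def)
  define W where "W = unit_vol TYPE('n) powr (1/p)"
  have W: "0 < W" using unit_vol_pos[where 'n = 'n] by (simp add: W_def)
  define Q where "Q = (1 / l) powr q"
  have Q: "0 < Q" using l by (simp add: Q_def)
  define Q2 where "Q2 = (1 / l) powr (q + 2)"
  have Q2: "0 < Q2" using l by (simp add: Q2_def)
  define H where "H = Q / (1 - l)"
  have H: "0 < H" using Q l by (simp add: H_def)
  \<comment> \<open>\<open>A\<close> and \<open>G\<close> are the constants in the bound of the
    remainders \<open>e k\<close>: \<open>A\<close> collects the initial value, the first step and
    the slack, \<open>G\<close> the oscillations. \<open>T1\<close> and \<open>T2\<close> belong to
    the tails of the increments of the coefficients.\<close>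
  define A where "A = 1 + 2 * K / th + K / (1 - th)"
  have A: "0 < A" using K th by (simp add: A_def add_pos_pos)
  define G where "G = K * H / th\<^sup>2"
  have G: "0 < G" using K H th by (simp add: G_def)
  define T1 where "T1 = C / (1 - th)"
  define T2 where "T2 = C * (K / (1 - th) + 1)"
  have T: "0 < T1" "0 < T2" using C K th by (auto simp: T1_def T2_def add_pos_pos)
  define D1 where "D1 = 4 * (T1 + T2 * (3 + Q + H))"
  have D1: "0 < D1" using T Q H by (simp add: D1_def add_pos_pos)
  define c1 where "c1 = Q2 * (4 * (1 + 4 * W * T1))"
  define c2 where "c2 = Q2 * (16 * W * T2)"
  have c12: "0 < c1" "0 < c2" using Q2 W T by (auto simp: c1_def c2_def add_pos_pos)
  define D2 where "D2 = c1 * A / th + c1 * G / th + c2 * ((1 + Q) * H) / th\<^sup>2 + c2 * H + c2 * 2 / th"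
  have D2: "0 < D2" using c12 A G Q H th by (simp add: D2_def add_pos_pos)
  define D where "D = D1 + D2"
  have D: "0 < D" "D1 \<le> D" "D2 \<le> D" using D1 D2 by (auto simp: D_def)
  show ?thesis
  proof (rule exI[of _ D], intro conjI D(1) allI impI)
    fix u f :: "(real ^ 'n) \<times> real \<Rightarrow> real" and \<eta> M :: real
    let ?\<Phi> = "\<lambda>t. LINT s:{0<..t}|lebesgue. osc p f s / s"
    let ?\<Psi> = "\<lambda>t. LINT s:{t<..1}|lebesgue. osc p f s / s powr (1 + 1/2)"
    let ?\<Psi>' = "\<lambda>r. LINT s:{r..1}|lebesgue. osc p f s / s powr (1 + 1/2)"
    assume "LpQ p 1 u \<and> LpQ p 1 f \<and> decay_step p l C K u f \<and> 0 < \<eta> \<and>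
      set_integrable lebesgue {0<..1} (\<lambda>s. osc p f s / s) \<and> M = ?\<Phi> 1 + avg_norm p 1 u + avg_norm p 1 f + \<eta>"
    then have u: "LpQ p 1 u" and f: "LpQ p 1 f" and st: "decay_step p l C K u f" and eta: "0 < \<eta>"
      and di: "set_integrable lebesgue {0<..1} (\<lambda>s. osc p f s / s)" and M: "M = ?\<Phi> 1 + avg_norm p 1 u + avg_norm p 1 f + \<eta>" by auto
    note OB = osc_integral_bounds[OF p0 f l di, folded q_def, folded Q_def, folded H_def]
    have Mu: "avg_norm p 1 u \<le> M" and Mf: "avg_norm p 1 f \<le> M" and M\<Phi>: "?\<Phi> 1 \<le> M" and M\<eta>: "\<eta> \<le> M" and M0: "0 < M"
      using OB(5)[of 1] eta avg_norm_nonneg[of p 1 u] avg_norm_nonneg[of p 1 f] unfolding M by auto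
    define r where "r k = l ^ k" for k :: nat
    have r: "0 < r k" "r k \<le> 1" for k using l by (auto simp: r_def intro: power_le_one)
    have rS: "r (Suc k) = l * r k" "r (Suc k) / l = r k" "r (Suc k) \<le> l" "r (Suc k) \<le> r k" for k
      using l r[of k] by (auto simp: r_def mult_left_le mult_left_le_one_le intro: power_le_one)
    have rsq: "sqrt (r k) = th ^ k" for k by (simp add: r_def th_def real_sqrt_power)
    \<comment> \<open>The slack shrinks like the radius, so its tail from \<open>k\<close> on is at
      most \<open>2 * \<eta> * r k\<close> and does not spoil the rate.\<close>
    define y where "y k = osc p f (r k) + \<eta> * r k" for k
    have yo: "osc p f (l ^ k) < y k" for k using eta r[of k] by (simp add: y_def r_def)
    obtain a :: "nat \<Rightarrow> real" and b :: "nat \<Rightarrow> real ^ 'n" and c :: "nat \<Rightarrow> real ^ 'n ^ 'n" and m :: "nat \<Rightarrow> real"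
      where "a 0 = 0 \<and> b 0 = 0 \<and> c 0 = 0 \<and> m 0 = 0 \<and> (\<forall>k. transpose (c k) = c k) \<and>
      (\<forall>k. \<bar>a (Suc k) - a k\<bar> / (l ^ k)\<^sup>2 + norm (b (Suc k) - b k) / l ^ k + norm (c (Suc k) - c k) + \<bar>m (Suc k) - m k\<bar>
         \<le> C * (avg_norm p (l ^ k) (\<lambda>z. u z - par_poly (a k) (b k) (c k) (m k) z) / (l ^ k)\<^sup>2 + y k)) \<and>
      (\<forall>k. avg_norm p (l ^ Suc k) (\<lambda>z. u z - par_poly (a (Suc k)) (b (Suc k)) (c (Suc k)) (m (Suc k)) z) / (l ^ Suc k)\<^sup>2
         \<le> sqrt l * (avg_norm p (l ^ k) (\<lambda>z. u z - par_poly (a k) (b k) (c k) (m k) z) / (l ^ k)\<^sup>2) + K * y k)"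
      using decay_sequence[OF st l C K yo] by (elim exE) (rule that)
    note seq = this
    define e where "e k = avg_norm p (r k) (\<lambda>z. u z - par_poly (a k) (b k) (c k) (m k) z) / (r k)\<^sup>2" for k
    have init: "a 0 = 0" "b 0 = 0" "c 0 = 0" "m 0 = 0" and sym: "\<And>k. transpose (c k) = c k"
      and co: "\<And>k. \<bar>a (Suc k) - a k\<bar> / (r k)\<^sup>2 + norm (b (Suc k) - b k) / r k + norm (c (Suc k) - c k) + \<bar>m (Suc k) - m k\<bar>
         \<le> C * (e k + y k)"
      and es: "\<And>k. e (Suc k) \<le> th * e k + K * y k"
      using seq unfolding e_def r_def th_def by auto
    have e0: "0 \<le> e k" for k by (simp add: e_def avg_norm_nonneg)
    have y0: "0 \<le> y k" for k using osc_nonneg[of p f "r k"] eta r[of k] by (simp add: y_def)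
    have ein: "e 0 \<le> M"
    proof -
      have "par_poly 0 0 (0 :: real ^ 'n ^ 'n) 0 = (\<lambda>_. 0)" by (auto simp: par_poly_def)
      then show ?thesis using Mu by (simp add: e_def init r_def)
    qed
    have oscS: "osc p f (r (Suc k)) \<le> Q * osc p f (r k)" for k
      using osc_shrink[OF p0 f r(1)[of "Suc k"] rS(4) r(2)[of k]] l r[of k] by (simp add: rS(1) Q_def q_def)
    have osc1: "osc p f (r 0) \<le> M" using osc_le[of p f 1 0] Mf by (simp add: r_def)
    \<comment> \<open>The differences of \<open>\<Phi>\<close> telescope. The sum starts at
      \<open>Suc n\<close> because the bound of \<open>osc\<close> at a radius involves
      \<open>\<Phi>\<close> one scale up.\<close>
    have sumosc: "(\<Sum>j\<in>{Suc n..<Suc i}. osc p f (r j)) \<le> H * ?\<Phi> (r n)" if "n \<le> i" for n i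
    proof -
      have "(\<Sum>j\<in>{Suc n..<Suc i}. osc p f (r j)) + H * ?\<Phi> (r i) \<le> H * ?\<Phi> (r n)"
        using that
      proof (induction i rule: dec_induct)
        case (step i)
        have "osc p f (r (Suc i)) \<le> H * (?\<Phi> (r i) - ?\<Phi> (r (Suc i)))"
          using OB(1)[OF r(1)[of "Suc i"] rS(3)] unfolding rS(2) .
        then show ?case using step by (simp add: right_diff_distrib)
      qed simp
      moreover have "0 \<le> H * ?\<Phi> (r i)" using H OB(5)[of "r i"] r[of i] by simp
      ultimately show ?thesis by linarith
    qed
    \<comment> \<open>Two terms are split off the sum so that \<open>\<Phi>\<close> is evaluated at
      \<open>r (Suc k)\<close> and not at \<open>r k\<close>. The final estimate concerns
      \<open>s\<close> between these radii and may contain \<open>\<Phi>\<close> only at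
      \<open>s\<close>, for which \<open>r k\<close> would be too large. The split terms are bounded
      there through \<open>\<Psi>\<close>.\<close>
    define B where "B k = (1 + Q) * osc p f (r k) + H * ?\<Phi> (r (Suc k)) + 2 * \<eta> * r k" for k
    have sumy: "(\<Sum>j\<in>{k..<n}. y j) \<le> B k" if kn: "k \<le> n" for k n
    proof -
      have "(\<Sum>j\<in>{k..<n}. osc p f (r j)) \<le> (\<Sum>j\<in>{k..<Suc (Suc n)}. osc p f (r j))"
        by (intro sum_mono2) (auto simp: osc_nonneg)
      also have "\<dots> = osc p f (r k) + osc p f (r (Suc k)) + (\<Sum>j\<in>{Suc (Suc k)..<Suc (Suc n)}. osc p f (r j))"
      proof -
        have "(\<Sum>j\<in>{k..<Suc (Suc n)}. osc p f (r j)) = osc p f (r k) + (\<Sum>j\<in>{Suc k..<Suc (Suc n)}. osc p f (r j))"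
          using kn by (intro sum.atLeast_Suc_lessThan) auto
        also have "(\<Sum>j\<in>{Suc k..<Suc (Suc n)}. osc p f (r j)) = osc p f (r (Suc k)) + (\<Sum>j\<in>{Suc (Suc k)..<Suc (Suc n)}. osc p f (r j))"
          using kn by (intro sum.atLeast_Suc_lessThan) auto
        finally show ?thesis by (simp only: add.assoc)
      qed
      also have "\<dots> \<le> osc p f (r k) + Q * osc p f (r k) + H * ?\<Phi> (r (Suc k))"
        using oscS[of k] sumosc[of "Suc k" "Suc n"] kn by (intro add_mono) auto
      finally have 1: "(\<Sum>j\<in>{k..<n}. osc p f (r j)) \<le> (1 + Q) * osc p f (r k) + H * ?\<Phi> (r (Suc k))"
        by (simp add: distrib_right)
      have "(\<Sum>j\<in>{k..<n}. \<eta> * r j) \<le> \<eta> * (2 * r k)"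
        unfolding sum_distrib_left[symmetric] r_def using geometric_tail_le[OF _ l(2) kn] l eta by (intro mult_left_mono) auto
      with 1 show ?thesis by (simp add: y_def sum.distrib B_def)
    qed
    have sume: "(\<Sum>j\<in>{k..<n}. e j) \<le> (e k + K * B k) / (1 - th)" if "k \<le> n" for k n
    proof -
      have "(1 - th) * (\<Sum>j\<in>{k..<n}. e j) \<le> e k + K * (\<Sum>j\<in>{k..<n}. y j)"
        by (rule contraction_sum[where th = th and e = e and w = y]) (use th e0 es that in auto)
      also have "\<dots> \<le> e k + K * B k" using sumy[OF that] K by (intro add_left_mono mult_left_mono) auto
      finally show ?thesis using th by (simp add: field_simps)
    qed
    define d where "d j = C * (e j + y j)" for j
    have d0: "0 \<le> d j" for j using C e0 y0 by (simp add: d_def)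
    have sumd: "(\<Sum>j\<in>{k..<n}. d j) \<le> T1 * e k + T2 * B k" if "k \<le> n" for k n
    proof -
      have "(\<Sum>j\<in>{k..<n}. d j) = C * ((\<Sum>j\<in>{k..<n}. e j) + (\<Sum>j\<in>{k..<n}. y j))"
        by (simp add: d_def sum_distrib_left sum.distrib distrib_left)
      also have "\<dots> \<le> C * ((e k + K * B k) / (1 - th) + B k)"
        using C sume[OF that] sumy[OF that] by (intro mult_left_mono) auto
      also have "\<dots> = T1 * e k + T2 * B k" by (simp add: T1_def T2_def add_divide_distrib algebra_simps)
      finally show ?thesis .
    qed
    have ds: "summable d"
    proof (rule summableI_nonneg_bounded[OF d0])
      show "sum d {..<n} \<le> T1 * e 0 + T2 * B 0" for n using sumd[of 0 n] by (simp add: lessThan_atLeast0)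
    qed
    \<comment> \<open>The tail of the increments measures how far the polynomial of index
      \<open>k\<close> is from the limit, in the weights natural at radius
      \<open>r k\<close>.\<close>
    define \<tau> where "\<tau> k = (\<Sum>j. d (j + k))" for k
    have \<tau>0: "0 \<le> \<tau> k" for k unfolding \<tau>_def using ds d0 by (intro suminf_nonneg) (auto simp: summable_iff_shift)
    have \<tau>T: "\<tau> k \<le> T1 * e k + T2 * B k" for k
      unfolding \<tau>_def
    proof (rule suminf_le_const)
      show "summable (\<lambda>j. d (j + k))" using ds by (simp add: summable_iff_shift)
      show "(\<Sum>j<n. d (j + k)) \<le> T1 * e k + T2 * B k" for n
        using sumd[of k "k + n"] sum.shift_bounds_nat_ivl[of d 0 k n] by (simp add: lessThan_atLeast0 add.commute)
    qed
    have dec1: "decseq r" by (rule decseq_SucI) (rule rS)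
    have dec2: "decseq (\<lambda>k. (r k)\<^sup>2)"
      by (rule decseq_SucI) (use rS(4) r in \<open>auto intro!: power_mono simp: less_imp_le\<close>)
    have parts: "\<bar>a (Suc k) - a k\<bar> \<le> (r k)\<^sup>2 * d k" "norm (b (Suc k) - b k) \<le> r k * d k"
      "norm (c (Suc k) - c k) \<le> 1 * d k" "\<bar>m (Suc k) - m k\<bar> \<le> 1 * d k" for k
    proof -
      have nn: "0 \<le> \<bar>a (Suc k) - a k\<bar> / (r k)\<^sup>2" "0 \<le> norm (b (Suc k) - b k) / r k" using r[of k] by auto
      have "\<bar>a (Suc k) - a k\<bar> / (r k)\<^sup>2 \<le> d k" "norm (b (Suc k) - b k) / r k \<le> d k"
        using co[of k] nn norm_ge_zero[of "c (Suc k) - c k"] abs_ge_zero[of "m (Suc k) - m k"] unfolding d_def by linarith+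
      then show "\<bar>a (Suc k) - a k\<bar> \<le> (r k)\<^sup>2 * d k" "norm (b (Suc k) - b k) \<le> r k * d k"
        using r[of k] by (auto simp: divide_le_eq mult.commute)
      show "norm (c (Suc k) - c k) \<le> 1 * d k" "\<bar>m (Suc k) - m k\<bar> \<le> 1 * d k"
        using co[of k] nn norm_ge_zero[of "c (Suc k) - c k"] abs_ge_zero[of "m (Suc k) - m k"] unfolding d_def by linarith+
    qed
    obtain a' where a': "a \<longlonglongrightarrow> a'" "\<And>k. norm (a' - a k) \<le> (r k)\<^sup>2 * \<tau> k"
      unfolding \<tau>_def by (rule telescope_limit[OF ds d0 dec2, of a]) (use parts(1) in auto)
    obtain b' where b': "b \<longlonglongrightarrow> b'" "\<And>k. norm (b' - b k) \<le> r k * \<tau> k"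
      unfolding \<tau>_def by (rule telescope_limit[OF ds d0 dec1, of b]) (use parts(2) r in \<open>auto simp: less_imp_le\<close>)
    obtain c' where c': "c \<longlonglongrightarrow> c'" "\<And>k. norm (c' - c k) \<le> 1 * \<tau> k"
      unfolding \<tau>_def by (rule telescope_limit[OF ds d0, of "\<lambda>_. 1" c]) (use parts(3) in \<open>auto simp: decseq_def\<close>)
    obtain m' where m': "m \<longlonglongrightarrow> m'" "\<And>k. norm (m' - m k) \<le> 1 * \<tau> k"
      unfolding \<tau>_def by (rule telescope_limit[OF ds d0, of "\<lambda>_. 1" m]) (use parts(4) in \<open>auto simp: decseq_def\<close>)
    have sym': "transpose c' = c'"
    proof -
      have "c' $ i $ j = c' $ j $ i" for i j
      proof (rule LIMSEQ_unique)
        show "(\<lambda>k. c k $ i $ j) \<longlonglongrightarrow> c' $ i $ j" by (intro tendsto_vec_nth c')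
        have "c k $ i $ j = c k $ j $ i" for k
          using sym[of k] by (metis transpose_def vec_lambda_beta)
        then show "(\<lambda>k. c k $ i $ j) \<longlonglongrightarrow> c' $ j $ i" by (simp add: tendsto_vec_nth c')
      qed
      then show ?thesis by (simp add: transpose_def vec_eq_iff)
    qed
    define E where "E s = avg_norm p s (\<lambda>z. u z - par_poly a' b' c' m' z) / s\<^sup>2" for s
    have LE: "LpQ p s (\<lambda>z. u z - par_poly a b c m z)" if "0 < s" "s \<le> 1" for s a b c m
      using that by (intro LpQ_diff p0 LpQ_subset[OF u] LpQ_par_poly) auto
    \<comment> \<open>On \<open>Qm (r k)\<close> each of the four coefficient differences
      contributes at most \<open>(r k)\<^sup>2 * \<tau> k\<close>, which gives the inner 4; the
      outer one is the quasi-triangle inequality.\<close>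
    have Ek: "E (r k) \<le> 4 * (e k + 4 * W * \<tau> k)" for k
    proof -
      let ?D = "par_poly (a k - a') (b k - b') (c k - c') (m k - m')"
      have eq: "u z - par_poly a' b' c' m' z = (u z - par_poly (a k) (b k) (c k) (m k) z) + ?D z" for z
        using par_poly_add[of "a k - a'" a' "b k - b'" b' "c k - c'" c' "m k - m'" m' z] by simp
      have LD: "LpQ p (r k) ?D" using r[of k] by (intro LpQ_par_poly p0) auto
      have "avg_norm p (r k) (\<lambda>z. u z - par_poly a' b' c' m' z) \<le>
          4 * (avg_norm p (r k) (\<lambda>z. u z - par_poly (a k) (b k) (c k) (m k) z) + avg_norm p (r k) ?D)"
        unfolding eq by (intro avg_norm_add p1 r LE LD)
      also have "avg_norm p (r k) ?D \<le> W * (4 * (r k)\<^sup>2 * \<tau> k)"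
        unfolding W_def
      proof (rule avg_norm_bounded[OF p0 r(1) LD])
        fix z :: "(real ^ 'n) \<times> real" assume z: "z \<in> Qm (r k)"
        have "\<bar>?D z\<bar> \<le> \<bar>a k - a'\<bar> + norm (b k - b') * r k + (norm (c k - c') + \<bar>m k - m'\<bar>) * (r k)\<^sup>2"
          using par_poly_bound[OF _ z] r[of k] by auto
        also have "\<dots> \<le> (r k)\<^sup>2 * \<tau> k + (r k * \<tau> k) * r k + (\<tau> k + \<tau> k) * (r k)\<^sup>2"
          using a'(2)[of k] b'(2)[of k] c'(2)[of k] m'(2)[of k] r[of k]
          by (intro add_mono mult_right_mono) (auto simp: norm_minus_commute abs_minus_commute less_imp_le)
        also have "\<dots> = 4 * (r k)\<^sup>2 * \<tau> k" by (simp add: power2_eq_square)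
        finally show "\<bar>?D z\<bar> \<le> 4 * (r k)\<^sup>2 * \<tau> k" .
      qed (use \<tau>0 in auto)
      finally have "E (r k) \<le> (4 * (avg_norm p (r k) (\<lambda>z. u z - par_poly (a k) (b k) (c k) (m k) z) + W * (4 * (r k)\<^sup>2 * \<tau> k))) / (r k)\<^sup>2"
        unfolding E_def by (intro divide_right_mono) auto
      also have "\<dots> = 4 * (e k + 4 * W * \<tau> k)" using r[of k] by (simp add: e_def field_simps)
      finally show ?thesis .
    qed
    have Er: "E s \<le> Q2 * E (r k)" if s: "r (Suc k) < s" "s \<le> r k" for s k
    proof -
      have s0: "0 < s" using s r[of "Suc k"] by linarith
      have "E s \<le> (r k / s) powr (q + 2) * E (r k)"
        unfolding E_def q_def by (rule scaled_shrink[OF p0 LE[OF r] s0 s(2)])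
      also have "\<dots> \<le> Q2 * E (r k)"
        unfolding Q2_def using s s0 q l r[of k] rS(1)[of k]
        by (intro mult_right_mono powr_mono2) (auto simp: E_def avg_norm_nonneg field_simps)
      finally show ?thesis .
    qed
    have es_sum: "summable e"
    proof (rule summableI_nonneg_bounded[OF e0])
      show "sum e {..<n} \<le> (e 0 + K * B 0) / (1 - th)" for n using sume[of 0 n] by (simp add: lessThan_atLeast0)
    qed
    have exc: "excess p u s \<le> Q2 * e k" if s: "l ^ Suc k < s" "s \<le> l ^ k" for k s
    proof -
      have s': "r (Suc k) < s" "s \<le> r k" using s by (auto simp: r_def)
      have s0: "0 < s" using s' r[of "Suc k"] by linarith
      have "excess p u s \<le> avg_norm p s (\<lambda>z. u z - par_poly (a k) (b k) (c k) (m k) z) / s\<^sup>2"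
        by (rule excess_le) (use sym[of k] in \<open>auto simp: P2_t_def\<close>)
      also have "\<dots> \<le> (r k / s) powr (q + 2) * e k"
        unfolding e_def q_def by (rule scaled_shrink[OF p0 LE[OF r] s0 s'(2)])
      also have "\<dots> \<le> Q2 * e k"
        unfolding Q2_def using s' s0 q l r[of k] rS(1)[of k]
        by (intro mult_right_mono powr_mono2 e0) (auto simp: field_simps)
      finally show ?thesis .
    qed
    then show "\<exists>e. summable e \<and> (\<forall>k r. l ^ Suc k < r \<and> r \<le> l ^ k \<longrightarrow> excess p u r \<le> e k)"
      using summable_mult[OF es_sum, of Q2] by (intro exI[of _ "\<lambda>k. Q2 * e k"]) auto
    have coef: "\<bar>a'\<bar> + norm b' + norm c' + \<bar>m'\<bar> \<le> D * M"
    proof -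
      have "\<bar>a'\<bar> + norm b' + norm c' + \<bar>m'\<bar> \<le> 4 * \<tau> 0"
        using a'(2)[of 0] b'(2)[of 0] c'(2)[of 0] m'(2)[of 0] by (simp add: init r_def)
      also have "\<dots> \<le> 4 * (T1 * e 0 + T2 * B 0)" using \<tau>T[of 0] by simp
      also have "B 0 \<le> (3 + Q + H) * M"
      proof -
        have "?\<Phi> (r (Suc 0)) \<le> M" using OB(3)[of "r (Suc 0)" 1] r[of "Suc 0"] M\<Phi> by simp
        then have "B 0 \<le> (1 + Q) * M + H * M + 2 * M"
          unfolding B_def using osc1 M\<eta> Q H by (intro add_mono mult_left_mono) (auto simp: r_def)
        then show ?thesis by (simp add: algebra_simps)
      qed
      also have "4 * (T1 * e 0 + T2 * ((3 + Q + H) * M)) \<le> D1 * M"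
        using ein T by (simp add: D1_def algebra_simps)
      also have "\<dots> \<le> D * M" using D M0 by (intro mult_right_mono) auto
      finally show ?thesis using T by simp
    qed
    have lim: "(E \<longlongrightarrow> 0) (at_right 0)"
    proof (rule order_tendstoI)
      fix x :: real assume "x < 0"
      then show "\<forall>\<^sub>F s in at_right 0. x < E s"
        by (intro always_eventually allI) (auto simp: E_def avg_norm_nonneg intro: less_le_trans)
    next
      fix x :: real assume x: "0 < x"
      have "\<tau> \<longlonglongrightarrow> 0" unfolding \<tau>_def using ds by (rule suminf_exist_split2)
      moreover have "e \<longlonglongrightarrow> 0" by (rule summable_LIMSEQ_zero[OF es_sum])
      ultimately have "(\<lambda>k. Q2 * (4 * (e k + 4 * W * \<tau> k))) \<longlonglongrightarrow> Q2 * (4 * (0 + 4 * W * 0))" by (intro tendsto_intros)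
      then have "\<forall>\<^sub>F k in sequentially. Q2 * (4 * (e k + 4 * W * \<tau> k)) < x"
        using x by (intro order_tendstoD(2)) auto
      then obtain k0 where k0: "\<And>k. k \<ge> k0 \<Longrightarrow> Q2 * (4 * (e k + 4 * W * \<tau> k)) < x" by (auto simp: eventually_sequentially)
      have "E s < x" if s: "0 < s" "s < r (Suc k0)" for s
      proof -
        obtain k where k: "l ^ Suc k < s" "s \<le> l ^ k"
          using ex_geometric_scale[of l s] l s r[of "Suc k0"] by force
        have "k \<ge> k0"
        proof (rule ccontr)
          assume "\<not> k0 \<le> k"
          then have "l ^ Suc k0 \<le> l ^ Suc k" using l by (intro power_decreasing) auto
          then show False using k s by (simp add: r_def)
        qed
        have "E s \<le> Q2 * E (r k)" using k by (intro Er) (auto simp: r_def)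
        also have "\<dots> \<le> Q2 * (4 * (e k + 4 * W * \<tau> k))" using Ek Q2 by (intro mult_left_mono) auto
        also have "\<dots> < x" by (rule k0[OF \<open>k \<ge> k0\<close>])
        finally show ?thesis .
      qed
      then show "\<forall>\<^sub>F s in at_right 0. E s < x"
        using r[of "Suc k0"] by (auto simp: eventually_at_right_field)
    qed
    \<comment> \<open>The recursion unrolled with \<open>th ^ k\<close> factored out. The initial
      value gives 1 and the first step \<open>2 * K / th\<close>; the later slacks are
      \<open>K * th ^ j\<close>, summing to the term with \<open>1 - th ^ (k - 1)\<close>; the
      oscillations telescope in \<open>\<Psi>\<close>. The truncated \<open>k - 1\<close> lets the
      indices 0 and 1 share \<open>r 0\<close>: the bound of \<open>osc\<close> by
      \<open>\<Psi>\<close> needs a radius at most \<open>l\<close>, so the first step uses the norm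
      of \<open>f\<close> instead.\<close>
    have ebound: "e k \<le> th ^ k * ((1 + 2 * K / th + K / (1 - th) * (1 - th ^ (k - 1))) * M + G * ?\<Psi> (r (k - 1)))" for k
    proof (induction k)
      case 0
      have "0 \<le> 2 * K / th * M" using K th M0 by simp
      moreover have "0 \<le> G * ?\<Psi> (r 0)" using G OB(6) by simp
      ultimately show ?case using ein by (simp add: distrib_right)
    next
      case (Suc k)
      show ?case
      proof (cases k)
        case 0
        have "y 0 \<le> M + M" using osc1 M\<eta> by (simp add: y_def r_def)
        then have "K * y 0 \<le> K * (2 * M)" using K by (intro mult_left_mono) auto
        moreover have "th * e 0 \<le> th * M" using ein th by (intro mult_left_mono) auto
        ultimately have "e (Suc 0) \<le> th * M + K * (2 * M)" using es[of 0] by linarith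
        also have "\<dots> = th * ((1 + 2 * K / th) * M)" using th by (simp add: field_simps)
        also have "\<dots> \<le> th * ((1 + 2 * K / th) * M + G * ?\<Psi> (r 0))"
          using th G OB(6)[of "r 0"] by (intro mult_left_mono) auto
        finally show ?thesis by (simp add: 0)
      next
        case (Suc j)
        let ?P = "?\<Psi> (r k)" and ?P' = "?\<Psi> (r j)"
        have kj: "k - 1 = j" "r (k - 1) = r j" using Suc by auto
        have "osc p f (r k) \<le> H * th ^ j * (?P - ?P')"
          using OB(2)[OF r(1)[of k]] rS(3)[of j] rS(2)[of j] rsq[of j] Suc by simp
        then have 1: "K * osc p f (r k) \<le> th * th ^ k * (G * (?P - ?P'))"
        proof -
          assume o: "osc p f (r k) \<le> H * th ^ j * (?P - ?P')"
          have "th * th ^ k * G = K * (H * th ^ j)" using th by (simp add: Suc G_def power2_eq_square)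
          then have eqn: "th * th ^ k * (G * (?P - ?P')) = K * (H * th ^ j * (?P - ?P'))" by (simp only: mult.assoc[symmetric])
          show ?thesis unfolding eqn by (rule mult_left_mono[OF o less_imp_le[OF K]])
        qed
        have "\<eta> * r k \<le> M * (th ^ k * th ^ k)"
        proof -
          have "r k = th ^ k * th ^ k" using th2 by (metis r_def power2_eq_square power_mult_distrib)
          then show ?thesis using M\<eta> th by (simp add: mult_right_mono)
        qed
        then have 2: "K * (\<eta> * r k) \<le> th * th ^ k * (K * th ^ j * M)"
          using mult_left_mono[of "\<eta> * r k" "M * (th ^ k * th ^ k)" K] K by (simp add: Suc mult_ac)
        have "e (Suc k) \<le> th * e k + K * osc p f (r k) + K * (\<eta> * r k)"
          using es[of k] by (simp add: y_def distrib_left)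
        also have "\<dots> \<le> th * (th ^ k * ((1 + 2 * K / th + K / (1 - th) * (1 - th ^ j)) * M + G * ?P'))
            + th * th ^ k * (G * (?P - ?P')) + th * th ^ k * (K * th ^ j * M)"
          using Suc.IH[unfolded kj] 1 2 th by (intro add_mono mult_left_mono) auto
        also have "\<dots> = th ^ Suc k * ((1 + 2 * K / th + (K / (1 - th) * (1 - th ^ j) + K * th ^ j)) * M + G * ?P)"
          by (simp add: algebra_simps)
        also have "K / (1 - th) * (1 - th ^ j) + K * th ^ j = K / (1 - th) * (1 - th ^ k)"
          using th by (simp add: Suc field_simps)
        finally show ?thesis by simp
      qed
    qed
    have fin: "E s \<le> D * (M * sqrt s + ?\<Phi> s + sqrt s * ?\<Psi>' s)" if s: "0 < s" "s \<le> l" for s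
    proof -
      obtain k where k: "l ^ Suc k < s" "s \<le> l ^ k" using ex_geometric_scale[of l s] l s by force
      \<comment> \<open>The restriction to \<open>s \<le> l\<close> puts \<open>s\<close> at least
        one scale down, so that \<open>r k \<le> l\<close> and \<open>osc p f (r k)\<close> can be
        bounded by \<open>\<Psi>\<close>.\<close>
      have "k \<noteq> 0" using k s by (intro notI) simp
      then obtain j where kj: "k = Suc j" by (cases k) auto
      have ks: "r (Suc k) < s" "s \<le> r k" using k by (auto simp: r_def)
      let ?q = "sqrt s"
      have q0: "0 < ?q" using s by simp
      have thq: "th ^ Suc k \<le> ?q" using ks rsq[of "Suc k"] by (metis real_sqrt_le_mono less_imp_le)
      have tk: "th ^ k \<le> ?q / th" and tj: "th ^ j \<le> ?q / th\<^sup>2"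
        using thq th by (auto simp: kj field_simps power2_eq_square)
      let ?P = "?\<Psi> (r k)"
      have P1: "?P \<le> ?\<Psi>' s" by (rule OB(7)[OF s(1) ks(2) r(2)])
      have P2: "?\<Psi> (r j) \<le> ?\<Psi>' s" using P1 OB(4)[of "r k" "r j"] r rS(4)[of j] kj by auto
      have P0: "0 \<le> ?\<Psi>' s" using P1 OB(6)[of "r k"] by linarith
      have Ph: "?\<Phi> (r (Suc k)) \<le> ?\<Phi> s" using OB(3)[of "r (Suc k)" s] ks r[of "Suc k"] s l by auto
      have o: "osc p f (r k) \<le> H * (?q / th\<^sup>2) * ?\<Psi>' s"
      proof -
        have "osc p f (r k) \<le> H * th ^ j * (?P - ?\<Psi> (r j))"
          using OB(2)[OF r(1)[of k]] rS(3)[of j] rS(2)[of j] rsq[of j] kj by simp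
        also have "\<dots> \<le> H * th ^ j * ?\<Psi>' s"
          using P1 OB(6)[of "r j"] H th by (intro mult_left_mono) auto
        also have "\<dots> \<le> H * (?q / th\<^sup>2) * ?\<Psi>' s"
          using tj H P0 by (intro mult_right_mono mult_left_mono) auto
        finally show ?thesis .
      qed
      have ek: "e k \<le> ?q / th * (A * M + G * ?\<Psi>' s)"
      proof -
        \<comment> \<open>Dropping the power leaves the full geometric series, which is the last
          summand of \<open>A\<close>.\<close>
        have "K / (1 - th) * (1 - th ^ (k - 1)) \<le> K / (1 - th) * 1" using K th by (intro mult_left_mono) auto
        then have "(1 + 2 * K / th + K / (1 - th) * (1 - th ^ (k - 1))) * M \<le> A * M"
          using M0 by (intro mult_right_mono) (auto simp: A_def)
        moreover have "G * ?\<Psi> (r (k - 1)) \<le> G * ?\<Psi>' s" using P2 G by (intro mult_left_mono) (auto simp: kj)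
        ultimately have "e k \<le> th ^ k * (A * M + G * ?\<Psi>' s)"
          using ebound[of k] th by (smt (verit) mult_left_mono zero_le_power)
        also have "\<dots> \<le> ?q / th * (A * M + G * ?\<Psi>' s)"
          using tk A M0 G P0 by (intro mult_right_mono) auto
        finally show ?thesis .
      qed
      have et: "\<eta> * r k \<le> M * (?q / th)"
      proof -
        have "r k = th ^ k * th ^ k" using th2 by (metis r_def power2_eq_square power_mult_distrib)
        also have "\<dots> \<le> th ^ k * 1" using th by (intro mult_left_mono power_le_one) auto
        finally have "r k \<le> ?q / th" using tk by simp
        then show ?thesis using M\<eta> M0 r[of k] eta by (intro mult_mono) auto
      qed
      have Bk: "B k \<le> (1 + Q) * (H * (?q / th\<^sup>2) * ?\<Psi>' s) + H * ?\<Phi> s + 2 * (M * (?q / th))"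
        unfolding B_def using o Ph et Q H by (intro add_mono mult_left_mono) auto
      have "E s \<le> Q2 * (4 * (e k + 4 * W * \<tau> k))"
        using Er[OF ks] mult_left_mono[OF Ek[of k], of Q2] Q2 by linarith
      also have "\<dots> \<le> Q2 * (4 * (e k + 4 * W * (T1 * e k + T2 * B k)))"
        using \<tau>T[of k] Q2 W by (intro mult_left_mono add_left_mono) auto
      also have "\<dots> = c1 * e k + c2 * B k" by (simp add: c1_def c2_def algebra_simps)
      also have "\<dots> \<le> c1 * (?q / th * (A * M + G * ?\<Psi>' s)) +
          c2 * ((1 + Q) * (H * (?q / th\<^sup>2) * ?\<Psi>' s) + H * ?\<Phi> s + 2 * (M * (?q / th)))"
        using c12 ek Bk by (intro add_mono mult_left_mono) auto
      also have "\<dots> = (c1 * A / th + c2 * 2 / th) * (M * ?q) + (c2 * H) * ?\<Phi> s + (c1 * G / th + c2 * ((1 + Q) * H) / th\<^sup>2) * (?q * ?\<Psi>' s)"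
        using th by (simp add: field_simps)
      also have "\<dots> \<le> D2 * (M * ?q) + D2 * ?\<Phi> s + D2 * (?q * ?\<Psi>' s)"
      proof (intro add_mono mult_right_mono)
        have nn: "0 \<le> c1 * A / th" "0 \<le> c1 * G / th" "0 \<le> c2 * ((1 + Q) * H) / th\<^sup>2" "0 \<le> c2 * H" "0 \<le> c2 * 2 / th"
          using c12 A G Q H th by auto
        show "c1 * A / th + c2 * 2 / th \<le> D2" "c2 * H \<le> D2" "c1 * G / th + c2 * ((1 + Q) * H) / th\<^sup>2 \<le> D2"
          unfolding D2_def using nn by linarith+
        show "0 \<le> M * ?q" using M0 q0 by simp
        show "0 \<le> ?\<Phi> s" using OB(5)[of s] s l by auto
        show "0 \<le> ?q * ?\<Psi>' s" using P0 q0 by simp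
      qed
      also have "\<dots> = D2 * (M * ?q + ?\<Phi> s + ?q * ?\<Psi>' s)" by (simp add: distrib_left)
      also have "\<dots> \<le> D * (M * ?q + ?\<Phi> s + ?q * ?\<Psi>' s)"
        using D M0 q0 P0 OB(5)[of s] s l by (intro mult_right_mono) auto
      finally show ?thesis .
    qed
    show "\<exists>a b c m. transpose c = c \<and> \<bar>a\<bar> + norm b + norm c + \<bar>m\<bar> \<le> D * M \<and>
      ((\<lambda>r. avg_norm p r (\<lambda>z. u z - par_poly a b c m z) / r\<^sup>2) \<longlongrightarrow> 0) (at_right 0) \<and>
      (\<forall>r. 0 < r \<and> r \<le> l \<longrightarrow> avg_norm p r (\<lambda>z. u z - par_poly a b c m z) / r\<^sup>2 \<le>
        D * (M * sqrt r + ?\<Phi> r + sqrt r * ?\<Psi>' r))"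
      using sym' coef lim[unfolded E_def[abs_def]] fin[unfolded E_def] by blast
  qed
qed

section \<open>Borel representatives and the theorem\<close>

lemma Borel_representative:
  fixes u :: "(real ^ 'n) \<times> real \<Rightarrow> real"
  assumes "u \<in> borel_measurable (lebesgue_on (Qm 1))"
  obtains u' where "u' \<in> borel_measurable borel" "AE z in lborel. z \<in> Qm 1 \<longrightarrow> u z = u' z"
proof -
  have "(\<lambda>z. indicator (Qm 1) z *\<^sub>R u z) \<in> borel_measurable lebesgue"
    using assms by (subst (asm) borel_measurable_restrict_space_iff) auto
  from completion_ex_borel_measurable_real[OF this] obtain u' where
    u': "u' \<in> borel_measurable lborel" "AE z in lborel. indicator (Qm 1) z *\<^sub>R u z = u' z" by blast
  have "AE z in lborel. z \<in> Qm 1 \<longrightarrow> u z = u' z" using u'(2) by eventually_elim auto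
  then show ?thesis using that u'(1) by auto
qed

text \<open>\<open>G\<close> may depend on the value and on the point, so that one statement covers
  powers of \<open>u - P\<close>, absolute values and products with test functions. As
  \<open>u\<close> is measurable on the unit cylinder only, it is cut off by the indicator before
  being composed.\<close>

lemma transfer_integral:
  fixes u u' :: "(real ^ 'n) \<times> real \<Rightarrow> real" and G :: "real \<Rightarrow> (real ^ 'n) \<times> real \<Rightarrow> real"
  assumes um: "u \<in> borel_measurable (lebesgue_on (Qm 1))" and [measurable]: "u' \<in> borel_measurable borel"
    and ae: "AE z in lborel. z \<in> Qm 1 \<longrightarrow> u z = u' z" and S: "S \<subseteq> Qm 1" and [measurable]: "S \<in> sets borel"
    and G[measurable]: "(\<lambda>(y, z). G y z) \<in> borel_measurable (borel \<Otimes>\<^sub>M borel)"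
  shows "(LINT z:S|lebesgue. G (u z) z) = (\<integral>z. indicator S z * G (u' z) z \<partial>lborel)"
    "integrable lebesgue (\<lambda>z. indicator S z * G (u z) z) \<longleftrightarrow> integrable lborel (\<lambda>z. indicator S z * G (u' z) z)"
proof -
  define U where "U z = indicator (Qm 1) z *\<^sub>R u z" for z
  have U: "U \<in> borel_measurable lebesgue"
    unfolding U_def using um by (subst (asm) borel_measurable_restrict_space_iff) auto
  have id: "(\<lambda>z :: (real ^ 'n) \<times> real. z) \<in> measurable lebesgue borel"
    by (rule measurable_completion) simp
  have "(\<lambda>z. (U z, z)) \<in> measurable lebesgue (borel \<Otimes>\<^sub>M borel)"
    by (rule measurable_Pair[OF U id])
  from measurable_compose[OF this G] have GU: "(\<lambda>z. G (U z) z) \<in> borel_measurable lebesgue" by simp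
  have Sl: "S \<in> sets lebesgue" using assms(5) by auto
  have m1: "(\<lambda>z. indicator S z * G (U z) z) \<in> borel_measurable lebesgue"
    by (intro borel_measurable_times borel_measurable_indicator Sl GU)
  have m2b: "(\<lambda>z. indicator S z * G (u' z) z) \<in> borel_measurable borel"
  proof -
    have "(\<lambda>z. (u' z, z)) \<in> measurable borel (borel \<Otimes>\<^sub>M borel)" by measurable
    from measurable_compose[OF this G] have [measurable]: "(\<lambda>z. G (u' z) z) \<in> borel_measurable borel" by simp
    show ?thesis by measurable
  qed
  then have m2: "(\<lambda>z. indicator S z * G (u' z) z) \<in> borel_measurable lebesgue"
    by (intro measurable_completion) simp
  have e: "(\<lambda>z. indicator S z * G (u z) z) = (\<lambda>z. indicator S z * G (U z) z)"
  proof
    fix z show "indicator S z * G (u z) z = indicator S z * G (U z) z"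
      using S by (cases "z \<in> S") (auto simp: U_def)
  qed
  have ae': "AE z in lebesgue. indicator S z * G (U z) z = indicator S z * G (u' z) z"
    using AE_completion[OF ae]
  proof eventually_elim
    case (elim z)
    show ?case using elim S by (cases "z \<in> S") (auto simp: U_def)
  qed
  have "(LINT z:S|lebesgue. G (u z) z) = (\<integral>z. indicator S z * G (u z) z \<partial>lebesgue)"
    by (simp add: set_lebesgue_integral_def)
  also have "\<dots> = (\<integral>z. indicator S z * G (u' z) z \<partial>lebesgue)"
    unfolding e by (rule integral_cong_AE[OF m1 m2 ae'])
  also have "\<dots> = (\<integral>z. indicator S z * G (u' z) z \<partial>lborel)"
    by (rule integral_completion) (use m2b in simp)
  finally show "(LINT z:S|lebesgue. G (u z) z) = (\<integral>z. indicator S z * G (u' z) z \<partial>lborel)" .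
  have "integrable lebesgue (\<lambda>z. indicator S z * G (u z) z) \<longleftrightarrow> integrable lebesgue (\<lambda>z. indicator S z * G (u' z) z)"
    unfolding e by (rule integrable_cong_AE[OF m1 m2 ae'])
  also have "\<dots> \<longleftrightarrow> integrable lborel (\<lambda>z. indicator S z * G (u' z) z)"
    by (rule integrable_completion) (use m2b in simp)
  finally show "integrable lebesgue (\<lambda>z. indicator S z * G (u z) z) \<longleftrightarrow> integrable lborel (\<lambda>z. indicator S z * G (u' z) z)" .
qed

lemma transfer_LpQ:
  fixes u u' :: "(real ^ 'n) \<times> real \<Rightarrow> real"
  assumes u: "in_Lp p (Qm 1) u" and u': "u' \<in> borel_measurable borel" and ae: "AE z in lborel. z \<in> Qm 1 \<longrightarrow> u z = u' z"
  shows "LpQ p 1 u'"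
proof -
  have um: "u \<in> borel_measurable (lebesgue_on (Qm 1))" and ui: "integrable (lebesgue_on (Qm 1)) (\<lambda>z. \<bar>u z\<bar> powr p)"
    using u by (auto simp: in_Lp_def)
  have "integrable lebesgue (\<lambda>z. indicator (Qm 1) z * \<bar>u z\<bar> powr p)"
    using ui by (subst (asm) integrable_restrict_space) auto
  then have "integrable lborel (\<lambda>z. indicator (Qm 1) z * \<bar>u' z\<bar> powr p)"
    using transfer_integral(2)[OF um u' ae subset_refl Qm_borel, of "\<lambda>y z. \<bar>y\<bar> powr p"] by simp
  then show ?thesis using u' by (simp add: LpQ_def)
qed

lemma transfer_powr:
  fixes u u' P :: "(real ^ 'n) \<times> real \<Rightarrow> real"
  assumes u: "in_Lp p (Qm 1) u" and u': "u' \<in> borel_measurable borel" and ae: "AE z in lborel. z \<in> Qm 1 \<longrightarrow> u z = u' z"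
    and P[measurable]: "P \<in> borel_measurable borel" and r: "0 < r" "r \<le> 1"
  shows "(LINT z:Qm r|lebesgue. \<bar>u z - P z\<bar> powr p) = (\<integral>z. indicator (Qm r) z * \<bar>u' z - P z\<bar> powr p \<partial>lborel)"
  by (rule transfer_integral(1)[OF _ u' ae, of "Qm r" "\<lambda>y z. \<bar>y - P z\<bar> powr p"])
    (use u Qm_mono[of r 1] r in \<open>auto simp: in_Lp_def\<close>)

lemma transfer_Lp_norm:
  fixes u u' :: "(real ^ 'n) \<times> real \<Rightarrow> real"
  assumes u: "in_Lp p (Qm 1) u" and u': "u' \<in> borel_measurable borel" and ae: "AE z in lborel. z \<in> Qm 1 \<longrightarrow> u z = u' z"
  shows "Lp_norm p (Qm 1) u = avg_norm p 1 u'"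
  using transfer_powr[OF u u' ae, of "\<lambda>_. 0" 1] by (simp add: Lp_norm_def avg_norm_def)

text \<open>The normalising power splits into \<open>r ^ (n + 2)\<close> and the \<open>p\<close>-th
  power of \<open>r\<^sup>2\<close>, so the two quantities agree for every competitor and no
  constant appears.\<close>

lemma transfer_N:
  fixes u u' :: "(real ^ 'n) \<times> real \<Rightarrow> real"
  assumes p: "0 < p" and u: "in_Lp p (Qm 1) u" and u': "u' \<in> borel_measurable borel"
    and ae: "AE z in lborel. z \<in> Qm 1 \<longrightarrow> u z = u' z" and r: "0 < r" "r \<le> 1"
  shows "N_t p u r = excess p u' r"
proof -
  have "((1 / r powr (real CARD('n) + 2 + 2 * p)) * (LINT z:Qm r|lebesgue. \<bar>u z - P z\<bar> powr p)) powr (1 / p) =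
      avg_norm p r (\<lambda>z. u' z - P z) / r\<^sup>2" if "P \<in> P2_t" for P
  proof -
    have P: "P \<in> borel_measurable borel" using that unfolding P2_t_def by auto
    let ?I = "\<integral>z. indicator (Qm r) z * \<bar>u' z - P z\<bar> powr p \<partial>lborel"
    have I0: "0 \<le> ?I" by (intro Bochner_Integration.integral_nonneg) auto
    have "r powr (real CARD('n) + 2 + 2 * p) = r powr real (CARD('n) + 2) * r powr (2 * p)"
      by (simp add: powr_add[symmetric] add.commute add.left_commute)
    also have "r powr real (CARD('n) + 2) = r ^ (CARD('n) + 2)" by (rule powr_realpow[OF r(1)])
    also have "r powr (2 * p) = (r\<^sup>2) powr p" using r powr_powr[of r 2 p] by simp
    finally have "((1 / r powr (real CARD('n) + 2 + 2 * p)) * ?I) powr (1 / p) =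
        (?I / r ^ (CARD('n) + 2) / (r\<^sup>2) powr p) powr (1/p)" by simp
    also have "\<dots> = avg_norm p r (\<lambda>z. u' z - P z) / r\<^sup>2"
      using I0 r p by (subst powr_divide) (auto simp: avg_norm_def powr_powr)
    finally show ?thesis unfolding transfer_powr[OF u u' ae P r] .
  qed
  then show ?thesis unfolding N_t_def excess_def by (intro INF_cong) auto
qed

lemma average_Qm:
  fixes g :: "(real ^ 'n) \<times> real \<Rightarrow> real"
  assumes "0 < r" "(LINT z:Qm r|lebesgue. g z) = I"
  shows "average (Qm r) g = (I / r ^ (CARD('n) + 2)) / unit_vol TYPE('n)"
proof -
  have "measure lebesgue (Qm r :: ((real ^ 'n) \<times> real) set) = r ^ (CARD('n) + 2) * unit_vol TYPE('n)"
    using measure_Qm_scale[OF assms(1), where 'n = 'n] by (simp add: measure_completion)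
  then show ?thesis using assms(2) by (simp add: average_def)
qed

lemma transfer_average:
  fixes u u' P :: "(real ^ 'n) \<times> real \<Rightarrow> real"
  assumes p: "0 < p" and u: "in_Lp p (Qm 1) u" and u': "u' \<in> borel_measurable borel"
    and ae: "AE z in lborel. z \<in> Qm 1 \<longrightarrow> u z = u' z" and P: "P \<in> borel_measurable borel" and r: "0 < r" "r \<le> 1"
  shows "average (Qm r) (\<lambda>z. \<bar>u z - P z\<bar> powr p) powr (1 / p) = avg_norm p r (\<lambda>z. u' z - P z) / unit_vol TYPE('n) powr (1/p)"
proof -
  have "0 \<le> (\<integral>z. indicator (Qm r) z * \<bar>u' z - P z\<bar> powr p \<partial>lborel) / r ^ (CARD('n) + 2)"
    using r by (intro divide_nonneg_nonneg Bochner_Integration.integral_nonneg) auto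
  then show ?thesis
    unfolding average_Qm[OF r(1) transfer_powr[OF u u' ae P r]] using unit_vol_pos[where 'n = 'n]
    by (subst powr_divide) (simp_all add: avg_norm_def)
qed

text \<open>The averages differ from the normalised norms by the volume of the unit cylinder, and a
  positive factor passes through the infimum over \<open>c\<close>.\<close>

lemma transfer_omega:
  fixes f f' :: "(real ^ 'n) \<times> real \<Rightarrow> real"
  assumes p: "0 < p" and f: "in_Lp p (Qm 1) f" and f': "f' \<in> borel_measurable borel"
    and ae: "AE z in lborel. z \<in> Qm 1 \<longrightarrow> f z = f' z" and r: "0 < r" "r \<le> 1"
  shows "omega_t p f r = (1 / unit_vol TYPE('n) powr (1/p)) * osc p f' r"
proof -
  define W where "W = unit_vol TYPE('n) powr (1/p)"
  have W: "0 < W" using unit_vol_pos[where 'n = 'n] by (simp add: W_def)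
  have e: "omega_t p f r = (INF c. avg_norm p r (\<lambda>z. f' z - c) / W)"
    unfolding omega_t_def W_def using transfer_average[OF p f f' ae _ r, of "\<lambda>_. _"] by simp
  have bd: "bdd_below (range (\<lambda>c. avg_norm p r (\<lambda>z. f' z - c) / W))"
    using W by (intro bdd_belowI[of _ 0]) (auto simp: avg_norm_nonneg)
  have "osc p f' r / W \<le> omega_t p f r"
    unfolding e using W osc_le[of p f' r] by (intro cINF_greatest) (auto intro: divide_right_mono)
  moreover have "omega_t p f r * W \<le> osc p f' r"
    unfolding osc_def
  proof (rule cINF_greatest)
    fix c
    have "omega_t p f r \<le> avg_norm p r (\<lambda>z. f' z - c) / W" unfolding e by (rule cINF_lower[OF bd]) simp
    then show "omega_t p f r * W \<le> avg_norm p r (\<lambda>z. f' z - c)" using W by (simp add: field_simps)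
  qed simp
  ultimately show ?thesis using W unfolding W_def[symmetric] by (simp add: field_simps)
qed

lemma transfer_heat:
  fixes u f u' f' :: "(real ^ 'n) \<times> real \<Rightarrow> real"
  assumes u: "in_Lp p (Qm 1) u" and u': "u' \<in> borel_measurable borel" and au: "AE z in lborel. z \<in> Qm 1 \<longrightarrow> u z = u' z"
    and f: "in_Lp p (Qm 1) f" and f': "f' \<in> borel_measurable borel" and af: "AE z in lborel. z \<in> Qm 1 \<longrightarrow> f z = f' z"
    and he: "heat_equation_Q1 u f"
  shows "heat_equation_Q1 u' f'"
  unfolding heat_equation_Q1_def
proof (intro allI impI)
  fix \<phi> :: "(real ^ 'n) \<times> real \<Rightarrow> real" assume t: "test_function (interior (Qm 1)) \<phi>"
  have b: "bump \<phi>" by (rule test_function_bump[OF t])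
  have m\<phi>[measurable]: "\<phi> \<in> borel_measurable borel" and ma: "(\<lambda>z. adj_op \<phi> z) \<in> borel_measurable borel"
    using b bump_adj_op[OF b] smooth_measurable unfolding bump_def by blast+
  have um: "u \<in> borel_measurable (lebesgue_on (Qm 1))" and fm: "f \<in> borel_measurable (lebesgue_on (Qm 1))"
    using u f by (auto simp: in_Lp_def)
  have ma2: "(\<lambda>(y :: real, z). y * adj_op \<phi> z) \<in> borel_measurable (borel \<Otimes>\<^sub>M borel)"
    unfolding split_beta' by (intro borel_measurable_times measurable_compose[OF measurable_snd ma] measurable_fst)
  have mf2: "(\<lambda>(y :: real, z). y * \<phi> z) \<in> borel_measurable (borel \<Otimes>\<^sub>M borel)" by measurable
  have "(LINT z:Qm 1|lebesgue. u' z * adj_op \<phi> z) = (LINT z:Qm 1|lebesgue. u z * adj_op \<phi> z)"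
    using transfer_integral(1)[OF um u' au subset_refl Qm_borel ma2]
      lebesgue_set_integral_lborel[OF borel_measurable_times[OF u' ma] Qm_borel] by simp
  also have "\<dots> = (LINT z:Qm 1|lebesgue. f z * \<phi> z)" using he t unfolding heat_equation_Q1_def by blast
  also have "\<dots> = (LINT z:Qm 1|lebesgue. f' z * \<phi> z)"
    using transfer_integral(1)[OF fm f' af subset_refl Qm_borel mf2]
      lebesgue_set_integral_lborel[OF borel_measurable_times[OF f' m\<phi>] Qm_borel] by simp
  finally show "(LINT z:Qm 1|lebesgue. u' z * adj_op \<phi> z) = (LINT z:Qm 1|lebesgue. f' z * \<phi> z)" .
qed

lemma transfer_lebesgue_point:
  fixes f f' :: "(real ^ 'n) \<times> real \<Rightarrow> real"
  assumes f: "in_Lp p (Qm 1) f" and f': "f' \<in> borel_measurable borel" and af: "AE z in lborel. z \<in> Qm 1 \<longrightarrow> f z = f' z"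
    and lp: "lebesgue_point_origin f 0"
  shows "((\<lambda>r. (\<integral>z. indicator (Qm r) z * \<bar>f' z\<bar> \<partial>lborel) / r ^ (CARD('n) + 2)) \<longlongrightarrow> 0) (at_right 0)"
proof (rule Lim_transform_eventually)
  let ?V = "unit_vol TYPE('n)"
  show "((\<lambda>r. average (Qm r) (\<lambda>z. \<bar>f z - 0\<bar>) * ?V) \<longlongrightarrow> 0) (at_right 0)"
    using tendsto_mult_left_zero[OF lp[unfolded lebesgue_point_origin_def]] .
  have "average (Qm r) (\<lambda>z. \<bar>f z - 0\<bar>) * ?V = (\<integral>z. indicator (Qm r) z * \<bar>f' z\<bar> \<partial>lborel) / r ^ (CARD('n) + 2)"
    if r: "0 < r" "r < 1" for r
  proof -
    have "(LINT z:Qm r|lebesgue. \<bar>f z - 0\<bar>) = (\<integral>z. indicator (Qm r) z * \<bar>f' z\<bar> \<partial>lborel)"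
      using transfer_integral(1)[OF _ f' af, of "Qm r" "\<lambda>y z. \<bar>y\<bar>"] f Qm_mono[of r 1] r by (auto simp: in_Lp_def)
    from average_Qm[OF r(1) this] show ?thesis using unit_vol_pos[where 'n = 'n] by simp
  qed
  then show "\<forall>\<^sub>F r in at_right 0. average (Qm r) (\<lambda>z. \<bar>f z - 0\<bar>) * ?V =
      (\<integral>z. indicator (Qm r) z * \<bar>f' z\<bar> \<partial>lborel) / r ^ (CARD('n) + 2)"
    by (auto simp: eventually_at_right_field intro!: exI[of _ 1])
qed

text \<open>Measurability comes from monotonicity: \<open>excess_shrink\<close> says that
  \<open>r powr ?q * excess p u r\<close> is increasing. On the shell between
  \<open>l ^ Suc k\<close> and \<open>l ^ k\<close> the integrand is at most
  \<open>e k / l ^ Suc k\<close>, so the shell contributes at most \<open>e k * (1 / l - 1)\<close>,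
  which is summable.\<close>

lemma Dini_excess:
  fixes u :: "(real ^ 'n) \<times> real \<Rightarrow> real"
  assumes p: "0 < p" and u: "LpQ p 1 u" and l: "0 < l" "l \<le> 1/2"
    and e: "summable e" "\<And>k r. l ^ Suc k < r \<Longrightarrow> r \<le> l ^ k \<Longrightarrow> excess p u r \<le> e k"
  shows "set_integrable lebesgue {0<..1} (\<lambda>r. excess p u r / r)"
proof -
  let ?q = "real (CARD('n) + 2) / p + 2"
  have "mono_on {0<..1} (\<lambda>r. r powr ?q * excess p u r)"
  proof (rule mono_onI)
    fix s r :: real assume sr: "s \<in> {0<..1}" "r \<in> {0<..1}" "s \<le> r"
    have "excess p u s \<le> (r / s) powr ?q * excess p u r" using sr by (intro excess_shrink[OF p u]) auto
    then have "s powr ?q * excess p u s \<le> s powr ?q * ((r / s) powr ?q * excess p u r)" by (intro mult_left_mono) auto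
    also have "\<dots> = r powr ?q * excess p u r" using sr by (simp add: powr_divide)
    finally show "s powr ?q * excess p u s \<le> r powr ?q * excess p u r" .
  qed
  then have "(\<lambda>r. r powr ?q * excess p u r) \<in> borel_measurable (restrict_space borel {0<..1})"
    by (rule borel_measurable_mono_on_fnc)
  then have [measurable]: "(\<lambda>r. indicator {0<..1} r *\<^sub>R (r powr ?q * excess p u r)) \<in> borel_measurable borel"
    by (subst (asm) borel_measurable_restrict_space_iff) auto
  have "(\<lambda>r. (indicator {0<..1} r *\<^sub>R (r powr ?q * excess p u r)) * (r powr (- ?q) / r)) \<in> borel_measurable borel"
    by measurable
  also have "(\<lambda>r. (indicator {0<..1} r *\<^sub>R (r powr ?q * excess p u r)) * (r powr (- ?q) / r)) =
      (\<lambda>r. indicator {0<..1} r *\<^sub>R (excess p u r / r))"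
  proof
    fix r :: real
    have "r powr ?q * r powr (- ?q) = 1" if "0 < r" using that by (simp flip: powr_add)
    then have "r powr ?q * excess p u r * (r powr (- ?q) / r) = excess p u r / r" if "0 < r"
      using that by (metis (no_types, opaque_lifting) mult.commute mult.left_commute mult_1 times_divide_eq_right)
    then show "(indicator {0<..1} r *\<^sub>R (r powr ?q * excess p u r)) * (r powr (- ?q) / r) = indicator {0<..1} r *\<^sub>R (excess p u r / r)"
      by (cases "r \<in> {0<..1}") auto
  qed
  finally have m: "(\<lambda>r. indicator {0<..1} r *\<^sub>R (excess p u r / r)) \<in> borel_measurable borel" .
  have lk: "l ^ Suc k < l ^ k" "0 < l ^ k" for k using l by auto
  have e0: "0 \<le> e k" for k using e(2)[OF lk(1) order_refl, of k] excess_nonneg[of p u "l ^ k"] by linarith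
  have "(\<integral>\<^sup>+r. ennreal (indicator {0<..1} r *\<^sub>R (excess p u r / r)) \<partial>lborel) \<le>
     (\<integral>\<^sup>+r. (\<Sum>k. ennreal (e k / l ^ Suc k) * indicator {l ^ Suc k<..l ^ k} r) \<partial>lborel)"
  proof (rule nn_integral_mono)
    fix r :: real
    show "ennreal (indicator {0<..1} r *\<^sub>R (excess p u r / r)) \<le> (\<Sum>k. ennreal (e k / l ^ Suc k) * indicator {l ^ Suc k<..l ^ k} r)"
    proof (cases "r \<in> {0<..1}")
      case True
      then obtain k where k: "l ^ Suc k < r" "r \<le> l ^ k" using ex_geometric_scale[of l r] l by force
      have "excess p u r / r \<le> e k / l ^ Suc k"
        using e(2)[OF k] k True e0[of k] lk(2)[of "Suc k"] by (intro frac_le) auto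
      then have "ennreal (indicator {0<..1} r *\<^sub>R (excess p u r / r)) \<le> ennreal (e k / l ^ Suc k) * indicator {l ^ Suc k<..l ^ k} r"
        using True k by (simp add: ennreal_leI)
      also have "\<dots> \<le> (\<Sum>k. ennreal (e k / l ^ Suc k) * indicator {l ^ Suc k<..l ^ k} r)"
      proof -
        define g :: "nat \<Rightarrow> ennreal" where "g k = ennreal (e k / l ^ Suc k) * indicator {l ^ Suc k<..l ^ k} r" for k
        have "sum g {k} \<le> suminf g" by (rule sum_le_suminf) auto
        then have "g k \<le> suminf g" by simp
        then show ?thesis unfolding g_def[abs_def] .
      qed
      finally show ?thesis .
    qed simp
  qed
  also have "\<dots> = (\<Sum>k. \<integral>\<^sup>+r. ennreal (e k / l ^ Suc k) * indicator {l ^ Suc k<..l ^ k} r \<partial>lborel)"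
    by (rule nn_integral_suminf) measurable
  also have "(\<lambda>k. \<integral>\<^sup>+r. ennreal (e k / l ^ Suc k) * indicator {l ^ Suc k<..l ^ k} r \<partial>lborel) = (\<lambda>k. ennreal (e k * (1 / l - 1)))"
  proof
    fix k
    have "(\<integral>\<^sup>+r. ennreal (e k / l ^ Suc k) * indicator {l ^ Suc k<..l ^ k} r \<partial>lborel) = ennreal (e k / l ^ Suc k) * ennreal (l ^ k - l ^ Suc k)"
      using less_imp_le[OF lk(1)] by (subst nn_integral_cmult) (auto simp: emeasure_lborel_Ioc)
    also have "\<dots> = ennreal (e k / l ^ Suc k * (l ^ k - l ^ Suc k))"
      using e0[of k] lk[of k] l by (intro ennreal_mult[symmetric]) auto
    also have "e k / l ^ Suc k * (l ^ k - l ^ Suc k) = e k * (1 / l - 1)" using l by (simp add: field_simps)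
    finally show "(\<integral>\<^sup>+r. ennreal (e k / l ^ Suc k) * indicator {l ^ Suc k<..l ^ k} r \<partial>lborel) = ennreal (e k * (1 / l - 1))" .
  qed
  also have "(\<Sum>k. ennreal (e k * (1 / l - 1))) = ennreal (\<Sum>k. e k * (1 / l - 1))"
  proof (intro suminf_ennreal2 summable_mult2 e(1) mult_nonneg_nonneg e0)
    show "0 \<le> 1 / l - 1" using l by (simp add: field_simps)
  qed
  also have "\<dots> < \<infinity>" by simp
  finally have "integrable lborel (\<lambda>r. indicator {0<..1} r *\<^sub>R (excess p u r / r))"
    by (intro integrableI_nonneg) (use m in \<open>auto simp: indicator_def excess_nonneg\<close>)
  then show ?thesis unfolding set_integrable_def using m by (subst integrable_completion) auto
qed

theorem theorem1p2:
  fixes p :: real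
  assumes "1 < p"
  shows "\<exists>\<alpha> rs C :: real. 0 < \<alpha> \<and> \<alpha> \<le> 1 \<and> 0 < rs \<and> rs \<le> 1 \<and> 0 < C \<and>
    (\<forall>u f :: (real ^ 'n) \<times> real \<Rightarrow> real.
      in_Lp p (Qm 1) u \<and> in_Lp p (Qm 1) f \<and> heat_equation_Q1 u f \<and> lebesgue_point_origin f 0 \<longrightarrow>
      (SUP r\<in>{0<..1}. ennreal (N_t p u r))
        \<le> ennreal C * (ennreal (Lp_norm p (Qm 1) u) + ennreal (Lp_norm p (Qm 1) f)
                        + (SUP r\<in>{0<..1}. ennreal (omega_t p f r)))
      \<and> ((omega_t p f \<longlongrightarrow> 0) (at_right 0) \<longrightarrow> (N_t p u \<longlongrightarrow> 0) (at_right 0))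
      \<and> (Dini (omega_t p f) \<longrightarrow>
           Dini (N_t p u) \<and>
           (\<exists>a b c m. transpose c = c \<and> caloric (par_poly a b c m) \<and>
              (\<forall>r\<in>{0<..rs}.
                 (average (Qm r) (\<lambda>z. \<bar>(u z - par_poly a b c m z) / r\<^sup>2\<bar> powr p)) powr (1 / p)
                 \<le> C * (M0_t p u f * r powr \<alpha>
                        + (LINT s:{0<..r}|lebesgue. omega_t p f s / s)
                        + r powr \<alpha> * (LINT s:{r..1}|lebesgue. omega_t p f s / s powr (1 + \<alpha>)))) \<and>
              \<bar>a\<bar> + norm b + norm c + \<bar>m\<bar> \<le> C * M0_t p u f)))"
proof -
  have p: "1 < p" and p0: "0 < p" using assms by auto
  obtain l C1 K where lCK: "0 < l \<and> l \<le> 1/2 \<and> 0 < C1 \<and> 0 < K \<and> (\<forall>(u :: (real ^ 'n) \<times> real \<Rightarrow> real) f.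
      LpQ p 1 u \<and> LpQ p 1 f \<and> heat_equation_Q1 u f \<longrightarrow> decay_step p l C1 K u f)"
    using one_step_fixed[OF p, where 'n = 'n, folded decay_step_def] by (elim exE) (rule that)
  then have l: "0 < l" "l \<le> 1/2" and C1: "0 < C1" and K: "0 < K" by auto
  have stp: "decay_step p l C1 K u f" if "LpQ p 1 u" "LpQ p 1 f" "heat_equation_Q1 u f"
    for u f :: "(real ^ 'n) \<times> real \<Rightarrow> real" using lCK that by blast
  obtain D where D0: "0 < D \<and> (\<forall>(u :: (real ^ 'n) \<times> real \<Rightarrow> real) f \<eta> M. LpQ p 1 u \<and> LpQ p 1 f \<and> decay_step p l C1 K u f \<and> 0 < \<eta> \<and>
    set_integrable lebesgue {0<..1} (\<lambda>s. osc p f s / s) \<and>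
    M = (LINT s:{0<..1}|lebesgue. osc p f s / s) + avg_norm p 1 u + avg_norm p 1 f + \<eta> \<longrightarrow>
    (\<exists>e. summable e \<and> (\<forall>k r. l ^ Suc k < r \<and> r \<le> l ^ k \<longrightarrow> excess p u r \<le> e k)) \<and>
    (\<exists>a b c m. transpose c = c \<and> \<bar>a\<bar> + norm b + norm c + \<bar>m\<bar> \<le> D * M \<and>
      ((\<lambda>r. avg_norm p r (\<lambda>z. u z - par_poly a b c m z) / r\<^sup>2) \<longlongrightarrow> 0) (at_right 0) \<and>
      (\<forall>r. 0 < r \<and> r \<le> l \<longrightarrow> avg_norm p r (\<lambda>z. u z - par_poly a b c m z) / r\<^sup>2 \<le>
        D * (M * sqrt r + (LINT s:{0<..r}|lebesgue. osc p f s / s)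
          + sqrt r * (LINT s:{r..1}|lebesgue. osc p f s / s powr (1 + 1/2))))))"
    using dini_core[OF p l C1 K, where 'n = 'n] by (rule exE)
  note D = conjunct1[OF D0] and core = conjunct2[OF D0, THEN spec, THEN spec, THEN spec, THEN spec, THEN mp]
  define W where "W = unit_vol TYPE('n) powr (1/p)"
  have W: "0 < W" using unit_vol_pos[where 'n = 'n] by (simp add: W_def)
  define Q where "Q = (1 / l) powr (real (CARD('n) + 2) / p + 2)"
  have Q: "0 < Q" using l by (simp add: Q_def)
  define G where "G = K / (1 - sqrt l)"
  have G: "0 < G" using K l by (simp add: G_def)
  \<comment> \<open>\<open>Q\<close> and \<open>G * W\<close> serve the first estimate,
    \<open>W\<close> converting \<open>omega_t\<close> to \<open>osc\<close>. In the other two terms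
    \<open>W + 2\<close> comes from comparing \<open>?M\<close> with \<open>M0\<close>, and the
    division by \<open>W\<close> from passing back to averages.\<close>
  define C where "C = Q + G * W + D * (W + 2) / W + D * (W + 2)"
  have Cpos: "0 < C" "Q \<le> C" "G * W \<le> C" "D * (W + 2) / W \<le> C" "D * (W + 2) \<le> C"
    using Q G W D by (auto simp: C_def add_pos_pos)
  show ?thesis
  \<comment> \<open>The exponent 1/2 reflects the gain of \<open>sqrt l\<close> per step of ratio
    \<open>l\<close>, and \<open>l\<close> bounds the radii for which \<open>dini_core\<close> gives
    the decay.\<close>
  proof (rule exI[of _ "1/2"], rule exI[of _ l], rule exI[of _ C], intro conjI allI impI; (elim conjE)?)
    fix u f :: "(real ^ 'n) \<times> real \<Rightarrow> real"
    assume u: "in_Lp p (Qm 1) u" and f: "in_Lp p (Qm 1) f" and he: "heat_equation_Q1 u f" and lp: "lebesgue_point_origin f 0"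
    obtain u' where u': "u' \<in> borel_measurable borel" and au: "AE z in lborel. z \<in> Qm 1 \<longrightarrow> u z = u' z"
      by (rule Borel_representative[of u]) (use u in \<open>simp add: in_Lp_def\<close>)
    obtain f' where f': "f' \<in> borel_measurable borel" and af: "AE z in lborel. z \<in> Qm 1 \<longrightarrow> f z = f' z"
      by (rule Borel_representative[of f]) (use f in \<open>simp add: in_Lp_def\<close>)
    have Lu: "LpQ p 1 u'" by (rule transfer_LpQ[OF u u' au])
    have Lf: "LpQ p 1 f'" by (rule transfer_LpQ[OF f f' af])
    have he': "heat_equation_Q1 u' f'" by (rule transfer_heat[OF u u' au f f' af he])
    have st: "decay_step p l C1 K u' f'" by (rule stp[OF Lu Lf he'])
    have nu: "Lp_norm p (Qm 1) u = avg_norm p 1 u'" by (rule transfer_Lp_norm[OF u u' au])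
    have nf: "Lp_norm p (Qm 1) f = avg_norm p 1 f'" by (rule transfer_Lp_norm[OF f f' af])
    have N: "N_t p u r = excess p u' r" if "0 < r" "r \<le> 1" for r by (rule transfer_N[OF p0 u u' au that])
    have om: "omega_t p f r = (1 / W) * osc p f' r" if "0 < r" "r \<le> 1" for r
      unfolding W_def by (rule transfer_omega[OF p0 f f' af that])
    let ?U = "avg_norm p 1 u'" and ?F = "avg_norm p 1 f'"
    have U0: "0 \<le> ?U" and F0: "0 \<le> ?F" by (auto simp: avg_norm_nonneg)
    have zeroP: "par_poly 0 0 0 0 = (\<lambda>_ :: (real ^ 'n) \<times> real. 0)" by (auto simp: par_poly_def)
    have zeroT: "transpose (0 :: real ^ 'n ^ 'n) = 0" by (simp add: transpose_def vec_eq_iff)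
    have zeroIn: "(\<lambda>_ :: (real ^ 'n) \<times> real. 0) \<in> P2_t"
    proof -
      have "par_poly 0 0 (0 :: real ^ 'n ^ 'n) 0 \<in> P2_t" unfolding P2_t_def using zeroT by blast
      then show ?thesis by (simp only: zeroP)
    qed
    have ex1: "excess p u' 1 \<le> ?U" using excess_le[OF zeroIn, of p u' 1] by simp
    {
      let ?S = "SUP r\<in>{0<..1}. ennreal (omega_t p f r)"
      show "(SUP r\<in>{0<..1}. ennreal (N_t p u r)) \<le> ennreal C * (ennreal (Lp_norm p (Qm 1) u) + ennreal (Lp_norm p (Qm 1) f) + ?S)"
      \<comment> \<open>An infinite supremum makes the right-hand side infinite because
        \<open>C\<close> is positive. Otherwise it is a real bound for all oscillations and
        \<open>excess_bound\<close> applies from radius 1.\<close>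
      proof (cases "?S = \<infinity>")
        case True
        have "ennreal C \<noteq> 0" using Cpos by simp
        then show ?thesis unfolding True by (simp add: ennreal_mult_top)
      next
        case False
        define S where "S = enn2real ?S"
        have S: "ennreal S = ?S" unfolding S_def using False by (intro ennreal_enn2real) (simp only: less_top infinity_ennreal_def not_False_eq_True)
        have S0: "0 \<le> S" by (simp add: S_def)
        have oS: "osc p f' r \<le> W * S" if r: "0 < r" "r \<le> 1" for r
        proof -
          have "ennreal (omega_t p f r) \<le> ennreal S" unfolding S using r by (intro SUP_upper) auto
          then have "(1 / W) * osc p f' r \<le> S" using S0 om[OF r] by simp
          then show ?thesis using W by (simp add: field_simps)
        qed
        show ?thesis
        proof (rule SUP_least)
          fix r :: real assume "r \<in> {0<..1}"
          then have r: "0 < r" "r \<le> 1" by auto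
          have "N_t p u r \<le> Q * excess p u' 1 + G * (W * S)"
            unfolding N[OF r] Q_def G_def by (rule excess_bound[OF p0 Lu st l K _ _ oS r]) auto
          also have "\<dots> \<le> C * ?U + C * ?F + C * S"
          proof -
            have "Q * excess p u' 1 \<le> C * ?U" using Cpos Q ex1 excess_nonneg[of p u' 1] by (intro mult_mono) auto
            moreover have "0 \<le> C * ?F" using Cpos F0 by simp
            moreover have "G * (W * S) \<le> C * S" using Cpos S0 mult_right_mono[of "G * W" C S] by (simp add: mult.assoc)
            ultimately show ?thesis by linarith
          qed
          finally have "ennreal (N_t p u r) \<le> ennreal (C * (?U + ?F + S))" by (intro ennreal_leI) (simp add: distrib_left)
          also have "\<dots> = ennreal C * (ennreal ?U + ennreal ?F + ennreal S)"
            using Cpos U0 F0 S0 by (simp add: ennreal_mult)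
          finally show "ennreal (N_t p u r) \<le> ennreal C * (ennreal (Lp_norm p (Qm 1) u) + ennreal (Lp_norm p (Qm 1) f) + ?S)"
            unfolding nu nf S .
        qed
      qed
    }
    have ev1: "\<forall>\<^sub>F r in at_right (0::real). 0 < r \<and> r \<le> 1"
      by (auto simp: eventually_at_right_field intro!: exI[of _ 1])
    {
      assume lim: "(omega_t p f \<longlongrightarrow> 0) (at_right 0)"
      have "(osc p f' \<longlongrightarrow> 0) (at_right 0)"
      proof (rule Lim_transform_eventually)
        show "((\<lambda>r. W * omega_t p f r) \<longlongrightarrow> 0) (at_right 0)" using tendsto_mult_right_zero[OF lim] .
        show "\<forall>\<^sub>F r in at_right 0. W * omega_t p f r = osc p f' r"
          using ev1 by eventually_elim (use om W in auto)
      qed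
      then have "(excess p u' \<longlongrightarrow> 0) (at_right 0)" by (rule excess_vanishes[OF p0 Lu st l K])
      then show "(N_t p u \<longlongrightarrow> 0) (at_right 0)"
      proof (rule Lim_transform_eventually)
        show "\<forall>\<^sub>F r in at_right 0. excess p u' r = N_t p u r" using ev1 by eventually_elim (use N in auto)
      qed
    }
    assume dini: "Dini (omega_t p f)"
    have "set_integrable lebesgue {0<..1} (\<lambda>s. (1 / W) * (osc p f' s / s))"
      using dini unfolding Dini_def by (subst set_integrable_cong[OF refl refl, of _ _ "\<lambda>s. omega_t p f s / s"]) (auto simp: om)
    then have di: "set_integrable lebesgue {0<..1} (\<lambda>s. osc p f' s / s)"
      using W by (subst (asm) set_integrable_mult_right_iff) auto
    let ?\<Phi> = "\<lambda>t. LINT s:{0<..t}|lebesgue. osc p f' s / s"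
    let ?\<Psi> = "\<lambda>r. LINT s:{r..1}|lebesgue. osc p f' s / s powr (1 + 1/2)"
    have I1: "(LINT s:{0<..r}|lebesgue. omega_t p f s / s) = (1 / W) * ?\<Phi> r" if "r \<le> 1" for r
    proof -
      have "(LINT s:{0<..r}|lebesgue. omega_t p f s / s) = (LINT s:{0<..r}|lebesgue. (1 / W) * (osc p f' s / s))"
        by (rule set_lebesgue_integral_cong) (use that om in auto)
      then show ?thesis by (simp only: set_integral_mult_right)
    qed
    have I2: "(LINT s:{r..1}|lebesgue. omega_t p f s / s powr (1 + 1/2)) = (1 / W) * ?\<Psi> r" if "0 < r" for r
    proof -
      have "(LINT s:{r..1}|lebesgue. omega_t p f s / s powr (1 + 1/2)) = (LINT s:{r..1}|lebesgue. (1 / W) * (osc p f' s / s powr (1 + 1/2)))"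
        by (rule set_lebesgue_integral_cong) (use that om in auto)
      then show ?thesis by (simp only: set_integral_mult_right)
    qed
    have \<Phi>0: "0 \<le> ?\<Phi> r" for r
      unfolding set_lebesgue_integral_def
      by (intro Bochner_Integration.integral_nonneg) (auto simp: indicator_def osc_nonneg)
    have \<Psi>0: "0 \<le> ?\<Psi> r" for r
      unfolding set_lebesgue_integral_def
      by (intro Bochner_Integration.integral_nonneg) (auto simp: indicator_def osc_nonneg)
    define M0 where "M0 = M0_t p u f"
    have M0: "M0 = (1 / W) * ?\<Phi> 1 + ?U + ?F" by (simp only: M0_def M0_t_def nu nf I1[OF order_refl])
    have M00: "0 \<le> M0" unfolding M0 using W \<Phi>0[of 1] U0 F0 by simp
    \<comment> \<open>For summability alone the slack need not be tied to the data, so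
      \<open>\<eta> = 1\<close> is taken.\<close>
    have "\<exists>e. summable e \<and> (\<forall>k r. l ^ Suc k < r \<and> r \<le> l ^ k \<longrightarrow> excess p u' r \<le> e k)"
      using core[of u' f' 1 "?\<Phi> 1 + ?U + ?F + 1"] Lu Lf st di by simp
    then obtain e where e: "summable e" "\<And>k r. l ^ Suc k < r \<Longrightarrow> r \<le> l ^ k \<Longrightarrow> excess p u' r \<le> e k" by blast
    have "set_integrable lebesgue {0<..1} (\<lambda>r. excess p u' r / r)" by (rule Dini_excess[OF p0 Lu l e])
    then show "Dini (N_t p u)"
      unfolding Dini_def by (subst set_integrable_cong[OF refl refl, of _ _ "\<lambda>r. excess p u' r / r"]) (auto simp: N)
    have avg: "(average (Qm r) (\<lambda>z. \<bar>(u z - par_poly a b c m z) / r\<^sup>2\<bar> powr p)) powr (1 / p) =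
        (avg_norm p r (\<lambda>z. u' z - par_poly a b c m z) / r\<^sup>2) / W" if r: "0 < r" "r \<le> 1" for r a b c m
    proof -
      have "average (Qm r) (\<lambda>z. \<bar>(u z - par_poly a b c m z) / r\<^sup>2\<bar> powr p) =
          average (Qm r) (\<lambda>z. \<bar>u z - par_poly a b c m z\<bar> powr p) / (r\<^sup>2) powr p"
        unfolding average_def using r by (simp add: powr_divide set_integral_divide_zero)
      moreover have "0 \<le> average (Qm r) (\<lambda>z. \<bar>u z - par_poly a b c m z\<bar> powr p)"
        unfolding average_def set_lebesgue_integral_def
        by (intro mult_nonneg_nonneg Bochner_Integration.integral_nonneg) auto
      ultimately have "(average (Qm r) (\<lambda>z. \<bar>(u z - par_poly a b c m z) / r\<^sup>2\<bar> powr p)) powr (1 / p) =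
          (average (Qm r) (\<lambda>z. \<bar>u z - par_poly a b c m z\<bar> powr p)) powr (1 / p) / r\<^sup>2"
        using p0 r by (simp add: powr_divide powr_powr)
      then show ?thesis
        using transfer_average[OF p0 u u' au par_poly_measurable r, of a b c m] by (simp add: W_def)
    qed
    show "\<exists>a b c m. transpose c = c \<and> caloric (par_poly a b c m) \<and>
        (\<forall>r\<in>{0<..l}. (average (Qm r) (\<lambda>z. \<bar>(u z - par_poly a b c m z) / r\<^sup>2\<bar> powr p)) powr (1 / p)
          \<le> C * (M0_t p u f * r powr (1/2) + (LINT s:{0<..r}|lebesgue. omega_t p f s / s)
             + r powr (1/2) * (LINT s:{r..1}|lebesgue. omega_t p f s / s powr (1 + 1/2)))) \<and>
        \<bar>a\<bar> + norm b + norm c + \<bar>m\<bar> \<le> C * M0_t p u f"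
    \<comment> \<open>The slack must be positive and at most a multiple of \<open>M0\<close>, and
      \<open>\<eta> = M0\<close> is used below. When \<open>M0\<close> is 0 this is impossible, but
      then the norm of \<open>u\<close> is zero and the zero polynomial does.\<close>
    proof (cases "M0 = 0")
      case True
      have Uz: "?U = 0" using True U0 F0 \<Phi>0[of 1] W unfolding M0
        by (smt (verit) divide_nonneg_nonneg mult_nonneg_nonneg)
      show ?thesis
      proof (rule exI[of _ 0], rule exI[of _ 0], rule exI[of _ 0], rule exI[of _ 0], intro conjI ballI)
        show "transpose (0 :: real ^ 'n ^ 'n) = 0" by (rule zeroT)
        show "caloric (par_poly 0 0 (0 :: real ^ 'n ^ 'n) 0)" by (simp add: caloric_def heat_op_par_poly)
        show "\<bar>0\<bar> + norm (0 :: real ^ 'n) + norm (0 :: real ^ 'n ^ 'n) + \<bar>0\<bar> \<le> C * M0_t p u f"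
          using M00 Cpos by (simp add: M0_def)
        fix r assume "r \<in> {0<..l}"
        then have r: "0 < r" "r \<le> 1" using l by auto
        have "avg_norm p r u' \<le> 0" using avg_norm_shrink[OF p0 r Lu] Uz by simp
        then have "avg_norm p r (\<lambda>z. u' z - par_poly 0 0 0 0 z) = 0"
          using avg_norm_nonneg[of p r u'] by (simp add: zeroP)
        moreover have "0 \<le> C * (M0_t p u f * r powr (1/2) + (LINT s:{0<..r}|lebesgue. omega_t p f s / s)
             + r powr (1/2) * (LINT s:{r..1}|lebesgue. omega_t p f s / s powr (1 + 1/2)))"
          unfolding I1[OF r(2)] I2[OF r(1)] M0_def[symmetric] using Cpos M00 \<Phi>0 \<Psi>0 W
          by (intro mult_nonneg_nonneg add_nonneg_nonneg) auto
        ultimately show "(average (Qm r) (\<lambda>z. \<bar>(u z - par_poly 0 0 0 0 z) / r\<^sup>2\<bar> powr p)) powr (1 / p)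
          \<le> C * (M0_t p u f * r powr (1/2) + (LINT s:{0<..r}|lebesgue. omega_t p f s / s)
             + r powr (1/2) * (LINT s:{r..1}|lebesgue. omega_t p f s / s powr (1 + 1/2)))"
          unfolding avg[OF r] by simp
      qed
    next
      case False
      then have Mp: "0 < M0" using M00 by simp
      let ?M = "?\<Phi> 1 + ?U + ?F + M0"
      \<comment> \<open>The integral in \<open>?M\<close> is at most \<open>W * M0\<close>, the two
        norms together at most \<open>M0\<close>, and the slack equals \<open>M0\<close>.\<close>
      have MW: "?M \<le> (W + 2) * M0"
      proof -
        have "?\<Phi> 1 \<le> W * M0"
        proof -
          have "W * ((1 / W) * ?\<Phi> 1) \<le> W * M0" unfolding M0 using W U0 F0 by (intro mult_left_mono) auto
          then show ?thesis using W by simp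
        qed
        moreover have "?U + ?F \<le> M0" unfolding M0 using W \<Phi>0[of 1] by simp
        ultimately show ?thesis by (simp add: distrib_right)
      qed
      have "\<exists>a b c m. transpose c = c \<and> \<bar>a\<bar> + norm b + norm c + \<bar>m\<bar> \<le> D * ?M \<and>
        ((\<lambda>r. avg_norm p r (\<lambda>z. u' z - par_poly a b c m z) / r\<^sup>2) \<longlongrightarrow> 0) (at_right 0) \<and>
        (\<forall>r. 0 < r \<and> r \<le> l \<longrightarrow> avg_norm p r (\<lambda>z. u' z - par_poly a b c m z) / r\<^sup>2 \<le>
          D * (?M * sqrt r + ?\<Phi> r + sqrt r * ?\<Psi> r))"
        using core[of u' f' M0 ?M] Lu Lf st di Mp by blast
      then obtain a b c m where sy: "transpose c = c" and co: "\<bar>a\<bar> + norm b + norm c + \<bar>m\<bar> \<le> D * ?M"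
        and li: "((\<lambda>r. avg_norm p r (\<lambda>z. u' z - par_poly a b c m z) / r\<^sup>2) \<longlongrightarrow> 0) (at_right 0)"
        and es: "\<And>r. 0 < r \<Longrightarrow> r \<le> l \<Longrightarrow> avg_norm p r (\<lambda>z. u' z - par_poly a b c m z) / r\<^sup>2 \<le>
          D * (?M * sqrt r + ?\<Phi> r + sqrt r * ?\<Psi> r)" by blast
      have tr: "(\<Sum>i\<in>UNIV. c $ i $ i) = m"
        by (rule caloric_limit[OF p Lu Lf he' li transfer_lebesgue_point[OF f f' af lp]])
      show ?thesis
      proof (rule exI[of _ a], rule exI[of _ b], rule exI[of _ c], rule exI[of _ m], intro conjI ballI)
        show "transpose c = c" by (rule sy)
        show "caloric (par_poly a b c m)" using tr by (simp add: caloric_def heat_op_par_poly)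
        have "D * ?M \<le> D * ((W + 2) * M0)" using MW D by (intro mult_left_mono) auto
        also have "\<dots> \<le> C * M0" using mult_right_mono[OF Cpos(5) M00] by (simp add: mult.assoc)
        finally show "\<bar>a\<bar> + norm b + norm c + \<bar>m\<bar> \<le> C * M0_t p u f" using co by (simp add: M0_def)
        fix r assume "r \<in> {0<..l}"
        then have r: "0 < r" "r \<le> l" "r \<le> 1" using l by auto
        let ?R = "M0 * sqrt r + (1 / W) * ?\<Phi> r + sqrt r * ((1 / W) * ?\<Psi> r)"
        have R0: "0 \<le> ?R" using M00 \<Phi>0[of r] \<Psi>0[of r] W r by (intro add_nonneg_nonneg mult_nonneg_nonneg) auto
        have "?M * sqrt r + ?\<Phi> r + sqrt r * ?\<Psi> r \<le> (W + 2) * ?R"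
        proof -
          have 1: "?M * sqrt r \<le> (W + 2) * (M0 * sqrt r)"
            using mult_right_mono[OF MW, of "sqrt r"] r by (simp add: mult.assoc)
          have 2: "x \<le> (W + 2) * ((1 / W) * x)" if "0 \<le> x" for x :: real
            using W that by (simp add: field_simps)
          have "sqrt r * ?\<Psi> r \<le> (W + 2) * ((1 / W) * (sqrt r * ?\<Psi> r))" using \<Psi>0[of r] r by (intro 2) auto
          then have 3: "sqrt r * ?\<Psi> r \<le> (W + 2) * (sqrt r * ((1 / W) * ?\<Psi> r))" by (simp only: mult.left_commute)
          show ?thesis using 1 2[OF \<Phi>0[of r]] 3 by (simp only: distrib_left)
        qed
        then have "D * (?M * sqrt r + ?\<Phi> r + sqrt r * ?\<Psi> r) / W \<le> D * ((W + 2) * ?R) / W"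
          using D W by (intro divide_right_mono mult_left_mono) auto
        also have "\<dots> = D * (W + 2) / W * ?R" by simp
        also have "\<dots> \<le> C * ?R" using Cpos R0 by (intro mult_right_mono) auto
        finally have "D * (?M * sqrt r + ?\<Phi> r + sqrt r * ?\<Psi> r) / W \<le> C * ?R" .
        moreover have "(avg_norm p r (\<lambda>z. u' z - par_poly a b c m z) / r\<^sup>2) / W \<le> D * (?M * sqrt r + ?\<Phi> r + sqrt r * ?\<Psi> r) / W"
          using es[OF r(1,2)] W by (intro divide_right_mono) auto
        ultimately have "(avg_norm p r (\<lambda>z. u' z - par_poly a b c m z) / r\<^sup>2) / W \<le> C * ?R" by linarith
        moreover have "r powr (1/2) = sqrt r" using r by (simp add: powr_half_sqrt)
        ultimately show "(average (Qm r) (\<lambda>z. \<bar>(u z - par_poly a b c m z) / r\<^sup>2\<bar> powr p)) powr (1 / p)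
          \<le> C * (M0_t p u f * r powr (1/2) + (LINT s:{0<..r}|lebesgue. omega_t p f s / s)
             + r powr (1/2) * (LINT s:{r..1}|lebesgue. omega_t p f s / s powr (1 + 1/2)))"
          unfolding avg[OF r(1,3)] I1[OF r(3)] I2[OF r(1)] M0_def[symmetric] by (simp only:)
      qed
    qed
  qed (use l Cpos in auto)
qed

end
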